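(* Let $\lambda$ be a monotone metric on the manifold $\mathcal M$ of positive definite $n\times n$ matrices with corresponding operator monotone function $F$, let $h(u)=\frac12\frac{(u-1)^2}{F(u)}$, and let $g\in G$ satisfy $g+\hat g=2h$ (so that $\lambda=\lambda^g=\lambda^{\hat g}$). Then the connections $\nabla^{(g)}$ and $\nabla^{(\hat g)}$ are dual with respect to $\lambda$. Moreover, these connections are torsion-free.
   Context: $\mathcal M_h$ is the real vector space of Hermitian $n\times n$ complex matrices and $\mathcal M\subset\mathcal M_h$ the open subset of positive definite matrices, a differentiable manifold with every tangent space $T_\rho$ identified with $\mathcal M_h$. Vector fields are thus $\mathcal M_h$-valued functions on $\mathcal M$; for $X\in\mathcal M_h$, $\mathcal X$ denotes the constant vector field with value $X$ (similarly $\mathcal Y,\mathcal Z$). $L_\rho$ and $R_\rho$ are left and right multiplication by $\rho$ on $M_n(\mathbb C)$ with inner product $\langle A,B\rangle=\operatorname{Tr}A^*B$; $L_\sigma/R_\rho=L_\sigma R_\rho^{-1}$. A monotone metric is a Riemannian metric on $\mathcal M$ of the form $\lambda_\rho(X,Y)=\operatorname{Tr}X J_\rho(Y)$ with $J_\rho=R_\rho^{-1/2}F(L_\rho/R_\rho)^{-1}R_\rho^{-1/2}$, where $F:(0,\infty)\to\mathbb R$ is operator monotone with $F(x)=xF(x^{-1})$ and $F(1)=1$. $G$ is the set of operator convex functions $g:(0,\infty)\to\mathbb R$ with $g(1)=0$, $g''(1)=1$; the transpose of $g$ is $\hat g(u)=ug(u^{-1})$, which again lies in $G$. For $g\in G$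 the relative $g$-entropy is $H_g(\rho,\sigma)=\operatorname{Tr}\rho^{1/2}g(L_\sigma/R_\rho)(\rho^{1/2})$, and $$\lambda^g_\rho(X,Y)=-\tfrac{\partial^2}{\partial s\partial t}H_g(\rho+sX,\rho+tY)|_{s,t=0}$$ is a monotone metric. The affine connection $\nabla^{(g)}$ is determined by $$\lambda^g_\rho(\nabla^{(g)}_{\mathcal X}\mathcal Y,\mathcal Z)=-\tfrac{\partial^3}{\partial s\partial t\partial u}H_g(\rho+sX+tY,\rho+uZ)|_{s,t,u=0}$$ for constant vector fields. Connections $\nabla,\nabla^*$ are dual with respect to $\lambda$ if $\mathcal X\lambda(\mathcal Y,\mathcal Z)=\lambda(\nabla_{\mathcal X}\mathcal Y,\mathcal Z)+\lambda(\mathcal Y,\nabla^*_{\mathcal X}\mathcal Z)$ for all vector fields. *)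

theory Defs
  imports "HOL-Analysis.Analysis" "Jordan_Normal_Form.Schur_Decomposition"
begin

no_notation vec_index (infixl \<open>$\<close> 100)
no_notation scalar_prod (infix \<open>\<bullet>\<close> 70)
hide_const (open) Matrix.mat Matrix.vec Matrix.row Matrix.rows Matrix.transpose_mat

text \<open>
  Operator monotonicity and operator convexity quantify over matrices of every size, so they are
  stated with the matrices of variable dimension from \<^theory>\<open>Jordan_Normal_Form.Matrix\<close>.
  A function on the open half-line is a total function of type \<^typ>\<open>real \<Rightarrow> real\<close>;
  its values at non-positive arguments are irrelevant throughout.
\<close>

definition hermitian_mat :: "nat \<Rightarrow> complex mat \<Rightarrow> bool" where
  "hermitian_mat k A \<longleftrightarrow> A \<in> carrier_mat k k \<and> mat_adjoint A = A"

definition pos_semidef_mat :: "nat \<Rightarrow> complex mat \<Rightarrow> bool" where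
  "pos_semidef_mat k A \<longleftrightarrow>
     hermitian_mat k A \<and> (\<forall>x\<in>carrier_vec k. 0 \<le> Re ((A *\<^sub>v x) \<bullet>c x))"

definition pos_def_mat :: "nat \<Rightarrow> complex mat \<Rightarrow> bool" where
  "pos_def_mat k A \<longleftrightarrow>
     hermitian_mat k A \<and> (\<forall>x\<in>carrier_vec k. x \<noteq> 0\<^sub>v k \<longrightarrow> 0 < Re ((A *\<^sub>v x) \<bullet>c x))"

definition loewner_le :: "nat \<Rightarrow> complex mat \<Rightarrow> complex mat \<Rightarrow> bool" where
  "loewner_le k A B \<longleftrightarrow> pos_semidef_mat k (B - A)"

text \<open>
  \<open>spectral_image k f A B\<close> says that \<open>B = f(A)\<close> for a Hermitian \<open>k \<times> k\<close> matrix \<open>A\<close>: there is a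
  unitary \<open>U\<close> with \<open>A = U diag(d) U\<^sup>*\<close> and \<open>B = U diag(f(d)) U\<^sup>*\<close>. The matrix \<open>B\<close> exists and
  does not depend on the choice of \<open>U\<close> and \<open>d\<close>.
\<close>

definition spectral_image ::
    "nat \<Rightarrow> (real \<Rightarrow> real) \<Rightarrow> complex mat \<Rightarrow> complex mat \<Rightarrow> bool" where
  "spectral_image k f A B \<longleftrightarrow>
     (\<exists>U d. U \<in> carrier_mat k k \<and> mat_adjoint U * U = 1\<^sub>m k \<and>
        A = U * mat_diag k (\<lambda>i. complex_of_real (d i)) * mat_adjoint U \<and>
        B = U * mat_diag k (\<lambda>i. complex_of_real (f (d i))) * mat_adjoint U)"

definition operator_monotone :: "(real \<Rightarrow> real) \<Rightarrow> bool" where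
  "operator_monotone f \<longleftrightarrow>
     (\<forall>k A B fA fB. pos_def_mat k A \<and> pos_def_mat k B \<and> loewner_le k A B \<and>
        spectral_image k f A fA \<and> spectral_image k f B fB \<longrightarrow> loewner_le k fA fB)"

definition operator_convex :: "(real \<Rightarrow> real) \<Rightarrow> bool" where
  "operator_convex f \<longleftrightarrow>
     (\<forall>k A B C fA fB fC t. pos_def_mat k A \<and> pos_def_mat k B \<and> 0 \<le> t \<and> t \<le> 1 \<and>
        C = complex_of_real t \<cdot>\<^sub>m A + complex_of_real (1 - t) \<cdot>\<^sub>m B \<and>
        spectral_image k f A fA \<and> spectral_image k f B fB \<and> spectral_image k f C fC \<longrightarrow>
        loewner_le k fC (complex_of_real t \<cdot>\<^sub>m fA + complex_of_real (1 - t) \<cdot>\<^sub>m fB))"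

definition transpose_fun :: "(real \<Rightarrow> real) \<Rightarrow> real \<Rightarrow> real" where
  "transpose_fun g u = u * g (inverse u)"

definition G :: "(real \<Rightarrow> real) set" where
  "G = {g. operator_convex g \<and> g 1 = 0 \<and> (deriv g has_real_derivative 1) (at 1)}"

definition conj_transpose :: "complex^'n^'m \<Rightarrow> complex^'m^'n" where
  "conj_transpose A = (\<chi> i j. cnj (A $ j $ i))"

definition Herm :: "(complex^'n^'n) set" where
  "Herm = {A. conj_transpose A = A}"

definition PD :: "(complex^'n^'n) set" where
  "PD = {A \<in> Herm. \<forall>x. x \<noteq> 0 \<longrightarrow> 0 < Re (\<Sum>i\<in>UNIV. cnj (x $ i) * (A *v x) $ i)}"

definition dir_deriv ::
    "(complex^'n^'n \<Rightarrow> 'b::real_normed_vector) \<Rightarrow> complex^'n^'n \<Rightarrow> complex^'n^'n \<Rightarrow> 'b" where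
  "dir_deriv f \<rho> X = vector_derivative (\<lambda>t. f (\<rho> + t *\<^sub>R X)) (at 0)"

text \<open>
  \<^const>\<open>PD\<close> is open in the real subspace \<^const>\<open>Herm\<close> (not in the space of all matrices), so only
  derivatives in Hermitian directions enter.
\<close>

primrec C_k_on_PD :: "nat \<Rightarrow> (complex^'n^'n \<Rightarrow> 'b::real_normed_vector) \<Rightarrow> bool" where
  "C_k_on_PD 0 f \<longleftrightarrow> continuous_on PD f"
| "C_k_on_PD (Suc k) f \<longleftrightarrow>
     f differentiable_on PD \<and> (\<forall>X\<in>Herm. C_k_on_PD k (\<lambda>\<rho>. dir_deriv f \<rho> X))"

definition smooth_on_PD :: "(complex^'n^'n \<Rightarrow> 'b::real_normed_vector) \<Rightarrow> bool" where
  "smooth_on_PD f \<longleftrightarrow> (\<forall>k. C_k_on_PD k f)"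

text \<open>Vector fields, metrics and connections only matter at points of \<^const>\<open>PD\<close>.\<close>

type_synonym 'n field = "complex^'n^'n \<Rightarrow> complex^'n^'n"
type_synonym 'n metric = "complex^'n^'n \<Rightarrow> complex^'n^'n \<Rightarrow> complex^'n^'n \<Rightarrow> real"
type_synonym 'n connection = "'n field \<Rightarrow> 'n field \<Rightarrow> 'n field"

definition vector_field :: "'n::finite field \<Rightarrow> bool" where
  "vector_field X \<longleftrightarrow> smooth_on_PD X \<and> (\<forall>\<rho>\<in>PD. X \<rho> \<in> Herm)"

definition lie_bracket :: "'n::finite field \<Rightarrow> 'n field \<Rightarrow> 'n field" where
  "lie_bracket X Y \<rho> = dir_deriv Y \<rho> (X \<rho>) - dir_deriv X \<rho> (Y \<rho>)"

definition riemannian_metric :: "'n::finite metric \<Rightarrow> bool" where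
  "riemannian_metric lam \<longleftrightarrow>
     (\<forall>\<rho>\<in>PD. \<forall>X\<in>Herm. \<forall>Y\<in>Herm. \<forall>Z\<in>Herm. \<forall>a.
        lam \<rho> (a *\<^sub>R X + Y) Z = a * lam \<rho> X Z + lam \<rho> Y Z) \<and>
     (\<forall>\<rho>\<in>PD. \<forall>X\<in>Herm. \<forall>Y\<in>Herm. lam \<rho> X Y = lam \<rho> Y X) \<and>
     (\<forall>\<rho>\<in>PD. \<forall>X\<in>Herm. X \<noteq> 0 \<longrightarrow> 0 < lam \<rho> X X) \<and>
     (\<forall>X\<in>Herm. \<forall>Y\<in>Herm. smooth_on_PD (\<lambda>\<rho>. lam \<rho> X Y))"

definition affine_connection :: "'n::finite connection \<Rightarrow> bool" where
  "affine_connection D \<longleftrightarrow>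
     (\<forall>X Y. vector_field X \<and> vector_field Y \<longrightarrow> vector_field (D X Y)) \<and>
     (\<forall>f X X' Y. smooth_on_PD f \<and> vector_field X \<and> vector_field X' \<and> vector_field Y \<longrightarrow>
        (\<forall>\<rho>\<in>PD. D (\<lambda>\<sigma>. f \<sigma> *\<^sub>R X \<sigma> + X' \<sigma>) Y \<rho> = f \<rho> *\<^sub>R D X Y \<rho> + D X' Y \<rho>)) \<and>
     (\<forall>X Y Y'. vector_field X \<and> vector_field Y \<and> vector_field Y' \<longrightarrow>
        (\<forall>\<rho>\<in>PD. D X (\<lambda>\<sigma>. Y \<sigma> + Y' \<sigma>) \<rho> = D X Y \<rho> + D X Y' \<rho>)) \<and>
     (\<forall>f X Y. smooth_on_PD f \<and> vector_field X \<and> vector_field Y \<longrightarrow>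
        (\<forall>\<rho>\<in>PD. D X (\<lambda>\<sigma>. f \<sigma> *\<^sub>R Y \<sigma>) \<rho> = dir_deriv f \<rho> (X \<rho>) *\<^sub>R Y \<rho> + f \<rho> *\<^sub>R D X Y \<rho>))"

definition torsion_free :: "'n::finite connection \<Rightarrow> bool" where
  "torsion_free D \<longleftrightarrow>
     (\<forall>X Y. vector_field X \<and> vector_field Y \<longrightarrow>
        (\<forall>\<rho>\<in>PD. D X Y \<rho> - D Y X \<rho> = lie_bracket X Y \<rho>))"

text \<open>Duality, including the existence of the derivative of \<open>\<lambda>(Y,Z)\<close> along \<open>X\<close>.\<close>

definition dual_connections :: "'n::finite metric \<Rightarrow> 'n connection \<Rightarrow> 'n connection \<Rightarrow> bool" where
  "dual_connections lam D D' \<longleftrightarrow>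
     (\<forall>X Y Z. vector_field X \<and> vector_field Y \<and> vector_field Z \<longrightarrow>
        (\<forall>\<rho>\<in>PD. ((\<lambda>t. let \<sigma> = \<rho> + t *\<^sub>R X \<rho> in lam \<sigma> (Y \<sigma>) (Z \<sigma>))
            has_real_derivative lam \<rho> (D X Y \<rho>) (Z \<rho>) + lam \<rho> (Y \<rho>) (D' X Z \<rho>)) (at 0)))"

text \<open>
  For a self-adjoint operator \<open>T\<close> with spectral decomposition \<open>T = \<Sum>c. c P\<^sub>c\<close>, this is
  \<open>f(T) = \<Sum>c. f(c) P\<^sub>c\<close>: the closest point in an eigenspace is the orthogonal projection onto it.
  The real inner product on \<^typ>\<open>complex^'n^'n\<close> is \<open>Re Tr A\<^sup>*B\<close>. As the eigenvalues
  of \<open>T\<close> are real and the eigenspaces of a complex linear \<open>T\<close> are complex subspaces, these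
  projections agree with those for the complex inner product.
\<close>

definition op_fun :: "(real \<Rightarrow> real) \<Rightarrow> ('a::euclidean_space \<Rightarrow> 'a) \<Rightarrow> 'a \<Rightarrow> 'a" where
  "op_fun f T x =
     (\<Sum>c | \<exists>v. v \<noteq> 0 \<and> T v = c *\<^sub>R v. f c *\<^sub>R closest_point {v. T v = c *\<^sub>R v} x)"

definition mat_sqrt :: "complex^'n^'n \<Rightarrow> complex^'n^'n" where
  "mat_sqrt \<rho> = matrix (op_fun sqrt ((*v) \<rho>))"

definition Lmul :: "complex^'n^'n \<Rightarrow> complex^'n^'n \<Rightarrow> complex^'n^'n" where
  "Lmul \<rho> A = \<rho> ** A"

definition Rmul :: "complex^'n^'n \<Rightarrow> complex^'n^'n \<Rightarrow> complex^'n^'n" where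
  "Rmul \<rho> A = A ** \<rho>"

definition LR_quot :: "complex^'n^'n \<Rightarrow> complex^'n^'n \<Rightarrow> complex^'n^'n \<Rightarrow> complex^'n^'n" where
  "LR_quot \<sigma> \<rho> = Lmul \<sigma> \<circ> inv_into UNIV (Rmul \<rho>)"

definition J :: "(real \<Rightarrow> real) \<Rightarrow> complex^'n^'n \<Rightarrow> complex^'n^'n \<Rightarrow> complex^'n^'n" where
  "J F \<rho> = op_fun (\<lambda>x. x powr (- 1 / 2)) (Rmul \<rho>) \<circ> inv_into UNIV (op_fun F (LR_quot \<rho> \<rho>)) \<circ>
           op_fun (\<lambda>x. x powr (- 1 / 2)) (Rmul \<rho>)"

definition monotone_metric :: "(real \<Rightarrow> real) \<Rightarrow> 'n::finite metric \<Rightarrow> bool" where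
  "monotone_metric F lam \<longleftrightarrow>
     riemannian_metric lam \<and>
     operator_monotone F \<and> (\<forall>x>0. F x = x * F (inverse x)) \<and> F 1 = 1 \<and>
     (\<forall>\<rho>\<in>PD. \<forall>X\<in>Herm. \<forall>Y\<in>Herm. complex_of_real (lam \<rho> X Y) = trace (X ** J F \<rho> Y))"

text \<open>The trace below is real for positive definite arguments.\<close>

definition rel_entropy :: "(real \<Rightarrow> real) \<Rightarrow> complex^'n^'n \<Rightarrow> complex^'n^'n \<Rightarrow> real" where
  "rel_entropy g \<rho> \<sigma> = Re (trace (mat_sqrt \<rho> ** op_fun g (LR_quot \<sigma> \<rho>) (mat_sqrt \<rho>)))"

definition entropy_metric :: "(real \<Rightarrow> real) \<Rightarrow> 'n::finite metric" where
  "entropy_metric g \<rho> X Y =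
     - deriv (\<lambda>s. deriv (\<lambda>t. rel_entropy g (\<rho> + s *\<^sub>R X) (\<rho> + t *\<^sub>R Y)) 0) 0"

text \<open>
  Every vector field is a combination of constant ones with smooth coefficients, so the values on
  constant fields determine \<open>D\<close> at all points of \<^const>\<open>PD\<close>.
\<close>

definition g_connection :: "(real \<Rightarrow> real) \<Rightarrow> 'n::finite connection \<Rightarrow> bool" where
  "g_connection g D \<longleftrightarrow>
     affine_connection D \<and>
     (\<forall>\<rho>\<in>PD. \<forall>X\<in>Herm. \<forall>Y\<in>Herm. \<forall>Z\<in>Herm.
        entropy_metric g \<rho> (D (\<lambda>_. X) (\<lambda>_. Y) \<rho>) Z =
          - deriv (\<lambda>s. deriv (\<lambda>t. deriv (\<lambda>u.
               rel_entropy g (\<rho> + s *\<^sub>R X + t *\<^sub>R Y) (\<rho> + u *\<^sub>R Z)) 0) 0) 0)"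

end

theory Submission
  imports Defs "HOL-Computational_Algebra.Polynomial"
begin

text \<open>
  Writing \<open>\<rho> = \<Sum>p. p P\<^sub>p\<close> and \<open>\<sigma> = \<Sum>q. q Q\<^sub>q\<close>, the relative entropy is the double spectral sum
  \<open>\<Phi>\<^sub>f(\<rho>, \<sigma>) = \<Sum>p q. f(p, q) Tr P\<^sub>p Q\<^sub>q\<close> with \<open>f(p, q) = p g(q/p)\<close>, and the transpose of \<open>g\<close> gives the
  same sum with the arguments exchanged. If \<open>f\<close> is a sum of products of polynomials, \<open>\<Phi>\<^sub>f\<close> is a
  polynomial in \<open>\<rho>\<close> and \<open>\<sigma>\<close>: its second derivatives in \<open>\<rho>\<close> are symmetric, so the connections are
  torsion-free, and the product rule along the diagonal gives duality. General vector fields are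
  reduced to constant ones by expansion in a basis.

  For a general \<open>g\<close> the mixed differences of \<open>\<Phi>\<^sub>f\<close> are bounded by those of \<open>f\<close> near the spectra. So \<open>f\<close>
  can be replaced by a polynomial that osculates it to third order at the pairs of eigenvalues, which
  needs three derivatives of \<open>g\<close>. Operator convexity provides them: by Gauss quadrature, the divided
  differences of \<open>g\<close> of even order are nonnegative, hence those of order up to four are locally bounded.
\<close>

hide_const (open) VectorSpace.subspace Matrix.orthogonal

section \<open>Divided differences\<close>

text \<open>Eigenprojections jump where eigenvalues meet, so spectral sums are never differentiated
  term by term. The substitute is the identity (p' - p) P P' = P (\<tau>' - \<tau>) P' for the
  spectral projections P of \<tau> at p and P' of \<tau>' at p': it pays for a difference of values
  of f with a perturbation of the matrix. As \<open>deriv\<close> is total, the existence of the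
  nested derivatives has to be proved as well, and the derivative of the metric moves both arguments
  at once. A tensor polynomial settles both by the product rule. For the last derivative, the error
  of the approximation may change the mixed second derivative by no more than o(s) when the spectra
  move by O(s). So the mixed partial derivative of the error, which contains the second derivative
  of g, must have a vanishing first derivative at the pairs of eigenvalues. This is where the third
  derivative of g enters. Divided differences over distinct points yield it without presupposing any
  regularity: a sign in order 6 bounds order 5, hence order 4, and this pays for three
  derivatives.\<close>

definition divided_diff :: "(real \<Rightarrow> real) \<Rightarrow> real set \<Rightarrow> real" where
  "divided_diff f S = (\<Sum>x\<in>S. f x / (\<Prod>y\<in>S - {x}. x - y))"

lemma divided_diff_insert:
  assumes "finite S" "x \<notin> S"
  shows "divided_diff f (insert x S) =
    f x / (\<Prod>y\<in>S. x - y) + (\<Sum>z\<in>S. f z / ((z - x) * (\<Prod>y\<in>S - {z}. z - y)))"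
proof -
  have "(\<Prod>y\<in>insert x S - {z}. z - y) = (z - x) * (\<Prod>y\<in>S - {z}. z - y)" if "z \<in> S" for z
  proof -
    have "insert x S - {z} = insert x (S - {z})" using that assms by auto
    then show ?thesis using assms by simp
  qed
  moreover have "insert x S - {x} = S" using assms by auto
  ultimately show ?thesis using assms by (simp add: divided_diff_def)
qed

text \<open>At the common nodes, 1/(z - x) - 1/(z - y) = (x - y) / ((z - x) (z - y)), while x and y
  each occur in only one of the two differences. This is the recursion of divided differences, read
  as the exchange of one node.\<close>

lemma divided_diff_exchange:
  assumes "finite S" "x \<notin> S" "y \<notin> S" "x \<noteq> y"
  shows "divided_diff f (insert x S) - divided_diff f (insert y S) =
    (x - y) * divided_diff f (insert x (insert y S))"
proof -
  define P where "P = (\<lambda>z. \<Prod>y\<in>S - {z}. z - y)"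
  have P: "P z \<noteq> 0" if "z \<in> S" for z
    using assms that by (auto simp: P_def)
  have Px: "(\<Prod>z\<in>S. x - z) \<noteq> 0" and Py: "(\<Prod>z\<in>S. y - z) \<noteq> 0" using assms by auto
  have "(\<Sum>z\<in>insert y S. f z / ((z - x) * (\<Prod>v\<in>insert y S - {z}. z - v))) =
      f y / ((y - x) * (\<Prod>z\<in>S. y - z)) + (\<Sum>z\<in>S. f z / ((z - x) * ((z - y) * P z)))"
  proof -
    have 1: "insert y S - {y} = S" using assms by auto
    have 2: "(\<Prod>v\<in>insert y S - {z}. z - v) = (z - y) * P z" if "z \<in> S" for z
    proof -
      have "insert y S - {z} = insert y (S - {z})" using that assms by auto
      then show ?thesis using assms by (simp add: P_def)
    qed
    show ?thesis using assms 1 2 by simp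
  qed
  then have 3: "divided_diff f (insert x (insert y S)) = f x / ((x - y) * (\<Prod>z\<in>S. x - z)) +
      (f y / ((y - x) * (\<Prod>z\<in>S. y - z)) + (\<Sum>z\<in>S. f z / ((z - x) * ((z - y) * P z))))"
    using assms by (subst divided_diff_insert) auto
  have 4: "f z / ((z - x) * P z) - f z / ((z - y) * P z) = (x - y) * (f z / ((z - x) * ((z - y) * P z)))"
    if "z \<in> S" for z
  proof -
    have "z \<noteq> x" "z \<noteq> y" using that assms by auto
    then show ?thesis using P[OF that] by (simp add: divide_simps) (simp add: algebra_simps)
  qed
  have 5: "(x - y) * (f x / ((x - y) * (\<Prod>z\<in>S. x - z))) = f x / (\<Prod>z\<in>S. x - z)"
    "(x - y) * (f y / ((y - x) * (\<Prod>z\<in>S. y - z))) = - (f y / (\<Prod>z\<in>S. y - z))"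
    using assms Px Py by (auto simp: divide_simps) (simp add: algebra_simps)
  have "(\<Sum>z\<in>S. f z / ((z - x) * P z)) - (\<Sum>z\<in>S. f z / ((z - y) * P z)) =
      (x - y) * (\<Sum>z\<in>S. f z / ((z - x) * ((z - y) * P z)))"
    using 4 by (simp add: sum_subtractf[symmetric] sum_distrib_left)
  then show ?thesis
    unfolding 3 distrib_left using assms 5 by (simp add: divided_diff_insert P_def)
qed

text \<open>The nodes of \<open>S\<close> are moved to their images one at a time, each move being
  one application of the exchange rule. \<open>R\<close> holds the nodes already moved and is there
  for the induction; applications start with \<open>R = {}\<close>.\<close>

lemma divided_diff_telescope:
  assumes "finite S" "finite R" "inj_on \<phi> S" "R \<inter> S = {}" "R \<inter> \<phi> ` S = {}" "S \<inter> \<phi> ` S = {}"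
  shows "\<exists>w. divided_diff f (R \<union> \<phi> ` S) - divided_diff f (R \<union> S) = (\<Sum>s\<in>S. (\<phi> s - s) * w s) \<and>
    (\<forall>s\<in>S. \<exists>U\<subseteq>R \<union> S \<union> \<phi> ` S. card U = Suc (card R + card S) \<and> w s = divided_diff f U)"
  using assms
proof (induction S arbitrary: R rule: finite_induct)
  case empty
  then show ?case by simp
next
  case (insert s S)
  let ?R = "insert (\<phi> s) R"
  have d: "\<phi> s \<notin> S" "s \<notin> R" "\<phi> s \<notin> R" "s \<noteq> \<phi> s" "s \<notin> \<phi> ` S" using insert.prems by auto
  have 1: "finite ?R" "inj_on \<phi> S" "?R \<inter> S = {}" "?R \<inter> \<phi> ` S = {}" "S \<inter> \<phi> ` S = {}"
    using insert.prems insert.hyps by (auto simp: inj_on_def)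
  obtain w where w: "divided_diff f (?R \<union> \<phi> ` S) - divided_diff f (?R \<union> S) = (\<Sum>s\<in>S. (\<phi> s - s) * w s)"
    "\<forall>s\<in>S. \<exists>U\<subseteq>?R \<union> S \<union> \<phi> ` S. card U = Suc (card ?R + card S) \<and> w s = divided_diff f U"
    using insert.IH[OF 1] by blast
  define U where "U = insert (\<phi> s) (insert s (R \<union> S))"
  have cU: "card U = Suc (card R + card (insert s S))"
    using insert.prems insert.hyps d by (auto simp: U_def card_Un_disjoint)
  have "divided_diff f (insert (\<phi> s) (R \<union> S)) - divided_diff f (insert s (R \<union> S)) = (\<phi> s - s) * divided_diff f U"
    unfolding U_def using insert.prems insert.hyps d by (intro divided_diff_exchange) auto
  then have "divided_diff f (R \<union> \<phi> ` insert s S) - divided_diff f (R \<union> insert s S) =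
      (\<Sum>s\<in>S. (\<phi> s - s) * w s) + (\<phi> s - s) * divided_diff f U"
    using w(1) by simp
  also have "\<dots> = (\<Sum>t\<in>insert s S. (\<phi> t - t) * (w(s := divided_diff f U)) t)"
    using insert.hyps by (auto intro!: sum.cong simp: add.commute)
  finally have 2: "divided_diff f (R \<union> \<phi> ` insert s S) - divided_diff f (R \<union> insert s S) =
      (\<Sum>t\<in>insert s S. (\<phi> t - t) * (w(s := divided_diff f U)) t)" .
  have 3: "\<exists>V\<subseteq>R \<union> insert s S \<union> \<phi> ` insert s S. card V = Suc (card R + card (insert s S)) \<and>
      (w(s := divided_diff f U)) t = divided_diff f V" if "t \<in> insert s S" for t
  proof (cases "t = s")
    case True
    then show ?thesis using cU by (intro exI[of _ U]) (auto simp: U_def)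
  next
    case False
    then have t: "t \<in> S" using that by simp
    obtain V where V: "V \<subseteq> ?R \<union> S \<union> \<phi> ` S" "card V = Suc (card ?R + card S)" "w t = divided_diff f V"
      using w(2) t by blast
    have "V \<subseteq> R \<union> insert s S \<union> \<phi> ` insert s S" using V(1) by blast
    moreover have "card V = Suc (card R + card (insert s S))"
      using V(2) d(3) insert.hyps insert.prems(1) by simp
    ultimately show ?thesis using False V(3) by auto
  qed
  show ?case using 2 3 by blast
qed

text \<open>Order \<open>j\<close> has \<open>Suc j\<close> nodes. Only sets of distinct nodes
  occur, so the notion presupposes no regularity of \<open>f\<close>.\<close>

definition bounded_divided_diffs :: "nat \<Rightarrow> (real \<Rightarrow> real) \<Rightarrow> bool" where
  "bounded_divided_diffs j f \<longleftrightarrow>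
     (\<forall>b c. 0 < b \<longrightarrow> (\<exists>C. \<forall>S. S \<subseteq> {b..c} \<and> card S = Suc j \<longrightarrow> \<bar>divided_diff f S\<bar> \<le> C))"

lemma bounded_divided_diffsD:
  assumes "bounded_divided_diffs j f" "0 < b"
  obtains C where "C \<ge> 0" "\<And>S. S \<subseteq> {b..c} \<Longrightarrow> card S = Suc j \<Longrightarrow> \<bar>divided_diff f S\<bar> \<le> C"
proof -
  obtain C where C: "\<forall>S. S \<subseteq> {b..c} \<and> card S = Suc j \<longrightarrow> \<bar>divided_diff f S\<bar> \<le> C"
    using assms unfolding bounded_divided_diffs_def by meson
  show ?thesis
  proof (rule that[of "\<bar>C\<bar>"])
    fix S assume "S \<subseteq> {b..c}" "card S = Suc j"
    then have "\<bar>divided_diff f S\<bar> \<le> C" using C by blast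
    then show "\<bar>divided_diff f S\<bar> \<le> \<bar>C\<bar>" by linarith
  qed simp
qed

text \<open>If the differences of order j + 1 are nonnegative, those of order j grow as the nodes
  move to the right. On \<open>{b..c}\<close> they are therefore caught between the values at one
  fixed node set left of \<open>b\<close> and one right of \<open>c\<close>.\<close>

lemma bounded_divided_diffs_of_nonneg:
  assumes pos: "\<And>S. S \<subseteq> {0<..} \<Longrightarrow> card S = Suc (Suc j) \<Longrightarrow> 0 \<le> divided_diff f S"
  shows "bounded_divided_diffs j f"
  unfolding bounded_divided_diffs_def
proof (intro allI impI)
  fix b c :: real assume b: "0 < b"
  obtain T where T: "T \<subseteq> {b/2<..<b}" "finite T" "card T = Suc j"
    using infinite_arbitrarily_large[of "{b/2<..<b}"] b by auto
  obtain T' where T': "T' \<subseteq> {c<..<c+1}" "finite T'" "card T' = Suc j"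
    using infinite_arbitrarily_large[of "{c<..<c+1}"] by auto
  have mono: "divided_diff f A \<le> divided_diff f B"
    if A: "finite A" "card A = Suc j" "finite B" "card B = Suc j" "A \<subseteq> {0<..}"
      and less: "\<And>x y. x \<in> A \<Longrightarrow> y \<in> B \<Longrightarrow> x < y" for A B
  proof -
    obtain \<phi> where \<phi>: "bij_betw \<phi> A B" using A finite_same_card_bij[of A B] by auto
    then have im: "\<phi> ` A = B" "inj_on \<phi> A" by (auto simp: bij_betw_def)
    have B0: "B \<subseteq> {0<..}"
    proof
      fix y assume "y \<in> B"
      obtain x where "x \<in> A" using A by fastforce
      then show "y \<in> {0<..}" using less \<open>y \<in> B\<close> A by fastforce
    qed
    have "A \<inter> \<phi> ` A = {}" using im less by fastforce
    with divided_diff_telescope[of A "{}" \<phi> f] im A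
    obtain w where w: "divided_diff f B - divided_diff f A = (\<Sum>s\<in>A. (\<phi> s - s) * w s)"
      "\<forall>s\<in>A. \<exists>U\<subseteq>A \<union> B. card U = Suc (Suc j) \<and> w s = divided_diff f U" by auto
    have "0 \<le> (\<phi> s - s) * w s" if "s \<in> A" for s
    proof -
      have "0 \<le> w s" using w(2) that pos A B0 by (metis Un_least subset_trans)
      moreover have "s < \<phi> s" using less that im by blast
      ultimately show ?thesis by simp
    qed
    then show ?thesis using w(1) sum_nonneg[of A] by (smt (verit))
  qed
  show "\<exists>C. \<forall>S. S \<subseteq> {b..c} \<and> card S = Suc j \<longrightarrow> \<bar>divided_diff f S\<bar> \<le> C"
  proof (intro exI[of _ "\<bar>divided_diff f T\<bar> + \<bar>divided_diff f T'\<bar>"] allI impI)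
    fix S assume S: "S \<subseteq> {b..c} \<and> card S = Suc j"
    then have fin: "finite S" by (metis card.infinite nat.distinct(1))
    have "divided_diff f T \<le> divided_diff f S"
      by (rule mono) (use T S fin b in fastforce)+
    moreover have "divided_diff f S \<le> divided_diff f T'"
      by (rule mono) (use T' S fin b in fastforce)+
    ultimately show "\<bar>divided_diff f S\<bar> \<le> \<bar>divided_diff f T\<bar> + \<bar>divided_diff f T'\<bar>" by linarith
  qed
qed

text \<open>Comparison with a fixed node set \<open>T\<close> just left of the interval: replacing
  its nodes by those of \<open>S\<close> costs \<open>Suc j\<close> differences of the next order,
  each multiplied by a displacement of at most \<open>c\<close>.\<close>

lemma bounded_divided_diffs_lower:
  assumes "bounded_divided_diffs (Suc j) f"
  shows "bounded_divided_diffs j f"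
  unfolding bounded_divided_diffs_def
proof (intro allI impI)
  fix b c :: real assume b: "0 < b"
  obtain T where T: "T \<subseteq> {b/2<..<b}" "finite T" "card T = Suc j"
    using infinite_arbitrarily_large[of "{b/2<..<b}"] b by auto
  obtain C where C: "C \<ge> 0" "\<And>S. S \<subseteq> {b/2..max b c} \<Longrightarrow> card S = Suc (Suc j) \<Longrightarrow> \<bar>divided_diff f S\<bar> \<le> C"
    using bounded_divided_diffsD[OF assms, of "b/2"] b by (metis half_gt_zero)
  show "\<exists>C. \<forall>S. S \<subseteq> {b..c} \<and> card S = Suc j \<longrightarrow> \<bar>divided_diff f S\<bar> \<le> C"
  proof (intro exI[of _ "\<bar>divided_diff f T\<bar> + Suc j * (\<bar>c\<bar> * C)"] allI impI)
    fix S assume S: "S \<subseteq> {b..c} \<and> card S = Suc j"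
    then have fin: "finite S" by (metis card.infinite nat.distinct(1))
    obtain \<phi> where \<phi>: "bij_betw \<phi> T S" using T S fin finite_same_card_bij[of T S] by auto
    then have im: "\<phi> ` T = S" "inj_on \<phi> T" by (auto simp: bij_betw_def)
    have "T \<inter> \<phi> ` T = {}" using im T S by fastforce
    with divided_diff_telescope[of T "{}" \<phi> f] im T
    obtain w where w: "divided_diff f S - divided_diff f T = (\<Sum>s\<in>T. (\<phi> s - s) * w s)"
      "\<forall>s\<in>T. \<exists>U\<subseteq>T \<union> S. card U = Suc (Suc j) \<and> w s = divided_diff f U" by auto
    have "\<bar>(\<phi> s - s) * w s\<bar> \<le> \<bar>c\<bar> * C" if s: "s \<in> T" for s
    proof -
      have sub: "T \<union> S \<subseteq> {b/2..max b c}" using T S b by fastforce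
      obtain U where U: "U\<subseteq>T \<union> S" "card U = Suc (Suc j)" "w s = divided_diff f U" using w(2) s by blast
      have "\<bar>w s\<bar> \<le> C" unfolding U(3) by (rule C(2)[OF subset_trans[OF U(1) sub] U(2)])
      moreover have "\<bar>\<phi> s - s\<bar> \<le> \<bar>c\<bar>"
      proof -
        have "\<phi> s \<in> {b..c}" "s \<in> {b/2<..<b}" using s im T S by auto
        then show ?thesis using b by auto
      qed
      ultimately show ?thesis unfolding abs_mult by (intro mult_mono) auto
    qed
    then have "\<bar>\<Sum>s\<in>T. (\<phi> s - s) * w s\<bar> \<le> (\<Sum>s\<in>T. \<bar>c\<bar> * C)"
      by (intro order_trans[OF sum_abs] sum_mono)
    then show "\<bar>divided_diff f S\<bar> \<le> \<bar>divided_diff f T\<bar> + Suc j * (\<bar>c\<bar> * C)"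
      using w(1) T by simp
  qed
qed

text \<open>Bounded differences of order 2 make the difference quotient at \<open>a\<close>
  Lipschitz on a punctured neighbourhood of \<open>a\<close>, so it has a limit there.\<close>

lemma bounded_divided_diffs_differentiable:
  assumes "bounded_divided_diffs 2 f" "0 < a"
  shows "\<exists>l. (f has_real_derivative l) (at a)"
proof -
  obtain C where C: "C \<ge> 0" "\<And>S. S \<subseteq> {a/2..2*a} \<Longrightarrow> card S = Suc 2 \<Longrightarrow> \<bar>divided_diff f S\<bar> \<le> C"
    using bounded_divided_diffsD[OF assms(1), of "a/2"] assms(2) by (metis half_gt_zero)
  define q where "q = (\<lambda>x. (f x - f a) / (x - a))"
  have lip: "\<bar>q x - q y\<bar> \<le> C * \<bar>x - y\<bar>"
    if "x \<in> {a/2..2*a}" "y \<in> {a/2..2*a}" "x \<noteq> a" "y \<noteq> a" for x y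
  proof (cases "x = y")
    case False
    have q: "q z = divided_diff f (insert z {a})" if "z \<noteq> a" for z
      using that by (subst divided_diff_insert) (auto simp: q_def divide_simps, simp add: algebra_simps)
    have "q x - q y = (x - y) * divided_diff f (insert x (insert y {a}))"
      unfolding q[OF that(3)] q[OF that(4)] using that False by (intro divided_diff_exchange) auto
    moreover have "\<bar>divided_diff f (insert x (insert y {a}))\<bar> \<le> C"
      using that False assms(2) by (intro C) auto
    ultimately show ?thesis unfolding abs_mult by (simp add: abs_mult mult.commute[of C] mult_left_mono)
  qed simp
  \<comment> \<open>Any sequence in the interval that avoids \<open>a\<close> and tends to it would
    do; it only serves to produce the candidate \<open>l\<close> by completeness.\<close>
  define X where "X = (\<lambda>n. a + a / (real n + 1))"
  have X: "X n \<in> {a/2..2*a}" "X n \<noteq> a" for n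
    using assms(2) by (auto simp: X_def field_simps)
  have Xlim: "X \<longlonglongrightarrow> a" unfolding X_def by real_asymp
  have "Cauchy (\<lambda>n. q (X n))"
  proof (rule metric_CauchyI)
    fix e :: real assume "e > 0"
    have "Cauchy X" using Xlim by (rule LIMSEQ_imp_Cauchy)
    then obtain N where N: "\<And>m n. m \<ge> N \<Longrightarrow> n \<ge> N \<Longrightarrow> dist (X m) (X n) < e / (C + 1)"
      using metric_CauchyD[of X "e / (C+1)"] \<open>e > 0\<close> C(1) by fastforce
    have "dist (q (X m)) (q (X n)) < e" if "m \<ge> N" "n \<ge> N" for m n
    proof -
      have "dist (q (X m)) (q (X n)) \<le> C * \<bar>X m - X n\<bar>"
        unfolding dist_real_def by (rule lip[OF X(1) X(1) X(2) X(2)])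
      also have "\<dots> \<le> (C + 1) * \<bar>X m - X n\<bar>" by (intro mult_right_mono) auto
      also have "\<dots> < e" using N[OF that] C(1) by (simp add: dist_real_def pos_less_divide_eq mult.commute)
      finally show ?thesis .
    qed
    then show "\<exists>M. \<forall>m\<ge>M. \<forall>n\<ge>M. dist (q (X m)) (q (X n)) < e" by blast
  qed
  then obtain l where l: "(\<lambda>n. q (X n)) \<longlonglongrightarrow> l" using Cauchy_convergent convergent_def by metis
  have bound: "\<bar>q x - l\<bar> \<le> C * \<bar>x - a\<bar>" if "x \<in> {a/2..2*a}" "x \<noteq> a" for x
  proof (rule LIMSEQ_le)
    show "(\<lambda>n. \<bar>q x - q (X n)\<bar>) \<longlonglongrightarrow> \<bar>q x - l\<bar>" by (intro tendsto_intros l)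
    show "(\<lambda>n. C * \<bar>x - X n\<bar>) \<longlonglongrightarrow> C * \<bar>x - a\<bar>" by (intro tendsto_intros Xlim)
    show "\<exists>N. \<forall>n\<ge>N. \<bar>q x - q (X n)\<bar> \<le> C * \<bar>x - X n\<bar>"
      using lip[OF that(1) X(1) that(2) X(2)] by blast
  qed
  have "((\<lambda>x. q x - l) \<longlongrightarrow> 0) (at a)"
  proof (rule Lim_null_comparison)
    have "eventually (\<lambda>x. x \<in> {a/2<..<2*a}) (at a)" using assms(2)
      by (intro eventually_at_in_open') auto
    moreover have "eventually (\<lambda>x. x \<noteq> a) (at a)" by (simp add: eventually_at_filter)
    ultimately show "eventually (\<lambda>x. norm (q x - l) \<le> C * \<bar>x - a\<bar>) (at a)"
      by eventually_elim (auto intro!: bound)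
    have "((\<lambda>x. C * \<bar>x - a\<bar>) \<longlongrightarrow> C * \<bar>a - a\<bar>) (at a)" by (intro tendsto_intros)
    then show "((\<lambda>x. C * \<bar>x - a\<bar>) \<longlongrightarrow> 0) (at a)" by simp
  qed
  then have "(q \<longlongrightarrow> l) (at a)" by (simp add: LIM_zero_iff)
  then show ?thesis unfolding has_field_derivative_iff q_def by blast
qed

text \<open>The denominators depend on differences of nodes only. Hence translating all nodes by h
  and dividing the increment by h leads to the divided difference of \<open>f'\<close> in the limit,
  and telescoping writes the same quotient as a sum of \<open>Suc j\<close> differences of
  \<open>f\<close> of the next order.\<close>

lemma bounded_divided_diffs_deriv:
  assumes bd: "bounded_divided_diffs (Suc j) f"
    and f': "\<And>x. 0 < x \<Longrightarrow> (f has_real_derivative f' x) (at x)"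
  shows "bounded_divided_diffs j f'"
  unfolding bounded_divided_diffs_def
proof (intro allI impI)
  fix b c :: real assume b: "0 < b"
  obtain C where C: "C \<ge> 0" "\<And>S. S \<subseteq> {b..c+1} \<Longrightarrow> card S = Suc (Suc j) \<Longrightarrow> \<bar>divided_diff f S\<bar> \<le> C"
    using bounded_divided_diffsD[OF bd b] by metis
  show "\<exists>C. \<forall>S. S \<subseteq> {b..c} \<and> card S = Suc j \<longrightarrow> \<bar>divided_diff f' S\<bar> \<le> C"
  proof (intro exI[of _ "Suc j * C"] allI impI)
    fix S assume S: "S \<subseteq> {b..c} \<and> card S = Suc j"
    then have fin: "finite S" by (metis card.infinite nat.distinct(1))
    have prod: "(\<Prod>y\<in>(+) h ` S - {h + x}. h + x - y) = (\<Prod>y\<in>S - {x}. x - y)" for h x :: real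
    proof -
      have "(+) h ` S - {h + x} = (+) h ` (S - {x})" by auto
      then show ?thesis by (simp add: prod.reindex)
    qed
    have shift: "divided_diff f ((+) h ` S) = (\<Sum>x\<in>S. f (x + h) / (\<Prod>y\<in>S - {x}. x - y))" for h
      unfolding divided_diff_def by (simp add: sum.reindex prod) (simp add: add.commute)
    have lim: "((\<lambda>h. (divided_diff f ((+) h ` S) - divided_diff f S) / h) \<longlongrightarrow> divided_diff f' S) (at_right 0)"
    proof -
      have "((\<lambda>h. (f (x + h) - f x) / h / (\<Prod>y\<in>S - {x}. x - y)) \<longlongrightarrow> f' x / (\<Prod>y\<in>S - {x}. x - y)) (at_right 0)"
        if "x \<in> S" for x
      proof -
        have "((\<lambda>h. (f (x + h) - f x) / h) \<longlongrightarrow> f' x) (at 0)"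
          using f'[of x] that S b by (auto simp: DERIV_def)
        then have "((\<lambda>h. (f (x + h) - f x) / h) \<longlongrightarrow> f' x) (at_right 0)"
          by (rule filterlim_mono) (auto intro: at_le)
        then show ?thesis using fin that by (intro tendsto_divide tendsto_const) auto
      qed
      then have "((\<lambda>h. \<Sum>x\<in>S. (f (x + h) - f x) / h / (\<Prod>y\<in>S - {x}. x - y)) \<longlongrightarrow> divided_diff f' S) (at_right 0)"
        unfolding divided_diff_def by (intro tendsto_sum)
      moreover have "(\<Sum>x\<in>S. (f (x + h) - f x) / h / (\<Prod>y\<in>S - {x}. x - y)) =
          (divided_diff f ((+) h ` S) - divided_diff f S) / h" for h
        unfolding shift by (simp add: divided_diff_def diff_divide_distrib sum_subtractf sum_divide_distrib
          mult.commute)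
      ultimately show ?thesis by simp
    qed
    \<comment> \<open>The shift has to avoid the differences of nodes; otherwise \<open>S\<close>
      meets its translate and telescoping does not apply.\<close>
    define D where "D = (\<lambda>(x, y). y - x) ` (S \<times> S)"
    have finD: "finite D" using fin by (simp add: D_def)
    have "eventually (\<lambda>h. h \<in> {0<..<1} \<and> h \<notin> D) (at_right (0::real))"
    proof -
      have "eventually (\<lambda>h. h \<in> {0<..<1}) (at_right (0::real))" by (rule eventually_at_right_real) simp
      moreover have "eventually (\<lambda>h. h \<notin> D - {0}) (at_right (0::real))"
      proof -
        have "open (- (D - {0}))" using finD by (intro open_Compl finite_imp_closed) auto
        then have "eventually (\<lambda>h. h \<in> - (D - {0})) (nhds 0)" by (rule eventually_nhds_in_open) auto
        then show ?thesis by (auto simp: eventually_at_filter elim: eventually_mono)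
      qed
      ultimately show ?thesis by eventually_elim auto
    qed
    then have "eventually (\<lambda>h. \<bar>(divided_diff f ((+) h ` S) - divided_diff f S) / h\<bar> \<le> Suc j * C) (at_right 0)"
    proof eventually_elim
      case (elim h)
      then have h: "0 < h" "h < 1" "h \<notin> D" by auto
      have disj: "S \<inter> (+) h ` S = {}"
      proof (rule ccontr)
        assume "S \<inter> (+) h ` S \<noteq> {}"
        then obtain x y where "x \<in> S" "y \<in> S" "y = h + x" by auto
        then have "h \<in> D" unfolding D_def by (intro image_eqI[of _ _ "(x, y)"]) auto
        then show False using h by simp
      qed
      obtain w where w: "divided_diff f ((+) h ` S) - divided_diff f S = (\<Sum>s\<in>S. (h + s - s) * w s)"
        "\<forall>s\<in>S. \<exists>U\<subseteq>S \<union> (+) h ` S. card U = Suc (Suc j) \<and> w s = divided_diff f U"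
        using divided_diff_telescope[of S "{}" "(+) h" f] fin disj S by auto
      have "\<bar>w s\<bar> \<le> C" if s: "s \<in> S" for s
      proof -
        obtain U where U: "U\<subseteq>S \<union> (+) h ` S" "card U = Suc (Suc j)" "w s = divided_diff f U" using w(2) s by blast
        have sub: "S \<union> (+) h ` S \<subseteq> {b..c+1}" using S h by fastforce
        show ?thesis unfolding U(3) by (rule C(2)[OF subset_trans[OF U(1) sub] U(2)])
      qed
      then have "\<bar>\<Sum>s\<in>S. w s\<bar> \<le> (\<Sum>s\<in>S. C)"
        by (intro order_trans[OF sum_abs] sum_mono)
      moreover have "(divided_diff f ((+) h ` S) - divided_diff f S) / h = (\<Sum>s\<in>S. w s)"
        using w(1) h by (simp add: sum_distrib_left[symmetric])
      ultimately show ?case using S by simp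
    qed
    then show "\<bar>divided_diff f' S\<bar> \<le> Suc j * C"
      by (intro tendsto_upperbound[OF tendsto_rabs[OF lim]]) auto
  qed
qed

definition thrice_differentiable :: "(real \<Rightarrow> real) \<Rightarrow> bool" where
  "thrice_differentiable f \<longleftrightarrow> (\<exists>f1 f2 f3. \<forall>x>0. (f has_real_derivative f1 x) (at x) \<and>
     (f1 has_real_derivative f2 x) (at x) \<and> (f2 has_real_derivative f3 x) (at x))"

text \<open>Each derivative lowers the order of boundedness by one, and differentiability itself
  takes order 2: from order 4, the second derivative is still bounded in order 2.\<close>

lemma bounded_divided_diffs_thrice_differentiable:
  assumes f: "bounded_divided_diffs 4 f"
  shows "thrice_differentiable f"
proof -
  have low: "bounded_divided_diffs 2 h \<Longrightarrow> \<exists>h'. \<forall>x>0. (h has_real_derivative h' x) (at x)" for h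
    using bounded_divided_diffs_differentiable by metis
  have f3: "bounded_divided_diffs 3 f" and f2: "bounded_divided_diffs 2 f"
    using bounded_divided_diffs_lower[of 3 f] bounded_divided_diffs_lower[of 2 f] f
    by (simp_all add: eval_nat_numeral)
  obtain f1 where f1: "\<And>x. x > 0 \<Longrightarrow> (f has_real_derivative f1 x) (at x)" using low[OF f2] by blast
  have "bounded_divided_diffs 3 f1" using bounded_divided_diffs_deriv[of 3 f f1] f f1 by simp
  then have f1b: "bounded_divided_diffs 2 f1" "bounded_divided_diffs (Suc 2) f1"
    using bounded_divided_diffs_lower[of 2 f1] by (simp_all add: eval_nat_numeral)
  obtain f2 where f2: "\<And>x. x > 0 \<Longrightarrow> (f1 has_real_derivative f2 x) (at x)" using low[OF f1b(1)] by blast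
  have "bounded_divided_diffs 2 f2" using bounded_divided_diffs_deriv[OF f1b(2) f2] .
  then obtain f3 where "\<And>x. x > 0 \<Longrightarrow> (f2 has_real_derivative f3 x) (at x)" using low by blast
  then show ?thesis unfolding thrice_differentiable_def using f1 f2 by blast
qed

text \<open>Exchange two of the nodes: the two smaller differences agree, being both 1 if they have
  a single node and both 0 by induction otherwise.\<close>

lemma divided_diff_one:
  assumes "finite S" "2 \<le> card S"
  shows "divided_diff (\<lambda>_. 1) S = 0"
  using assms
proof (induction "card S" arbitrary: S rule: less_induct)
  case less
  obtain a S1 where 1: "S = insert a S1" "a \<notin> S1"
    using less.prems by (metis card.empty ex_in_conv mk_disjoint_insert not_numeral_le_zero)
  obtain b T where 2: "S1 = insert b T" "b \<notin> T"
    using less.prems 1 by (metis One_nat_def Suc_1 Suc_leD card.empty card_insert_disjoint ex_in_conv finite_insert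
      mk_disjoint_insert not_less_eq_eq order_refl)
  have fin: "finite T" and ab: "a \<noteq> b" "a \<notin> T" using less.prems 1 2 by auto
  have c: "card S = Suc (Suc (card T))" using fin ab 1 2 by simp
  have "divided_diff (\<lambda>_. 1) (insert a T) = divided_diff (\<lambda>_. 1) (insert b T)"
  proof (cases "T = {}")
    case True
    then show ?thesis by (simp add: divided_diff_def)
  next
    case False
    then have "2 \<le> Suc (card T)" using fin by (simp add: Suc_le_eq card_gt_0_iff)
    then show ?thesis using less.hyps[of "insert a T"] less.hyps[of "insert b T"] c fin ab 2 by simp
  qed
  then have "(a - b) * divided_diff (\<lambda>_. 1) S = 0"
    using divided_diff_exchange[of T a b "\<lambda>_. 1"] fin ab 1 2 by simp
  then show ?case using ab by simp
qed

text \<open>Synthetic division at a node \<open>a\<close>: the factor x - a removes the term at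
  \<open>a\<close> and cancels one factor of each other denominator, which leaves the divided
  difference of the quotient over the remaining nodes.\<close>

lemma divided_diff_poly:
  assumes "finite S" "degree p < card S"
  shows "divided_diff (poly p) S = coeff p (card S - 1)"
  using assms
proof (induction S arbitrary: p rule: finite_induct)
  case empty
  then show ?case by simp
next
  case (insert a S)
  show ?case
  proof (cases "S = {}")
    case True
    then obtain c where "p = [:c:]" using insert.prems degree_eq_zeroE[of p] by auto
    then show ?thesis using True by (simp add: divided_diff_def)
  next
    case False
    then have cS: "card S > 0" using insert.hyps by (simp add: card_gt_0_iff)
    define q where "q = synthetic_div p a"
    define d where "d = poly p a"
    have p: "p = [:d:] + [:-a, 1:] * q"
      using synthetic_div_correct'[of a p] by (simp add: q_def d_def)
    have dq: "degree q < card S" using insert.prems insert.hyps cS by (simp add: q_def degree_synthetic_div)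
    have "poly p x = d + (x - a) * poly q x" for x
      using arg_cong[OF p, of "\<lambda>p. poly p x"] by (simp add: algebra_simps)
    then have split: "divided_diff (poly p) T = d * divided_diff (\<lambda>_. 1) T + divided_diff (\<lambda>x. (x - a) * poly q x) T"
      for T
      by (simp add: divided_diff_def sum_distrib_left sum.distrib[symmetric] add_divide_distrib[symmetric])
    have red: "divided_diff (\<lambda>x. (x - a) * poly q x) (insert a S) = divided_diff (poly q) S"
      using insert.hyps by (subst divided_diff_insert) (auto simp: divided_diff_def intro!: sum.cong)
    have one: "divided_diff (\<lambda>_. 1) (insert a S) = 0"
      using cS insert.hyps by (intro divided_diff_one) auto
    have co: "coeff p (card S) = coeff q (card S - 1)"
    proof -
      obtain k where k: "card S = Suc k" using cS by (cases "card S") auto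
      have "coeff q (Suc k) = 0" using dq k by (intro coeff_eq_0) auto
      then show ?thesis using arg_cong[OF p, of "\<lambda>p. coeff p (Suc k)"] k by simp
    qed
    then show ?thesis unfolding split red one using insert.IH[OF dq] insert.hyps by simp
  qed
qed

section \<open>Operator convex functions\<close>

lemma mat_adjoint_index:
  assumes "A \<in> carrier_mat r c" "i < c" "j < r"
  shows "mat_adjoint A $$ (i, j) = cnj (A $$ (j, i))"
  using assms unfolding mat_adjoint_def by (auto simp: mat_of_rows_def)

lemma mat_adjoint_carrier: "A \<in> carrier_mat r c \<Longrightarrow> mat_adjoint A \<in> carrier_mat c r"
  unfolding mat_adjoint_def by (auto simp: mat_of_rows_def)

lemma mat_adjoint_one: "mat_adjoint (1\<^sub>m k :: complex mat) = 1\<^sub>m k"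
proof -
  have U: "(1\<^sub>m k :: complex mat) \<in> carrier_mat k k" by simp
  show ?thesis by (rule eq_matI) (use mat_adjoint_carrier[OF U] in \<open>auto simp: mat_adjoint_index[OF U]\<close>)
qed

text \<open>The shape that \<open>spectral_image\<close> prescribes: for unitary \<open>U\<close>, a
  function acts on it through \<open>d\<close> alone.\<close>

definition spectral_mat :: "nat \<Rightarrow> complex mat \<Rightarrow> (nat \<Rightarrow> real) \<Rightarrow> complex mat" where
  "spectral_mat k U d = U * mat_diag k (\<lambda>i. complex_of_real (d i)) * mat_adjoint U"

definition quad_form :: "complex mat \<Rightarrow> complex Matrix.vec \<Rightarrow> real" where
  "quad_form A x = Re ((A *\<^sub>v x) \<bullet>c x)"

lemma spectral_mat_carrier:
  "U \<in> carrier_mat k k \<Longrightarrow> spectral_mat k U d \<in> carrier_mat k k"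
  unfolding spectral_mat_def by (meson mat_adjoint_carrier mat_diag_dim mult_carrier_mat)

lemma spectral_mat_index:
  assumes U: "U \<in> carrier_mat k k" and "i < k" "j < k"
  shows "spectral_mat k U d $$ (i, j) = (\<Sum>l<k. U $$ (i, l) * d l * cnj (U $$ (j, l)))"
proof -
  have "U * mat_diag k (\<lambda>i. complex_of_real (d i)) = Matrix.mat k k (\<lambda>(i,l). U $$ (i,l) * d l)"
    by (rule mat_diag_mult_right[OF U])
  then show ?thesis unfolding spectral_mat_def
    using assms mat_adjoint_carrier[OF U]
    by (simp add: scalar_prod_def mat_adjoint_index[OF U] atLeast0LessThan)
qed

lemma spectral_mat_hermitian:
  assumes U: "U \<in> carrier_mat k k"
  shows "hermitian_mat k (spectral_mat k U d)"
  unfolding hermitian_mat_def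
proof (intro conjI spectral_mat_carrier[OF U] eq_matI)
  have C: "spectral_mat k U d \<in> carrier_mat k k" by (rule spectral_mat_carrier[OF U])
  show "dim_row (mat_adjoint (spectral_mat k U d)) = dim_row (spectral_mat k U d)"
    "dim_col (mat_adjoint (spectral_mat k U d)) = dim_col (spectral_mat k U d)"
    using C mat_adjoint_carrier[OF C] by auto
  fix i j assume "i < dim_row (spectral_mat k U d)" "j < dim_col (spectral_mat k U d)"
  then have ij: "i < k" "j < k" using C by auto
  show "mat_adjoint (spectral_mat k U d) $$ (i, j) = spectral_mat k U d $$ (i, j)"
    using ij by (subst mat_adjoint_index[OF C]) (simp_all add: spectral_mat_index[OF U] mult_ac)
qed

lemma quad_form_eq:
  assumes "A \<in> carrier_mat k k" "x \<in> carrier_vec k"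
  shows "quad_form A x = Re (\<Sum>i<k. \<Sum>j<k. A $$ (i,j) * vec_index x j * cnj (vec_index x i))"
  using assms unfolding quad_form_def
  by (simp add: scalar_prod_def atLeast0LessThan sum_distrib_right)

lemma quad_form_spectral_mat:
  assumes U: "U \<in> carrier_mat k k" and x: "x \<in> carrier_vec k"
  shows "quad_form (spectral_mat k U d) x =
    (\<Sum>l<k. d l * (cmod (\<Sum>j<k. cnj (U $$ (j, l)) * vec_index x j))\<^sup>2)"
proof -
  have "quad_form (spectral_mat k U d) x =
      Re (\<Sum>i<k. \<Sum>j<k. (\<Sum>l<k. U $$ (i, l) * d l * cnj (U $$ (j, l))) * vec_index x j * cnj (vec_index x i))"
    by (subst quad_form_eq[OF spectral_mat_carrier[OF U] x]) (simp add: spectral_mat_index[OF U])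
  also have "(\<Sum>i<k. \<Sum>j<k. (\<Sum>l<k. U $$ (i, l) * d l * cnj (U $$ (j, l))) * vec_index x j * cnj (vec_index x i)) =
      (\<Sum>i<k. \<Sum>j<k. \<Sum>l<k. d l * ((cnj (U $$ (j, l)) * vec_index x j) * (U $$ (i, l) * cnj (vec_index x i))))"
    unfolding sum_distrib_right by (intro sum.cong refl) (simp add: mult_ac)
  also have "\<dots> = (\<Sum>l<k. \<Sum>i<k. \<Sum>j<k. d l * ((cnj (U $$ (j, l)) * vec_index x j) *
      (U $$ (i, l) * cnj (vec_index x i))))"
    by (rule trans[OF sum.cong[OF refl sum.swap] sum.swap])
  also have "\<dots> = (\<Sum>l<k. d l * ((\<Sum>j<k. cnj (U $$ (j, l)) * vec_index x j) *
      cnj (\<Sum>j<k. cnj (U $$ (j, l)) * vec_index x j)))"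
  proof -
    have "(\<Sum>i<k. \<Sum>j<k. D * (a j * b i)) = D * ((\<Sum>j<k. a j) * (\<Sum>i<k. b i))" for a b :: "nat \<Rightarrow> complex" and D
      by (subst sum.swap, simp only: sum_product, simp only: sum_distrib_left)
    then show ?thesis by (intro sum.cong refl) simp
  qed
  also have "\<dots> = of_real (\<Sum>l<k. d l * (cmod (\<Sum>j<k. cnj (U $$ (j, l)) * vec_index x j))\<^sup>2)"
    unfolding of_real_sum of_real_mult complex_norm_square ..
  finally show ?thesis by simp
qed

lemma spectral_mat_pos_def:
  assumes U: "U \<in> carrier_mat k k" and UU: "U * mat_adjoint U = 1\<^sub>m k" and d: "\<And>l. l < k \<Longrightarrow> 0 < d l"
  shows "pos_def_mat k (spectral_mat k U d)"
  unfolding pos_def_mat_def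
proof (intro conjI ballI impI spectral_mat_hermitian[OF U])
  fix x :: "complex Matrix.vec" assume x: "x \<in> carrier_vec k" and x0: "x \<noteq> 0\<^sub>v k"
  let ?y = "\<lambda>l. cmod (\<Sum>j<k. cnj (U $$ (j, l)) * vec_index x j)"
  obtain i where i: "i < k" "vec_index x i \<noteq> 0" using x x0 by (metis carrier_vecD eq_vecI index_zero_vec)
  \<comment> \<open>With all eigenvalues equal to 1 the form is the squared length of
    \<open>x\<close>, so some coordinate of \<open>x\<close> in the basis of columns of
    \<open>U\<close> is nonzero.\<close>
  have "quad_form (spectral_mat k U (\<lambda>_. 1)) x = quad_form (1\<^sub>m k) x"
    using U UU mat_diag_one[of k, where 'a = complex] by (simp add: spectral_mat_def)
  also have "\<dots> = (\<Sum>i<k. (cmod (vec_index x i))\<^sup>2)"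
  proof -
    have "(\<Sum>j<k. 1\<^sub>m k $$ (i,j) * vec_index x j * cnj (vec_index x i)) = of_real ((cmod (vec_index x i))\<^sup>2)"
      if "i < k" for i
    proof -
      have "(\<Sum>j<k. 1\<^sub>m k $$ (i,j) * vec_index x j * cnj (vec_index x i)) =
          (\<Sum>j<k. if j = i then vec_index x i * cnj (vec_index x i) else 0)"
        using that by (intro sum.cong) auto
      then show ?thesis using that by (simp add: complex_norm_square[symmetric] del: of_real_power)
    qed
    then show ?thesis using x by (subst quad_form_eq[of _ k]) simp_all
  qed
  also have "\<dots> > 0" using i by (intro sum_pos2[of _ i]) auto
  finally have "0 < (\<Sum>l<k. (?y l)\<^sup>2)" using quad_form_spectral_mat[OF U x, of "\<lambda>_. 1"] by simp
  then obtain l where l: "l < k" "?y l \<noteq> 0"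
    by (metis (mono_tags, lifting) lessThan_iff less_irrefl power_zero_numeral sum.neutral)
  have "0 < (\<Sum>l<k. d l * (?y l)\<^sup>2)"
    using l d by (intro sum_pos2[of _ l]) (auto simp: less_imp_le)
  then show "0 < Re ((spectral_mat k U d *\<^sub>v x) \<bullet>c x)"
    using quad_form_spectral_mat[OF U x, of d] by (simp add: quad_form_def)
qed

text \<open>The block matrix with off-diagonal part deleted is the mean of the matrix and its conjugate
  by \<open>diag (1, \<dots>, 1, -1)\<close>.\<close>

lemma operator_convex_compression:
  fixes W :: "nat \<Rightarrow> nat \<Rightarrow> real"
  assumes g: "operator_convex g"
    and orth: "\<And>i j. i \<le> m \<Longrightarrow> j \<le> m \<Longrightarrow> (\<Sum>k\<le>m. W k i * W k j) = (if i = j then 1 else 0)"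
    and lam: "\<And>k. k \<le> m \<Longrightarrow> 0 < lam k"
    and mu: "\<And>i j. i < m \<Longrightarrow> j < m \<Longrightarrow> (\<Sum>k\<le>m. lam k * (W k i * W k j)) = (if i = j then mu i else 0)"
  shows "(\<Sum>i<m. (a i)\<^sup>2 * g (mu i)) \<le> (\<Sum>k\<le>m. g (lam k) * (\<Sum>i<m. W k i * a i)\<^sup>2)"
proof -
  define N where "N = Suc m"
  have range: "{..m} = {..<N}" by (auto simp: N_def)
  \<comment> \<open>The diagonal of the conjugating reflection: \<open>U'\<close> is
    \<open>U\<close> with its last row negated.\<close>
  define s where "s = (\<lambda>i. if i = m then -1 else 1 :: real)"
  define U where "U = Matrix.mat N N (\<lambda>(i,k). complex_of_real (W k i))"
  define U' where "U' = Matrix.mat N N (\<lambda>(i,k). complex_of_real (s i * W k i))"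
  \<comment> \<open>The mean is diagonal: its leading block by the hypothesis on \<open>mu\<close>,
    while the last diagonal entry is whatever the original matrix has there.\<close>
  define c where "c = (\<lambda>i. if i < m then mu i else (\<Sum>k\<le>m. lam k * (W k m * W k m)))"
  have UC: "U \<in> carrier_mat N N" "U' \<in> carrier_mat N N" "(1\<^sub>m N :: complex mat) \<in> carrier_mat N N"
    by (simp_all add: U_def U'_def)
  have orthN: "(\<Sum>k<N. W k i * W k j) = (if i = j then 1 else 0)" if "i < N" "j < N" for i j
    using orth[of i j] that by (simp only: range[symmetric]) (simp add: N_def)
  have UU: "U * mat_adjoint U = 1\<^sub>m N" "U' * mat_adjoint U' = 1\<^sub>m N"
  proof -
    have "U * mat_adjoint U = spectral_mat N U (\<lambda>_. 1)" "U' * mat_adjoint U' = spectral_mat N U' (\<lambda>_. 1)"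
      using UC mat_diag_one[of N, where 'a = complex] by (simp_all add: spectral_mat_def)
    moreover have "spectral_mat N U (\<lambda>_. 1) = 1\<^sub>m N"
    proof (rule eq_matI)
      fix i j assume "i < dim_row (1\<^sub>m N :: complex mat)" "j < dim_col (1\<^sub>m N :: complex mat)"
      then have ij: "i < N" "j < N" by auto
      then have "spectral_mat N U (\<lambda>_. 1) $$ (i,j) = of_real (\<Sum>k<N. W k i * W k j)"
        unfolding spectral_mat_index[OF UC(1) ij] by (simp add: U_def)
      then show "spectral_mat N U (\<lambda>_. 1) $$ (i,j) = 1\<^sub>m N $$ (i,j)"
        using ij by (simp only: orthN) simp
    qed (use spectral_mat_carrier[OF UC(1)] in auto)
    moreover have "spectral_mat N U' (\<lambda>_. 1) = 1\<^sub>m N"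
    proof (rule eq_matI)
      fix i j assume "i < dim_row (1\<^sub>m N :: complex mat)" "j < dim_col (1\<^sub>m N :: complex mat)"
      then have ij: "i < N" "j < N" by auto
      then have "spectral_mat N U' (\<lambda>_. 1) $$ (i,j) = of_real (s i * s j * (\<Sum>k<N. W k i * W k j))"
        unfolding spectral_mat_index[OF UC(2) ij] by (simp add: U'_def sum_distrib_left mult_ac)
      then show "spectral_mat N U' (\<lambda>_. 1) $$ (i,j) = 1\<^sub>m N $$ (i,j)"
        using ij by (simp only: orthN) (simp add: s_def)
    qed (use spectral_mat_carrier[OF UC(2)] in auto)
    ultimately show "U * mat_adjoint U = 1\<^sub>m N" "U' * mat_adjoint U' = 1\<^sub>m N" by simp_all
  qed
  have UU2: "mat_adjoint U * U = 1\<^sub>m N" "mat_adjoint U' * U' = 1\<^sub>m N"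
    using mat_mult_left_right_inverse[OF UC(1) mat_adjoint_carrier[OF UC(1)] UU(1)]
      mat_mult_left_right_inverse[OF UC(2) mat_adjoint_carrier[OF UC(2)] UU(2)] by simp_all
  have img: "spectral_image N g (spectral_mat N V d) (spectral_mat N V (\<lambda>l. g (d l)))"
    if "V \<in> carrier_mat N N" "mat_adjoint V * V = 1\<^sub>m N" for V d
    using that unfolding spectral_image_def spectral_mat_def by blast
  have ci: "c i = (\<Sum>k<N. lam k * (W k i * W k i))" if "i < N" for i
    using that mu[of i i] unfolding range by (auto simp: c_def N_def less_Suc_eq_le range)
  have C: "spectral_mat N (1\<^sub>m N) c =
      complex_of_real (1/2) \<cdot>\<^sub>m spectral_mat N U lam + complex_of_real (1 - 1/2) \<cdot>\<^sub>m spectral_mat N U' lam"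
  proof (rule eq_matI)
    fix i j assume "i < dim_row (complex_of_real (1/2) \<cdot>\<^sub>m spectral_mat N U lam +
        complex_of_real (1 - 1/2) \<cdot>\<^sub>m spectral_mat N U' lam)"
     "j < dim_col (complex_of_real (1/2) \<cdot>\<^sub>m spectral_mat N U lam +
         complex_of_real (1 - 1/2) \<cdot>\<^sub>m spectral_mat N U' lam)"
    then have ij: "i < N" "j < N" using carrier_matD[OF spectral_mat_carrier[OF UC(2)]] by auto
    have 1: "spectral_mat N U lam $$ (i,j) = of_real (\<Sum>k<N. lam k * (W k i * W k j))"
      unfolding spectral_mat_index[OF UC(1) ij] using ij by (simp add: U_def mult_ac)
    have 2: "spectral_mat N U' lam $$ (i,j) = of_real (s i * s j * (\<Sum>k<N. lam k * (W k i * W k j)))"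
      unfolding spectral_mat_index[OF UC(2) ij] using ij by (simp add: U'_def sum_distrib_left mult_ac)
    have 3: "spectral_mat N (1\<^sub>m N) c $$ (i,j) = of_real (if i = j then c i else 0)"
      using ij by (simp add: spectral_mat_index[OF UC(3)] if_distrib[of "\<lambda>a. a * _"] if_distrib[of cnj]
        if_distrib[of "\<lambda>a. _ * a"] cong: if_cong)
    have 4: "(if i = j then c i else 0) = 1/2 * (\<Sum>k<N. lam k * (W k i * W k j)) +
        1/2 * (s i * s j * (\<Sum>k<N. lam k * (W k i * W k j)))"
    proof (cases "i = j")
      case True
      then show ?thesis using ci[OF ij(1)] by (simp add: s_def)
    next
      case False
      show ?thesis
      proof (cases "i = m \<or> j = m")
        case True
        then show ?thesis using False by (auto simp: s_def)
      next
        case 5: False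
        then have "i < m" "j < m" using ij by (auto simp: N_def)
          then show ?thesis using mu[of i j] False unfolding range by simp
      qed
    qed
    have "spectral_mat N (1\<^sub>m N) c $$ (i,j) =
        1/2 * spectral_mat N U lam $$ (i,j) + 1/2 * spectral_mat N U' lam $$ (i,j)"
      unfolding 1 2 3 4 by simp
    then show "spectral_mat N (1\<^sub>m N) c $$ (i,j) =
      (complex_of_real (1/2) \<cdot>\<^sub>m spectral_mat N U lam + complex_of_real (1 - 1/2) \<cdot>\<^sub>m spectral_mat N U' lam) $$ (i,j)"
      using ij carrier_matD[OF spectral_mat_carrier[OF UC(1)]] carrier_matD[OF spectral_mat_carrier[OF UC(2)]] by simp
  qed (use carrier_matD[OF spectral_mat_carrier[OF UC(2)]] carrier_matD[OF spectral_mat_carrier[OF UC(3)]] in auto)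
  let ?gA = "spectral_mat N U (\<lambda>l. g (lam l))" and ?gB = "spectral_mat N U' (\<lambda>l. g (lam l))"
    and ?gC = "spectral_mat N (1\<^sub>m N) (\<lambda>l. g (c l))"
  have pd: "pos_def_mat N (spectral_mat N U lam)" "pos_def_mat N (spectral_mat N U' lam)"
    using lam spectral_mat_pos_def[OF UC(1) UU(1)] spectral_mat_pos_def[OF UC(2) UU(2)]
    by (simp_all add: N_def less_Suc_eq_le)
  have "loewner_le N ?gC (complex_of_real (1/2) \<cdot>\<^sub>m ?gA + complex_of_real (1 - 1/2) \<cdot>\<^sub>m ?gB)"
  proof (rule g[unfolded operator_convex_def, rule_format], intro conjI)
    show "spectral_mat N (1\<^sub>m N) c =
      complex_of_real (1/2) \<cdot>\<^sub>m spectral_mat N U lam + complex_of_real (1 - 1/2) \<cdot>\<^sub>m spectral_mat N U' lam"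
      by (rule C)
    show "spectral_image N g (spectral_mat N (1\<^sub>m N) c) ?gC"
      by (intro img UC) (simp add: mat_adjoint_one)
  qed (use pd img[OF UC(1) UU2(1)] img[OF UC(2) UU2(2)] in simp_all)
  \<comment> \<open>As the last coordinate is 0, the forms of \<open>?gA\<close> and
    \<open>?gB\<close> agree at \<open>x\<close>, and the last diagonal entry of the mean does not
    enter.\<close>
  moreover define x where "x = Matrix.vec N (\<lambda>i. complex_of_real (if i < m then a i else 0))"
  moreover have x: "x \<in> carrier_vec N" by (simp add: x_def)
  ultimately have ge: "0 \<le> quad_form ((complex_of_real (1/2) \<cdot>\<^sub>m ?gA + complex_of_real (1 - 1/2) \<cdot>\<^sub>m ?gB) - ?gC) x"
    unfolding loewner_le_def pos_semidef_mat_def quad_form_def by blast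
  have car: "?gA \<in> carrier_mat N N" "?gB \<in> carrier_mat N N" "?gC \<in> carrier_mat N N"
    by (simp_all add: spectral_mat_carrier UC)
  have "quad_form ((complex_of_real (1/2) \<cdot>\<^sub>m ?gA + complex_of_real (1 - 1/2) \<cdot>\<^sub>m ?gB) - ?gC) x =
      1/2 * quad_form ?gA x + 1/2 * quad_form ?gB x - quad_form ?gC x"
  proof -
    have "quad_form ((complex_of_real (1/2) \<cdot>\<^sub>m ?gA + complex_of_real (1 - 1/2) \<cdot>\<^sub>m ?gB) - ?gC) x =
        Re (\<Sum>i<N. \<Sum>j<N. (1/2 * ?gA $$ (i,j) + 1/2 * ?gB $$ (i,j) - ?gC $$ (i,j)) * vec_index x j *
        cnj (vec_index x i))"
      using car x by (subst quad_form_eq[of _ N]) auto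
    also have "(\<Sum>i<N. \<Sum>j<N. (1/2 * ?gA $$ (i,j) + 1/2 * ?gB $$ (i,j) - ?gC $$ (i,j)) * vec_index x j *
        cnj (vec_index x i)) =
        of_real (1/2) * (\<Sum>i<N. \<Sum>j<N. ?gA $$ (i,j) * vec_index x j * cnj (vec_index x i)) +
        of_real (1/2) * (\<Sum>i<N. \<Sum>j<N. ?gB $$ (i,j) * vec_index x j * cnj (vec_index x i)) -
        (\<Sum>i<N. \<Sum>j<N. ?gC $$ (i,j) * vec_index x j * cnj (vec_index x i))"
      unfolding sum_distrib_left sum.distrib[symmetric] sum_subtractf[symmetric]
      by (intro sum.cong refl) (simp add: algebra_simps)
    finally show ?thesis unfolding quad_form_eq[OF car(1) x] quad_form_eq[OF car(2) x] quad_form_eq[OF car(3) x]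
      by (simp del: of_real_divide)
  qed
  moreover have "quad_form ?gA x = (\<Sum>k\<le>m. g (lam k) * (\<Sum>i<m. W k i * a i)\<^sup>2)"
  proof -
    have "(\<Sum>j<N. cnj (U $$ (j, l)) * vec_index x j) = of_real (\<Sum>i<m. W l i * a i)" if "l < N" for l
      using that by (simp add: U_def x_def N_def)
    then have "(cmod (\<Sum>j<N. cnj (U $$ (j, l)) * vec_index x j))\<^sup>2 = (\<Sum>i<m. W l i * a i)\<^sup>2" if "l < N" for l
      using that by (simp only: norm_of_real power2_abs)
    then show ?thesis unfolding quad_form_spectral_mat[OF UC(1) x] range by simp
  qed
  moreover have "quad_form ?gB x = (\<Sum>k\<le>m. g (lam k) * (\<Sum>i<m. W k i * a i)\<^sup>2)"
  proof -
    have "(\<Sum>j<N. cnj (U' $$ (j, l)) * vec_index x j) = of_real (\<Sum>i<m. W l i * a i)" if "l < N" for l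
      using that by (simp add: U'_def x_def N_def s_def)
    then have "(cmod (\<Sum>j<N. cnj (U' $$ (j, l)) * vec_index x j))\<^sup>2 = (\<Sum>i<m. W l i * a i)\<^sup>2" if "l < N" for l
      using that by (simp only: norm_of_real power2_abs)
    then show ?thesis unfolding quad_form_spectral_mat[OF UC(2) x] range by simp
  qed
  moreover have "quad_form ?gC x = (\<Sum>i<m. (a i)\<^sup>2 * g (mu i))"
  proof -
    have "(\<Sum>j<N. cnj (1\<^sub>m N $$ (j, l)) * vec_index x j) = (\<Sum>j<N. if j = l then vec_index x j else 0)"
      if "l < N" for l by (intro sum.cong) (use that in auto)
    then have "(\<Sum>j<N. cnj (1\<^sub>m N $$ (j, l)) * vec_index x j) = vec_index x l" if "l < N" for l
      using that by simp
    then have "quad_form ?gC x = (\<Sum>l<N. g (c l) * (cmod (vec_index x l))\<^sup>2)"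
      unfolding quad_form_spectral_mat[OF UC(3) x] by simp
    also have "\<dots> = (\<Sum>i<m. (a i)\<^sup>2 * g (mu i))"
      by (simp add: N_def x_def c_def mult.commute)
    finally show ?thesis .
  qed
  ultimately show ?thesis using ge by simp
qed

lemma sum_even_odd:
  fixes f :: "nat \<Rightarrow> 'a::comm_monoid_add"
  shows "(\<Sum>j\<le>2*m. f j) = (\<Sum>k\<le>m. f (2*k)) + (\<Sum>i<m. f (2*i+1))"
proof (induction m)
  case (Suc m)
  have "(\<Sum>j\<le>2*Suc m. f j) = (\<Sum>j\<le>2*m. f j) + f (2*m+1) + f (2*Suc m)" by simp
  then show ?case unfolding Suc by (simp add: ac_simps)
qed simp

text \<open>Gauss quadrature: with the nodes of \<open>S\<close> in increasing order, the divided difference weights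
  are positive at even and negative at odd positions, and the odd nodes are the Gauss nodes for the
  measure on the even ones. In the orthonormal basis of the Lagrange polynomials at the odd nodes,
  the multiplication operator compresses to the diagonal matrix of the odd nodes.\<close>

lemma operator_convex_divided_diff_nonneg:
  assumes g: "operator_convex g" and S: "S \<subseteq> {0<..}" and card: "card S = 2 * m + 1" and m: "0 < m"
  shows "0 \<le> divided_diff g S"
proof -
  have fin: "finite S" using card by (metis add_is_0 card.infinite one_neq_zero)
  define x where "x = (\<lambda>j. sorted_list_of_set S ! j)"
  have less: "x i < x j" if "i < j" "j \<le> 2*m" for i j
    using that strict_sorted_list_of_set[of S] card sorted_wrt_nth_less[of "(<)" "sorted_list_of_set S" i j]
    by (simp add: x_def)
  have inj: "inj_on x {..2*m}"
    by (rule inj_onI) (metis atMost_iff less less_irrefl nat_neq_iff)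
  have img: "x ` {..2*m} = S"
  proof -
    have "S = (\<lambda>j. sorted_list_of_set S ! j) ` {..<card S}"
      using fin by (metis length_sorted_list_of_set list.set_map map_nth set_sorted_list_of_set set_upt
        atLeast0LessThan)
    then show ?thesis using card by (simp add: x_def lessThan_Suc_atMost)
  qed
  define P where "P = (\<lambda>j. \<Prod>l\<in>{..2*m} - {j}. x j - x l)"
  have PS: "(\<Prod>y\<in>S - {x j}. x j - y) = P j" if "j \<le> 2*m" for j
  proof -
    have "S - {x j} = x ` ({..2*m} - {j})"
      using inj that unfolding img[symmetric] by (subst inj_on_image_set_diff[of x "{..2*m}"]) auto
    then show ?thesis
      unfolding P_def using inj by (simp add: prod.reindex inj_on_diff)
  qed
  \<comment> \<open>Exactly the \<open>2*m - j\<close> factors with \<open>l > j\<close> are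
    negative, and this number has the parity of \<open>j\<close>.\<close>
  have Psign: "0 < (-1)^j * P j" if "j \<le> 2*m" for j
  proof -
    have "{..2*m} - {j} = {..<j} \<union> {j<..2*m}" using that by auto
    then have "P j = (\<Prod>l<j. x j - x l) * (\<Prod>l\<in>{j<..2*m}. x j - x l)"
      unfolding P_def by (simp add: prod.union_disjoint Int_def)
    also have "(\<Prod>l\<in>{j<..2*m}. x j - x l) = (\<Prod>l\<in>{j<..2*m}. (-1) * (x l - x j))" by simp
    also have "\<dots> = (-1)^(2*m - j) * (\<Prod>l\<in>{j<..2*m}. x l - x j)"
      by (subst prod.distrib) simp
    also have "(-1)^(2*m - j) = (-1 :: real)^j"
      using that by (simp add: minus_one_power_iff)
    finally have "(-1)^j * P j = (\<Prod>l<j. x j - x l) * (\<Prod>l\<in>{j<..2*m}. x l - x j)"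
      by (simp add: minus_one_power_iff)
    also have "\<dots> > 0" using that less by (intro mult_pos_pos prod_pos) auto
    finally show ?thesis .
  qed
  \<comment> \<open>Square roots of the absolute weights, chosen to make the matrix \<open>W\<close>
    below orthogonal.\<close>
  define w where "w = (\<lambda>k. sqrt (1 / P (2*k)))"
  define a where "a = (\<lambda>i. sqrt (- 1 / P (2*i+1)))"
  have w: "(w k)\<^sup>2 = 1 / P (2*k)" if "k \<le> m" for k
    using Psign[of "2*k"] that by (simp add: w_def)
  have a: "(a i)\<^sup>2 = - 1 / P (2*i+1)" and a0: "a i > 0" if "i < m" for i
    using Psign[of "2*i+1"] that by (simp_all add: a_def divide_less_0_iff)
  have dd: "divided_diff f S = (\<Sum>k\<le>m. (w k)\<^sup>2 * f (x (2*k))) - (\<Sum>i<m. (a i)\<^sup>2 * f (x (2*i+1)))" for f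
  proof -
    have "divided_diff f S = (\<Sum>j\<le>2*m. f (x j) / P j)"
      unfolding divided_diff_def img[symmetric] using inj
      by (subst sum.reindex) (auto simp: PS[unfolded img[symmetric]])
    also have "\<dots> = (\<Sum>k\<le>m. (w k)\<^sup>2 * f (x (2*k))) + (\<Sum>i<m. - ((a i)\<^sup>2 * f (x (2*i+1))))"
      unfolding sum_even_odd by (intro arg_cong2[of _ _ _ _ "(+)"] sum.cong refl) (simp_all add: w a)
    finally show ?thesis by (simp add: sum_negf)
  qed
  define mu where "mu = (\<lambda>i. x (2*i+1))"
  define om where "om = (\<Prod>l<m. [:- mu l, 1:])"
  define el where "el = (\<lambda>i. Polynomial.smult (inverse (\<Prod>l\<in>{..<m}-{i}. mu i - mu l)) (\<Prod>l\<in>{..<m}-{i}. [:- mu l, 1:]))"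
  have mu_ne: "mu i \<noteq> mu j" if "i < m" "j < m" "i \<noteq> j" for i j
    using inj_onD[OF inj, of "2*i+1" "2*j+1"] that by (auto simp: mu_def)
  have om: "poly om (mu i) = 0" if "i < m" for i
    using that by (auto simp: om_def poly_prod)
  have deg_om: "degree om = m" "lead_coeff om = 1"
    unfolding om_def lead_coeff_prod by (simp_all add: degree_prod_sum_eq)
  have el: "poly (el i) (mu j) = (if i = j then 1 else 0)" if "i < m" "j < m" for i j
    using that mu_ne by (auto simp: el_def poly_prod intro!: left_inverse)
  have deg_el: "degree (el i) \<le> m - 1" if "i < m" for i
    unfolding el_def using that by (intro order_trans[OF degree_smult_le]) (simp add: degree_prod_sum_eq)
  have el_sum: "(\<Sum>i<m. poly (el i) y) = 1" for y
  proof -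
    have "(\<Sum>i<m. el i) = 1"
    proof (rule poly_eqI_degree)
      fix y assume "y \<in> mu ` {..<m}"
      then show "poly (\<Sum>i<m. el i) y = poly 1 y" by (auto simp: poly_sum el)
    next
      have "inj_on mu {..<m}" using mu_ne by (force intro: inj_onI)
      then have c: "card (mu ` {..<m}) = m" by (simp add: card_image)
      have "degree (\<Sum>i<m. el i) \<le> m - 1" using deg_el by (intro degree_sum_le) auto
      then show "card (mu ` {..<m}) > degree (\<Sum>i<m. el i)" using m c by simp
      show "card (mu ` {..<m}) > degree (1 :: real poly)" using m c by simp
    qed
    then have "poly (\<Sum>i<m. el i) y = 1" by simp
    then show ?thesis by (simp add: poly_sum)
  qed
  \<comment> \<open>A divided difference over \<open>2*m + 1\<close> nodes extracts the coefficient
    of degree \<open>2*m\<close>. Read the other way, the odd nodes form a quadrature rule for the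
    even ones that is exact below this degree.\<close>
  have quad: "(\<Sum>k\<le>m. (w k)\<^sup>2 * poly p (x (2*k))) = coeff p (2*m) + (\<Sum>i<m. (a i)\<^sup>2 * poly p (mu i))"
    if "degree p \<le> 2*m" for p
    using divided_diff_poly[OF fin, of p] dd[of "poly p"] card that by (simp add: mu_def)
  have quad0: "(\<Sum>k\<le>m. (w k)\<^sup>2 * poly p (x (2*k))) = (\<Sum>i<m. (a i)\<^sup>2 * poly p (mu i))"
    if "degree p < 2*m" for p
    using quad[of p] that by (simp add: coeff_eq_0)
  \<comment> \<open>The first columns are the Lagrange polynomials at the odd nodes, normalised by
    the Gauss weights. The last one is \<open>om\<close>, which vanishes at all odd nodes and so is
    orthogonal to the others; its squared norm is the leading coefficient of \<open>om * om\<close>,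
    that is 1.\<close>
  define W where "W = (\<lambda>k i. if i < m then w k * poly (el i) (x (2*k)) / a i else w k * poly om (x (2*k)))"
  have nodes: "(\<Sum>l<m. (a l)\<^sup>2 * (poly (el i) (mu l) * poly (el j) (mu l) * f l)) =
      (if i = j then (a i)\<^sup>2 * f i else 0)"
    if "i < m" "j < m" for i j f
  proof -
    have "(\<Sum>l<m. (a l)\<^sup>2 * (poly (el i) (mu l) * poly (el j) (mu l) * f l)) =
        (\<Sum>l<m. if l = i then (if i = j then (a i)\<^sup>2 * f i else 0) else 0)"
      by (intro sum.cong) (use that in \<open>auto simp: el\<close>)
    then show ?thesis using that by simp
  qed
  have "(\<Sum>i<m. (a i)\<^sup>2 * g (mu i)) \<le> (\<Sum>k\<le>m. g (x (2*k)) * (\<Sum>i<m. W k i * a i)\<^sup>2)"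
  proof (rule operator_convex_compression[OF g])
    fix k assume "k \<le> m"
    then have "x (2*k) \<in> S" unfolding img[symmetric] by simp
    then show "0 < x (2*k)" using S by auto
  next
    fix i j assume ij: "i < m" "j < m"
    let ?p = "el i * el j * [:0, 1:]"
    have "degree ?p \<le> degree (el i) + degree (el j) + 1"
      by (intro order_trans[OF degree_mult_le] add_mono) simp_all
    \<comment> \<open>The degree is at most 2 (m - 1) + 1, so multiplication by the variable just
      stays within the range of exactness.\<close>
    then have d: "degree ?p < 2*m" using deg_el[OF ij(1)] deg_el[OF ij(2)] m by linarith
    have "(\<Sum>k\<le>m. x (2*k) * (W k i * W k j)) = (\<Sum>k\<le>m. (w k)\<^sup>2 * poly ?p (x (2*k))) / (a i * a j)"
      using ij by (simp add: W_def sum_divide_distrib power2_eq_square mult_ac)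
    also have "\<dots> = (if i = j then mu i else 0)"
      unfolding quad0[OF d] using nodes[OF ij, of mu] ij a0[of i] a0[of j] by (simp add: power2_eq_square mult_ac)
    finally show "(\<Sum>k\<le>m. x (2*k) * (W k i * W k j)) = (if i = j then mu i else 0)" .
  next
    have A: "(\<Sum>k\<le>m. W k i * W k j) = (if i = j then 1 else 0)" if ij: "i < m" "j \<le> m" for i j
    proof (cases "j = m")
      case False
      then have j: "j < m" using ij by simp
      let ?p = "el i * el j"
      have "degree ?p \<le> degree (el i) + degree (el j)" by (rule degree_mult_le)
      then have d: "degree ?p < 2*m" using deg_el[OF ij(1)] deg_el[OF j] m by linarith
      have "(\<Sum>k\<le>m. W k i * W k j) = (\<Sum>k\<le>m. (w k)\<^sup>2 * poly ?p (x (2*k))) / (a i * a j)"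
        using ij j by (simp add: W_def sum_divide_distrib power2_eq_square mult_ac)
      also have "\<dots> = (if i = j then 1 else 0)"
        unfolding quad0[OF d] using nodes[OF ij(1) j, of "\<lambda>_. 1"] ij j a0[of i] a0[of j]
          by (simp add: power2_eq_square)
      finally show ?thesis .
    next
      case True
      let ?p = "el i * om"
      have "degree ?p \<le> degree (el i) + degree om" by (rule degree_mult_le)
      then have d: "degree ?p < 2*m" using deg_el[OF ij(1)] deg_om m by linarith
      have "(\<Sum>k\<le>m. W k i * W k j) = (\<Sum>k\<le>m. (w k)\<^sup>2 * poly ?p (x (2*k))) / a i"
        using ij True by (simp add: W_def sum_divide_distrib power2_eq_square mult_ac)
      also have "\<dots> = 0"
        unfolding quad0[OF d] by (simp add: om)
      finally show ?thesis using ij True by simp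
    qed
    have B: "(\<Sum>k\<le>m. W k m * W k m) = 1"
    proof -
      have d: "degree (om * om) = 2*m" using deg_om by (subst degree_mult_eq) auto
      have "(\<Sum>k\<le>m. W k m * W k m) = (\<Sum>k\<le>m. (w k)\<^sup>2 * poly (om * om) (x (2*k)))"
        by (simp add: W_def power2_eq_square mult_ac)
      also have "\<dots> = coeff (om * om) (2*m)" using quad[of "om * om"] d by (simp add: om)
      also have "\<dots> = lead_coeff (om * om)" using d by simp
      also have "\<dots> = 1" unfolding lead_coeff_mult using deg_om by simp
      finally show ?thesis .
    qed
    fix i j assume ij: "i \<le> m" "j \<le> m"
    show "(\<Sum>k\<le>m. W k i * W k j) = (if i = j then 1 else 0)"
    proof (cases "i = m")
      case True
      then show ?thesis using A[of j m] B ij by (cases "j = m") (auto simp: mult.commute)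
    qed (use A ij in simp)
  qed
  also have "\<dots> = (\<Sum>k\<le>m. (w k)\<^sup>2 * g (x (2*k)))"
  proof (intro sum.cong refl)
    fix k
    \<comment> \<open>The test vector \<open>a\<close> represents the constant polynomial 1, because
      the Lagrange polynomials sum to 1. This is what turns the compression inequality into a
      statement about the bare weights.\<close>
    have "(\<Sum>i<m. W k i * a i) = (\<Sum>i<m. w k * poly (el i) (x (2*k)))"
    proof (intro sum.cong refl)
      fix i assume "i \<in> {..<m}"
      then show "W k i * a i = w k * poly (el i) (x (2*k))" using a0[of i] by (simp add: W_def)
    qed
    also have "\<dots> = w k" using el_sum by (simp add: sum_distrib_left[symmetric])
    finally show "g (x (2*k)) * (\<Sum>i<m. W k i * a i)\<^sup>2 = (w k)\<^sup>2 * g (x (2*k))" by simp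
  qed
  finally show ?thesis unfolding dd by (simp add: mu_def)
qed

text \<open>Seven nodes, \<open>m = 3\<close>, give a sign in order 6 and so a bound in order 5. By
  the same argument five nodes would bound order 3 only, one less than three derivatives
  cost.\<close>

lemma operator_convex_thrice_differentiable:
  assumes "operator_convex g"
  shows "thrice_differentiable g"
proof -
  have "bounded_divided_diffs 5 g"
  proof (rule bounded_divided_diffs_of_nonneg)
    fix S :: "real set" assume "S \<subseteq> {0<..}" "card S = Suc (Suc 5)"
    then show "0 \<le> divided_diff g S"
      by (intro operator_convex_divided_diff_nonneg[OF assms, of S 3]) auto
  qed
  then have "bounded_divided_diffs 4 g" using bounded_divided_diffs_lower[of 4 g] by simp
  then show ?thesis by (rule bounded_divided_diffs_thrice_differentiable)
qed

text \<open>Intended for powers, whose transposes \<open>p * (1/p)^k\<close> arise when a polynomial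
  in q/p is multiplied by p and expanded. The terms with \<open>g1\<close> cancel in the second
  derivative.\<close>

lemma thrice_differentiable_transpose:
  assumes "thrice_differentiable g"
  shows "thrice_differentiable (transpose_fun g)"
proof -
  obtain g1 g2 g3 where g: "\<And>x. x > 0 \<Longrightarrow> (g has_real_derivative g1 x) (at x)"
    "\<And>x. x > 0 \<Longrightarrow> (g1 has_real_derivative g2 x) (at x)" "\<And>x. x > 0 \<Longrightarrow> (g2 has_real_derivative g3 x) (at x)"
    using assms unfolding thrice_differentiable_def by metis
  have inv: "((\<lambda>x. inverse x) has_real_derivative - (inverse x * inverse x)) (at x)" if "x > 0" for x :: real
    using that by (auto intro!: derivative_eq_intros simp: power2_eq_square)
  note ch = DERIV_chain2[OF g(1) inv] DERIV_chain2[OF g(2) inv] DERIV_chain2[OF g(3) inv]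
  show ?thesis unfolding thrice_differentiable_def
  proof (intro exI allI impI conjI)
    fix x :: real assume x: "x > 0"
    then have ix: "inverse x > 0" by simp
    note d = ch(1)[OF ix x] ch(2)[OF ix x] ch(3)[OF ix x]
    have i4: "((\<lambda>x. (inverse x)^3) has_real_derivative - 3 * (inverse x)^4) (at x)"
      using x by (auto intro!: derivative_eq_intros simp: field_simps eval_nat_numeral)
    show "(transpose_fun g has_real_derivative g (inverse x) - inverse x * g1 (inverse x)) (at x)"
      unfolding transpose_fun_def
      by (rule DERIV_cong[OF DERIV_mult[OF DERIV_ident d(1)]]) (use x in \<open>simp add: field_simps\<close>)
    show "((\<lambda>x. g (inverse x) - inverse x * g1 (inverse x)) has_real_derivative
        (inverse x)^3 * g2 (inverse x)) (at x)"
      by (rule DERIV_cong[OF DERIV_diff[OF d(1) DERIV_mult[OF inv[OF x] d(2)]]])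
        (simp add: algebra_simps power3_eq_cube)
    show "((\<lambda>x. (inverse x)^3 * g2 (inverse x)) has_real_derivative
        - 3 * (inverse x)^4 * g2 (inverse x) - (inverse x)^5 * g3 (inverse x)) (at x)"
      by (rule DERIV_cong[OF DERIV_mult[OF i4 d(3)]]) (simp add: algebra_simps eval_nat_numeral)
  qed
qed

section \<open>Spectral calculus\<close>

text \<open>The variational inequality of the closest point, tested with z and with -z, becomes
  orthogonality. This connects \<open>op_fun\<close>, which is defined by closest points, with
  orthogonal projections.\<close>

lemma closest_point_subspace_iff:
  fixes E :: "'a::euclidean_space set"
  assumes E: "subspace E"
  shows "y = closest_point E x \<longleftrightarrow> y \<in> E \<and> (\<forall>z\<in>E. (x - y) \<bullet> z = 0)"
proof -
  let ?c = "closest_point E x"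
  have ne: "E \<noteq> {}" using subspace_0[OF E] by auto
  have c: "?c \<in> E" by (rule closest_point_in_set[OF closed_subspace[OF E] ne])
  have orth: "(x - ?c) \<bullet> z = 0" if z: "z \<in> E" for z
  proof -
    have "(x - ?c) \<bullet> ((?c + z) - ?c) \<le> 0" "(x - ?c) \<bullet> ((?c - z) - ?c) \<le> 0"
      by (intro closest_point_dot subspace_imp_convex closed_subspace E subspace_add subspace_diff c z)+
    then show ?thesis by simp
  qed
  have "y = ?c" if y: "y \<in> E" "\<forall>z\<in>E. (x - y) \<bullet> z = 0"
  proof -
    have d: "y - ?c \<in> E" by (intro subspace_diff E y c)
    have "(y - ?c) \<bullet> (y - ?c) = (x - ?c) \<bullet> (y - ?c) - (x - y) \<bullet> (y - ?c)"
      by (simp add: inner_diff_left)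
    also have "\<dots> = 0" using orth[OF d] y(2) d by simp
    finally show ?thesis by simp
  qed
  then show ?thesis using c orth by blast
qed

lemma linear_closest_point_subspace:
  fixes E :: "'a::euclidean_space set"
  assumes E: "subspace E"
  shows "linear (closest_point E)"
proof (rule linearI)
  note cp = closest_point_subspace_iff[OF E, THEN iffD1, OF refl]
  fix x y :: 'a and c :: real
  have "closest_point E x + closest_point E y = closest_point E (x + y)"
    using cp[of x] cp[of y] by (simp add: closest_point_subspace_iff[OF E] subspace_add[OF E] inner_diff_left
      inner_add_left)
  then show "closest_point E (x + y) = closest_point E x + closest_point E y" ..
  have "c *\<^sub>R closest_point E x = closest_point E (c *\<^sub>R x)"
    using cp[of x] by (simp add: closest_point_subspace_iff[OF E] subspace_scale[OF E] inner_diff_left)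
  then show "closest_point E (c *\<^sub>R x) = c *\<^sub>R closest_point E x" ..
qed

lemma closest_point_subspace_selfadjoint:
  fixes E :: "'a::euclidean_space set"
  assumes E: "subspace E"
  shows "closest_point E x \<bullet> y = x \<bullet> closest_point E y"
proof -
  note cp = closest_point_subspace_iff[OF E, THEN iffD1, OF refl]
  have "(x - closest_point E x) \<bullet> closest_point E y = 0" "(y - closest_point E y) \<bullet> closest_point E x = 0"
    using cp[of x] cp[of y] by blast+
  then show ?thesis by (simp add: inner_diff_left inner_diff_right inner_commute)
qed

text \<open>Let \<open>v\<close> maximise the Rayleigh quotient over the unit sphere of
  \<open>S\<close>, with maximum c. The form \<open>B\<close> is nonnegative on \<open>S\<close> and
  vanishes at \<open>v\<close>, so as in the Cauchy-Schwarz inequality \<open>v\<close> lies in its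
  kernel, which says that \<open>T v\<close> is c times \<open>v\<close>.\<close>

lemma selfadjoint_eigenvector:
  fixes T :: "'a::euclidean_space \<Rightarrow> 'a"
  assumes T: "linear T" and sa: "\<And>x y. T x \<bullet> y = x \<bullet> T y"
    and S: "subspace S" "T ` S \<subseteq> S" "S \<noteq> {0}"
  shows "\<exists>v\<in>S. v \<noteq> 0 \<and> (\<exists>c. T v = c *\<^sub>R v)"
proof -
  let ?K = "sphere 0 1 \<inter> S"
  obtain u where u: "u \<in> S" "u \<noteq> 0" using S subspace_0[OF S(1)] by blast
  have "(1 / norm u) *\<^sub>R u \<in> ?K" using u by (auto intro: subspace_scale S)
  then have ne: "?K \<noteq> {}" by blast
  have "compact ?K" by (intro compact_Int_closed closed_subspace S compact_sphere)
  moreover have "continuous_on ?K (\<lambda>x. x \<bullet> T x)"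
    by (intro continuous_intros linear_continuous_on_compose[OF _ T] continuous_on_id)
  ultimately obtain v where v: "v \<in> ?K" "\<And>x. x \<in> ?K \<Longrightarrow> x \<bullet> T x \<le> v \<bullet> T v"
    using continuous_attains_sup[of ?K "\<lambda>x. x \<bullet> T x"] ne by blast
  define c where "c = v \<bullet> T v"
  have vS: "v \<in> S" and v1: "v \<bullet> v = 1" using v(1) by (auto simp: norm_eq_1)
  define B where "B = (\<lambda>x y. c * (x \<bullet> y) - x \<bullet> T y)"
  have pos: "0 \<le> B x x" if x: "x \<in> S" for x
  proof (cases "x = 0")
    case False
    have "(1 / norm x) *\<^sub>R x \<in> ?K" using x False by (auto intro: subspace_scale S)
    from v(2)[OF this] have "(x \<bullet> T x) / (norm x)\<^sup>2 \<le> c"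
      by (simp add: linear_scale[OF T] c_def power2_eq_square)
    then show ?thesis using False by (simp add: B_def power2_norm_eq_inner pos_divide_le_eq)
  qed (simp add: B_def linear_0[OF T])
  have B0: "B v y = 0" if y: "y \<in> S" for y
  proof -
    \<comment> \<open>The minimiser of the quadratic would divide by \<open>B y y\<close>, which may
      be 0; adding 1 keeps the denominator positive and the value still negative unless
      \<open>B v y = 0\<close>.\<close>
    define t where "t = - B v y / (B y y + 1)"
    have q: "B y y + 1 > 0" using pos[OF y] by simp
    have "B (v + t *\<^sub>R y) (v + t *\<^sub>R y) = B v v + 2 * t * B v y + t\<^sup>2 * B y y"
      using sa[of v y] by (simp add: B_def linear_add[OF T] linear_scale[OF T] inner_add_left inner_add_right
        algebra_simps power2_eq_square inner_commute)
    moreover have "B v v = 0" using v1 by (simp add: B_def c_def)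
    moreover have "0 \<le> B (v + t *\<^sub>R y) (v + t *\<^sub>R y)" by (intro pos subspace_add subspace_scale S y vS)
    ultimately have "0 \<le> 2 * t * B v y + t\<^sup>2 * B y y" by simp
    also have "\<dots> = - (B v y)\<^sup>2 * (B y y + 2) / (B y y + 1)\<^sup>2"
    proof -
      have "2 * (- b / Q) * b + (- b / Q)\<^sup>2 * (Q - 1) = - b\<^sup>2 * (Q + 1) / Q\<^sup>2" if "Q > 0" for b Q :: real
        using that by (simp add: divide_simps power2_eq_square) (simp add: algebra_simps)
      from this[OF q, of "B v y"] show ?thesis by (simp add: t_def add.commute)
    qed
    finally have "(B v y)\<^sup>2 * (B y y + 2) \<le> 0" using q by (simp add: divide_le_0_iff zero_le_divide_iff)
    then show ?thesis using q by (simp add: mult_le_0_iff)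
  qed
  have "c *\<^sub>R v - T v \<in> S" using S vS by (intro subspace_diff subspace_scale S vS) auto
  then have "B v (c *\<^sub>R v - T v) = 0" by (rule B0)
  moreover have "B v z = (c *\<^sub>R v - T v) \<bullet> z" for z using sa[of v z] by (simp add: B_def inner_diff_left)
  ultimately have "c *\<^sub>R v - T v = 0" by simp
  then have "T v = c *\<^sub>R v" by simp
  then show ?thesis using vS v1 by (intro bexI[of _ v]) auto
qed

text \<open>The orthogonal complement of the span of the eigenvectors is invariant. If it were
  nonzero it would contain an eigenvector, which would be orthogonal to itself.\<close>

lemma selfadjoint_span_eigenvectors:
  fixes T :: "'a::euclidean_space \<Rightarrow> 'a"
  assumes T: "linear T" and sa: "\<And>x y. T x \<bullet> y = x \<bullet> T y"
  shows "span {v. \<exists>c. T v = c *\<^sub>R v} = UNIV"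
proof -
  let ?V = "span {v. \<exists>c. T v = c *\<^sub>R v}"
  define S where "S = {x. \<forall>y\<in>?V. x \<bullet> y = 0}"
  have S: "subspace S" unfolding S_def real_vector.subspace_def by (auto simp: inner_add_left)
  have TV: "T y \<in> ?V" if "y \<in> ?V" for y
    using that
  proof (induction rule: span_induct)
    case base
    show ?case using T by (simp add: real_vector.subspace_def linear_0 linear_add linear_scale span_add span_scale
      span_zero)
  next
    case (step x)
    then obtain c where "T x = c *\<^sub>R x" by blast
    then show ?case using step span_base span_scale by metis
  qed
  have "S = {0}"
  proof (rule ccontr)
    assume "S \<noteq> {0}"
    moreover have "T ` S \<subseteq> S" using sa TV by (auto simp: S_def)
    ultimately obtain v where v: "v \<in> S" "v \<noteq> 0" "\<exists>c. T v = c *\<^sub>R v"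
      using selfadjoint_eigenvector[OF T sa S] by blast
    then have "v \<in> ?V" by (auto intro: span_base)
    then have "v \<bullet> v = 0" using v(1) by (auto simp: S_def)
    then show False using v by simp
  qed
  moreover have "x - closest_point ?V x \<in> S" for x
    using closest_point_subspace_iff[of ?V "closest_point ?V x" x] by (auto simp: S_def subspace_span)
  ultimately have "x = closest_point ?V x" for x by auto
  moreover have "closest_point ?V x \<in> ?V" for x
    using closest_point_subspace_iff[of ?V "closest_point ?V x" x] subspace_span by auto
  ultimately show ?thesis by (metis UNIV_eq_I)
qed

text \<open>The values \<open>c i\<close> may coincide and some \<open>E i\<close> may be 0, so the
  \<open>E i\<close> need not be the spectral projections of \<open>T\<close>: the projection for d
  is the sum of those with \<open>c i = d\<close>. Such coincidences do occur, as different pairs of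
  eigenvalues can have the same quotient.\<close>

lemma op_fun_resolution:
  fixes E :: "'i \<Rightarrow> 'a::euclidean_space \<Rightarrow> 'a"
  assumes I: "finite I" and lin: "\<And>i. i \<in> I \<Longrightarrow> linear (E i)"
    and sa: "\<And>i x y. i \<in> I \<Longrightarrow> E i x \<bullet> y = x \<bullet> E i y"
    and orth: "\<And>i j x. i \<in> I \<Longrightarrow> j \<in> I \<Longrightarrow> E i (E j x) = (if i = j then E i x else 0)"
    and id: "\<And>x. (\<Sum>i\<in>I. E i x) = x"
    and T: "\<And>x. T x = (\<Sum>i\<in>I. c i *\<^sub>R E i x)"
  shows "op_fun f T x = (\<Sum>i\<in>I. f (c i) *\<^sub>R E i x)"
proof -
  have ET: "E i (T v) = c i *\<^sub>R E i v" if "i \<in> I" for i v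
  proof -
    have "E i (T v) = (\<Sum>j\<in>I. c j *\<^sub>R E i (E j v))"
      using lin[OF that] by (simp add: T linear_sum linear_scale)
    also have "\<dots> = (\<Sum>j\<in>I. if j = i then c i *\<^sub>R E i v else 0)"
      by (intro sum.cong) (auto simp: orth that)
    finally show ?thesis using that I by simp
  qed
  have zero: "E i v = 0" if "T v = d *\<^sub>R v" "i \<in> I" "c i \<noteq> d" for i v d
  proof -
    have "c i *\<^sub>R E i v = d *\<^sub>R E i v" using ET[OF that(2), of v] that lin[OF that(2)] by (simp add: linear_scale)
    then show ?thesis using that(3) by simp
  qed
  have TE: "T (E i v) = c i *\<^sub>R E i v" if "i \<in> I" for i v
  proof -
    have "T (E i v) = (\<Sum>j\<in>I. if j = i then c i *\<^sub>R E i v else 0)"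
      unfolding T by (intro sum.cong) (auto simp: orth that)
    then show ?thesis using that I by simp
  qed
  have sub: "subspace {v. T v = d *\<^sub>R v}" for d
  proof -
    have lT: "linear T" unfolding T[abs_def] by (intro linear_compose_sum ballI linear_compose_scale_right lin)
    show ?thesis by (simp add: real_vector.subspace_def linear_0[OF lT] linear_add[OF lT] linear_scale[OF lT]
      scaleR_add_right)
  qed
  have sum_part: "v = (\<Sum>i\<in>{i\<in>I. c i = d}. E i v)" if "T v = d *\<^sub>R v" for v d
  proof -
    have "(\<Sum>i\<in>{i\<in>I. c i = d}. E i v) = (\<Sum>i\<in>I. E i v)"
      using I zero[OF that] by (intro sum.mono_neutral_left) auto
    then show ?thesis by (simp add: id)
  qed
  have cp: "closest_point {v. T v = d *\<^sub>R v} x = (\<Sum>i\<in>{i\<in>I. c i = d}. E i x)" for d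
  proof -
    let ?y = "\<Sum>i\<in>{i\<in>I. c i = d}. E i x"
    have lT: "linear T" unfolding T[abs_def] by (intro linear_compose_sum ballI linear_compose_scale_right lin)
    have "T ?y = d *\<^sub>R ?y" by (simp add: linear_sum[OF lT] TE scaleR_sum_right)
    moreover have "(x - ?y) \<bullet> z = 0" if z: "T z = d *\<^sub>R z" for z
    proof -
      have "?y \<bullet> z = x \<bullet> (\<Sum>i\<in>{i\<in>I. c i = d}. E i z)"
        by (simp add: inner_sum_left inner_sum_right sa)
      then show ?thesis using sum_part[OF z] by (simp add: inner_diff_left)
    qed
    ultimately show ?thesis using closest_point_subspace_iff[OF sub, of ?y d x] by auto
  qed
  define S where "S = {d. \<exists>v. v \<noteq> 0 \<and> T v = d *\<^sub>R v}"
  have Ssub: "S \<subseteq> c ` I"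
  proof
    fix d assume "d \<in> S"
    then obtain v where v: "v \<noteq> 0" "T v = d *\<^sub>R v" by (auto simp: S_def)
    then have "{i\<in>I. c i = d} \<noteq> {}" using sum_part[OF v(2)] by (metis sum.empty)
    then show "d \<in> c ` I" by auto
  qed
  have "op_fun f T x = (\<Sum>d\<in>S. f d *\<^sub>R (\<Sum>i\<in>{i\<in>I. c i = d}. E i x))"
    unfolding op_fun_def S_def cp ..
  \<comment> \<open>A value \<open>c i\<close> that is not an eigenvalue contributes 0, for
    \<open>E i x\<close> would otherwise be an eigenvector.\<close>
  also have "\<dots> = (\<Sum>d\<in>c ` I. f d *\<^sub>R (\<Sum>i\<in>{i\<in>I. c i = d}. E i x))"
  proof (rule sum.mono_neutral_left)
    show "\<forall>d\<in>c ` I - S. f d *\<^sub>R (\<Sum>i\<in>{i\<in>I. c i = d}. E i x) = 0"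
    proof
      fix d assume d: "d \<in> c ` I - S"
      have "E i x = 0" if "i \<in> {i\<in>I. c i = d}" for i
        using d TE[of i x] that by (auto simp: S_def)
      then show "f d *\<^sub>R (\<Sum>i\<in>{i\<in>I. c i = d}. E i x) = 0" by simp
    qed
  qed (use I Ssub in auto)
  also have "\<dots> = (\<Sum>d\<in>c ` I. \<Sum>i\<in>{i\<in>I. c i = d}. f (c i) *\<^sub>R E i x)"
    by (simp add: scaleR_sum_right)
  also have "\<dots> = (\<Sum>i\<in>I. f (c i) *\<^sub>R E i x)"
    using I by (intro sum.group) auto
  finally show ?thesis .
qed

section \<open>Matrix algebra and the real inner product Re Tr A*B\<close>

lemma bounded_bilinear_matrix_mult:
  "bounded_bilinear (\<lambda>(A :: complex^'n::finite^'n) (B :: complex^'n^'n). A ** B)"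
proof -
  have "bilinear (\<lambda>(A :: complex^'n^'n) (B :: complex^'n^'n). A ** B)"
    unfolding bilinear_def
    by (auto intro!: linearI simp: matrix_matrix_mult_def Finite_Cartesian_Product.vec_eq_iff scaleR_sum_right
      sum.distrib algebra_simps)
  then show ?thesis by (simp add: bilinear_conv_bounded_bilinear)
qed

interpretation matmul: bounded_bilinear "\<lambda>(A :: complex^'n::finite^'n) (B :: complex^'n^'n). A ** B"
  by (rule bounded_bilinear_matrix_mult)

lemma matrix_vector_scaleR:
  "(c *\<^sub>R A) *v (x :: complex^'n::finite) = c *\<^sub>R (A *v x)" "A *v (c *\<^sub>R x) = c *\<^sub>R (A *v x)"
  by (simp_all add: matrix_vector_mult_def Finite_Cartesian_Product.vec_eq_iff scaleR_sum_right)

lemma linear_matrix_vector: "linear (\<lambda>x :: complex^'n::finite. A *v x)"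
  by (rule linearI) (simp_all add: matrix_vector_scaleR matrix_vector_right_distrib)

lemma conj_transpose_mult: "conj_transpose (A ** B) = conj_transpose B ** conj_transpose (A :: complex^'n::finite^'n)"
  by (simp add: conj_transpose_def matrix_matrix_mult_def Finite_Cartesian_Product.vec_eq_iff mult.commute)

lemma conj_transpose_conj_transpose [simp]: "conj_transpose (conj_transpose A) = A"
  by (simp add: conj_transpose_def Finite_Cartesian_Product.vec_eq_iff)

lemma conj_transpose_mat_1: "conj_transpose (mat 1) = (mat 1 :: complex^'n::finite^'n)"
  by (simp add: conj_transpose_def Finite_Cartesian_Product.mat_def Finite_Cartesian_Product.vec_eq_iff)

lemma linear_conj_transpose: "linear (conj_transpose :: complex^'n::finite^'n \<Rightarrow> complex^'n^'n)"
  by (rule linearI) (simp_all add: conj_transpose_def Finite_Cartesian_Product.vec_eq_iff)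

lemma inner_matrix_eq_trace: "A \<bullet> B = Re (trace (conj_transpose A ** B))" for A B :: "complex^'n::finite^'n"
proof -
  have "A \<bullet> B = (\<Sum>i\<in>UNIV. \<Sum>j\<in>UNIV. Re (cnj (A $ i $ j) * B $ i $ j))"
    by (simp add: inner_vec_def inner_complex_def)
  also have "\<dots> = Re (trace (conj_transpose A ** B))"
    by (subst sum.swap) (simp add: trace_def matrix_matrix_mult_def conj_transpose_def)
  finally show ?thesis .
qed

lemma inner_vec_complex: "x \<bullet> y = Re (\<Sum>i\<in>UNIV. cnj (x $ i) * y $ i)" for x y :: "complex^'n::finite"
  by (simp add: inner_vec_def inner_complex_def)

lemma inner_matrix_vector: "(A *v x) \<bullet> y = x \<bullet> (conj_transpose A *v y)" for x y :: "complex^'n::finite"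
proof -
  have "(A *v x) \<bullet> y = Re (\<Sum>i\<in>UNIV. \<Sum>j\<in>UNIV. cnj (A $ i $ j) * cnj (x $ j) * y $ i)"
    by (simp add: inner_vec_complex matrix_vector_mult_def sum_distrib_right)
  also have "(\<Sum>i\<in>UNIV. \<Sum>j\<in>UNIV. cnj (A $ i $ j) * cnj (x $ j) * y $ i) =
      (\<Sum>j\<in>UNIV. cnj (x $ j) * (conj_transpose A *v y) $ j)"
    by (subst sum.swap) (simp add: matrix_vector_mult_def conj_transpose_def sum_distrib_left mult_ac)
  finally show ?thesis by (simp add: inner_vec_complex)
qed

lemma subspace_Herm: "subspace (Herm :: (complex^'n::finite^'n) set)"
  using linear_conj_transpose[where 'n='n]
  by (simp add: Herm_def real_vector.subspace_def linear_add linear_scale linear_0)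

section \<open>Spectral projections of Hermitian matrices\<close>

definition eigs :: "complex^'n^'n \<Rightarrow> real set" where
  "eigs \<rho> = {c. \<exists>v. v \<noteq> 0 \<and> \<rho> *v v = c *\<^sub>R v}"

definition eig_proj :: "complex^'n^'n \<Rightarrow> real \<Rightarrow> complex^'n^'n" where
  "eig_proj \<rho> c = matrix (closest_point {v. \<rho> *v v = c *\<^sub>R v})"

text \<open>\<open>matrix\<close> represents complex linear maps, whereas a closest point map is at
  first only real linear. It commutes with multiplication by \<open>\<i>\<close> because eigenspaces
  for real eigenvalues are stable under it and it is skew-adjoint for the real inner
  product.\<close>

lemma eig_proj_vector:
  fixes \<rho> :: "complex^'n::finite^'n"
  shows "eig_proj \<rho> c *v x = closest_point {v. \<rho> *v v = c *\<^sub>R v} x"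
proof -
  let ?E = "{v. \<rho> *v v = c *\<^sub>R v}"
  let ?P = "closest_point ?E"
  have E: "subspace ?E"
    by (simp add: real_vector.subspace_def matrix_vector_right_distrib matrix_vector_scaleR scaleR_add_right)
  have lin: "linear ?P" by (rule linear_closest_point_subspace[OF E])
  have comm: "A *v (k *s v) = k *s (A *v v)" for k :: complex and v :: "complex^'n" and A :: "complex^'n^'n"
    by (simp add: matrix_vector_mult_def Finite_Cartesian_Product.vec_eq_iff sum_distrib_left mult_ac)
  have Ei: "\<i> *s z \<in> ?E" if "z \<in> ?E" for z
    using that by (simp add: comm) (simp add: Finite_Cartesian_Product.vec_eq_iff)
  have ii: "(\<i> *s u) \<bullet> z = u \<bullet> (- \<i> *s z)" for u z :: "complex^'n"
    by (simp add: inner_vec_complex)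
  have i: "?P (\<i> *s x) = \<i> *s ?P x" for x
  proof -
    have cp: "?P x \<in> ?E" "\<forall>z\<in>?E. (x - ?P x) \<bullet> z = 0"
      using closest_point_subspace_iff[OF E, of "?P x" x] by auto
    have "(\<i> *s x - \<i> *s ?P x) \<bullet> z = 0" if z: "z \<in> ?E" for z
    proof -
      have "- \<i> *s z = - (\<i> *s z)" by (simp add: Finite_Cartesian_Product.vec_eq_iff)
      then have m: "- \<i> *s z \<in> ?E" using Ei[OF z] subspace_neg[OF E] by metis
      have "(\<i> *s x - \<i> *s ?P x) \<bullet> z = (\<i> *s (x - ?P x)) \<bullet> z" by (simp add: vec.scale_right_diff_distrib)
      also have "\<dots> = (x - ?P x) \<bullet> (- \<i> *s z)" by (rule ii)
      also have "\<dots> = 0" using cp(2) m by blast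
      finally show ?thesis .
    qed
    then have "\<i> *s ?P x = ?P (\<i> *s x)"
      using closest_point_subspace_iff[OF E, of "\<i> *s ?P x" "\<i> *s x"] Ei[OF cp(1)] by blast
    then show ?thesis ..
  qed
  have cs: "k *s v = Re k *\<^sub>R v + Im k *\<^sub>R (\<i> *s v)" for k :: complex and v :: "complex^'n"
    by (simp add: Finite_Cartesian_Product.vec_eq_iff complex_eq_iff)
  have "Vector_Spaces.linear (*s) (*s) ?P"
  proof (unfold_locales)
    fix k :: complex and x y :: "complex^'n"
    show "?P (x + y) = ?P x + ?P y" by (rule linear_add[OF lin])
    have "?P (k *s x) = Re k *\<^sub>R ?P x + Im k *\<^sub>R (\<i> *s ?P x)"
      by (subst cs) (simp add: linear_add[OF lin] linear_scale[OF lin] i)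
    then show "?P (k *s x) = k *s ?P x" by (simp add: cs[symmetric])
  qed
  then show ?thesis unfolding eig_proj_def by (rule matrix_works)
qed

lemma matrix_eqI: "(\<And>x :: complex^'n::finite. A *v x = B *v x) \<Longrightarrow> A = B"
  by (simp add: matrix_eq)

context
  fixes \<rho> :: "complex^'n::finite^'n"
  assumes \<rho>: "\<rho> \<in> Herm"
begin

lemma Herm_inner: "(\<rho> *v x) \<bullet> y = x \<bullet> (\<rho> *v y)"
  using \<rho> by (simp add: inner_matrix_vector Herm_def)

lemma subspace_eigenspace: "subspace {v. \<rho> *v v = c *\<^sub>R v}"
  by (simp add: real_vector.subspace_def matrix_vector_right_distrib matrix_vector_scaleR scaleR_add_right)

lemma eigenspace_orthogonal:
  assumes "\<rho> *v v = c *\<^sub>R v" "\<rho> *v w = d *\<^sub>R w" "c \<noteq> d"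
  shows "v \<bullet> w = 0"
  using Herm_inner[of v w] assms by simp

lemma eig_proj_eigenvector:
  assumes "\<rho> *v v = d *\<^sub>R v"
  shows "eig_proj \<rho> c *v v = (if c = d then v else 0)"
proof -
  have "(if c = d then v else 0) \<in> {v. \<rho> *v v = c *\<^sub>R v} \<and>
      (\<forall>z\<in>{v. \<rho> *v v = c *\<^sub>R v}. (v - (if c = d then v else 0)) \<bullet> z = 0)"
    using assms eigenspace_orthogonal[OF assms] by auto
  then show ?thesis unfolding eig_proj_vector
    using closest_point_subspace_iff[OF subspace_eigenspace, of "if c = d then v else 0" c v] by auto
qed

lemma eig_proj_in: "\<rho> *v (eig_proj \<rho> c *v x) = c *\<^sub>R (eig_proj \<rho> c *v x)"
  unfolding eig_proj_vector
  using closest_point_subspace_iff[OF subspace_eigenspace, of "closest_point {v. \<rho> *v v = c *\<^sub>R v} x" c x] by auto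

text \<open>Eigenvectors for different eigenvalues are orthogonal, hence independent. The bound on
  the number of eigenvalues is what makes the later perturbation constants independent of the
  matrix.\<close>

lemma finite_eigs: "finite (eigs \<rho>)"
  and card_eigs: "card (eigs \<rho>) \<le> DIM(complex^'n)"
proof -
  define v where "v = (\<lambda>c. SOME v. v \<noteq> 0 \<and> \<rho> *v v = c *\<^sub>R v)"
  have v: "v c \<noteq> 0 \<and> \<rho> *v v c = c *\<^sub>R v c" if "c \<in> eigs \<rho>" for c
    using someI_ex[of "\<lambda>v. v \<noteq> 0 \<and> \<rho> *v v = c *\<^sub>R v"] that unfolding eigs_def v_def by blast
  have inj: "inj_on v (eigs \<rho>)"
  proof (rule inj_onI)
    fix c d assume "c \<in> eigs \<rho>" "d \<in> eigs \<rho>" "v c = v d"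
    then have "c *\<^sub>R v c = d *\<^sub>R v c" "v c \<noteq> 0" using v[of c] v[of d] by metis+
    then show "c = d" by simp
  qed
  have "independent (v ` eigs \<rho>)"
  proof (rule pairwise_orthogonal_independent)
    show "pairwise orthogonal (v ` eigs \<rho>)"
    proof (clarsimp simp: pairwise_def real_inner_class.orthogonal_def)
      fix c d assume "c \<in> eigs \<rho>" "d \<in> eigs \<rho>" "v c \<noteq> v d"
      then show "v c \<bullet> v d = 0" using v eigenspace_orthogonal[of "v c" c "v d" d] by metis
    qed
    show "0 \<notin> v ` eigs \<rho>" using v by fastforce
  qed
  from independent_bound[OF this] have "finite (v ` eigs \<rho>)" "card (v ` eigs \<rho>) \<le> DIM(complex^'n)" by auto
  then show "finite (eigs \<rho>)" "card (eigs \<rho>) \<le> DIM(complex^'n)"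
    using inj by (auto simp: finite_image_iff card_image)
qed

lemma span_eigenvectors: "span {v. \<exists>c. \<rho> *v v = c *\<^sub>R v} = UNIV"
  by (rule selfadjoint_span_eigenvectors[OF linear_matrix_vector Herm_inner])

lemma matrix_eq_on_eigenvectors:
  assumes "\<And>v c. v \<noteq> 0 \<Longrightarrow> \<rho> *v v = c *\<^sub>R v \<Longrightarrow> A *v v = B *v v"
  shows "A = B"
proof (rule matrix_eqI)
  fix x
  have "x \<in> span {v. \<exists>c. \<rho> *v v = c *\<^sub>R v}" using span_eigenvectors by simp
  then show "A *v x = B *v x"
  proof (rule linear_eq_on[OF linear_matrix_vector linear_matrix_vector])
    fix v assume "v \<in> {v. \<exists>c. \<rho> *v v = c *\<^sub>R v}"
    then show "A *v v = B *v v" using assms by (cases "v = 0") auto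
  qed
qed

lemma sum_eig_proj: "(\<Sum>c\<in>eigs \<rho>. eig_proj \<rho> c) = mat 1"
proof (rule matrix_eq_on_eigenvectors)
  fix v d assume v: "v \<noteq> 0" "\<rho> *v v = d *\<^sub>R v"
  then have d: "d \<in> eigs \<rho>" by (auto simp: eigs_def)
  have "(\<Sum>c\<in>S. eig_proj \<rho> c) *v v = (\<Sum>c\<in>S. eig_proj \<rho> c *v v)" for S
    by (induction S rule: infinite_finite_induct) (simp_all add: matrix_vector_mult_add_rdistrib)
  then show "(\<Sum>c\<in>eigs \<rho>. eig_proj \<rho> c) *v v = mat 1 *v v"
    using d finite_eigs by (simp add: eig_proj_eigenvector[OF v(2)])
qed

lemma eig_proj_mult: "eig_proj \<rho> c ** eig_proj \<rho> d = (if c = d then eig_proj \<rho> c else 0)"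
  by (rule matrix_eq_on_eigenvectors) (auto simp: matrix_vector_mul_assoc[symmetric] eig_proj_eigenvector)

lemma eig_proj_Herm: "eig_proj \<rho> c \<in> Herm"
proof -
  have "conj_transpose (eig_proj \<rho> c) = eig_proj \<rho> c"
  proof (rule matrix_eqI)
    fix x
    have "(conj_transpose (eig_proj \<rho> c) *v x) \<bullet> y = (eig_proj \<rho> c *v x) \<bullet> y" for y
    proof -
      have "(conj_transpose (eig_proj \<rho> c) *v x) \<bullet> y = x \<bullet> (eig_proj \<rho> c *v y)"
        by (simp add: inner_matrix_vector)
      then show ?thesis unfolding eig_proj_vector
        using closest_point_subspace_selfadjoint[OF subspace_eigenspace] by simp
    qed
    then show "conj_transpose (eig_proj \<rho> c) *v x = eig_proj \<rho> c *v x"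
      by (metis vector_eq_rdot)
  qed
  then show ?thesis by (simp add: Herm_def)
qed

lemma eig_proj_left: "\<rho> ** eig_proj \<rho> c = c *\<^sub>R eig_proj \<rho> c"
  by (rule matrix_eqI) (simp add: matrix_vector_mul_assoc[symmetric] eig_proj_in matrix_vector_scaleR)

lemma eig_proj_right: "eig_proj \<rho> c ** \<rho> = c *\<^sub>R eig_proj \<rho> c"
proof -
  have "eig_proj \<rho> c ** \<rho> = conj_transpose (\<rho> ** eig_proj \<rho> c)"
    using eig_proj_Herm \<rho> by (simp add: conj_transpose_mult Herm_def)
  also have "\<dots> = c *\<^sub>R eig_proj \<rho> c"
    unfolding eig_proj_left using eig_proj_Herm[of c] by (simp add: linear_scale[OF linear_conj_transpose] Herm_def)
  finally show ?thesis .
qed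

lemma eig_decomp: "\<rho> = (\<Sum>c\<in>eigs \<rho>. c *\<^sub>R eig_proj \<rho> c)"
proof -
  have "\<rho> = \<rho> ** (\<Sum>c\<in>eigs \<rho>. eig_proj \<rho> c)" by (simp add: sum_eig_proj)
  then show ?thesis by (simp add: matmul.sum_right eig_proj_left)
qed

lemma eig_proj_nonzero:
  assumes "c \<in> eigs \<rho>"
  shows "eig_proj \<rho> c \<noteq> 0"
proof -
  obtain v where "v \<noteq> 0" "\<rho> *v v = c *\<^sub>R v" using assms by (auto simp: eigs_def)
  then show ?thesis using eig_proj_eigenvector[of v c c] by auto
qed

text \<open>A Hermitian idempotent P satisfies <P, P> = <1, P>, and Cauchy-Schwarz does the rest.
  The bound is uniform in \<rho> although the projections are not continuous in it.\<close>

lemma norm_eig_proj: "norm (eig_proj \<rho> c) \<le> norm (mat 1 :: complex^'n^'n)"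
proof -
  let ?P = "eig_proj \<rho> c"
  have "?P \<bullet> ?P = (mat 1) \<bullet> ?P"
    using eig_proj_Herm[of c] eig_proj_mult[of c c]
    by (simp add: inner_matrix_eq_trace Herm_def conj_transpose_mat_1)
  then have "(norm ?P)\<^sup>2 \<le> norm (mat 1 :: complex^'n^'n) * norm ?P"
    using norm_cauchy_schwarz[of "mat 1" ?P] by (simp add: power2_norm_eq_inner)
  then show ?thesis by (cases "?P = 0") (simp_all add: power2_eq_square)
qed

end

section \<open>Relative entropy as a spectral sum\<close>

definition re_trace :: "complex^'n::finite^'n \<Rightarrow> real" where "re_trace A = Re (trace A)"

lemma bounded_linear_re_trace: "bounded_linear (re_trace :: complex^'n::finite^'n \<Rightarrow> real)"
  unfolding re_trace_def trace_def
  by (intro linear_conv_bounded_linear[THEN iffD1] linearI) (simp_all add: sum.distrib sum_distrib_left)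

lemmas re_trace_add = linear_add[OF bounded_linear.linear[OF bounded_linear_re_trace]]
  and re_trace_scaleR = linear_scale[OF bounded_linear.linear[OF bounded_linear_re_trace]]
  and re_trace_sum = linear_sum[OF bounded_linear.linear[OF bounded_linear_re_trace]]

lemma re_trace_commute: "re_trace (A ** B) = re_trace (B ** A)"
  unfolding re_trace_def by (subst trace_mul_sym) simp

lemma inner_eq_re_trace: "A \<bullet> B = re_trace (conj_transpose A ** B)" for A B :: "complex^'n::finite^'n"
  by (simp add: inner_matrix_eq_trace re_trace_def)

definition Phi :: "(real \<Rightarrow> real \<Rightarrow> real) \<Rightarrow> complex^'n::finite^'n \<Rightarrow> complex^'n^'n \<Rightarrow> real" where
  "Phi f \<tau> \<sigma> = (\<Sum>p\<in>eigs \<tau>. \<Sum>q\<in>eigs \<sigma>. f p q * re_trace (eig_proj \<tau> p ** eig_proj \<sigma> q))"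

lemma Phi_commute: "Phi f \<tau> \<sigma> = Phi (\<lambda>p q. f q p) \<sigma> \<tau>"
proof -
  have "re_trace (eig_proj \<tau> p ** eig_proj \<sigma> q) = re_trace (eig_proj \<sigma> q ** eig_proj \<tau> p)" for p q
    by (rule re_trace_commute)
  then show ?thesis unfolding Phi_def by (subst sum.swap) (simp only:)
qed

lemma Phi_cong:
  "(\<And>p q. p \<in> eigs \<tau> \<Longrightarrow> q \<in> eigs \<sigma> \<Longrightarrow> f p q = g p q) \<Longrightarrow> Phi f \<tau> \<sigma> = Phi g \<tau> \<sigma>"
  by (simp add: Phi_def)

lemma Phi_diff: "Phi (\<lambda>p q. f p q - g p q) \<tau> \<sigma> = Phi f \<tau> \<sigma> - Phi g \<tau> \<sigma>"
  by (simp add: Phi_def sum_subtractf left_diff_distrib)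

lemma PD_iff: "\<rho> \<in> PD \<longleftrightarrow> \<rho> \<in> Herm \<and> (\<forall>x. x \<noteq> 0 \<longrightarrow> 0 < x \<bullet> (\<rho> *v x))"
  by (simp add: PD_def inner_vec_complex)

lemma PD_Herm: "\<rho> \<in> PD \<Longrightarrow> \<rho> \<in> Herm" by (simp add: PD_iff)

lemma PD_eigs_pos: assumes "\<rho> \<in> PD" "c \<in> eigs \<rho>" shows "0 < c"
proof -
  obtain v where v: "v \<noteq> 0" "\<rho> *v v = c *\<^sub>R v" using assms(2) by (auto simp: eigs_def)
  then have "0 < v \<bullet> (c *\<^sub>R v)" using assms(1) by (metis PD_iff)
  then have "0 < c * (v \<bullet> v)" by simp
  moreover have "0 < v \<bullet> v" using v by simp
  ultimately show ?thesis by (simp add: zero_less_mult_iff)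
qed

lemma sum_matrix_vector: "(\<Sum>i\<in>I. A i) *v (x :: complex^'n::finite) = (\<Sum>i\<in>I. A i *v x)"
  by (induction I rule: infinite_finite_induct) (simp_all add: matrix_vector_mult_add_rdistrib)

lemma Herm_eigs_pos_PD:
  fixes \<rho> :: "complex^'n::finite^'n"
  assumes \<rho>: "\<rho> \<in> Herm" and pos: "\<And>c. c \<in> eigs \<rho> \<Longrightarrow> 0 < c"
  shows "\<rho> \<in> PD"
  unfolding PD_iff
proof (intro conjI \<rho> allI impI)
  fix x :: "complex^'n" assume x: "x \<noteq> 0"
  have sa: "x \<bullet> (eig_proj \<rho> c *v x) = (eig_proj \<rho> c *v x) \<bullet> (eig_proj \<rho> c *v x)" for c
    using eig_proj_Herm[OF \<rho>, of c] eig_proj_mult[OF \<rho>, of c c]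
    by (simp add: inner_matrix_vector Herm_def matrix_vector_mul_assoc)
  have "(\<Sum>c\<in>eigs \<rho>. eig_proj \<rho> c *v x) = x"
    by (simp add: sum_matrix_vector[symmetric] sum_eig_proj[OF \<rho>])
  then obtain c where c: "c \<in> eigs \<rho>" "eig_proj \<rho> c *v x \<noteq> 0" using x by (metis sum.neutral)
  have "\<rho> *v x = (\<Sum>c\<in>eigs \<rho>. c *\<^sub>R (eig_proj \<rho> c *v x))"
    using arg_cong[OF eig_decomp[OF \<rho>], of "\<lambda>A. A *v x"] by (simp add: sum_matrix_vector matrix_vector_scaleR)
  then have "x \<bullet> (\<rho> *v x) = (\<Sum>c\<in>eigs \<rho>. c * ((eig_proj \<rho> c *v x) \<bullet> (eig_proj \<rho> c *v x)))"
    by (simp add: inner_sum_right sa)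
  also have "\<dots> > 0" using c pos by (intro sum_pos2[OF finite_eigs[OF \<rho>] c(1)]) (auto simp: less_imp_le)
  finally show "0 < x \<bullet> (\<rho> *v x)" .
qed

lemma mat_sqrt_eq: "\<rho> \<in> Herm \<Longrightarrow> mat_sqrt \<rho> = (\<Sum>c\<in>eigs \<rho>. sqrt c *\<^sub>R eig_proj \<rho> c)"
proof -
  have "op_fun sqrt ((*v) \<rho>) = (\<lambda>x. (\<Sum>c\<in>eigs \<rho>. sqrt c *\<^sub>R eig_proj \<rho> c) *v x)"
    by (rule ext) (simp add: op_fun_def eigs_def eig_proj_vector sum_matrix_vector matrix_vector_scaleR)
  then show ?thesis by (simp add: mat_sqrt_def matrix_of_matrix_vector_mul)
qed

definition spec_fun :: "(real \<Rightarrow> real) \<Rightarrow> complex^'n::finite^'n \<Rightarrow> complex^'n^'n" where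
  "spec_fun f \<rho> = (\<Sum>c\<in>eigs \<rho>. f c *\<^sub>R eig_proj \<rho> c)"

lemma spec_fun_eig_proj:
  assumes "\<rho> \<in> Herm" "c \<in> eigs \<rho>"
  shows "spec_fun f \<rho> ** eig_proj \<rho> c = f c *\<^sub>R eig_proj \<rho> c" "eig_proj \<rho> c ** spec_fun f \<rho> = f c *\<^sub>R eig_proj \<rho> c"
proof -
  have *: "(\<Sum>d\<in>eigs \<rho>. if d = c then f c *\<^sub>R eig_proj \<rho> c else 0) = f c *\<^sub>R eig_proj \<rho> c"
    using finite_eigs[OF assms(1)] assms(2) by simp
  have "spec_fun f \<rho> ** eig_proj \<rho> c = (\<Sum>d\<in>eigs \<rho>. if d = c then f c *\<^sub>R eig_proj \<rho> c else 0)"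
    unfolding spec_fun_def matmul.sum_left matmul.scaleR_left eig_proj_mult[OF assms(1)] by (intro sum.cong) auto
  then show "spec_fun f \<rho> ** eig_proj \<rho> c = f c *\<^sub>R eig_proj \<rho> c" by (simp add: *)
  have "eig_proj \<rho> c ** spec_fun f \<rho> = (\<Sum>d\<in>eigs \<rho>. if d = c then f c *\<^sub>R eig_proj \<rho> c else 0)"
    unfolding spec_fun_def matmul.sum_right matmul.scaleR_right eig_proj_mult[OF assms(1)] by (intro sum.cong) auto
  then show "eig_proj \<rho> c ** spec_fun f \<rho> = f c *\<^sub>R eig_proj \<rho> c" by (simp add: *)
qed

lemma spec_fun_mult:
  assumes "\<rho> \<in> Herm"
  shows "spec_fun f \<rho> ** spec_fun g \<rho> = spec_fun (\<lambda>c. f c * g c) \<rho>"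
proof -
  have "spec_fun f \<rho> ** spec_fun g \<rho> = (\<Sum>c\<in>eigs \<rho>. g c *\<^sub>R (spec_fun f \<rho> ** eig_proj \<rho> c))"
    unfolding spec_fun_def[of g] matmul.sum_right matmul.scaleR_right ..
  then show ?thesis by (simp add: spec_fun_eig_proj[OF assms]) (simp add: spec_fun_def mult.commute)
qed

lemma spec_fun_one: "\<rho> \<in> Herm \<Longrightarrow> spec_fun (\<lambda>_. 1) \<rho> = mat 1"
  by (simp add: spec_fun_def sum_eig_proj)

lemma spec_fun_id: "\<rho> \<in> Herm \<Longrightarrow> spec_fun (\<lambda>c. c) \<rho> = \<rho>"
  by (simp add: spec_fun_def eig_decomp[symmetric])

lemma spec_fun_cong: "(\<And>c. c \<in> eigs \<rho> \<Longrightarrow> f c = g c) \<Longrightarrow> spec_fun f \<rho> = spec_fun g \<rho>"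
  by (simp add: spec_fun_def)

lemma inv_Rmul:
  assumes "\<rho> \<in> PD"
  shows "inv_into UNIV (Rmul \<rho>) A = A ** spec_fun inverse \<rho>"
proof -
  have h: "\<rho> \<in> Herm" using assms by (rule PD_Herm)
  have "spec_fun inverse \<rho> ** \<rho> = spec_fun inverse \<rho> ** spec_fun (\<lambda>c. c) \<rho>" by (simp add: spec_fun_id[OF h])
  also have "\<dots> = spec_fun (\<lambda>_. 1) \<rho>" unfolding spec_fun_mult[OF h]
    by (rule spec_fun_cong) (use PD_eigs_pos[OF assms] in force)
  finally have 1: "spec_fun inverse \<rho> ** \<rho> = mat 1" by (simp add: spec_fun_one[OF h])
  then have 2: "\<rho> ** spec_fun inverse \<rho> = mat 1" by (metis matrix_left_right_inverse)
  have "inj (Rmul \<rho>)"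
  proof (rule injI)
    fix A B assume "Rmul \<rho> A = Rmul \<rho> B"
    then have "A ** \<rho> ** spec_fun inverse \<rho> = B ** \<rho> ** spec_fun inverse \<rho>" by (simp add: Rmul_def)
    then show "A = B" by (simp add: matrix_mul_assoc[symmetric] 2)
  qed
  then show ?thesis by (rule inv_f_eq) (simp add: Rmul_def matrix_mul_assoc[symmetric] 1)
qed

lemma LR_quot_eq:
  assumes "\<rho> \<in> PD" "\<sigma> \<in> PD"
  shows "LR_quot \<sigma> \<rho> A = (\<Sum>(q,p)\<in>eigs \<sigma> \<times> eigs \<rho>. (q / p) *\<^sub>R (eig_proj \<sigma> q ** A ** eig_proj \<rho> p))"
proof -
  have "LR_quot \<sigma> \<rho> A = spec_fun (\<lambda>c. c) \<sigma> ** A ** spec_fun inverse \<rho>"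
    using assms by (simp add: LR_quot_def Lmul_def inv_Rmul spec_fun_id PD_Herm matrix_mul_assoc)
  also have "\<dots> = (\<Sum>p\<in>eigs \<rho>. \<Sum>q\<in>eigs \<sigma>. (q / p) *\<^sub>R (eig_proj \<sigma> q ** A ** eig_proj \<rho> p))"
    unfolding spec_fun_def matmul.sum_left matmul.sum_right matmul.scaleR_left matmul.scaleR_right scaleR_sum_right
    by (intro sum.cong refl) (simp add: divide_inverse mult.commute)
  finally show ?thesis by (subst (asm) sum.swap) (simp add: sum.cartesian_product)
qed

lemma inner_sandwich:
  fixes A B P Q :: "complex^'n::finite^'n"
  assumes "P \<in> Herm" "Q \<in> Herm"
  shows "(Q ** A ** P) \<bullet> B = A \<bullet> (Q ** B ** P)"
proof -
  have "(Q ** A ** P) \<bullet> B = re_trace (P ** (conj_transpose A ** Q ** B))"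
    using assms by (simp add: inner_eq_re_trace conj_transpose_mult Herm_def matrix_mul_assoc)
  also have "\<dots> = re_trace ((conj_transpose A ** Q ** B) ** P)" by (rule re_trace_commute)
  finally show ?thesis by (simp add: inner_eq_re_trace matrix_mul_assoc)
qed

lemma linear_sandwich: "linear (\<lambda>A. Q ** A ** P)" for P Q :: "complex^'n::finite^'n"
  by (rule linearI) (simp_all add: matmul.add_left matmul.add_right matmul.scaleR_left matmul.scaleR_right)

text \<open>Sandwiching between a projection of \<sigma> on the left and one of \<rho> on the right
  gives orthogonal projections on the space of matrices that sum to the identity, and the quotient
  operator acts as q/p on the range of each. So \<open>op_fun_resolution\<close> applies.\<close>

lemma op_fun_LR_quot:
  assumes "\<rho> \<in> PD" "\<sigma> \<in> PD"
  shows "op_fun f (LR_quot \<sigma> \<rho>) A =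
    (\<Sum>q\<in>eigs \<sigma>. \<Sum>p\<in>eigs \<rho>. f (q / p) *\<^sub>R (eig_proj \<sigma> q ** A ** eig_proj \<rho> p))"
proof -
  have h: "\<rho> \<in> Herm" "\<sigma> \<in> Herm" using assms by (auto intro: PD_Herm)
  define E where "E = (\<lambda>(q,p) A. eig_proj \<sigma> q ** A ** eig_proj \<rho> p)"
  have "op_fun f (LR_quot \<sigma> \<rho>) A = (\<Sum>i\<in>eigs \<sigma> \<times> eigs \<rho>. f (case i of (q,p) \<Rightarrow> q / p) *\<^sub>R E i A)"
  proof (rule op_fun_resolution)
    show "finite (eigs \<sigma> \<times> eigs \<rho>)" using h by (simp add: finite_eigs)
    show "linear (E i)" for i by (cases i) (simp add: E_def linear_sandwich)
    show "E i x \<bullet> y = x \<bullet> E i y" for i x y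
      by (cases i) (simp add: E_def inner_sandwich eig_proj_Herm h)
    show "E i (E j x) = (if i = j then E i x else 0)" for i j x
    proof -
      obtain q p q' p' where ij: "i = (q,p)" "j = (q',p')" by (metis surj_pair)
      have "E i (E j x) = (eig_proj \<sigma> q ** eig_proj \<sigma> q') ** x ** (eig_proj \<rho> p' ** eig_proj \<rho> p)"
        by (simp add: E_def ij matrix_mul_assoc)
      then show ?thesis unfolding eig_proj_mult[OF h(1)] eig_proj_mult[OF h(2)]
        by (auto simp: E_def ij)
    qed
    show "(\<Sum>i\<in>eigs \<sigma> \<times> eigs \<rho>. E i x) = x" for x
    proof -
      have "(\<Sum>i\<in>eigs \<sigma> \<times> eigs \<rho>. E i x) = (\<Sum>q\<in>eigs \<sigma>. eig_proj \<sigma> q) ** x ** (\<Sum>p\<in>eigs \<rho>. eig_proj \<rho> p)"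
        unfolding matmul.sum_left matmul.sum_right
        by (subst sum.swap) (simp add: E_def sum.cartesian_product split_def)
      then show ?thesis by (simp add: sum_eig_proj h)
    qed
    show "LR_quot \<sigma> \<rho> x = (\<Sum>i\<in>eigs \<sigma> \<times> eigs \<rho>. (case i of (q,p) \<Rightarrow> q / p) *\<^sub>R E i x)" for x
      unfolding LR_quot_eq[OF assms] by (intro sum.cong) (auto simp: E_def)
  qed
  also have "\<dots> = (\<Sum>q\<in>eigs \<sigma>. \<Sum>p\<in>eigs \<rho>. f (q / p) *\<^sub>R (eig_proj \<sigma> q ** A ** eig_proj \<rho> p))"
    unfolding sum.cartesian_product by (intro sum.cong) (auto simp: E_def)
  finally show ?thesis .
qed

text \<open>By cyclicity of the trace each of the two square roots meets the projection of \<rho> at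
  p and contributes a factor \<open>sqrt p\<close>.\<close>

lemma rel_entropy_eq_Phi:
  assumes "\<rho> \<in> PD" "\<sigma> \<in> PD"
  shows "rel_entropy g \<rho> \<sigma> = Phi (\<lambda>p q. p * g (q / p)) \<rho> \<sigma>"
proof -
  have h: "\<rho> \<in> Herm" "\<sigma> \<in> Herm" using assms by (auto intro: PD_Herm)
  have s: "mat_sqrt \<rho> = spec_fun sqrt \<rho>" by (simp add: mat_sqrt_eq[OF h(1)] spec_fun_def)
  have t: "re_trace (spec_fun sqrt \<rho> ** (eig_proj \<sigma> q ** spec_fun sqrt \<rho> ** eig_proj \<rho> p)) =
      p * re_trace (eig_proj \<rho> p ** eig_proj \<sigma> q)" if p: "p \<in> eigs \<rho>" for p q
  proof -
    have "re_trace (spec_fun sqrt \<rho> ** (eig_proj \<sigma> q ** spec_fun sqrt \<rho> ** eig_proj \<rho> p)) =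
        re_trace ((spec_fun sqrt \<rho> ** eig_proj \<sigma> q) ** (spec_fun sqrt \<rho> ** eig_proj \<rho> p))"
      by (simp add: matrix_mul_assoc)
    also have "\<dots> = sqrt p * re_trace (spec_fun sqrt \<rho> ** eig_proj \<sigma> q ** eig_proj \<rho> p)"
      unfolding spec_fun_eig_proj[OF h(1) p] by (simp add: matmul.scaleR_right re_trace_scaleR)
    also have "\<dots> = sqrt p * re_trace (eig_proj \<rho> p ** (spec_fun sqrt \<rho> ** eig_proj \<sigma> q))"
      by (subst re_trace_commute) simp
    also have "\<dots> = p * re_trace (eig_proj \<rho> p ** eig_proj \<sigma> q)"
      unfolding matrix_mul_assoc spec_fun_eig_proj[OF h(1) p] using PD_eigs_pos[OF assms(1) p]
      by (simp add: matmul.scaleR_left re_trace_scaleR mult.assoc[symmetric])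
    finally show ?thesis .
  qed
  have "rel_entropy g \<rho> \<sigma> = (\<Sum>q\<in>eigs \<sigma>. \<Sum>p\<in>eigs \<rho>. p * g (q / p) * re_trace (eig_proj \<rho> p ** eig_proj \<sigma> q))"
    unfolding rel_entropy_def s op_fun_LR_quot[OF assms] re_trace_def[symmetric]
      matmul.sum_right re_trace_sum matmul.scaleR_right re_trace_scaleR
    by (intro sum.cong refl) (simp add: t)
  then show ?thesis unfolding Phi_def by (subst sum.swap) simp
qed

section \<open>The operator of a monotone metric in spectral coordinates\<close>

lemma op_fun_Rmul:
  fixes \<rho> :: "complex^'n::finite^'n"
  assumes h: "\<rho> \<in> Herm"
  shows "op_fun f (Rmul \<rho>) A = A ** spec_fun f \<rho>"
proof -
  define E where "E = (\<lambda>p (A :: complex^'n^'n). A ** eig_proj \<rho> p)"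
  have E: "E p A = mat 1 ** A ** eig_proj \<rho> p" for p A by (simp add: E_def)
  have one: "mat 1 \<in> Herm" by (simp add: Herm_def conj_transpose_mat_1)
  have "op_fun f (Rmul \<rho>) A = (\<Sum>i\<in>eigs \<rho>. f i *\<^sub>R E i A)"
  proof (rule op_fun_resolution[where c = "\<lambda>i. i"])
    show "linear (E i)" for i by (simp only: E[abs_def] linear_sandwich)
    show "E i x \<bullet> y = x \<bullet> E i y" for i x y
      unfolding E by (intro inner_sandwich eig_proj_Herm h one)
    show "E i (E j x) = (if i = j then E i x else 0)" for i j x
    proof -
      have "E i (E j x) = x ** (eig_proj \<rho> j ** eig_proj \<rho> i)" by (simp add: E_def matrix_mul_assoc)
      then show ?thesis unfolding eig_proj_mult[OF h] by (auto simp: E_def)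
    qed
    show "(\<Sum>i\<in>eigs \<rho>. E i x) = x" for x
      by (simp add: E_def matmul.sum_right[symmetric] sum_eig_proj h)
    show "Rmul \<rho> x = (\<Sum>i\<in>eigs \<rho>. i *\<^sub>R E i x)" for x
      unfolding Rmul_def by (subst eig_decomp[OF h]) (simp add: matmul.sum_right matmul.scaleR_right E_def)
  qed (rule finite_eigs[OF h])
  then show ?thesis by (simp add: E_def spec_fun_def matmul.sum_right matmul.scaleR_right)
qed

text \<open>The functional calculus is multiplicative, so by positivity of \<open>F\<close> the
  inverse of the middle factor is the calculus of \<open>1 / F\<close>. Both outer factors act at
  the same eigenvalue p of right multiplication and together give 1/p.\<close>

lemma J_eq:
  assumes \<rho>: "\<rho> \<in> PD" and F: "\<And>u. u > 0 \<Longrightarrow> F u > 0"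
  shows "J F \<rho> Y = (\<Sum>q\<in>eigs \<rho>. \<Sum>p\<in>eigs \<rho>. (1 / (p * F (q / p))) *\<^sub>R (eig_proj \<rho> q ** Y ** eig_proj \<rho> p))"
proof -
  have h: "\<rho> \<in> Herm" using \<rho> by (rule PD_Herm)
  let ?T = "\<lambda>f A. op_fun f (LR_quot \<rho> \<rho>) A"
  have comp: "?T f (?T g A) = ?T (\<lambda>u. f u * g u) A" for f g A
  proof -
    have *: "eig_proj \<rho> q ** (\<Sum>q'\<in>eigs \<rho>. \<Sum>p'\<in>eigs \<rho>. g (q' / p') *\<^sub>R (eig_proj \<rho> q' ** A ** eig_proj \<rho> p')) **
        eig_proj \<rho> p
        = g (q / p) *\<^sub>R (eig_proj \<rho> q ** A ** eig_proj \<rho> p)" if qp: "q \<in> eigs \<rho>" "p \<in> eigs \<rho>" for q p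
    proof -
      have "eig_proj \<rho> q ** (\<Sum>q'\<in>eigs \<rho>. \<Sum>p'\<in>eigs \<rho>. g (q' / p') *\<^sub>R (eig_proj \<rho> q' ** A ** eig_proj \<rho> p')) **
          eig_proj \<rho> p
        = (\<Sum>q'\<in>eigs \<rho>. \<Sum>p'\<in>eigs \<rho>. g (q' / p') *\<^sub>R ((eig_proj \<rho> q ** eig_proj \<rho> q') ** A **
        (eig_proj \<rho> p' ** eig_proj \<rho> p)))"
        unfolding matmul.sum_left matmul.sum_right matmul.scaleR_left matmul.scaleR_right
        by (simp add: matrix_mul_assoc)
      also have "\<dots> = (\<Sum>q'\<in>eigs \<rho>. if q' = q then (\<Sum>p'\<in>eigs \<rho>. if p' =
          p then g (q / p) *\<^sub>R (eig_proj \<rho> q ** A ** eig_proj \<rho> p) else 0) else 0)"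
        unfolding eig_proj_mult[OF h] by (intro sum.cong refl) (auto intro!: sum.neutral sum.cong)
      finally show ?thesis using qp by (simp add: finite_eigs[OF h])
    qed
    show ?thesis
      unfolding op_fun_LR_quot[OF \<rho> \<rho>, of f] op_fun_LR_quot[OF \<rho> \<rho>, of g] op_fun_LR_quot[OF \<rho> \<rho>, of "\<lambda>u. f u * g u"]
      by (intro sum.cong refl) (simp add: *)
  qed
  have idt: "?T (\<lambda>u. f u * g u) A = A" if "\<And>u. u > 0 \<Longrightarrow> f u * g u = 1" for f g :: "real \<Rightarrow> real" and A
  proof -
    have "?T (\<lambda>u. f u * g u) A = (\<Sum>q\<in>eigs \<rho>. \<Sum>p\<in>eigs \<rho>. eig_proj \<rho> q ** A ** eig_proj \<rho> p)"
      unfolding op_fun_LR_quot[OF \<rho> \<rho>] using PD_eigs_pos[OF \<rho>] that by (intro sum.cong refl) simp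
    also have "\<dots> = (\<Sum>q\<in>eigs \<rho>. eig_proj \<rho> q) ** A ** (\<Sum>p\<in>eigs \<rho>. eig_proj \<rho> p)"
      unfolding matmul.sum_left matmul.sum_right by (subst sum.swap) simp
    finally show ?thesis by (simp add: sum_eig_proj h)
  qed
  have inv: "inv_into UNIV (?T F) A = ?T (\<lambda>u. inverse (F u)) A" for A
  proof (rule inv_f_eq)
    show "inj (?T F)"
      by (rule inj_on_inverseI[of _ "?T (\<lambda>u. inverse (F u))"]) (use F in \<open>force simp: comp intro!: idt\<close>)
    show "?T F (?T (\<lambda>u. inverse (F u)) A) = A"
      unfolding comp by (rule idt) (use F in force)
  qed
  define s where "s = spec_fun (\<lambda>x. x powr (- 1 / 2)) \<rho>"
  have s: "s ** eig_proj \<rho> p = (p powr (- 1 / 2)) *\<^sub>R eig_proj \<rho> p" "eig_proj \<rho> p ** s =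
      (p powr (- 1 / 2)) *\<^sub>R eig_proj \<rho> p" if "p \<in> eigs \<rho>" for p
    unfolding s_def by (rule spec_fun_eig_proj[OF h that])+
  have "J F \<rho> Y = ?T (\<lambda>u. inverse (F u)) (Y ** s) ** s"
    by (simp add: J_def op_fun_Rmul[OF h] s_def inv)
  also have "\<dots> = (\<Sum>q\<in>eigs \<rho>. \<Sum>p\<in>eigs \<rho>. inverse (F (q / p)) *\<^sub>R (eig_proj \<rho> q ** Y ** (s ** eig_proj \<rho> p ** s)))"
    unfolding op_fun_LR_quot[OF \<rho> \<rho>] matmul.sum_left matmul.scaleR_left by (simp add: matrix_mul_assoc)
  also have "\<dots> = (\<Sum>q\<in>eigs \<rho>. \<Sum>p\<in>eigs \<rho>. (1 / (p * F (q / p))) *\<^sub>R (eig_proj \<rho> q ** Y ** eig_proj \<rho> p))"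
  proof (intro sum.cong refl)
    fix q p assume p: "p \<in> eigs \<rho>"
    have "p powr (- 1 / 2) * p powr (- 1 / 2) = 1 / p"
      using PD_eigs_pos[OF \<rho> p] by (simp add: powr_add[symmetric] powr_minus_divide)
    then have "s ** eig_proj \<rho> p ** s = (1 / p) *\<^sub>R eig_proj \<rho> p"
      using s[OF p] by (simp add: matmul.scaleR_left)
    then show "inverse (F (q / p)) *\<^sub>R (eig_proj \<rho> q ** Y ** (s ** eig_proj \<rho> p ** s)) =
        (1 / (p * F (q / p))) *\<^sub>R (eig_proj \<rho> q ** Y ** eig_proj \<rho> p)"
      by (simp add: matmul.scaleR_right divide_inverse mult.commute)
  qed
  finally show ?thesis .
qed

section \<open>Perturbation of spectral sums\<close>

definition mixed_diff :: "(real \<Rightarrow> real \<Rightarrow> real) \<Rightarrow> real \<Rightarrow> real \<Rightarrow> real \<Rightarrow> real \<Rightarrow> real" where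
  "mixed_diff f p p' q q' = f p' q' - f p' q - f p q' + f p q"

text \<open>The eigenprojections of two matrices cannot be matched with each other. Inserting both
  resolutions of the identity writes the two spectral sums over the same index triples with the same
  weights, so that they can be subtracted term by term.\<close>

lemma Phi_refine_left:
  fixes \<tau> \<tau>' \<sigma> :: "complex^'n::finite^'n"
  assumes "\<tau> \<in> Herm" "\<tau>' \<in> Herm"
  shows "(\<Sum>p\<in>eigs \<tau>. \<Sum>p'\<in>eigs \<tau>'. \<Sum>q\<in>eigs \<sigma>. f p' q *
      re_trace (eig_proj \<tau> p ** eig_proj \<tau>' p' ** eig_proj \<sigma> q)) = Phi f \<tau>' \<sigma>" (is "?A = _")
    and "(\<Sum>p\<in>eigs \<tau>. \<Sum>p'\<in>eigs \<tau>'. \<Sum>q\<in>eigs \<sigma>. f p q *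
      re_trace (eig_proj \<tau> p ** eig_proj \<tau>' p' ** eig_proj \<sigma> q)) = Phi f \<tau> \<sigma>" (is "?B = _")
proof -
  have 1: "(\<Sum>p\<in>eigs \<tau>. re_trace (eig_proj \<tau> p ** X ** Y)) = re_trace (X ** Y)" for X Y :: "complex^'n^'n"
    by (simp add: re_trace_sum[symmetric] matmul.sum_left[symmetric] sum_eig_proj assms)
  have "?A = (\<Sum>p'\<in>eigs \<tau>'. \<Sum>q\<in>eigs \<sigma>. \<Sum>p\<in>eigs \<tau>. f p' q * re_trace (eig_proj \<tau> p ** eig_proj \<tau>' p' ** eig_proj \<sigma> q))"
    by (rule trans[OF sum.swap sum.cong[OF refl sum.swap]])
  also have "\<dots> = Phi f \<tau>' \<sigma>" by (simp add: sum_distrib_left[symmetric] 1 Phi_def)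
  finally show "?A = Phi f \<tau>' \<sigma>" .
  have 2: "(\<Sum>p'\<in>eigs \<tau>'. re_trace (X ** eig_proj \<tau>' p' ** Y)) = re_trace (X ** Y)" for X Y :: "complex^'n^'n"
    by (simp add: re_trace_sum[symmetric] matmul.sum_left[symmetric] matmul.sum_right[symmetric] sum_eig_proj assms)
  have "?B = (\<Sum>p\<in>eigs \<tau>. \<Sum>q\<in>eigs \<sigma>. \<Sum>p'\<in>eigs \<tau>'. f p q * re_trace (eig_proj \<tau> p ** eig_proj \<tau>' p' ** eig_proj \<sigma> q))"
    by (rule sum.cong[OF refl sum.swap])
  also have "\<dots> = Phi f \<tau> \<sigma>" by (simp add: sum_distrib_left[symmetric] 2 Phi_def)
  finally show "?B = Phi f \<tau> \<sigma>" .
qed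

lemma Phi_diff_left:
  fixes \<tau> \<tau>' \<sigma> :: "complex^'n::finite^'n"
  assumes "\<tau> \<in> Herm" "\<tau>' \<in> Herm"
  shows "Phi f \<tau>' \<sigma> - Phi f \<tau> \<sigma> = (\<Sum>p\<in>eigs \<tau>. \<Sum>p'\<in>eigs \<tau>'. \<Sum>q\<in>eigs \<sigma>. (f p' q - f p q) *
      re_trace (eig_proj \<tau> p ** eig_proj \<tau>' p' ** eig_proj \<sigma> q))"
  unfolding Phi_refine_left[OF assms, symmetric] by (simp add: sum_subtractf left_diff_distrib)

text \<open>The refinement is carried out in both arguments, and the four values of \<open>f\<close>
  then share one weight. That weight contains a product of projections of \<tau> and \<tau>' and one
  of projections of \<sigma>' and \<sigma>, hence small factors of both kinds.\<close>

lemma Phi_mixed_diff: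
  fixes \<tau> \<tau>' \<sigma> \<sigma>' :: "complex^'n::finite^'n"
  assumes \<tau>: "\<tau> \<in> Herm" "\<tau>' \<in> Herm" and \<sigma>: "\<sigma> \<in> Herm" "\<sigma>' \<in> Herm"
  shows "Phi f \<tau>' \<sigma>' - Phi f \<tau>' \<sigma> - Phi f \<tau> \<sigma>' + Phi f \<tau> \<sigma> =
    (\<Sum>p\<in>eigs \<tau>. \<Sum>p'\<in>eigs \<tau>'. \<Sum>q'\<in>eigs \<sigma>'. \<Sum>q\<in>eigs \<sigma>. mixed_diff f p p' q q' *
      re_trace (eig_proj \<tau> p ** eig_proj \<tau>' p' ** (eig_proj \<sigma>' q' ** eig_proj \<sigma> q)))"
proof -
  let ?w = "\<lambda>p p' q' q. re_trace (eig_proj \<tau> p ** eig_proj \<tau>' p' ** (eig_proj \<sigma>' q' ** eig_proj \<sigma> q))"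
  have 1: "(\<Sum>q\<in>eigs \<sigma>. ?w p p' q' q) = re_trace (eig_proj \<tau> p ** eig_proj \<tau>' p' ** eig_proj \<sigma>' q')" for p p' q'
    by (simp add: re_trace_sum[symmetric] matmul.sum_right[symmetric] sum_eig_proj \<sigma>)
  have 2: "(\<Sum>q'\<in>eigs \<sigma>'. ?w p p' q' q) = re_trace (eig_proj \<tau> p ** eig_proj \<tau>' p' ** eig_proj \<sigma> q)" for p p' q
    by (simp add: re_trace_sum[symmetric] matmul.sum_right[symmetric] matmul.sum_left[symmetric] sum_eig_proj \<sigma>)
  have A: "(\<Sum>p\<in>eigs \<tau>. \<Sum>p'\<in>eigs \<tau>'. \<Sum>q'\<in>eigs \<sigma>'. \<Sum>q\<in>eigs \<sigma>. h p p' q' * ?w p p' q' q) =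
      (\<Sum>p\<in>eigs \<tau>. \<Sum>p'\<in>eigs \<tau>'. \<Sum>q'\<in>eigs \<sigma>'. h p p' q' * re_trace (eig_proj \<tau> p ** eig_proj \<tau>' p' ** eig_proj \<sigma>' q'))"
      for h
    by (simp add: sum_distrib_left[symmetric] 1)
  have B: "(\<Sum>p\<in>eigs \<tau>. \<Sum>p'\<in>eigs \<tau>'. \<Sum>q'\<in>eigs \<sigma>'. \<Sum>q\<in>eigs \<sigma>. h p p' q * ?w p p' q' q) =
      (\<Sum>p\<in>eigs \<tau>. \<Sum>p'\<in>eigs \<tau>'. \<Sum>q\<in>eigs \<sigma>. h p p' q * re_trace (eig_proj \<tau> p ** eig_proj \<tau>' p' ** eig_proj \<sigma> q))" for h
  proof -
    have "(\<Sum>q'\<in>eigs \<sigma>'. \<Sum>q\<in>eigs \<sigma>. h p p' q * ?w p p' q' q) =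
        (\<Sum>q\<in>eigs \<sigma>. h p p' q * re_trace (eig_proj \<tau> p ** eig_proj \<tau>' p' ** eig_proj \<sigma> q))" for p p'
      by (subst sum.swap) (simp add: sum_distrib_left[symmetric] 2)
    then show ?thesis by (simp only:)
  qed
  note T = A[of "\<lambda>p p' q'. f p' q'", unfolded Phi_refine_left[OF \<tau>]] B[of "\<lambda>p p' q. f p' q", unfolded
    Phi_refine_left[OF \<tau>]]
    A[of "\<lambda>p p' q'. f p q'", unfolded Phi_refine_left[OF \<tau>]] B[of "\<lambda>p p' q. f p q", unfolded Phi_refine_left[OF \<tau>]]
  show ?thesis unfolding T[symmetric] mixed_diff_def
    by (simp only: sum_subtractf[symmetric] sum.distrib[symmetric] left_diff_distrib distrib_right)
qed

text \<open>Each eigenvalue is produced by letting its matrix act on the adjacent projection. The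
  identities say that eigenspaces for distant eigenvalues of nearby matrices overlap little; the
  factor \<open>p' - p\<close> is what a Lipschitz bound on \<open>f\<close> provides.\<close>

lemma eig_proj_sandwich_diff:
  fixes \<tau> \<tau>' :: "complex^'n::finite^'n"
  assumes "\<tau> \<in> Herm" "\<tau>' \<in> Herm"
  shows "(p' - p) *\<^sub>R (eig_proj \<tau> p ** eig_proj \<tau>' p') = eig_proj \<tau> p ** ((\<tau>' - \<tau>) ** eig_proj \<tau>' p')"
    and "(p' - p) *\<^sub>R (eig_proj \<tau>' p' ** eig_proj \<tau> p) = eig_proj \<tau>' p' ** ((\<tau>' - \<tau>) ** eig_proj \<tau> p)"
proof -
  have "eig_proj \<tau> p ** ((\<tau>' - \<tau>) ** eig_proj \<tau>' p') =
      eig_proj \<tau> p ** (\<tau>' ** eig_proj \<tau>' p') - (eig_proj \<tau> p ** \<tau>) ** eig_proj \<tau>' p'"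
    by (simp add: matmul.diff_left matmul.diff_right matrix_mul_assoc)
  then show "(p' - p) *\<^sub>R (eig_proj \<tau> p ** eig_proj \<tau>' p') = eig_proj \<tau> p ** ((\<tau>' - \<tau>) ** eig_proj \<tau>' p')"
    by (simp add: eig_proj_left[OF assms(2)] eig_proj_right[OF assms(1)] matmul.scaleR_left matmul.scaleR_right
      scaleR_left_diff_distrib)
  have "eig_proj \<tau>' p' ** ((\<tau>' - \<tau>) ** eig_proj \<tau> p) =
      (eig_proj \<tau>' p' ** \<tau>') ** eig_proj \<tau> p - eig_proj \<tau>' p' ** (\<tau> ** eig_proj \<tau> p)"
    by (simp add: matmul.diff_left matmul.diff_right matrix_mul_assoc)
  then show "(p' - p) *\<^sub>R (eig_proj \<tau>' p' ** eig_proj \<tau> p) = eig_proj \<tau>' p' ** ((\<tau>' - \<tau>) ** eig_proj \<tau> p)"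
    by (simp add: eig_proj_left[OF assms(1)] eig_proj_right[OF assms(2)] matmul.scaleR_left matmul.scaleR_right
      scaleR_left_diff_distrib)
qed

lemma matrix_mult_bound:
  obtains M where "0 < M" "\<And>(A :: complex^'n::finite^'n) (B :: complex^'n^'n). norm (A ** B) \<le> norm A * norm B * M"
proof -
  have "\<exists>K>0. \<forall>(A :: complex^'n^'n) (B :: complex^'n^'n). norm (A ** B) \<le> norm A * norm B * K"
    by (rule matmul.pos_bounded)
  then obtain K where K: "0 < K \<and> (\<forall>(A :: complex^'n^'n) (B :: complex^'n^'n). norm (A ** B) \<le> norm A * norm B * K)"
    ..
  show ?thesis by (rule that[of K]) (simp_all add: K)
qed

lemma sandwich_bound:
  obtains K where "0 < K" "\<And>\<tau> \<tau>' D p p'. \<tau> \<in> Herm \<Longrightarrow> \<tau>' \<in> Herm \<Longrightarrow>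
    norm (eig_proj \<tau> p ** (D ** eig_proj \<tau>' p') :: complex^'n::finite^'n) \<le> K * norm D"
proof -
  obtain M where M: "0 < M" "\<And>(A :: complex^'n^'n) (B :: complex^'n^'n). norm (A ** B) \<le> norm A * norm B * M"
    by (rule matrix_mult_bound) (rule that; blast)
  define N where "N = norm (mat 1 :: complex^'n^'n)"
  have "norm (eig_proj \<tau> p ** (D ** eig_proj \<tau>' p')) \<le> (N * M * N * M + 1) * norm D"
    if h: "\<tau> \<in> Herm" "\<tau>' \<in> Herm" for \<tau> \<tau>' D :: "complex^'n^'n" and p p'
  proof -
    have P: "norm (eig_proj \<tau> p) \<le> N" "norm (eig_proj \<tau>' p') \<le> N"
      unfolding N_def using h by (auto intro: norm_eig_proj)
    have "norm (eig_proj \<tau> p ** (D ** eig_proj \<tau>' p')) \<le> norm (eig_proj \<tau> p) * norm (D ** eig_proj \<tau>' p') * M"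
      by (rule M)
    also have "\<dots> \<le> N * (norm D * norm (eig_proj \<tau>' p') * M) * M"
      using P M by (intro mult_mono mult_nonneg_nonneg) (auto simp: N_def)
    also have "\<dots> \<le> N * (norm D * N * M) * M"
      using P M by (intro mult_left_mono mult_right_mono mult_nonneg_nonneg) (auto simp: N_def)
    also have "\<dots> \<le> (N * M * N * M + 1) * norm D" by (simp add: algebra_simps)
    finally show ?thesis .
  qed
  moreover have "0 < N * M * N * M + 1" using M by (simp add: N_def add_nonneg_pos)
  ultimately show ?thesis by (rule that[rotated])
qed

lemma re_trace_mult_bound:
  obtains K where "0 < K" "\<And>(A :: complex^'n::finite^'n) (B :: complex^'n^'n). \<bar>re_trace (A ** B)\<bar> \<le>
      K * (norm A * norm B)"
proof -
  obtain M where M: "0 < M" "\<And>(A :: complex^'n^'n) (B :: complex^'n^'n). norm (A ** B) \<le> norm A * norm B * M"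
    by (rule matrix_mult_bound) (rule that; blast)
  have "\<exists>T>0. \<forall>A :: complex^'n^'n. norm (re_trace A) \<le> norm A * T"
    by (rule bounded_linear.pos_bounded[OF bounded_linear_re_trace])
  then obtain T where T: "0 < T \<and> (\<forall>A :: complex^'n^'n. norm (re_trace A) \<le> norm A * T)" ..
  have "\<bar>re_trace (A ** B)\<bar> \<le> (M * T) * (norm A * norm B)" for A B :: "complex^'n^'n"
  proof -
    have "\<bar>re_trace (A ** B)\<bar> \<le> norm (A ** B) * T" using T by (metis real_norm_def)
    also have "\<dots> \<le> (norm A * norm B * M) * T" using M T by (intro mult_right_mono) auto
    finally show ?thesis by (simp add: mult_ac)
  qed
  then show ?thesis using that[of "M * T"] M(1) T by simp
qed

lemma sum_abs_bound:
  fixes f :: "'a \<Rightarrow> real"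
  assumes "\<And>x. x \<in> A \<Longrightarrow> \<bar>f x\<bar> \<le> c" "card A \<le> N" "0 \<le> c"
  shows "\<bar>sum f A\<bar> \<le> real N * c"
proof -
  have "\<bar>sum f A\<bar> \<le> (\<Sum>x\<in>A. c)" using assms(1) by (intro order_trans[OF sum_abs] sum_mono)
  also have "\<dots> \<le> real N * c" using assms by (simp add: mult_right_mono)
  finally show ?thesis .
qed

text \<open>In each term the Lipschitz bound on \<open>f\<close> supplies the eigenvalue gaps, and
  the sandwich identities trade these for the perturbations of the matrices. The number of terms is
  bounded by the dimension, so a single constant serves all matrices and all \<open>f\<close>, and
  \<open>f\<close> matters only on the spectra.\<close>

lemma Phi_diff_bounds:
  obtains C where "0 < C"
    "\<And>(\<tau> :: complex^'n::finite^'n) \<tau>' \<sigma> f L. \<tau> \<in> Herm \<Longrightarrow> \<tau>' \<in> Herm \<Longrightarrow> \<sigma> \<in> Herm \<Longrightarrow> 0 \<le> L \<Longrightarrow>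
      (\<And>p p' q. p \<in> eigs \<tau> \<Longrightarrow> p' \<in> eigs \<tau>' \<Longrightarrow> q \<in> eigs \<sigma> \<Longrightarrow> \<bar>f p' q - f p q\<bar> \<le> L * \<bar>p' - p\<bar>) \<Longrightarrow>
      \<bar>Phi f \<tau>' \<sigma> - Phi f \<tau> \<sigma>\<bar> \<le> C * L * norm (\<tau>' - \<tau>)"
    "\<And>(\<tau> :: complex^'n::finite^'n) \<tau>' \<sigma> \<sigma>' f L. \<tau> \<in> Herm \<Longrightarrow> \<tau>' \<in> Herm \<Longrightarrow> \<sigma> \<in> Herm \<Longrightarrow> \<sigma>' \<in> Herm \<Longrightarrow> 0 \<le> L \<Longrightarrow>
      (\<And>p p' q q'. p \<in> eigs \<tau> \<Longrightarrow> p' \<in> eigs \<tau>' \<Longrightarrow> q \<in> eigs \<sigma> \<Longrightarrow> q' \<in> eigs \<sigma>' \<Longrightarrow>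
        \<bar>mixed_diff f p p' q q'\<bar> \<le> L * (\<bar>p' - p\<bar> * \<bar>q' - q\<bar>)) \<Longrightarrow>
      \<bar>Phi f \<tau>' \<sigma>' - Phi f \<tau>' \<sigma> - Phi f \<tau> \<sigma>' + Phi f \<tau> \<sigma>\<bar> \<le> C * L * (norm (\<tau>' - \<tau>) * norm (\<sigma>' - \<sigma>))"
proof -
  obtain S where S: "0 < S" "\<And>\<tau> \<tau>' D p p'. \<tau> \<in> Herm \<Longrightarrow> \<tau>' \<in> Herm \<Longrightarrow>
    norm (eig_proj \<tau> p ** (D ** eig_proj \<tau>' p') :: complex^'n^'n) \<le> S * norm D"
    by (rule sandwich_bound) (rule that; blast)
  obtain K where K: "0 < K" "\<And>(A :: complex^'n^'n) (B :: complex^'n^'n). \<bar>re_trace (A ** B)\<bar> \<le> K * (norm A * norm B)"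
    by (rule re_trace_mult_bound) (rule that; blast)
  define U where "U = norm (mat 1 :: complex^'n^'n)"
  define N where "N = DIM(complex^'n)"
  define C where "C = real N ^ 3 * (K * S * U) + real N ^ 4 * (K * S * S) + 1"
  have U0: "0 \<le> U" by (simp add: U_def)
  have C1: "real N ^ 3 * (K * S * U) \<le> C" and C2: "real N ^ 4 * (K * S * S) \<le> C" and C0: "0 < C"
    using K(1) S(1) U0 by (auto simp: C_def intro!: add_nonneg_pos add_nonneg_nonneg mult_nonneg_nonneg)
  have b1: "\<bar>Phi f \<tau>' \<sigma> - Phi f \<tau> \<sigma>\<bar> \<le> C * L * norm (\<tau>' - \<tau>)"
    if h: "\<tau> \<in> Herm" "\<tau>' \<in> Herm" "\<sigma> \<in> Herm" and L: "0 \<le> L"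
      and f: "\<And>p p' q. p \<in> eigs \<tau> \<Longrightarrow> p' \<in> eigs \<tau>' \<Longrightarrow> q \<in> eigs \<sigma> \<Longrightarrow> \<bar>f p' q - f p q\<bar> \<le> L * \<bar>p' - p\<bar>"
    for \<tau> \<tau>' \<sigma> :: "complex^'n^'n" and f L
  proof -
    let ?B = "L * (K * (S * norm (\<tau>' - \<tau>) * U))"
    have B0: "0 \<le> ?B" using L K S U0 by (intro mult_nonneg_nonneg) auto
    have tm: "\<bar>(f p' q - f p q) * re_trace (eig_proj \<tau> p ** eig_proj \<tau>' p' ** eig_proj \<sigma> q)\<bar> \<le> ?B"
      if "p \<in> eigs \<tau>" "p' \<in> eigs \<tau>'" "q \<in> eigs \<sigma>" for p p' q
    proof -
      let ?w = "re_trace (eig_proj \<tau> p ** eig_proj \<tau>' p' ** eig_proj \<sigma> q)"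
      have "(p' - p) * ?w = re_trace ((p' - p) *\<^sub>R (eig_proj \<tau> p ** eig_proj \<tau>' p') ** eig_proj \<sigma> q)"
        by (simp add: matmul.scaleR_left re_trace_scaleR)
      also have "\<bar>\<dots>\<bar> \<le> K * (norm (eig_proj \<tau> p ** ((\<tau>' - \<tau>) ** eig_proj \<tau>' p')) * norm (eig_proj \<sigma> q))"
        unfolding eig_proj_sandwich_diff(1)[OF h(1,2)] by (rule K)
      also have "\<dots> \<le> K * (S * norm (\<tau>' - \<tau>) * U)"
        using S(2)[OF h(1,2)] norm_eig_proj[OF h(3)] K(1) S(1) by (intro mult_left_mono mult_mono) (auto simp: U_def)
      finally have w: "\<bar>p' - p\<bar> * \<bar>?w\<bar> \<le> K * (S * norm (\<tau>' - \<tau>) * U)" by (simp add: abs_mult)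
      have "\<bar>(f p' q - f p q) * ?w\<bar> \<le> (L * \<bar>p' - p\<bar>) * \<bar>?w\<bar>"
        unfolding abs_mult using f[OF that] by (intro mult_right_mono) auto
      also have "\<dots> \<le> ?B" using mult_left_mono[OF w L] by (simp add: mult.assoc)
      finally show ?thesis .
    qed
    have "\<bar>Phi f \<tau>' \<sigma> - Phi f \<tau> \<sigma>\<bar> \<le> real N * (real N * (real N * ?B))"
      unfolding Phi_diff_left[OF h(1,2)] N_def using h L K(1) S(1) U0
      by (intro sum_abs_bound card_eigs tm mult_nonneg_nonneg) auto
    also have "\<dots> = (real N ^ 3 * (K * S * U)) * (L * norm (\<tau>' - \<tau>))" by (simp add: power3_eq_cube mult_ac)
    also have "\<dots> \<le> C * (L * norm (\<tau>' - \<tau>))" using C1 L by (intro mult_right_mono) auto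
    finally show ?thesis by (simp add: mult.assoc)
  qed
  have b2: "\<bar>Phi f \<tau>' \<sigma>' - Phi f \<tau>' \<sigma> - Phi f \<tau> \<sigma>' + Phi f \<tau> \<sigma>\<bar> \<le> C * L * (norm (\<tau>' - \<tau>) * norm (\<sigma>' - \<sigma>))"
    if h: "\<tau> \<in> Herm" "\<tau>' \<in> Herm" "\<sigma> \<in> Herm" "\<sigma>' \<in> Herm" and L: "0 \<le> L"
      and f: "\<And>p p' q q'. p \<in> eigs \<tau> \<Longrightarrow> p' \<in> eigs \<tau>' \<Longrightarrow> q \<in> eigs \<sigma> \<Longrightarrow> q' \<in> eigs \<sigma>' \<Longrightarrow>
        \<bar>mixed_diff f p p' q q'\<bar> \<le> L * (\<bar>p' - p\<bar> * \<bar>q' - q\<bar>)"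
    for \<tau> \<tau>' \<sigma> \<sigma>' :: "complex^'n^'n" and f L
  proof -
    let ?B = "L * (K * (S * norm (\<tau>' - \<tau>) * (S * norm (\<sigma>' - \<sigma>))))"
    have B0: "0 \<le> ?B" using L K S by (intro mult_nonneg_nonneg) auto
    have tm: "\<bar>mixed_diff f p p' q q' * re_trace (eig_proj \<tau> p ** eig_proj \<tau>' p' **
        (eig_proj \<sigma>' q' ** eig_proj \<sigma> q))\<bar> \<le> ?B"
      if "p \<in> eigs \<tau>" "p' \<in> eigs \<tau>'" "q' \<in> eigs \<sigma>'" "q \<in> eigs \<sigma>" for p p' q q'
    proof -
      let ?w = "re_trace (eig_proj \<tau> p ** eig_proj \<tau>' p' ** (eig_proj \<sigma>' q' ** eig_proj \<sigma> q))"
      have "(p' - p) * (q' - q) * ?w = re_trace ((p' - p) *\<^sub>R (eig_proj \<tau> p ** eig_proj \<tau>' p') **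
          ((q' - q) *\<^sub>R (eig_proj \<sigma>' q' ** eig_proj \<sigma> q)))"
        by (simp add: matmul.scaleR_left matmul.scaleR_right re_trace_scaleR)
      also have "\<bar>\<dots>\<bar> \<le> K * (norm (eig_proj \<tau> p ** ((\<tau>' - \<tau>) ** eig_proj \<tau>' p')) *
          norm (eig_proj \<sigma>' q' ** ((\<sigma>' - \<sigma>) ** eig_proj \<sigma> q)))"
        unfolding eig_proj_sandwich_diff(1)[OF h(1,2)] eig_proj_sandwich_diff(2)[OF h(3,4)] by (rule K)
      also have "\<dots> \<le> K * (S * norm (\<tau>' - \<tau>) * (S * norm (\<sigma>' - \<sigma>)))"
        using S(2)[OF h(1,2)] S(2)[OF h(4,3)] K(1) S(1) by (intro mult_left_mono mult_mono) auto
      finally have w: "\<bar>p' - p\<bar> * \<bar>q' - q\<bar> * \<bar>?w\<bar> \<le> K * (S * norm (\<tau>' - \<tau>) * (S * norm (\<sigma>' - \<sigma>)))"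
        by (simp add: abs_mult)
      have "\<bar>mixed_diff f p p' q q' * ?w\<bar> \<le> (L * (\<bar>p' - p\<bar> * \<bar>q' - q\<bar>)) * \<bar>?w\<bar>"
        unfolding abs_mult using f[OF that(1,2,4,3)] by (intro mult_right_mono) auto
      also have "\<dots> \<le> ?B" using mult_left_mono[OF w L] by (simp add: mult.assoc)
      finally show ?thesis .
    qed
    have "\<bar>Phi f \<tau>' \<sigma>' - Phi f \<tau>' \<sigma> - Phi f \<tau> \<sigma>' + Phi f \<tau> \<sigma>\<bar> \<le> real N * (real N * (real N * (real N * ?B)))"
      unfolding Phi_mixed_diff[OF h] N_def using h L K(1) S(1) U0
      by (intro sum_abs_bound card_eigs tm mult_nonneg_nonneg) auto
    also have "\<dots> = (real N ^ 4 * (K * S * S)) * (L * (norm (\<tau>' - \<tau>) * norm (\<sigma>' - \<sigma>)))"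
      by (simp add: eval_nat_numeral mult_ac)
    also have "\<dots> \<le> C * (L * (norm (\<tau>' - \<tau>) * norm (\<sigma>' - \<sigma>)))" using C2 L by (intro mult_right_mono) auto
    finally show ?thesis by (simp add: mult.assoc)
  qed
  show ?thesis
  proof (rule that[OF C0], goal_cases)
    case (1 \<tau> \<tau>' \<sigma> f L)
    then show ?case by (rule b1)
  next
    case (2 \<tau> \<tau>' \<sigma> \<sigma>' f L)
    then show ?case by (rule b2)
  qed
qed

text \<open>If c' were far from the whole spectrum of \<tau>, its projection P' would have small
  overlap with every projection of \<tau> and, being the sum of these overlaps, would be small. But
  P' is a nonzero idempotent, which bounds its norm from below.\<close>

lemma eigs_near:
  obtains C where "0 < C" "\<And>(\<tau> :: complex^'n::finite^'n) \<tau>' c'. \<tau> \<in> Herm \<Longrightarrow> \<tau>' \<in> Herm \<Longrightarrow> c' \<in> eigs \<tau>' \<Longrightarrow>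
     \<exists>c\<in>eigs \<tau>. \<bar>c' - c\<bar> \<le> C * norm (\<tau>' - \<tau>)"
proof -
  obtain M where M: "0 < M" "\<And>(A :: complex^'n^'n) (B :: complex^'n^'n). norm (A ** B) \<le> norm A * norm B * M"
    by (rule matrix_mult_bound) (rule that; blast)
  obtain S where S: "0 < S" "\<And>\<tau> \<tau>' D p p'. \<tau> \<in> Herm \<Longrightarrow> \<tau>' \<in> Herm \<Longrightarrow>
    norm (eig_proj \<tau> p ** (D ** eig_proj \<tau>' p') :: complex^'n^'n) \<le> S * norm D"
    by (rule sandwich_bound) (rule that; blast)
  define N where "N = DIM(complex^'n)"
  \<comment> \<open>Chosen so that at most N overlaps of size S/C add up to 1/(2M), half of the
    lower bound 1/M for a nonzero idempotent.\<close>
  define C where "C = 2 * real N * S * M"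
  have N: "0 < N" by (simp add: N_def)
  then have C0: "0 < C" using S M by (simp add: C_def)
  have "\<exists>c\<in>eigs \<tau>. \<bar>c' - c\<bar> \<le> C * norm (\<tau>' - \<tau>)"
    if h: "\<tau> \<in> Herm" "\<tau>' \<in> Herm" and c': "c' \<in> eigs \<tau>'" for \<tau> \<tau>' :: "complex^'n^'n" and c'
  proof (rule ccontr)
    assume "\<not> ?thesis"
    then have far: "C * norm (\<tau>' - \<tau>) < \<bar>c' - c\<bar>" if "c \<in> eigs \<tau>" for c using that by force
    let ?P = "eig_proj \<tau>' c'"
    have P0: "?P \<noteq> 0" by (rule eig_proj_nonzero[OF h(2) c'])
    have "norm ?P \<le> norm ?P * norm ?P * M" using M(2)[of ?P ?P] by (simp add: eig_proj_mult[OF h(2)])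
    then have P1: "1 \<le> norm ?P * M" using P0 by simp
    have part: "norm (eig_proj \<tau> c ** ?P) \<le> S / C" if c: "c \<in> eigs \<tau>" for c
    proof -
      have "\<bar>c' - c\<bar> * norm (eig_proj \<tau> c ** ?P) = norm ((c' - c) *\<^sub>R (eig_proj \<tau> c ** ?P))" by simp
      also have "\<dots> \<le> S * norm (\<tau>' - \<tau>)"
        unfolding eig_proj_sandwich_diff(1)[OF h] by (rule S(2)[OF h])
      finally have le: "\<bar>c' - c\<bar> * norm (eig_proj \<tau> c ** ?P) \<le> S * norm (\<tau>' - \<tau>)" .
      show ?thesis
      proof (cases "norm (\<tau>' - \<tau>) = 0")
        case True
        then have "norm (eig_proj \<tau> c ** ?P) \<le> 0"
          using le far[OF c] by (simp add: mult_le_0_iff)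
        then show ?thesis using S C0 by (meson divide_nonneg_pos less_imp_le order_trans)
      next
        case False
        then have d: "0 < norm (\<tau>' - \<tau>)" by simp
        have "(C * norm (\<tau>' - \<tau>)) * norm (eig_proj \<tau> c ** ?P) \<le> \<bar>c' - c\<bar> * norm (eig_proj \<tau> c ** ?P)"
          using far[OF c] by (intro mult_right_mono) auto
        also have "\<dots> \<le> S * norm (\<tau>' - \<tau>)" by (rule le)
        finally have "(C * norm (eig_proj \<tau> c ** ?P)) * norm (\<tau>' - \<tau>) \<le> S * norm (\<tau>' - \<tau>)" by (simp add: mult_ac)
        then have "C * norm (eig_proj \<tau> c ** ?P) \<le> S" using d by (rule mult_right_le_imp_le)
        then show ?thesis using C0 by (simp add: pos_le_divide_eq mult.commute)
      qed
    qed
    have "?P = (\<Sum>c\<in>eigs \<tau>. eig_proj \<tau> c ** ?P)"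
      by (simp add: matmul.sum_left[symmetric] sum_eig_proj[OF h(1)])
    then have "norm ?P \<le> (\<Sum>c\<in>eigs \<tau>. norm (eig_proj \<tau> c ** ?P))" by (metis norm_sum)
    also have "\<dots> \<le> (\<Sum>c\<in>eigs \<tau>. S / C)" by (intro sum_mono part)
    also have "\<dots> \<le> real N * (S / C)"
      using card_eigs[OF h(1)] S C0 by (simp add: N_def divide_right_mono mult_right_mono)
    also have "\<dots> = 1 / (2 * M)" using N S by (simp add: C_def)
    finally have "norm ?P * M \<le> 1 / 2" using M by (simp add: pos_le_divide_eq)
    then show False using P1 by simp
  qed
  with C0 show ?thesis by (rule that)
qed

text \<open>By \<open>eigs_near\<close> the eigenvalues move by less than the smallest eigenvalue of
  \<rho>, so they remain positive.\<close>

lemma PD_nhd: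
  fixes \<rho> :: "complex^'n::finite^'n"
  assumes "\<rho> \<in> PD"
  obtains d where "0 < d" "\<And>\<tau>. \<tau> \<in> Herm \<Longrightarrow> norm (\<tau> - \<rho>) < d \<Longrightarrow> \<tau> \<in> PD"
proof -
  obtain C where C: "0 < C" "\<And>(\<tau> :: complex^'n^'n) \<tau>' c'. \<tau> \<in> Herm \<Longrightarrow> \<tau>' \<in> Herm \<Longrightarrow> c' \<in> eigs \<tau>' \<Longrightarrow>
     \<exists>c\<in>eigs \<tau>. \<bar>c' - c\<bar> \<le> C * norm (\<tau>' - \<tau>)" by (rule eigs_near) (rule that; blast)
  have h: "\<rho> \<in> Herm" using assms by (rule PD_Herm)
  have "\<exists>m>0. \<forall>c\<in>eigs \<rho>. m \<le> c"
  proof (cases "eigs \<rho> = {}")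
    case False
    then show ?thesis using finite_eigs[OF h] PD_eigs_pos[OF assms] by (intro exI[of _ "Min (eigs \<rho>)"]) auto
  next
    case True
    then show ?thesis by (intro exI[of _ 1]) simp
  qed
  then obtain m where m: "m > 0" "\<And>c. c \<in> eigs \<rho> \<Longrightarrow> m \<le> c" by metis
  have "\<tau> \<in> PD" if t: "\<tau> \<in> Herm" "norm (\<tau> - \<rho>) < m / C" for \<tau>
  proof (rule Herm_eigs_pos_PD[OF t(1)])
    fix c' assume "c' \<in> eigs \<tau>"
    then obtain c where c: "c \<in> eigs \<rho>" "\<bar>c' - c\<bar> \<le> C * norm (\<tau> - \<rho>)" using C(2)[OF h t(1)] by blast
    have "C * norm (\<tau> - \<rho>) < m" using t(2) C(1) by (simp add: pos_less_divide_eq mult.commute)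
    then show "0 < c'" using c m(2)[OF c(1)] by linarith
  qed
  moreover have "0 < m / C" using m C by simp
  ultimately show ?thesis by (rule that[rotated])
qed

section \<open>Osculating tensor polynomials\<close>

definition thicken :: "real set \<Rightarrow> real \<Rightarrow> real set" where
  "thicken R \<delta> = {x. \<exists>r\<in>R. \<bar>x - r\<bar> \<le> \<delta>}"

text \<open>The additional factor \<delta> expresses the order of contact. Later \<delta> is
  proportional to the parameter s of a line through \<rho>, and the factor turns smallness of the
  error into o(s), as the third derivative demands.\<close>

definition small_near :: "(real \<Rightarrow> real \<Rightarrow> real) \<Rightarrow> real set \<Rightarrow> real set \<Rightarrow> bool" where
  "small_near f R S \<longleftrightarrow> (\<forall>\<epsilon>>0. \<forall>\<^sub>F \<delta> in at_right 0.
     \<forall>p\<in>thicken R \<delta>. \<forall>p'\<in>thicken R \<delta>. \<forall>q\<in>thicken S \<delta>. \<forall>q'\<in>thicken S \<delta>.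
       \<bar>mixed_diff f p p' q q'\<bar> \<le> \<epsilon> * \<delta> * (\<bar>p' - p\<bar> * \<bar>q' - q\<bar>) \<and>
       \<bar>f p' q - f p q\<bar> \<le> \<epsilon> * \<delta> * \<bar>p' - p\<bar> \<and> \<bar>f p q' - f p q\<bar> \<le> \<epsilon> * \<delta> * \<bar>q' - q\<bar>)"

lemma small_near_add:
  assumes "small_near f R S" "small_near g R S"
  shows "small_near (\<lambda>p q. f p q + g p q) R S"
  unfolding small_near_def
proof (intro allI impI)
  fix \<epsilon> :: real assume "0 < \<epsilon>"
  then have e: "0 < \<epsilon> / 2" by simp
  have le: "\<bar>a + b\<bar> \<le> \<epsilon> * \<delta> * x" if "\<bar>a\<bar> \<le> \<epsilon> / 2 * \<delta> * x" "\<bar>b\<bar> \<le> \<epsilon> / 2 * \<delta> * x" for a b \<delta> x :: real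
    using that by linarith
  show "\<forall>\<^sub>F \<delta> in at_right 0.
     \<forall>p\<in>thicken R \<delta>. \<forall>p'\<in>thicken R \<delta>. \<forall>q\<in>thicken S \<delta>. \<forall>q'\<in>thicken S \<delta>.
       \<bar>mixed_diff (\<lambda>p q. f p q + g p q) p p' q q'\<bar> \<le> \<epsilon> * \<delta> * (\<bar>p' - p\<bar> * \<bar>q' - q\<bar>) \<and>
       \<bar>f p' q + g p' q - (f p q + g p q)\<bar> \<le> \<epsilon> * \<delta> * \<bar>p' - p\<bar> \<and>
       \<bar>f p q' + g p q' - (f p q + g p q)\<bar> \<le> \<epsilon> * \<delta> * \<bar>q' - q\<bar>"
    using assms(1)[unfolded small_near_def, rule_format, OF e] assms(2)[unfolded small_near_def, rule_format, OF e]
  proof eventually_elim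
    case (elim \<delta>)
    show ?case
    proof (intro ballI conjI)
      fix p p' q q' assume pq: "p \<in> thicken R \<delta>" "p' \<in> thicken R \<delta>" "q \<in> thicken S \<delta>" "q' \<in> thicken S \<delta>"
      note F = elim(1)[rule_format, OF pq] and G = elim(2)[rule_format, OF pq]
      have "mixed_diff (\<lambda>p q. f p q + g p q) p p' q q' = mixed_diff f p p' q q' + mixed_diff g p p' q q'"
        by (simp add: mixed_diff_def)
      then show "\<bar>mixed_diff (\<lambda>p q. f p q + g p q) p p' q q'\<bar> \<le> \<epsilon> * \<delta> * (\<bar>p' - p\<bar> * \<bar>q' - q\<bar>)"
        using le F G by metis
      have "f p' q + g p' q - (f p q + g p q) = (f p' q - f p q) + (g p' q - g p q)" by simp
      then show "\<bar>f p' q + g p' q - (f p q + g p q)\<bar> \<le> \<epsilon> * \<delta> * \<bar>p' - p\<bar>" using le F G by metis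
      have "f p q' + g p q' - (f p q + g p q) = (f p q' - f p q) + (g p q' - g p q)" by simp
      then show "\<bar>f p q' + g p q' - (f p q + g p q)\<bar> \<le> \<epsilon> * \<delta> * \<bar>q' - q\<bar>" using le F G by metis
    qed
  qed
qed

lemma small_near_zero: "small_near (\<lambda>p q. 0) R S"
  unfolding small_near_def
proof (intro allI impI)
  fix \<epsilon> :: real assume e: "0 < \<epsilon>"
  have "\<forall>\<^sub>F \<delta> in at_right (0::real). 0 < \<delta>" by (simp add: eventually_at_right_less)
  then show "\<forall>\<^sub>F \<delta> in at_right 0.
     \<forall>p\<in>thicken R \<delta>. \<forall>p'\<in>thicken R \<delta>. \<forall>q\<in>thicken S \<delta>. \<forall>q'\<in>thicken S \<delta>.
       \<bar>mixed_diff (\<lambda>p q. 0) p p' q q'\<bar> \<le> \<epsilon> * \<delta> * (\<bar>p' - p\<bar> * \<bar>q' - q\<bar>) \<and>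
       \<bar>0 - 0 :: real\<bar> \<le> \<epsilon> * \<delta> * \<bar>p' - p\<bar> \<and> \<bar>0 - 0 :: real\<bar> \<le> \<epsilon> * \<delta> * \<bar>q' - q\<bar>"
    by eventually_elim (use e in \<open>simp add: mixed_diff_def\<close>)
qed

lemma small_near_sum:
  assumes "\<And>k. k \<in> K \<Longrightarrow> small_near (f k) R S" "finite K"
  shows "small_near (\<lambda>p q. \<Sum>k\<in>K. f k p q) R S"
  using assms(2,1) by (induction K rule: finite_induct) (simp_all add: small_near_zero small_near_add)

definition flat_at :: "(real \<Rightarrow> real \<Rightarrow> real) \<Rightarrow> real \<Rightarrow> real \<Rightarrow> bool" where
  "flat_at f r s \<longleftrightarrow> f r s = 0 \<and> ((\<lambda>z. f (fst z) (snd z)) has_derivative (\<lambda>_. 0)) (at (r, s))"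

lemma flat_at_bound:
  assumes "flat_at f r s" "0 < \<epsilon>"
  shows "\<forall>\<^sub>F \<delta> in at_right 0. \<forall>p q. \<bar>p - r\<bar> \<le> \<delta> \<longrightarrow> \<bar>q - s\<bar> \<le> \<delta> \<longrightarrow> \<bar>f p q\<bar> \<le> \<epsilon> * \<delta>"
proof -
  have e: "0 < \<epsilon> / 2" using assms by simp
  have d: "((\<lambda>z. f (fst z) (snd z)) has_derivative (\<lambda>_. 0)) (at (r, s))" and z: "f r s = 0"
    using assms(1) by (auto simp: flat_at_def)
  obtain d where d: "d > 0" "\<And>z. norm (z - (r, s)) < d \<Longrightarrow>
      norm (f (fst z) (snd z) - f (fst (r, s)) (snd (r, s)) - 0) \<le> \<epsilon> / 2 * norm (z - (r, s))"
    using d[unfolded has_derivative_at_alt] e by blast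
  have "\<forall>\<^sub>F \<delta> in at_right (0::real). \<delta> \<in> {0<..<d/3}" using d(1) by (intro eventually_at_right_real) simp
  then show ?thesis
  proof eventually_elim
    case (elim \<delta>)
    show ?case
    proof (intro allI impI)
      fix p q assume pq: "\<bar>p - r\<bar> \<le> \<delta>" "\<bar>q - s\<bar> \<le> \<delta>"
      have n: "norm ((p, q) - (r, s)) \<le> 2 * \<delta>"
        using norm_Pair_le[of "p - r" "q - s"] pq by simp
      then have "\<bar>f p q\<bar> \<le> \<epsilon> / 2 * norm ((p, q) - (r, s))"
        using d(2)[of "(p, q)"] elim z by simp
      also have "\<dots> \<le> \<epsilon> / 2 * (2 * \<delta>)" using n e by (intro mult_left_mono) auto
      finally show "\<bar>f p q\<bar> \<le> \<epsilon> * \<delta>" by simp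
    qed
  qed
qed

lemma flat_at_bound_sets:
  assumes "\<And>r s. r \<in> R \<Longrightarrow> s \<in> S \<Longrightarrow> flat_at f r s" "0 < \<epsilon>" "finite R" "finite S"
  shows "\<forall>\<^sub>F \<delta> in at_right 0. \<forall>p\<in>thicken R \<delta>. \<forall>q\<in>thicken S \<delta>. \<bar>f p q\<bar> \<le> \<epsilon> * \<delta>"
proof -
  have "\<forall>\<^sub>F \<delta> in at_right 0. \<forall>r\<in>R. \<forall>s\<in>S. \<forall>p q. \<bar>p - r\<bar> \<le> \<delta> \<longrightarrow> \<bar>q - s\<bar> \<le> \<delta> \<longrightarrow> \<bar>f p q\<bar> \<le> \<epsilon> * \<delta>"
    using assms by (intro eventually_ball_finite ballI flat_at_bound) auto
  then show ?thesis by eventually_elim (auto simp: thicken_def)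
qed

lemma finite_set_gap:
  assumes "finite (R :: real set)"
  obtains \<gamma> where "0 < \<gamma>" "\<And>r r'. r \<in> R \<Longrightarrow> r' \<in> R \<Longrightarrow> r \<noteq> r' \<Longrightarrow> 4 * \<gamma> \<le> \<bar>r - r'\<bar>"
proof -
  define D where "D = insert 1 ((\<lambda>(r, r'). \<bar>r - r'\<bar>) ` {(r, r') \<in> R \<times> R. r \<noteq> r'})"
  have fin: "finite D" unfolding D_def using assms
    by (intro finite.insertI finite_imageI finite_subset[OF _ finite_cartesian_product[OF assms assms]]) auto
  have pos: "0 < Min D" using fin by (subst Min_gr_iff) (auto simp: D_def)
  show ?thesis
  proof (rule that[of "Min D / 4"])
    fix r r' assume "r \<in> R" "r' \<in> R" "r \<noteq> r'"
    then have "\<bar>r - r'\<bar> \<in> D" by (auto simp: D_def image_iff)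
    then show "4 * (Min D / 4) \<le> \<bar>r - r'\<bar>" using fin by simp
  qed (use pos in simp)
qed

text \<open>The thickened set consists of short intervals. Within one of them the mean value theorem
  applies; points of different intervals are at least \<open>2 * \<gamma>\<close> apart, so there
  the bound on \<open>f\<close> itself suffices, at the price of the term
  \<open>1 / \<gamma>\<close>.\<close>

lemma thicken_lipschitz:
  assumes gap: "\<And>r r'. r \<in> R \<Longrightarrow> r' \<in> R \<Longrightarrow> r \<noteq> r' \<Longrightarrow> 4 * \<gamma> \<le> \<bar>r - r'\<bar>" and \<delta>: "\<delta> \<le> \<gamma>" "0 < \<gamma>"
    and d: "\<And>x. x \<in> thicken R \<delta> \<Longrightarrow> (f has_real_derivative f' x) (at x)"
    and b: "\<And>x. x \<in> thicken R \<delta> \<Longrightarrow> \<bar>f' x\<bar> \<le> A" "\<And>x. x \<in> thicken R \<delta> \<Longrightarrow> \<bar>f x\<bar> \<le> A"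
    and p: "p \<in> thicken R \<delta>" "p' \<in> thicken R \<delta>"
  shows "\<bar>f p' - f p\<bar> \<le> A * (1 + 1 / \<gamma>) * \<bar>p' - p\<bar>"
proof -
  have A: "0 \<le> A" using b(2)[OF p(1)] by simp
  obtain r r' where r: "r \<in> R" "\<bar>p - r\<bar> \<le> \<delta>" "r' \<in> R" "\<bar>p' - r'\<bar> \<le> \<delta>" using p by (auto simp: thicken_def)
  show ?thesis
  proof (cases "r = r'")
    case True
    have sub: "{r-\<delta>..r+\<delta>} \<subseteq> thicken R \<delta>"
    proof
      fix x assume "x \<in> {r-\<delta>..r+\<delta>}"
      then have "\<bar>x - r\<bar> \<le> \<delta>" by (simp add: abs_le_iff)
      then show "x \<in> thicken R \<delta>" using r(1) by (auto simp: thicken_def)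
    qed
    have "norm (f p' - f p) \<le> A * norm (p' - p)"
    proof (rule field_differentiable_bound[of "{r-\<delta>..r+\<delta>}" f f'])
      show "(f has_field_derivative f' z) (at z within {r-\<delta>..r+\<delta>})" if "z \<in> {r-\<delta>..r+\<delta>}" for z
        using d that sub by (blast intro: has_field_derivative_at_within)
      show "norm (f' z) \<le> A" if "z \<in> {r-\<delta>..r+\<delta>}" for z using b(1) that sub by auto
      show "p' \<in> {r-\<delta>..r+\<delta>}" "p \<in> {r-\<delta>..r+\<delta>}" using r True by (auto simp: abs_le_iff)
    qed simp
    also have "\<dots> \<le> A * (1 + 1 / \<gamma>) * norm (p' - p)"
      using A \<delta>(2) by (intro mult_right_mono) (simp_all add: distrib_left)
    finally show ?thesis by simp
  next
    case False
    then have "2 * \<gamma> \<le> \<bar>p' - p\<bar>" using gap[OF r(1,3)] r \<delta> by linarith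
    have "\<bar>f p' - f p\<bar> \<le> 2 * A" using b(2)[OF p(1)] b(2)[OF p(2)] by linarith
    also have "\<dots> = A / \<gamma> * (2 * \<gamma>)" using \<delta>(2) by simp
    also have "\<dots> \<le> A / \<gamma> * \<bar>p' - p\<bar>" using A \<delta>(2) \<open>2 * \<gamma> \<le> \<bar>p' - p\<bar>\<close> by (intro mult_left_mono) auto
    also have "\<dots> \<le> A * (1 + 1 / \<gamma>) * \<bar>p' - p\<bar>" using A \<delta>(2) by (intro mult_right_mono) (simp_all add: distrib_left)
    finally show ?thesis .
  qed
qed

lemma eventually_thicken_pos:
  assumes "finite R" "R \<subseteq> {0<..}"
  shows "\<forall>\<^sub>F \<delta> in at_right 0. \<forall>p\<in>thicken R \<delta>. 0 < p"
proof -
  have "\<forall>\<^sub>F \<delta> in at_right 0. \<forall>r\<in>R. \<delta> \<in> {0<..<r}"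
    using assms by (intro eventually_ball_finite ballI eventually_at_right_real) auto
  then show ?thesis by eventually_elim (force simp: thicken_def)
qed

text \<open>Two applications of \<open>thicken_lipschitz\<close>: in q, to \<open>f\<close> and to
  \<open>fp\<close>, and then in p, to the increment in q. Since points near different eigenvalues
  are compared as well, all of \<open>f\<close>, \<open>fp\<close>, \<open>fq\<close> and
  \<open>fpq\<close> have to be small, not the mixed derivative alone.\<close>

lemma small_near_of_flat:
  assumes fin: "finite R" "finite S" and pos: "R \<subseteq> {0<..}" "S \<subseteq> {0<..}"
    and dp: "\<And>p q. 0 < p \<Longrightarrow> 0 < q \<Longrightarrow> ((\<lambda>p. f p q) has_real_derivative fp p q) (at p)"
    and dq: "\<And>p q. 0 < p \<Longrightarrow> 0 < q \<Longrightarrow> (f p has_real_derivative fq p q) (at q)"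
    and dpq: "\<And>p q. 0 < p \<Longrightarrow> 0 < q \<Longrightarrow> (fp p has_real_derivative fpq p q) (at q)"
    and flat: "\<And>r s. r \<in> R \<Longrightarrow> s \<in> S \<Longrightarrow> flat_at f r s \<and> flat_at fp r s \<and> flat_at fq r s \<and> flat_at fpq r s"
  shows "small_near f R S"
  unfolding small_near_def
proof (intro allI impI)
  fix \<epsilon> :: real assume \<epsilon>: "0 < \<epsilon>"
  obtain \<gamma>1 where g1: "0 < \<gamma>1" "\<And>r r'. r \<in> R \<Longrightarrow> r' \<in> R \<Longrightarrow> r \<noteq> r' \<Longrightarrow> 4 * \<gamma>1 \<le> \<bar>r - r'\<bar>"
    using finite_set_gap[OF fin(1)] by metis
  obtain \<gamma>2 where g2: "0 < \<gamma>2" "\<And>r r'. r \<in> S \<Longrightarrow> r' \<in> S \<Longrightarrow> r \<noteq> r' \<Longrightarrow> 4 * \<gamma>2 \<le> \<bar>r - r'\<bar>"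
    using finite_set_gap[OF fin(2)] by metis
  define \<gamma> where "\<gamma> = min \<gamma>1 \<gamma>2"
  have g: "0 < \<gamma>" and gR: "\<And>r r'. r \<in> R \<Longrightarrow> r' \<in> R \<Longrightarrow> r \<noteq> r' \<Longrightarrow> 4 * \<gamma> \<le> \<bar>r - r'\<bar>"
    and gS: "\<And>r r'. r \<in> S \<Longrightarrow> r' \<in> S \<Longrightarrow> r \<noteq> r' \<Longrightarrow> 4 * \<gamma> \<le> \<bar>r - r'\<bar>"
    using g1 g2 by (auto simp: \<gamma>_def) force+
  define c where "c = 1 + 1 / \<gamma>"
  have c1: "1 \<le> c" using g by (simp add: c_def)
  \<comment> \<open>Each application of \<open>thicken_lipschitz\<close> costs a factor
    \<open>c\<close>, and the mixed difference takes two of them.\<close>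
  define e where "e = \<epsilon> / (c * c)"
  have e: "0 < e" using \<epsilon> c1 by (simp add: e_def)
  have ec: "e * c * c = \<epsilon>" using c1 by (simp add: e_def)
  have ec1: "e * c \<le> \<epsilon>"
  proof -
    have "e * c * 1 \<le> e * c * c" using e c1 by (intro mult_left_mono) auto
    then show ?thesis using ec by simp
  qed
  note fl = flat_at_bound_sets[OF _ e fin]
  have ev: "\<forall>\<^sub>F \<delta> in at_right 0. \<forall>p\<in>thicken R \<delta>. \<forall>q\<in>thicken S \<delta>. \<bar>f p q\<bar> \<le> e * \<delta>"
    "\<forall>\<^sub>F \<delta> in at_right 0. \<forall>p\<in>thicken R \<delta>. \<forall>q\<in>thicken S \<delta>. \<bar>fp p q\<bar> \<le> e * \<delta>"
    "\<forall>\<^sub>F \<delta> in at_right 0. \<forall>p\<in>thicken R \<delta>. \<forall>q\<in>thicken S \<delta>. \<bar>fq p q\<bar> \<le> e * \<delta>"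
    "\<forall>\<^sub>F \<delta> in at_right 0. \<forall>p\<in>thicken R \<delta>. \<forall>q\<in>thicken S \<delta>. \<bar>fpq p q\<bar> \<le> e * \<delta>"
    by (intro fl; use flat in blast)+
  have small: "\<forall>\<^sub>F \<delta> in at_right 0. \<delta> \<in> {0<..<\<gamma>}" using g by (rule eventually_at_right_real)
  show "\<forall>\<^sub>F \<delta> in at_right 0.
     \<forall>p\<in>thicken R \<delta>. \<forall>p'\<in>thicken R \<delta>. \<forall>q\<in>thicken S \<delta>. \<forall>q'\<in>thicken S \<delta>.
       \<bar>mixed_diff f p p' q q'\<bar> \<le> \<epsilon> * \<delta> * (\<bar>p' - p\<bar> * \<bar>q' - q\<bar>) \<and>
       \<bar>f p' q - f p q\<bar> \<le> \<epsilon> * \<delta> * \<bar>p' - p\<bar> \<and> \<bar>f p q' - f p q\<bar> \<le> \<epsilon> * \<delta> * \<bar>q' - q\<bar>"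
    using ev small eventually_thicken_pos[OF fin(1) pos(1)] eventually_thicken_pos[OF fin(2) pos(2)]
  proof eventually_elim
    case (elim \<delta>)
    have \<delta>: "\<delta> \<le> \<gamma>" "0 < \<delta>" using elim(5) by auto
    have lipq: "\<bar>h q' - h q\<bar> \<le> e * \<delta> * c * \<bar>q' - q\<bar>"
      if "\<And>q. q \<in> thicken S \<delta> \<Longrightarrow> (h has_real_derivative h' q) (at q)" "\<And>q. q \<in> thicken S \<delta> \<Longrightarrow> \<bar>h' q\<bar> \<le> e * \<delta>"
        "\<And>q. q \<in> thicken S \<delta> \<Longrightarrow> \<bar>h q\<bar> \<le> e * \<delta>" "q \<in> thicken S \<delta>" "q' \<in> thicken S \<delta>" for h h' q q'
      unfolding c_def by (rule thicken_lipschitz[OF gS \<delta>(1) g that])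
    show ?case
    proof (intro ballI conjI)
      fix p p' q q' assume p: "p \<in> thicken R \<delta>" "p' \<in> thicken R \<delta>" and q: "q \<in> thicken S \<delta>" "q' \<in> thicken S \<delta>"
      have A: "\<bar>f x q' - f x q\<bar> \<le> e * \<delta> * c * \<bar>q' - q\<bar>" if "x \<in> thicken R \<delta>" for x
        by (rule lipq[of "f x" "fq x"]) (use that q elim in \<open>auto intro!: dq\<close>)
      have B: "\<bar>fp x q' - fp x q\<bar> \<le> e * \<delta> * c * \<bar>q' - q\<bar>" if "x \<in> thicken R \<delta>" for x
        by (rule lipq[of "fp x" "fpq x"]) (use that q elim in \<open>auto intro!: dpq\<close>)
      have "\<bar>(f p' q' - f p' q) - (f p q' - f p q)\<bar> \<le> (e * \<delta> * c * \<bar>q' - q\<bar>) * (1 + 1 / \<gamma>) * \<bar>p' - p\<bar>"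
        by (rule thicken_lipschitz[OF gR \<delta>(1) g, where f = "\<lambda>x. f x q' - f x q" and f' = "\<lambda>x. fp x q' - fp x q"])
          (use p q elim A B in \<open>auto intro!: DERIV_diff dp\<close>)
      also have "\<dots> = \<epsilon> * \<delta> * (\<bar>p' - p\<bar> * \<bar>q' - q\<bar>)" unfolding ec[symmetric] by (simp add: c_def mult_ac)
      finally show "\<bar>mixed_diff f p p' q q'\<bar> \<le> \<epsilon> * \<delta> * (\<bar>p' - p\<bar> * \<bar>q' - q\<bar>)"
        by (simp add: mixed_diff_def algebra_simps)
      have up: "e * \<delta> * c * x \<le> \<epsilon> * \<delta> * x" if "0 \<le> x" for x
      proof -
        have "(e * c) * (\<delta> * x) \<le> \<epsilon> * (\<delta> * x)" using ec1 \<delta>(2) that by (intro mult_right_mono) auto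
        then show ?thesis by (simp add: mult_ac)
      qed
      have "\<bar>f p' q - f p q\<bar> \<le> e * \<delta> * (1 + 1 / \<gamma>) * \<bar>p' - p\<bar>"
        by (rule thicken_lipschitz[OF gR \<delta>(1) g, where f = "\<lambda>x. f x q" and f' = "\<lambda>x. fp x q"])
          (use p q elim in \<open>auto intro!: dp\<close>)
      then show "\<bar>f p' q - f p q\<bar> \<le> \<epsilon> * \<delta> * \<bar>p' - p\<bar>" using up[of "\<bar>p' - p\<bar>"] by (simp add: c_def)
      show "\<bar>f p q' - f p q\<bar> \<le> \<epsilon> * \<delta> * \<bar>q' - q\<bar>" using A[OF p(1)] up[of "\<bar>q' - q\<bar>"] by simp
    qed
  qed
qed

section \<open>Hermite interpolation to third order\<close>

lemma pderiv_dvd_power: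
  fixes p :: "real poly"
  assumes "[:-r, 1:] ^ Suc n dvd p"
  shows "[:-r, 1:] ^ n dvd pderiv p"
proof -
  obtain c where c: "p = [:-r, 1:] ^ Suc n * c" using assms by (rule dvdE)
  have "[:-r, 1:] ^ n dvd [:-r, 1:] ^ Suc n" by (rule le_imp_power_dvd) simp
  then show ?thesis unfolding c pderiv_mult pderiv_power_Suc
    by (intro dvd_add dvd_mult2 dvd_mult dvd_smult dvd_refl)
qed

lemma poly_zero_of_dvd_power: "[:-r, 1:] ^ Suc n dvd p \<Longrightarrow> poly p r = (0 :: real)"
  unfolding poly_eq_0_iff_dvd by (metis dvd_mult_left power_Suc)

definition jet3 :: "real poly \<Rightarrow> real \<Rightarrow> real \<times> real \<times> real \<times> real" where
  "jet3 p r = (poly p r, poly (pderiv p) r, poly (pderiv (pderiv p)) r, poly (pderiv (pderiv (pderiv p))) r)"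

lemma jet3_eq_of_dvd:
  assumes "[:-r, 1:] ^ 4 dvd p - q"
  shows "jet3 p r = jet3 q r"
proof -
  have n: "(4::nat) = Suc 3" "(3::nat) = Suc 2" "(2::nat) = Suc 1" "(1::nat) = Suc 0" by simp_all
  note 4 = assms[unfolded n(1)]
  note 3 = pderiv_dvd_power[OF 4]
  note 2 = pderiv_dvd_power[OF 3[unfolded n(2)]]
  note 1 = pderiv_dvd_power[OF 2[unfolded n(3)]]
  note poly_zero_of_dvd_power[OF 4] poly_zero_of_dvd_power[OF 3[unfolded n(2)]]
    poly_zero_of_dvd_power[OF 2[unfolded n(3)]] poly_zero_of_dvd_power[OF 1[unfolded n(4)]]
  then show ?thesis by (simp add: jet3_def pderiv_diff)
qed

text \<open>The polynomial \<open>1 - (1 - w\<^sup>4)\<^sup>4\<close> agrees to third order with \<open>1\<close> at zeros of \<open>w - 1\<close>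
  and with \<open>0\<close> at zeros of \<open>w\<close>.\<close>

lemma hermite_interpolation:
  fixes a :: "real \<Rightarrow> real \<times> real \<times> real \<times> real"
  assumes R: "finite R"
  obtains m where "\<And>r. r \<in> R \<Longrightarrow> jet3 m r = a r"
proof -
  \<comment> \<open>The Lagrange basis polynomial of the node: 1 at \<open>r\<close> and 0 at the
    other nodes.\<close>
  define w where "w = (\<lambda>r. \<Prod>t\<in>R - {r}. Polynomial.smult (inverse (r - t)) [:-t, 1:])"
  define chi where "chi = (\<lambda>r. 1 - (1 - w r ^ 4) ^ 4)"
  have w1: "poly (w r) r = 1" if "r \<in> R" for r
  proof -
    have "poly (w r) r = (\<Prod>t\<in>R - {r}. inverse (r - t) * (r - t))"
      unfolding w_def poly_prod by (intro prod.cong refl) (simp add: algebra_simps)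
    also have "\<dots> = 1" by (intro prod.neutral) auto
    finally show ?thesis .
  qed
  have w0: "[:-s, 1:] dvd w r" if "r \<in> R" "s \<in> R" "s \<noteq> r" for r s
    unfolding poly_eq_0_iff_dvd[symmetric] using that R by (auto simp: w_def poly_prod)
  have chi1: "[:-r, 1:] ^ 4 dvd 1 - chi r" if "r \<in> R" for r
  proof -
    have "[:-r, 1:] dvd 1 - w r ^ 4" unfolding poly_eq_0_iff_dvd[symmetric] using w1[OF that] by simp
    then show ?thesis unfolding chi_def by (simp add: dvd_power_same)
  qed
  have chi0: "[:-s, 1:] ^ 4 dvd chi r" if "r \<in> R" "s \<in> R" "s \<noteq> r" for r s
  proof -
    have "chi r = w r ^ 4 * (4 - 6 * w r ^ 4 + 4 * w r ^ 8 - w r ^ 12)"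
      by (simp add: chi_def algebra_simps eval_nat_numeral)
    moreover have "[:-s, 1:] ^ 4 dvd w r ^ 4" using w0[OF that] by (rule dvd_power_same)
    ultimately show ?thesis by (metis dvd_mult2)
  qed
  \<comment> \<open>The cubic Taylor polynomial at \<open>r\<close> with the prescribed derivatives;
    2 and 6 are the factorials.\<close>
  define T where "T = (\<lambda>r. case a r of (a0, a1, a2, a3) \<Rightarrow> [:a0, a1, a2 / 2, a3 / 6:] \<circ>\<^sub>p [:-r, 1:])"
  have T: "jet3 (T r) r = a r" for r
    by (cases "a r") (simp add: T_def jet3_def pderiv_pcompose pderiv_pCons poly_pcompose field_simps)
  define m where "m = (\<Sum>s\<in>R. chi s * T s)"
  show ?thesis
  proof (rule that[of m])
    fix r assume r: "r \<in> R"
    have "m - T r = (\<Sum>s\<in>R - {r}. chi s * T s) - (1 - chi r) * T r"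
      unfolding m_def using R r by (subst sum.remove[of R r]) (auto simp: algebra_simps)
    moreover have "[:-r, 1:] ^ 4 dvd (\<Sum>s\<in>R - {r}. chi s * T s)"
      using chi0 r by (intro dvd_sum dvd_mult2) auto
    ultimately have "[:-r, 1:] ^ 4 dvd m - T r" using chi1[OF r] by (metis dvd_diff dvd_mult2)
    then show "jet3 m r = a r" using jet3_eq_of_dvd T by metis
  qed
qed

lemma thrice_differentiable_hermite:
  assumes f: "thrice_differentiable f" and R: "finite R" "R \<subseteq> {0<..}"
  shows "\<exists>m h1 h2 h3. (\<forall>x>0. ((\<lambda>x. f x - poly m x) has_real_derivative h1 x) (at x) \<and>
      (h1 has_real_derivative h2 x) (at x) \<and> (h2 has_real_derivative h3 x) (at x)) \<and>
    (\<forall>r\<in>R. f r - poly m r = 0 \<and> h1 r = 0 \<and> h2 r = 0 \<and> h3 r = 0)"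
proof -
  obtain f1 f2 f3 where d: "\<And>x. x > 0 \<Longrightarrow> (f has_real_derivative f1 x) (at x)"
    "\<And>x. x > 0 \<Longrightarrow> (f1 has_real_derivative f2 x) (at x)" "\<And>x. x > 0 \<Longrightarrow> (f2 has_real_derivative f3 x) (at x)"
    using f unfolding thrice_differentiable_def by metis
  obtain m where m: "\<And>r. r \<in> R \<Longrightarrow> jet3 m r = (f r, f1 r, f2 r, f3 r)"
    by (rule hermite_interpolation[OF R(1), of "\<lambda>r. (f r, f1 r, f2 r, f3 r)"]) (rule that; blast)
  show ?thesis
  proof (intro exI conjI allI impI ballI)
    fix x :: real assume x: "0 < x"
    show "((\<lambda>x. f x - poly m x) has_real_derivative f1 x - poly (pderiv m) x) (at x)"
      "((\<lambda>x. f1 x - poly (pderiv m) x) has_real_derivative f2 x - poly (pderiv (pderiv m)) x) (at x)"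
      "((\<lambda>x. f2 x - poly (pderiv (pderiv m)) x) has_real_derivative f3 x -
          poly (pderiv (pderiv (pderiv m))) x) (at x)"
      by (intro DERIV_diff d x poly_DERIV)+
  next
    fix r assume "r \<in> R"
    from m[OF this] show "f r - poly m r = 0" "f1 r - poly (pderiv m) r = 0"
      "f2 r - poly (pderiv (pderiv m)) r = 0" "f3 r - poly (pderiv (pderiv (pderiv m))) r = 0"
      by (simp_all add: jet3_def)
  qed
qed

lemma thrice_differentiable_power: "thrice_differentiable (\<lambda>x. x ^ k)"
proof -
  have "(poly p has_real_derivative poly (pderiv p) x) (at x)" for p and x :: real by (rule poly_DERIV)
  then have "thrice_differentiable (poly (Polynomial.monom 1 k))" unfolding thrice_differentiable_def by blast
  then show ?thesis by (simp add: poly_monom[abs_def])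
qed

text \<open>In the product rule one term contains the value of \<open>h\<close> and the other its
  derivative, and both vanish at the point.\<close>

lemma flat_atI:
  assumes "F = (\<lambda>p q. c p q * h p q)" "h r s = 0"
    "((\<lambda>z. h (fst z) (snd z)) has_derivative (\<lambda>_. 0)) (at (r, s))"
    "(\<lambda>z. c (fst z) (snd z)) differentiable (at (r, s))"
  shows "flat_at F r s"
proof -
  obtain c' where "((\<lambda>z. c (fst z) (snd z)) has_derivative c') (at (r, s))"
    using assms(4) by (auto simp: differentiable_def)
  from has_derivative_mult[OF this assms(3)] show ?thesis
    unfolding flat_at_def assms(1) by (simp add: assms(2))
qed

lemma flat_at_add: "flat_at f r s \<Longrightarrow> flat_at g r s \<Longrightarrow> flat_at (\<lambda>p q. f p q + g p q) r s"
  unfolding flat_at_def by (auto dest: has_derivative_add)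

lemma differentiable_fst_snd:
  "(fst :: real \<times> real \<Rightarrow> real) differentiable F" "(snd :: real \<times> real \<Rightarrow> real) differentiable F"
  by (rule bounded_linear_imp_differentiable[OF bounded_linear_fst]
    bounded_linear_imp_differentiable[OF bounded_linear_snd])+

text \<open>Two osculations. A polynomial m replaces g at the quotients s/r; then p m(q/p) is a sum
  of powers of q times the functions p (1/p)^k, and these are in turn replaced by polynomials
  osculating at \<open>R\<close>. Only after the second replacement are both factors polynomials,
  which can be evaluated at matrices and differentiated algebraically.\<close>

lemma thrice_differentiable_tensor_approx:
  assumes g: "thrice_differentiable g" and R: "finite R" "R \<subseteq> {0<..}" and S: "finite S" "S \<subseteq> {0<..}"
  shows "\<exists>(N :: nat) \<alpha> \<beta>.
    small_near (\<lambda>p q. p * g (q / p) - (\<Sum>k<N. poly (\<alpha> k) p * poly (\<beta> k) q)) R S"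
proof -
  define U where "U = (\<lambda>(r, s). s / r) ` (R \<times> S)"
  have "0 < s / r" if "r \<in> R" "s \<in> S" for r s using R S that by (intro divide_pos_pos) auto
  then have U: "finite U" "U \<subseteq> {0<..}" using R(1) S(1) by (auto simp: U_def)
  obtain m h1 h2 h3 where hm: "(\<forall>x>0. ((\<lambda>x. g x - poly m x) has_real_derivative h1 x) (at x) \<and>
      (h1 has_real_derivative h2 x) (at x) \<and> (h2 has_real_derivative h3 x) (at x)) \<and>
    (\<forall>r\<in>U. g r - poly m r = 0 \<and> h1 r = 0 \<and> h2 r = 0 \<and> h3 r = 0)"
    using thrice_differentiable_hermite[OF g U] by (elim exE)
  define H where "H = (\<lambda>x. g x - poly m x)"
  have h: "(H has_real_derivative h1 x) (at x)" "(h1 has_real_derivative h2 x) (at x)"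
    "(h2 has_real_derivative h3 x) (at x)" if "0 < x" for x
    using conjunct1[OF hm, rule_format, OF that] unfolding H_def by blast+
  have H0: "H r = 0 \<and> h1 r = 0 \<and> h2 r = 0 \<and> h3 r = 0" if "r \<in> U" for r
    using conjunct2[OF hm, rule_format, OF that] by (simp add: H_def)
  have comp: "((\<lambda>z. k (snd z / fst z)) has_derivative (\<lambda>_. 0)) (at (r, s))"
    if "(k has_real_derivative 0) (at (s / r))" "0 < r" for k :: "real \<Rightarrow> real" and r s
  proof -
    have "(\<lambda>z. snd z / fst z) differentiable at (r, s)" using that(2)
      by (auto intro!: derivative_intros differentiable_fst_snd)
    then obtain D where D: "((\<lambda>z. snd z / fst z) has_derivative D) (at (r, s))" by (auto simp: differentiable_def)
    have "(k has_derivative (\<lambda>_. 0)) (at (s / r))"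
      using that(1) unfolding has_field_derivative_def lambda_zero .
    from has_derivative_compose[OF D, of k "\<lambda>_. 0"] this show ?thesis by simp
  qed
  \<comment> \<open>With u = q/p the partial derivatives are H - u H', H' and -(u/p) H''. Flatness
    of the mixed one uses the vanishing of the third derivative \<open>h3\<close> at the
    quotients.\<close>
  have s0: "small_near (\<lambda>p q. p * H (q / p)) R S"
  proof (rule small_near_of_flat[OF R(1) S(1) R(2) S(2)])
    fix p q :: real assume pq: "0 < p" "0 < q"
    then have u: "0 < q / p" by simp
    have chp: "((\<lambda>p. k (q / p)) has_real_derivative k' * (- q / p\<^sup>2)) (at p)"
      if "(k has_real_derivative k') (at (q / p))" for k k'
    proof (rule DERIV_chain2[of k k' "\<lambda>p. q / p" p, OF that])
      show "((\<lambda>p. q / p) has_real_derivative - q / p\<^sup>2) (at p)"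
        using pq by (auto intro!: derivative_eq_intros simp: power2_eq_square)
    qed
    have chq: "((\<lambda>q. k (q / p)) has_real_derivative k' * (1 / p)) (at q)"
      if "(k has_real_derivative k') (at (q / p))" for k k'
      by (rule DERIV_chain2[of k k' "\<lambda>q. q / p" q, OF that]) (use pq in \<open>auto intro!: derivative_eq_intros\<close>)
    have dl: "((\<lambda>q. - (q / p)) has_real_derivative - (1 / p)) (at q)"
      using pq by (auto intro!: derivative_eq_intros)
    show "((\<lambda>p. p * H (q / p)) has_real_derivative H (q / p) + - (q / p) * h1 (q / p)) (at p)"
      by (rule DERIV_cong[OF DERIV_mult[OF DERIV_ident chp[OF h(1)[OF u]]]])
        (use pq in \<open>simp add: power2_eq_square\<close>)
    show "((\<lambda>q. p * H (q / p)) has_real_derivative h1 (q / p)) (at q)"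
      by (rule DERIV_cong[OF DERIV_cmult[OF chq[OF h(1)[OF u]]]]) (use pq in simp)
    show "((\<lambda>q. H (q / p) + - (q / p) * h1 (q / p)) has_real_derivative - (q / p^2) * h2 (q / p)) (at q)"
      by (rule DERIV_cong[OF DERIV_add[OF chq[OF h(1)[OF u]] DERIV_mult[OF dl chq[OF h(2)[OF u]]]]])
        (use pq in \<open>simp add: power2_eq_square\<close>)
  next
    fix r s assume rs: "r \<in> R" "s \<in> S"
    then have r: "0 < r" and s: "0 < s" and su: "s / r \<in> U" using R S by (auto simp: U_def)
    from r s have sr: "0 < s / r" by simp
    note z = H0[OF su]
    have D: "((\<lambda>z. H (snd z / fst z)) has_derivative (\<lambda>_. 0)) (at (r, s))"
      "((\<lambda>z. h1 (snd z / fst z)) has_derivative (\<lambda>_. 0)) (at (r, s))"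
      "((\<lambda>z. h2 (snd z / fst z)) has_derivative (\<lambda>_. 0)) (at (r, s))"
      using h(1)[OF sr] h(2)[OF sr] h(3)[OF sr] z r by (auto intro!: comp)
    have d: "(\<lambda>z. fst z) differentiable (at (r, s))" "(\<lambda>z. - (snd z / fst z)) differentiable (at (r, s))"
      "(\<lambda>z. - (snd z / (fst z)^2)) differentiable (at (r, s))"
      using r by (auto intro!: derivative_intros differentiable_fst_snd)
    have f1: "flat_at (\<lambda>p q. p * H (q / p)) r s"
      by (rule flat_atI[where c = "\<lambda>p q. p" and h = "\<lambda>p q. H (q / p)"]) (use D(1) d(1) z in simp_all)
    have f2: "flat_at (\<lambda>p q. - (q / p) * h1 (q / p)) r s"
      by (rule flat_atI[where c = "\<lambda>p q. - (q / p)" and h = "\<lambda>p q. h1 (q / p)"]) (use D(2) d(2) z in simp_all)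
    have f3: "flat_at (\<lambda>p q. - (q / p^2) * h2 (q / p)) r s"
      by (rule flat_atI[where c = "\<lambda>p q. - (q / p^2)" and h = "\<lambda>p q. h2 (q / p)"]) (use D(3) d(3) z in simp_all)
    have f4: "flat_at (\<lambda>p q. H (q / p)) r s" and f5: "flat_at (\<lambda>p q. h1 (q / p)) r s"
      using D(1,2) z by (simp_all add: flat_at_def)
    show "flat_at (\<lambda>p q. p * H (q / p)) r s \<and> flat_at (\<lambda>p q. H (q / p) + - (q / p) * h1 (q / p)) r s \<and>
      flat_at (\<lambda>p q. h1 (q / p)) r s \<and> flat_at (\<lambda>p q. - (q / p^2) * h2 (q / p)) r s"
      using f1 f3 f5 flat_at_add[OF f4 f2] by blast
  qed
  define N where "N = Suc (degree m)"
  define \<beta> where "\<beta> = (\<lambda>k. Polynomial.monom (coeff m k) k)"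
  \<comment> \<open>Here \<open>b k p\<close> is p (1/p)^k, a negative power of p once k exceeds 1.
    The coefficients of \<open>m\<close> have been put into \<open>\<beta>\<close>.\<close>
  define b where "b = (\<lambda>k. transpose_fun (\<lambda>x. x ^ k))"
  have "\<exists>\<alpha>. small_near (\<lambda>p q. (b k p - poly \<alpha> p) * poly (\<beta> k) q) R S" for k
  proof -
    have tb: "thrice_differentiable (b k)" unfolding b_def
      by (intro thrice_differentiable_transpose thrice_differentiable_power)
    obtain \<alpha> a1 a2 a3 where am: "(\<forall>x>0. ((\<lambda>x. b k x - poly \<alpha> x) has_real_derivative a1 x) (at x) \<and>
        (a1 has_real_derivative a2 x) (at x) \<and> (a2 has_real_derivative a3 x) (at x)) \<and>
      (\<forall>r\<in>R. b k r - poly \<alpha> r = 0 \<and> a1 r = 0 \<and> a2 r = 0 \<and> a3 r = 0)"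
      using thrice_differentiable_hermite[OF tb R] by (elim exE)
    have a: "((\<lambda>x. b k x - poly \<alpha> x) has_real_derivative a1 x) (at x)" "(a1 has_real_derivative a2 x) (at x)"
      if "0 < x" for x using conjunct1[OF am, rule_format, OF that] by blast+
    have a0: "b k r - poly \<alpha> r = 0 \<and> a1 r = 0 \<and> a2 r = 0 \<and> a3 r = 0" if "r \<in> R" for r
      using conjunct2[OF am, rule_format, OF that] .
    have "small_near (\<lambda>p q. (b k p - poly \<alpha> p) * poly (\<beta> k) q) R S"
    proof (rule small_near_of_flat[OF R(1) S(1) R(2) S(2)])
      fix p q :: real assume pq: "0 < p" "0 < q"
      show "((\<lambda>p. (b k p - poly \<alpha> p) * poly (\<beta> k) q) has_real_derivative a1 p * poly (\<beta> k) q) (at p)"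
        by (rule DERIV_cmult_right[OF a(1)[OF pq(1)]])
      show "((\<lambda>q. (b k p - poly \<alpha> p) * poly (\<beta> k) q) has_real_derivative
          (b k p - poly \<alpha> p) * poly (pderiv (\<beta> k)) q) (at q)"
        by (rule DERIV_cmult[OF poly_DERIV])
      show "((\<lambda>q. a1 p * poly (\<beta> k) q) has_real_derivative a1 p * poly (pderiv (\<beta> k)) q) (at q)"
        by (rule DERIV_cmult[OF poly_DERIV])
    next
      fix r s assume rs: "r \<in> R" "s \<in> S"
      then have r: "0 < r" using R by auto
      have cf: "((\<lambda>z. f (fst z)) has_derivative (\<lambda>_. 0)) (at (r, s))" if "(f has_real_derivative 0) (at r)"
        for f :: "real \<Rightarrow> real"
      proof -
        have "(f has_derivative (\<lambda>_. 0)) (at (fst (r, s)))" using that unfolding has_field_derivative_def lambda_zero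
          by simp
        from has_derivative_compose[OF has_derivative_fst[OF has_derivative_ident] this] show ?thesis .
      qed
      have dp: "(\<lambda>z. poly c (snd z)) differentiable (at (r, s))" for c :: "real poly"
      proof -
        have "(poly c has_derivative (*) (poly (pderiv c) s)) (at (snd (r, s)))"
          using poly_DERIV[of c s] by (simp add: has_field_derivative_def)
        from has_derivative_compose[OF has_derivative_snd[OF has_derivative_ident] this] show ?thesis
          by (auto simp: differentiable_def)
      qed
      note z = a0[OF rs(1)]
      have D: "((\<lambda>z. b k (fst z) - poly \<alpha> (fst z)) has_derivative (\<lambda>_. 0)) (at (r, s))"
        "((\<lambda>z. a1 (fst z)) has_derivative (\<lambda>_. 0)) (at (r, s))"
        using cf[of "\<lambda>x. b k x - poly \<alpha> x"] cf[of a1] a(1)[OF r] a(2)[OF r] z by auto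
      have fl: "flat_at (\<lambda>p q. f p * poly c q) r s"
        if "f r = 0" "((\<lambda>z. f (fst z)) has_derivative (\<lambda>_. 0)) (at (r, s))" for f c
        by (rule flat_atI[where c = "\<lambda>p q. poly c q" and h = "\<lambda>p q. f p"]) (use that dp in \<open>auto simp: mult.commute\<close>)
      show "flat_at (\<lambda>p q. (b k p - poly \<alpha> p) * poly (\<beta> k) q) r s \<and> flat_at (\<lambda>p q. a1 p * poly (\<beta> k) q) r s \<and>
        flat_at (\<lambda>p q. (b k p - poly \<alpha> p) * poly (pderiv (\<beta> k)) q) r s \<and>
        flat_at (\<lambda>p q. a1 p * poly (pderiv (\<beta> k)) q) r s"
        using z D by (auto intro!: fl)
    qed
    then show ?thesis by blast
  qed
  then have "\<forall>k. \<exists>\<alpha>. small_near (\<lambda>p q. (b k p - poly \<alpha> p) * poly (\<beta> k) q) R S" by blast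
  from choice[OF this] obtain \<alpha> where \<alpha>: "\<forall>k. small_near (\<lambda>p q. (b k p - poly (\<alpha> k) p) * poly (\<beta> k) q) R S" ..
  have eq: "p * g (q / p) - (\<Sum>k<N. poly (\<alpha> k) p * poly (\<beta> k) q) =
      p * H (q / p) + (\<Sum>k<N. (b k p - poly (\<alpha> k) p) * poly (\<beta> k) q)" for p q
  proof -
    have "p * poly m (q / p) = (\<Sum>k<N. b k p * poly (\<beta> k) q)"
      unfolding poly_altdef[of m] N_def lessThan_Suc_atMost sum_distrib_left
      by (intro sum.cong refl)
        (simp add: b_def \<beta>_def transpose_fun_def poly_monom power_mult_distrib power_inverse divide_inverse mult_ac)
    then show ?thesis by (simp add: H_def algebra_simps sum_subtractf)
  qed
  have "small_near (\<lambda>p q. p * H (q / p) + (\<Sum>k<N. (b k p - poly (\<alpha> k) p) * poly (\<beta> k) q)) R S"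
    by (intro small_near_add s0 small_near_sum \<alpha>[rule_format]) auto
  then have "small_near (\<lambda>p q. p * g (q / p) - (\<Sum>k<N. poly (\<alpha> k) p * poly (\<beta> k) q)) R S"
    by (simp only: eq)
  then show ?thesis by blast
qed

section \<open>Derivatives of spectral sums\<close>

primrec mat_pow :: "complex^'n::finite^'n \<Rightarrow> nat \<Rightarrow> complex^'n^'n" where
  "mat_pow A 0 = mat 1"
| "mat_pow A (Suc k) = A ** mat_pow A k"

primrec mat_pow_d :: "complex^'n::finite^'n \<Rightarrow> complex^'n^'n \<Rightarrow> nat \<Rightarrow> complex^'n^'n" where
  "mat_pow_d A Y 0 = 0"
| "mat_pow_d A Y (Suc k) = A ** mat_pow_d A Y k + Y ** mat_pow A k"

text \<open>The recursion for \<open>mat_pow_d\<close> differentiated once more, in the direction X.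
  It is visibly symmetric in X and Y; this symmetry is what becomes freedom from torsion.\<close>

primrec mat_pow_dd :: "complex^'n::finite^'n \<Rightarrow> complex^'n^'n \<Rightarrow> complex^'n^'n \<Rightarrow> nat \<Rightarrow> complex^'n^'n" where
  "mat_pow_dd A X Y 0 = 0"
| "mat_pow_dd A X Y (Suc k) = A ** mat_pow_dd A X Y k + X ** mat_pow_d A Y k + Y ** mat_pow_d A X k"

lemma mat_pow_dd_commute: "mat_pow_dd A X Y k = mat_pow_dd A Y X k"
  by (induction k) (simp_all add: add_ac)

lemma has_vector_derivative_line: "((\<lambda>t. A + t *\<^sub>R X) has_vector_derivative X) (at t)"
  by (auto intro!: derivative_eq_intros)

lemmas has_vector_derivative_matmul = bounded_bilinear.has_vector_derivative[OF bounded_bilinear_matrix_mult]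

lemma mat_pow_has_derivative: "((\<lambda>t. mat_pow (A + t *\<^sub>R Y) k) has_vector_derivative mat_pow_d A Y k) (at 0)"
proof (induction k)
  case (Suc k)
  show ?case
    using has_vector_derivative_matmul[OF has_vector_derivative_line[of A Y 0] Suc] by simp
qed simp

lemma mat_pow_d_has_derivative:
  "((\<lambda>t. mat_pow_d (A + t *\<^sub>R X) Y k) has_vector_derivative mat_pow_dd A X Y k) (at 0)"
proof (induction k)
  case (Suc k)
  have "((\<lambda>t. Y ** mat_pow (A + t *\<^sub>R X) k) has_vector_derivative Y ** mat_pow_d A X k) (at 0)"
    using has_vector_derivative_matmul[OF has_vector_derivative_const[of Y] mat_pow_has_derivative[of A X k]]
    by simp
  from has_vector_derivative_add[OF has_vector_derivative_matmul[OF has_vector_derivative_line[of A X 0] Suc] this]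
  show ?case by simp
qed simp

definition mat_poly :: "real poly \<Rightarrow> complex^'n::finite^'n \<Rightarrow> complex^'n^'n" where
  "mat_poly c A = (\<Sum>i\<le>degree c. coeff c i *\<^sub>R mat_pow A i)"

definition mat_poly_d :: "real poly \<Rightarrow> complex^'n::finite^'n \<Rightarrow> complex^'n^'n \<Rightarrow> complex^'n^'n" where
  "mat_poly_d c A Y = (\<Sum>i\<le>degree c. coeff c i *\<^sub>R mat_pow_d A Y i)"

definition mat_poly_dd :: "real poly \<Rightarrow> complex^'n::finite^'n \<Rightarrow> complex^'n^'n \<Rightarrow> complex^'n^'n \<Rightarrow> complex^'n^'n" where
  "mat_poly_dd c A X Y = (\<Sum>i\<le>degree c. coeff c i *\<^sub>R mat_pow_dd A X Y i)"

lemma mat_poly_dd_commute: "mat_poly_dd c A X Y = mat_poly_dd c A Y X"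
  by (simp add: mat_poly_dd_def mat_pow_dd_commute)

lemma has_vector_derivative_scaleR_const:
  assumes "(f has_vector_derivative f') (at x)"
  shows "((\<lambda>x. c *\<^sub>R f x) has_vector_derivative c *\<^sub>R f') (at x)"
  using bounded_linear.has_vector_derivative[OF bounded_linear_scaleR_right assms] .

lemma mat_poly_has_derivative: "((\<lambda>t. mat_poly c (A + t *\<^sub>R Y)) has_vector_derivative mat_poly_d c A Y) (at 0)"
  unfolding mat_poly_def mat_poly_d_def
  by (intro has_vector_derivative_sum has_vector_derivative_scaleR_const mat_pow_has_derivative)

lemma mat_poly_d_has_derivative:
  "((\<lambda>t. mat_poly_d c (A + t *\<^sub>R X) Y) has_vector_derivative mat_poly_dd c A X Y) (at 0)"
  unfolding mat_poly_d_def mat_poly_dd_def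
  by (intro has_vector_derivative_sum has_vector_derivative_scaleR_const mat_pow_d_has_derivative)

lemma spec_fun_mult_left: "\<rho> \<in> Herm \<Longrightarrow> \<rho> ** spec_fun f \<rho> = spec_fun (\<lambda>c. c * f c) \<rho>"
  using spec_fun_mult[of \<rho> "\<lambda>c. c" f] by (simp add: spec_fun_id)

lemma mat_pow_eq_spec_fun: "\<rho> \<in> Herm \<Longrightarrow> mat_pow \<rho> k = spec_fun (\<lambda>c. c ^ k) \<rho>"
  by (induction k) (simp_all add: spec_fun_one spec_fun_mult_left)

lemma mat_poly_eq_spec_fun: "\<rho> \<in> Herm \<Longrightarrow> mat_poly c \<rho> = spec_fun (poly c) \<rho>"
proof -
  assume h: "\<rho> \<in> Herm"
  have "mat_poly c \<rho> = (\<Sum>i\<le>degree c. \<Sum>x\<in>eigs \<rho>. (coeff c i * x ^ i) *\<^sub>R eig_proj \<rho> x)"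
    by (simp add: mat_poly_def mat_pow_eq_spec_fun[OF h] spec_fun_def scaleR_sum_right)
  also have "\<dots> = spec_fun (poly c) \<rho>"
    by (subst sum.swap) (simp add: spec_fun_def poly_altdef scaleR_sum_left)
  finally show ?thesis .
qed

lemma Phi_tensor:
  assumes "\<tau> \<in> Herm" "\<sigma> \<in> Herm"
  shows "Phi (\<lambda>p q. \<Sum>k<N. poly (\<alpha> k) p * poly (\<beta> k) q) \<tau> \<sigma> =
    (\<Sum>k<N. re_trace (mat_poly (\<alpha> k) \<tau> ** mat_poly (\<beta> k) \<sigma>))"
proof -
  have "re_trace (mat_poly (\<alpha> k) \<tau> ** mat_poly (\<beta> k) \<sigma>) =
      (\<Sum>p\<in>eigs \<tau>. \<Sum>q\<in>eigs \<sigma>. poly (\<alpha> k) p * poly (\<beta> k) q * re_trace (eig_proj \<tau> p ** eig_proj \<sigma> q))" for k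
  proof -
    have "spec_fun (poly (\<alpha> k)) \<tau> ** spec_fun (poly (\<beta> k)) \<sigma> =
        (\<Sum>p\<in>eigs \<tau>. \<Sum>q\<in>eigs \<sigma>. (poly (\<alpha> k) p * poly (\<beta> k) q) *\<^sub>R (eig_proj \<tau> p ** eig_proj \<sigma> q))"
      unfolding spec_fun_def[of _ \<tau>] matmul.sum_left matmul.scaleR_left
      by (simp add: spec_fun_def matmul.sum_right matmul.scaleR_right scaleR_sum_right)
    then show ?thesis
      by (simp only: mat_poly_eq_spec_fun[OF assms(1)] mat_poly_eq_spec_fun[OF assms(2)] re_trace_sum re_trace_scaleR
        real_scaleR_def)
  qed
  then have "(\<Sum>k<N. re_trace (mat_poly (\<alpha> k) \<tau> ** mat_poly (\<beta> k) \<sigma>)) =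
      (\<Sum>k<N. \<Sum>p\<in>eigs \<tau>. \<Sum>q\<in>eigs \<sigma>. poly (\<alpha> k) p * poly (\<beta> k) q * re_trace (eig_proj \<tau> p ** eig_proj \<sigma> q))"
    by (simp only:)
  also have "\<dots> = (\<Sum>p\<in>eigs \<tau>. \<Sum>q\<in>eigs \<sigma>. \<Sum>k<N. poly (\<alpha> k) p * poly (\<beta> k) q * re_trace (eig_proj \<tau> p ** eig_proj \<sigma> q))"
    by (rule trans[OF sum.swap sum.cong[OF refl sum.swap]])
  finally show ?thesis by (simp add: Phi_def sum_distrib_right)
qed

text \<open>The suffix lists the derivatives taken: \<open>q\<close> for the one in the second
  argument, and one \<open>p\<close> for each in the first.\<close>

definition tensor_q where
  "tensor_q N \<alpha> \<beta> \<tau> \<sigma> Z = (\<Sum>k<N::nat. re_trace (mat_poly (\<alpha> k) \<tau> ** mat_poly_d (\<beta> k) \<sigma> Z))"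

definition tensor_pq where
  "tensor_pq N \<alpha> \<beta> \<tau> \<sigma> Y Z = (\<Sum>k<N::nat. re_trace (mat_poly_d (\<alpha> k) \<tau> Y ** mat_poly_d (\<beta> k) \<sigma> Z))"

definition tensor_ppq where
  "tensor_ppq N \<alpha> \<beta> \<tau> \<sigma> X Y Z = (\<Sum>k<N::nat. re_trace (mat_poly_dd (\<alpha> k) \<tau> X Y ** mat_poly_d (\<beta> k) \<sigma> Z))"

lemma tensor_ppq_commute: "tensor_ppq N \<alpha> \<beta> \<tau> \<sigma> X Y Z = tensor_ppq N \<alpha> \<beta> \<tau> \<sigma> Y X Z"
proof -
  have "mat_poly_dd (\<alpha> k) \<tau> X Y = mat_poly_dd (\<alpha> k) \<tau> Y X" for k by (rule mat_poly_dd_commute)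
  then show ?thesis unfolding tensor_ppq_def by (simp only:)
qed

lemma re_trace_mult_has_derivative:
  fixes A B :: "real \<Rightarrow> complex^'n::finite^'n"
  assumes "(A has_vector_derivative A') (at x)" "(B has_vector_derivative B') (at x)"
  shows "((\<lambda>x. re_trace (A x ** B x)) has_real_derivative re_trace (A x ** B') + re_trace (A' ** B x)) (at x)"
  unfolding has_real_derivative_iff_has_vector_derivative re_trace_add[symmetric]
  by (rule bounded_linear.has_vector_derivative[OF bounded_linear_re_trace has_vector_derivative_matmul[OF assms]])

lemma re_trace_zero [simp]: "re_trace 0 = 0"
  by (rule linear_0[OF bounded_linear.linear[OF bounded_linear_re_trace]])

text \<open>In the last claim both arguments move. By cyclicity of the trace, the term from the
  second argument is again of the form \<open>tensor_ppq\<close> but with \<alpha> and \<beta>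
  exchanged. This exchange is the origin of the transposed function in the duality.\<close>

lemma tensor_has_derivative:
  "((\<lambda>u. \<Sum>k<N. re_trace (mat_poly (\<alpha> k) \<tau> ** mat_poly (\<beta> k) (\<sigma> + u *\<^sub>R Z))) has_real_derivative
      tensor_q N \<alpha> \<beta> \<tau> \<sigma> Z) (at 0)"
  "((\<lambda>t. tensor_q N \<alpha> \<beta> (\<tau> + t *\<^sub>R Y) \<sigma> Z) has_real_derivative tensor_pq N \<alpha> \<beta> \<tau> \<sigma> Y Z) (at 0)"
  "((\<lambda>s. tensor_pq N \<alpha> \<beta> (\<tau> + s *\<^sub>R X) \<sigma> Y Z) has_real_derivative tensor_ppq N \<alpha> \<beta> \<tau> \<sigma> X Y Z) (at 0)"
  "((\<lambda>s. tensor_pq N \<alpha> \<beta> (\<tau> + s *\<^sub>R X) (\<sigma> + s *\<^sub>R X) Y Z) has_real_derivative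
     tensor_ppq N \<alpha> \<beta> \<tau> \<sigma> X Y Z + tensor_ppq N \<beta> \<alpha> \<sigma> \<tau> X Z Y) (at 0)"
proof -
  note c = has_vector_derivative_const
  note m = re_trace_mult_has_derivative
  show "((\<lambda>u. \<Sum>k<N. re_trace (mat_poly (\<alpha> k) \<tau> ** mat_poly (\<beta> k) (\<sigma> + u *\<^sub>R Z))) has_real_derivative
      tensor_q N \<alpha> \<beta> \<tau> \<sigma> Z) (at 0)"
    unfolding tensor_q_def by (intro DERIV_sum DERIV_cong[OF m[OF c mat_poly_has_derivative]]) simp
  show "((\<lambda>t. tensor_q N \<alpha> \<beta> (\<tau> + t *\<^sub>R Y) \<sigma> Z) has_real_derivative tensor_pq N \<alpha> \<beta> \<tau> \<sigma> Y Z) (at 0)"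
    unfolding tensor_q_def tensor_pq_def by (intro DERIV_sum DERIV_cong[OF m[OF mat_poly_has_derivative c]]) simp
  show "((\<lambda>s. tensor_pq N \<alpha> \<beta> (\<tau> + s *\<^sub>R X) \<sigma> Y Z) has_real_derivative tensor_ppq N \<alpha> \<beta> \<tau> \<sigma> X Y Z) (at 0)"
    unfolding tensor_ppq_def tensor_pq_def by (intro DERIV_sum DERIV_cong[OF m[OF mat_poly_d_has_derivative c]]) simp
  show "((\<lambda>s. tensor_pq N \<alpha> \<beta> (\<tau> + s *\<^sub>R X) (\<sigma> + s *\<^sub>R X) Y Z) has_real_derivative
     tensor_ppq N \<alpha> \<beta> \<tau> \<sigma> X Y Z + tensor_ppq N \<beta> \<alpha> \<sigma> \<tau> X Z Y) (at 0)"
    unfolding tensor_ppq_def tensor_pq_def sum.distrib[symmetric]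
  proof (intro DERIV_sum DERIV_cong[OF m[OF mat_poly_d_has_derivative mat_poly_d_has_derivative]])
    fix k
    have "re_trace (mat_poly_d (\<alpha> k) \<tau> Y ** mat_poly_dd (\<beta> k) \<sigma> X Z) =
        re_trace (mat_poly_dd (\<beta> k) \<sigma> X Z ** mat_poly_d (\<alpha> k) \<tau> Y)"
      by (rule re_trace_commute)
    then show "re_trace (mat_poly_d (\<alpha> k) (\<tau> + 0 *\<^sub>R X) Y ** mat_poly_dd (\<beta> k) \<sigma> X Z) +
        re_trace (mat_poly_dd (\<alpha> k) \<tau> X Y ** mat_poly_d (\<beta> k) (\<sigma> + 0 *\<^sub>R X) Z) =
      re_trace (mat_poly_dd (\<alpha> k) \<tau> X Y ** mat_poly_d (\<beta> k) \<sigma> Z) +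
      re_trace (mat_poly_dd (\<beta> k) \<sigma> X Z ** mat_poly_d (\<alpha> k) \<tau> Y)"
      by simp
  qed
qed

section \<open>Transfer of the derivatives from tensor polynomials to spectral sums\<close>

definition small_at :: "(real \<Rightarrow> real \<Rightarrow> real) \<Rightarrow> real set \<Rightarrow> real set \<Rightarrow> real \<Rightarrow> real \<Rightarrow> bool" where
  "small_at f R S e \<delta> \<longleftrightarrow> (\<forall>p\<in>thicken R \<delta>. \<forall>p'\<in>thicken R \<delta>. \<forall>q\<in>thicken S \<delta>. \<forall>q'\<in>thicken S \<delta>.
       \<bar>mixed_diff f p p' q q'\<bar> \<le> e * \<delta> * (\<bar>p' - p\<bar> * \<bar>q' - q\<bar>) \<and>
       \<bar>f p' q - f p q\<bar> \<le> e * \<delta> * \<bar>p' - p\<bar> \<and> \<bar>f p q' - f p q\<bar> \<le> e * \<delta> * \<bar>q' - q\<bar>)"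

lemma small_nearD:
  assumes "small_near f R S" "0 < e"
  shows "\<exists>b. 0 < b \<and> (\<forall>\<delta>. 0 < \<delta> \<longrightarrow> \<delta> < b \<longrightarrow> small_at f R S e \<delta>)"
proof -
  have "\<forall>\<^sub>F \<delta> in at_right 0. small_at f R S e \<delta>"
    using assms unfolding small_near_def small_at_def by blast
  then obtain b where b: "0 < b" "\<forall>y>0. y < b \<longrightarrow> small_at f R S e y"
    unfolding eventually_at_right_field by blast
  then show ?thesis by blast
qed

lemma small_near_swap: "small_near f R S \<Longrightarrow> small_near (\<lambda>p q. f q p) S R"
proof -
  assume f: "small_near f R S"
  have m: "mixed_diff (\<lambda>p q. f q p) p p' q q' = mixed_diff f q q' p p'" for p p' q q'
    by (simp add: mixed_diff_def)
  show ?thesis unfolding small_near_def m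
  proof (intro allI impI)
    fix \<epsilon> :: real assume "0 < \<epsilon>"
    from f[unfolded small_near_def, rule_format, OF this]
    show "\<forall>\<^sub>F \<delta> in at_right 0. \<forall>p\<in>thicken S \<delta>. \<forall>p'\<in>thicken S \<delta>. \<forall>q\<in>thicken R \<delta>. \<forall>q'\<in>thicken R \<delta>.
       \<bar>mixed_diff f q q' p p'\<bar> \<le> \<epsilon> * \<delta> * (\<bar>p' - p\<bar> * \<bar>q' - q\<bar>) \<and>
       \<bar>f q p' - f q p\<bar> \<le> \<epsilon> * \<delta> * \<bar>p' - p\<bar> \<and> \<bar>f q' p - f q p\<bar> \<le> \<epsilon> * \<delta> * \<bar>q' - q\<bar>"
    proof eventually_elim
      case (elim \<delta>)
      show ?case
      proof (intro ballI)
        fix p p' q q' assume a: "p \<in> thicken S \<delta>" "p' \<in> thicken S \<delta>" "q \<in> thicken R \<delta>" "q' \<in> thicken R \<delta>"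
        from elim[rule_format, OF a(3,4,1,2)]
        show "\<bar>mixed_diff f q q' p p'\<bar> \<le> \<epsilon> * \<delta> * (\<bar>p' - p\<bar> * \<bar>q' - q\<bar>) \<and>
          \<bar>f q p' - f q p\<bar> \<le> \<epsilon> * \<delta> * \<bar>p' - p\<bar> \<and> \<bar>f q' p - f q p\<bar> \<le> \<epsilon> * \<delta> * \<bar>q' - q\<bar>"
          by (simp add: mult.commute)
      qed
    qed
  qed
qed

definition tensor_approx :: "(real \<Rightarrow> real \<Rightarrow> real) \<Rightarrow> bool" where
  "tensor_approx f \<longleftrightarrow> (\<forall>R S. finite R \<and> finite S \<and> R \<subseteq> {0<..} \<and> S \<subseteq> {0<..} \<longrightarrow>
     (\<exists>(N :: nat) \<alpha> \<beta>. small_near (\<lambda>p q. f p q - (\<Sum>k<N. poly (\<alpha> k) p * poly (\<beta> k) q)) R S))"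

lemma tensor_approx_swap: "tensor_approx f \<Longrightarrow> tensor_approx (\<lambda>p q. f q p)"
  unfolding tensor_approx_def
proof (intro allI impI)
  fix R S :: "real set" assume f: "\<forall>R S. finite R \<and> finite S \<and> R \<subseteq> {0<..} \<and> S \<subseteq> {0<..} \<longrightarrow>
     (\<exists>(N :: nat) \<alpha> \<beta>. small_near (\<lambda>p q. f p q - (\<Sum>k<N. poly (\<alpha> k) p * poly (\<beta> k) q)) R S)"
    and RS: "finite R \<and> finite S \<and> R \<subseteq> {0<..} \<and> S \<subseteq> {0<..}"
  then obtain N :: nat and \<alpha> \<beta> where "small_near (\<lambda>p q. f p q - (\<Sum>k<N. poly (\<alpha> k) p * poly (\<beta> k) q)) S R" by meson
  from small_near_swap[OF this]
  have "small_near (\<lambda>p q. f q p - (\<Sum>k<N. poly (\<beta> k) p * poly (\<alpha> k) q)) R S" by (simp add: mult.commute)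
  then show "\<exists>(N :: nat) \<alpha> \<beta>. small_near (\<lambda>p q. f q p - (\<Sum>k<N. poly (\<alpha> k) p * poly (\<beta> k) q)) R S" by blast
qed

lemma tensor_approxD:
  assumes "tensor_approx f" "\<tau> \<in> PD" "\<sigma> \<in> PD"
  shows "\<exists>(N :: nat) \<alpha> \<beta>.
    small_near (\<lambda>p q. f p q - (\<Sum>k<N. poly (\<alpha> k) p * poly (\<beta> k) q)) (eigs \<tau>) (eigs \<sigma>)"
proof -
  have "finite (eigs \<tau>) \<and> finite (eigs \<sigma>) \<and> eigs \<tau> \<subseteq> {0<..} \<and> eigs \<sigma> \<subseteq> {0<..}"
    using PD_eigs_pos[OF assms(2)] PD_eigs_pos[OF assms(3)] finite_eigs[OF PD_Herm[OF assms(2)]]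
      finite_eigs[OF PD_Herm[OF assms(3)]] by auto
  then show ?thesis using assms(1) unfolding tensor_approx_def by simp
qed

lemma thicken_mono:
  assumes "\<delta>' \<le> \<delta>"
  shows "thicken R \<delta>' \<subseteq> thicken R \<delta>"
  unfolding thicken_def using assms order_trans by blast

lemma has_real_derivative_zeroI:
  assumes "\<And>e. 0 < e \<Longrightarrow> \<forall>\<^sub>F s in at 0. \<bar>f s - f 0\<bar> \<le> e * \<bar>s\<bar>"
  shows "(f has_real_derivative 0) (at 0)"
  unfolding DERIV_def
proof (rule tendstoI)
  fix e :: real assume e: "0 < e"
  have "\<forall>\<^sub>F s in at 0. \<bar>f s - f 0\<bar> \<le> e / 2 * \<bar>s\<bar>" using e by (intro assms) simp
  moreover have "\<forall>\<^sub>F s in at (0::real). s \<noteq> 0" by (simp add: eventually_at_filter)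
  ultimately show "\<forall>\<^sub>F h in at 0. dist ((f (0 + h) - f 0) / h) 0 < e"
  proof eventually_elim
    case (elim s)
    then have "\<bar>f s - f 0\<bar> / \<bar>s\<bar> \<le> e / 2" by (simp add: pos_divide_le_eq)
    also have "\<dots> < e" using e by simp
    finally show ?case by (simp add: dist_real_def)
  qed
qed

text \<open>A bound on increments passes to the derivative. In this way the estimates for
  \<open>Phi\<close> are lifted to \<open>Phi_q\<close> and then to \<open>Phi_pq\<close>.\<close>

lemma DERIV_unique_bound:
  assumes "(f has_real_derivative d) (at 0)" "\<forall>\<^sub>F u in at 0. \<bar>f u - f 0\<bar> \<le> B * \<bar>u\<bar>"
  shows "\<bar>d\<bar> \<le> B"
proof -
  have "((\<lambda>u. \<bar>(f u - f 0) / u\<bar>) \<longlongrightarrow> \<bar>d\<bar>) (at 0)"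
    using assms(1) by (intro tendsto_rabs) (simp add: DERIV_def)
  moreover have "\<forall>\<^sub>F u in at 0. \<bar>(f u - f 0) / u\<bar> \<le> B"
  proof -
    have "\<forall>\<^sub>F u in at (0::real). u \<noteq> 0" by (simp add: eventually_at_filter)
    then show ?thesis using assms(2)
      by eventually_elim (simp add: abs_divide pos_divide_le_eq)
  qed
  ultimately show ?thesis by (rule tendsto_upperbound) simp
qed

lemma eventually_nhds_at: "eventually P (nhds a) \<Longrightarrow> eventually P (at a)"
  by (auto simp: eventually_at_filter elim: eventually_mono)

text \<open>The derivatives are nested as in \<open>entropy_metric\<close>, with the second argument
  innermost. Since \<open>deriv\<close> is total, that they exist is shown separately.\<close>

definition Phi_q :: "(real \<Rightarrow> real \<Rightarrow> real) \<Rightarrow> complex^'n::finite^'n \<Rightarrow> complex^'n^'n \<Rightarrow> complex^'n^'n \<Rightarrow> real" where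
  "Phi_q f \<tau> \<sigma> Z = deriv (\<lambda>u. Phi f \<tau> (\<sigma> + u *\<^sub>R Z)) 0"

definition Phi_pq ::
    "(real \<Rightarrow> real \<Rightarrow> real) \<Rightarrow> complex^'n::finite^'n \<Rightarrow> complex^'n^'n \<Rightarrow> complex^'n^'n \<Rightarrow> complex^'n^'n \<Rightarrow> real" where
  "Phi_pq f \<tau> \<sigma> Y Z = deriv (\<lambda>t. Phi_q f (\<tau> + t *\<^sub>R Y) \<sigma> Z) 0"

lemma Herm_line: "\<rho> \<in> Herm \<Longrightarrow> X \<in> Herm \<Longrightarrow> \<rho> + t *\<^sub>R X \<in> Herm"
  by (intro subspace_add subspace_scale subspace_Herm)

lemma eventually_PD_line:
  assumes "\<rho> \<in> PD" "X \<in> Herm"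
  shows "\<forall>\<^sub>F t in nhds 0. \<rho> + t *\<^sub>R X \<in> PD"
proof -
  obtain d where d: "0 < d" "\<And>\<tau>. \<tau> \<in> Herm \<Longrightarrow> norm (\<tau> - \<rho>) < d \<Longrightarrow> \<tau> \<in> PD"
    using PD_nhd[OF assms(1)] by metis
  have "((\<lambda>t. norm (t *\<^sub>R X)) \<longlongrightarrow> norm ((0::real) *\<^sub>R X)) (nhds 0)"
    by (intro tendsto_intros tendsto_ident_at[of _ UNIV, simplified] filterlim_ident)
  then have "\<forall>\<^sub>F t in nhds 0. norm (t *\<^sub>R X) < d" using d(1) by (intro order_tendstoD(2)) auto
  then show ?thesis
    by eventually_elim (use d(2) Herm_line[OF PD_Herm[OF assms(1)] assms(2)] in auto)
qed

context
  fixes C K :: real and ty :: "'n::finite itself"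
  assumes C: "0 < C"
    and diff_bound: "\<And>(\<tau> :: complex^'n^'n) \<tau>' \<sigma> f L. \<tau> \<in> Herm \<Longrightarrow> \<tau>' \<in> Herm \<Longrightarrow> \<sigma> \<in> Herm \<Longrightarrow> 0 \<le> L \<Longrightarrow>
      (\<And>p p' q. p \<in> eigs \<tau> \<Longrightarrow> p' \<in> eigs \<tau>' \<Longrightarrow> q \<in> eigs \<sigma> \<Longrightarrow> \<bar>f p' q - f p q\<bar> \<le> L * \<bar>p' - p\<bar>) \<Longrightarrow>
      \<bar>Phi f \<tau>' \<sigma> - Phi f \<tau> \<sigma>\<bar> \<le> C * L * norm (\<tau>' - \<tau>)"
    and mixed_bound: "\<And>(\<tau> :: complex^'n^'n) \<tau>' \<sigma> \<sigma>' f L. \<tau> \<in> Herm \<Longrightarrow> \<tau>' \<in> Herm \<Longrightarrow> \<sigma> \<in> Herm \<Longrightarrow> \<sigma>' \<in> Herm \<Longrightarrow> 0 \<le> L \<Longrightarrow>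
      (\<And>p p' q q'. p \<in> eigs \<tau> \<Longrightarrow> p' \<in> eigs \<tau>' \<Longrightarrow> q \<in> eigs \<sigma> \<Longrightarrow> q' \<in> eigs \<sigma>' \<Longrightarrow>
        \<bar>mixed_diff f p p' q q'\<bar> \<le> L * (\<bar>p' - p\<bar> * \<bar>q' - q\<bar>)) \<Longrightarrow>
      \<bar>Phi f \<tau>' \<sigma>' - Phi f \<tau>' \<sigma> - Phi f \<tau> \<sigma>' + Phi f \<tau> \<sigma>\<bar> \<le> C * L * (norm (\<tau>' - \<tau>) * norm (\<sigma>' - \<sigma>))"
    and K: "0 < K"
    and near: "\<And>(\<tau> :: complex^'n^'n) \<tau>' c'. \<tau> \<in> Herm \<Longrightarrow> \<tau>' \<in> Herm \<Longrightarrow> c' \<in> eigs \<tau>' \<Longrightarrow>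
     \<exists>c\<in>eigs \<tau>. \<bar>c' - c\<bar> \<le> K * norm (\<tau>' - \<tau>)"
begin

lemma eigs_subset_thicken:
  fixes \<tau> \<tau>' :: "complex^'n^'n"
  assumes "\<tau> \<in> Herm" "\<tau>' \<in> Herm" "eigs \<tau> \<subseteq> thicken R \<delta>'" "\<delta>' + K * norm (\<tau>' - \<tau>) \<le> \<delta>"
  shows "eigs \<tau>' \<subseteq> thicken R \<delta>"
proof
  fix c' assume "c' \<in> eigs \<tau>'"
  then obtain c where c: "c \<in> eigs \<tau>" "\<bar>c' - c\<bar> \<le> K * norm (\<tau>' - \<tau>)" using near assms by blast
  then obtain r where r: "r \<in> R" "\<bar>c - r\<bar> \<le> \<delta>'" using assms(3) by (auto simp: thicken_def)
  have "\<bar>c' - r\<bar> \<le> \<delta>" using c(2) r(2) assms(4) by linarith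
  then show "c' \<in> thicken R \<delta>" using r by (auto simp: thicken_def)
qed

lemma eigs_thicken_self: "0 \<le> \<delta> \<Longrightarrow> eigs (\<tau> :: complex^'n^'n) \<subseteq> thicken (eigs \<tau>) \<delta>"
proof
  fix x assume "0 \<le> \<delta>" "x \<in> eigs \<tau>"
  then show "x \<in> thicken (eigs \<tau>) \<delta>" unfolding thicken_def by (intro CollectI bexI[of _ x]) auto
qed

lemma eventually_eigs_line:
  fixes \<sigma> Z :: "complex^'n^'n"
  assumes "\<sigma> \<in> Herm" "Z \<in> Herm" "eigs \<sigma> \<subseteq> thicken S \<delta>'" "\<delta>' < \<delta>"
  shows "\<forall>\<^sub>F u in nhds 0. eigs (\<sigma> + u *\<^sub>R Z) \<subseteq> thicken S \<delta>"
proof -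
  have "((\<lambda>t. K * norm (t *\<^sub>R Z)) \<longlongrightarrow> K * norm ((0::real) *\<^sub>R Z)) (nhds 0)"
    by (intro tendsto_intros filterlim_ident)
  then have "\<forall>\<^sub>F t in nhds 0. K * norm (t *\<^sub>R Z) < \<delta> - \<delta>'" using assms(4) by (intro order_tendstoD(2)) auto
  then show ?thesis
  proof eventually_elim
    case (elim u)
    then show ?case by (intro eigs_subset_thicken[OF assms(1) Herm_line[OF assms(1,2)] assms(3)]) simp
  qed
qed

text \<open>The spectrum of the moving argument stays in the thickened set, so the Lipschitz bound
  for spectral sums makes the increment an arbitrarily small multiple of |u|. The bound is stated
  for the first argument, hence the exchange of arguments.\<close>

lemma Phi_small_has_derivative:
  fixes \<tau> \<sigma> Z :: "complex^'n^'n"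
  assumes h: "\<tau> \<in> Herm" "\<sigma> \<in> Herm" "Z \<in> Herm" and f: "small_near f (eigs \<tau>) (eigs \<sigma>)"
  shows "((\<lambda>u. Phi f \<tau> (\<sigma> + u *\<^sub>R Z)) has_real_derivative 0) (at 0)"
proof (rule has_real_derivative_zeroI)
  fix e :: real assume e: "0 < e"
  define e1 where "e1 = e / (C * (norm Z + 1))"
  have Z1: "0 < norm Z + 1" by (simp add: add_nonneg_pos)
  have e1: "0 < e1" using e C Z1 by (simp add: e1_def)
  obtain b where bb: "0 < b \<and> (\<forall>\<delta>. 0 < \<delta> \<longrightarrow> \<delta> < b \<longrightarrow> small_at f (eigs \<tau>) (eigs \<sigma>) e1 \<delta>)"
    using small_nearD[OF f e1] by (elim exE)
  note b = conjunct1[OF bb] conjunct2[OF bb, rule_format]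
  define \<delta> where "\<delta> = min 1 (b / 2)"
  have \<delta>: "0 < \<delta>" "\<delta> < b" "\<delta> \<le> 1" using b(1) by (auto simp: \<delta>_def)
  note sm = b(2)[OF \<delta>(1,2)]
  have "\<forall>\<^sub>F u in nhds 0. eigs (\<sigma> + u *\<^sub>R Z) \<subseteq> thicken (eigs \<sigma>) \<delta>"
    using eigs_thicken_self[of 0 \<sigma>] \<delta>(1) by (intro eventually_eigs_line[OF h(2,3)]) auto
  then have "\<forall>\<^sub>F u in at 0. eigs (\<sigma> + u *\<^sub>R Z) \<subseteq> thicken (eigs \<sigma>) \<delta>"
    by (rule eventually_nhds_at)
  then show "\<forall>\<^sub>F u in at 0. \<bar>Phi f \<tau> (\<sigma> + u *\<^sub>R Z) - Phi f \<tau> (\<sigma> + 0 *\<^sub>R Z)\<bar> \<le> e * \<bar>u\<bar>"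
  proof eventually_elim
    case (elim u)
    have "\<bar>Phi (\<lambda>q p. f p q) (\<sigma> + u *\<^sub>R Z) \<tau> - Phi (\<lambda>q p. f p q) \<sigma> \<tau>\<bar> \<le> C * (e1 * \<delta>) * norm ((\<sigma> + u *\<^sub>R Z) - \<sigma>)"
    proof (rule diff_bound)
      fix q q' p assume "q \<in> eigs \<sigma>" "q' \<in> eigs (\<sigma> + u *\<^sub>R Z)" "p \<in> eigs \<tau>"
      then have "q \<in> thicken (eigs \<sigma>) \<delta>" "q' \<in> thicken (eigs \<sigma>) \<delta>" "p \<in> thicken (eigs \<tau>) \<delta>"
        using elim \<delta>(1) eigs_thicken_self[of \<delta> \<sigma>] eigs_thicken_self[of \<delta> \<tau>] by auto
      then show "\<bar>f p q' - f p q\<bar> \<le> e1 * \<delta> * \<bar>q' - q\<bar>" using sm unfolding small_at_def by blast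
    qed (use h e1 \<delta> Herm_line in auto)
    also have "C * (e1 * \<delta>) * norm ((\<sigma> + u *\<^sub>R Z) - \<sigma>) = (C * e1 * norm Z) * \<delta> * \<bar>u\<bar>" by simp
    also have "\<dots> \<le> (C * e1 * (norm Z + 1)) * 1 * \<bar>u\<bar>"
      using C e1 \<delta> Z1 by (intro mult_mono mult_nonneg_nonneg) auto
    also have "C * e1 * (norm Z + 1) = e" using C Z1 by (simp add: e1_def)
    finally show ?case by (simp add: Phi_commute[of f])
  qed
qed

lemma Phi_has_derivative:
  fixes \<tau> \<sigma> Z :: "complex^'n^'n"
  assumes h: "\<tau> \<in> Herm" "\<sigma> \<in> Herm" "Z \<in> Herm"
    and f: "small_near (\<lambda>p q. f p q - (\<Sum>k<N. poly (\<alpha> k) p * poly (\<beta> k) q)) (eigs \<tau>) (eigs \<sigma>)"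
  shows "((\<lambda>u. Phi f \<tau> (\<sigma> + u *\<^sub>R Z)) has_real_derivative tensor_q N \<alpha> \<beta> \<tau> \<sigma> Z) (at 0)"
proof -
  let ?Q = "\<lambda>p q. f p q - (\<Sum>k<N. poly (\<alpha> k) p * poly (\<beta> k) q)"
  have "Phi f \<tau> (\<sigma> + u *\<^sub>R Z) = Phi ?Q \<tau> (\<sigma> + u *\<^sub>R Z) +
      (\<Sum>k<N. re_trace (mat_poly (\<alpha> k) \<tau> ** mat_poly (\<beta> k) (\<sigma> + u *\<^sub>R Z)))" for u
    unfolding Phi_diff Phi_tensor[OF h(1) Herm_line[OF h(2,3)]] by simp
  then show ?thesis
    by (simp only:) (rule DERIV_cong[OF DERIV_add[OF Phi_small_has_derivative[OF h f] tensor_has_derivative(1)]],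
      simp)
qed

lemma Phi_q_has_derivative:
  fixes \<tau> \<sigma> Z :: "complex^'n^'n"
  assumes "tensor_approx f" "\<tau> \<in> PD" "\<sigma> \<in> PD" "Z \<in> Herm"
  shows "((\<lambda>u. Phi f \<tau> (\<sigma> + u *\<^sub>R Z)) has_real_derivative Phi_q f \<tau> \<sigma> Z) (at 0)"
proof -
  obtain N :: nat and \<alpha> \<beta> where
    s: "small_near (\<lambda>p q. f p q - (\<Sum>k<N. poly (\<alpha> k) p * poly (\<beta> k) q)) (eigs \<tau>) (eigs \<sigma>)"
    using tensor_approxD[OF assms(1-3)] by (elim exE)
  from Phi_has_derivative[OF PD_Herm[OF assms(2)] PD_Herm[OF assms(3)] assms(4) s]
  show ?thesis by (simp add: Phi_q_def DERIV_imp_deriv)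
qed

text \<open>The mixed difference bound for the error, divided by u and taken to the limit. The
  inequality \<open>\<delta>' < \<delta>\<close> leaves the spectrum of the second argument room to
  move.\<close>

lemma Phi_q_diff_bound:
  fixes \<tau> \<tau>' \<sigma> Z :: "complex^'n^'n"
  assumes f: "tensor_approx f" and pd: "\<tau> \<in> PD" "\<tau>' \<in> PD" "\<sigma> \<in> PD" and Z: "Z \<in> Herm"
    and sm: "small_at (\<lambda>p q. f p q - (\<Sum>k<N. poly (\<alpha> k) p * poly (\<beta> k) q)) R S e \<delta>" and e: "0 \<le> e" "0 \<le> \<delta>"
    and near: "eigs \<tau> \<subseteq> thicken R \<delta>" "eigs \<tau>' \<subseteq> thicken R \<delta>" "eigs \<sigma> \<subseteq> thicken S \<delta>'" "\<delta>' < \<delta>"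
  shows "\<bar>(Phi_q f \<tau>' \<sigma> Z - tensor_q N \<alpha> \<beta> \<tau>' \<sigma> Z) - (Phi_q f \<tau> \<sigma> Z - tensor_q N \<alpha> \<beta> \<tau> \<sigma> Z)\<bar> \<le>
    C * (e * \<delta>) * norm (\<tau>' - \<tau>) * norm Z"
proof -
  let ?Q = "\<lambda>p q. f p q - (\<Sum>k<N. poly (\<alpha> k) p * poly (\<beta> k) q)"
  note h = pd[THEN PD_Herm]
  have dQ: "((\<lambda>u. Phi ?Q x (\<sigma> + u *\<^sub>R Z)) has_real_derivative Phi_q f x \<sigma> Z - tensor_q N \<alpha> \<beta> x \<sigma> Z) (at 0)"
    if x: "x \<in> PD" for x
    unfolding Phi_diff Phi_tensor[OF PD_Herm[OF x] Herm_line[OF h(3) Z]]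
    by (intro DERIV_diff Phi_q_has_derivative f x pd Z tensor_has_derivative)
  define w where "w = (\<lambda>u. Phi ?Q \<tau>' (\<sigma> + u *\<^sub>R Z) - Phi ?Q \<tau> (\<sigma> + u *\<^sub>R Z))"
  have dw: "(w has_real_derivative (Phi_q f \<tau>' \<sigma> Z - tensor_q N \<alpha> \<beta> \<tau>' \<sigma> Z) -
      (Phi_q f \<tau> \<sigma> Z - tensor_q N \<alpha> \<beta> \<tau> \<sigma> Z)) (at 0)"
    unfolding w_def by (intro DERIV_diff dQ pd)
  have "\<forall>\<^sub>F u in at 0. eigs (\<sigma> + u *\<^sub>R Z) \<subseteq> thicken S \<delta>"
    by (rule eventually_nhds_at[OF eventually_eigs_line[OF h(3) Z near(3,4)]])
  then have "\<forall>\<^sub>F u in at 0. \<bar>w u - w 0\<bar> \<le> (C * (e * \<delta>) * norm (\<tau>' - \<tau>) * norm Z) * \<bar>u\<bar>"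
  proof eventually_elim
    case (elim u)
    have sub: "eigs \<sigma> \<subseteq> thicken S \<delta>" using near(3) thicken_mono[of \<delta>' \<delta> S] near(4) by auto
    have "\<bar>Phi ?Q \<tau>' (\<sigma> + u *\<^sub>R Z) - Phi ?Q \<tau>' \<sigma> - Phi ?Q \<tau> (\<sigma> + u *\<^sub>R Z) + Phi ?Q \<tau> \<sigma>\<bar>
        \<le> C * (e * \<delta>) * (norm (\<tau>' - \<tau>) * norm ((\<sigma> + u *\<^sub>R Z) - \<sigma>))"
    proof (rule mixed_bound)
      fix p p' q q' assume "p \<in> eigs \<tau>" "p' \<in> eigs \<tau>'" "q \<in> eigs \<sigma>" "q' \<in> eigs (\<sigma> + u *\<^sub>R Z)"
      then have "p \<in> thicken R \<delta>" "p' \<in> thicken R \<delta>" "q \<in> thicken S \<delta>" "q' \<in> thicken S \<delta>"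
        using near(1,2) sub elim by auto
      then show "\<bar>mixed_diff ?Q p p' q q'\<bar> \<le> e * \<delta> * (\<bar>p' - p\<bar> * \<bar>q' - q\<bar>)"
        using sm unfolding small_at_def by blast
    qed (use h e Herm_line[OF h(3) Z] in auto)
    then show ?case by (simp add: w_def algebra_simps)
  qed
  then show ?thesis by (rule DERIV_unique_bound[OF dw])
qed

text \<open>By \<open>Phi_q_diff_bound\<close> the increments of the error of the first derivative
  are arbitrarily small multiples of |t|, so the tensor polynomial alone determines the
  derivative.\<close>

lemma Phi_q_line_has_derivative:
  fixes \<tau> \<sigma> Y Z :: "complex^'n^'n"
  assumes f: "tensor_approx f" and pd: "\<tau> \<in> PD" "\<sigma> \<in> PD" and YZ: "Y \<in> Herm" "Z \<in> Herm"
    and sm: "small_near (\<lambda>p q. f p q - (\<Sum>k<N. poly (\<alpha> k) p * poly (\<beta> k) q)) (eigs \<tau>) (eigs \<sigma>)"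
  shows "((\<lambda>t. Phi_q f (\<tau> + t *\<^sub>R Y) \<sigma> Z) has_real_derivative tensor_pq N \<alpha> \<beta> \<tau> \<sigma> Y Z) (at 0)"
proof -
  note h = pd[THEN PD_Herm]
  define w where "w = (\<lambda>t. Phi_q f (\<tau> + t *\<^sub>R Y) \<sigma> Z - tensor_q N \<alpha> \<beta> (\<tau> + t *\<^sub>R Y) \<sigma> Z)"
  have "(w has_real_derivative 0) (at 0)"
  proof (rule has_real_derivative_zeroI)
    fix e :: real assume e: "0 < e"
    define D where "D = C * (norm Y * norm Z) + 1"
    have D: "0 < D" using C by (simp add: D_def add_nonneg_pos)
    have e1: "0 < e / D" using e D by simp
    obtain b where bb: "0 < b \<and> (\<forall>\<delta>. 0 < \<delta> \<longrightarrow> \<delta> < b \<longrightarrow>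
        small_at (\<lambda>p q. f p q - (\<Sum>k<N. poly (\<alpha> k) p * poly (\<beta> k) q)) (eigs \<tau>) (eigs \<sigma>) (e / D) \<delta>)"
      using small_nearD[OF sm e1] by (elim exE)
    note b = conjunct1[OF bb] conjunct2[OF bb, rule_format]
    define \<delta> where "\<delta> = min 1 (b / 2)"
    have \<delta>: "0 < \<delta>" "\<delta> < b" "\<delta> \<le> 1" using b(1) by (auto simp: \<delta>_def)
    have "\<forall>\<^sub>F t in at 0. eigs (\<tau> + t *\<^sub>R Y) \<subseteq> thicken (eigs \<tau>) \<delta>"
      using eigs_thicken_self[of 0 \<tau>] \<delta>(1) by (intro eventually_nhds_at eventually_eigs_line[OF h(1) YZ(1)]) auto
    moreover have "\<forall>\<^sub>F t in at 0. \<tau> + t *\<^sub>R Y \<in> PD" by (intro eventually_nhds_at eventually_PD_line pd YZ)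
    ultimately show "\<forall>\<^sub>F t in at 0. \<bar>w t - w 0\<bar> \<le> e * \<bar>t\<bar>"
    proof eventually_elim
      case (elim t)
      have "\<bar>w t - w 0\<bar> \<le> C * (e / D * \<delta>) * norm ((\<tau> + t *\<^sub>R Y) - \<tau>) * norm Z"
        unfolding w_def
        using Phi_q_diff_bound[OF f pd(1) elim(2) pd(2) YZ(2) b(2)[OF \<delta>(1,2)] _ _ _ elim(1), of 0]
          e1 \<delta>(1) eigs_thicken_self[of 0 \<sigma>] eigs_thicken_self[of \<delta> \<tau>] by simp
      also have "\<dots> = (C * (norm Y * norm Z)) * (e / D) * \<delta> * \<bar>t\<bar>" by simp
      also have "\<dots> \<le> D * (e / D) * 1 * \<bar>t\<bar>"
        using C e1 \<delta> D by (intro mult_mono mult_nonneg_nonneg) (auto simp: D_def)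
      also have "\<dots> = e * \<bar>t\<bar>" using D by simp
      finally show ?case .
    qed
  qed
  then have "((\<lambda>t. w t + tensor_q N \<alpha> \<beta> (\<tau> + t *\<^sub>R Y) \<sigma> Z) has_real_derivative tensor_pq N \<alpha> \<beta> \<tau> \<sigma> Y Z) (at 0)"
    by (rule DERIV_cong[OF DERIV_add[OF _ tensor_has_derivative(2)]]) simp
  then show ?thesis by (simp add: w_def)
qed

lemma Phi_pq_eq_tensor_pq:
  fixes \<tau> \<sigma> Y Z :: "complex^'n^'n"
  assumes "tensor_approx f" "\<tau> \<in> PD" "\<sigma> \<in> PD" "Y \<in> Herm" "Z \<in> Herm"
    "small_near (\<lambda>p q. f p q - (\<Sum>k<N. poly (\<alpha> k) p * poly (\<beta> k) q)) (eigs \<tau>) (eigs \<sigma>)"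
  shows "Phi_pq f \<tau> \<sigma> Y Z = tensor_pq N \<alpha> \<beta> \<tau> \<sigma> Y Z"
  unfolding Phi_pq_def by (rule DERIV_imp_deriv[OF Phi_q_line_has_derivative[OF assms]])

text \<open>Every pair of positive definite matrices has an osculating polynomial of its own, so the
  second derivative exists everywhere and not only at one centre of approximation.\<close>

lemma Phi_q_line_differentiable:
  fixes \<tau> \<sigma> Y Z :: "complex^'n^'n"
  assumes "tensor_approx f" "\<tau> \<in> PD" "\<sigma> \<in> PD" "Y \<in> Herm" "Z \<in> Herm"
  shows "((\<lambda>t. Phi_q f (\<tau> + t *\<^sub>R Y) \<sigma> Z) has_real_derivative Phi_pq f \<tau> \<sigma> Y Z) (at 0)"
proof -
  obtain N :: nat and \<alpha> \<beta> where
    s: "small_near (\<lambda>p q. f p q - (\<Sum>k<N. poly (\<alpha> k) p * poly (\<beta> k) q)) (eigs \<tau>) (eigs \<sigma>)"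
    using tensor_approxD[OF assms(1-3)] by (elim exE)
  from Phi_q_line_has_derivative[OF assms s] show ?thesis by (simp add: Phi_pq_eq_tensor_pq[OF assms s])
qed

text \<open>Two polynomials are involved: existence of the derivative at the pair comes from the one
  osculating there, whereas the estimate compares with the one that is good near \<open>R\<close>
  and \<open>S\<close>, the spectra of another pair.\<close>

lemma Phi_pq_bound:
  fixes \<tau> \<sigma> Y Z :: "complex^'n^'n"
  assumes f: "tensor_approx f" and pd: "\<tau> \<in> PD" "\<sigma> \<in> PD" and YZ: "Y \<in> Herm" "Z \<in> Herm"
    and sm: "small_at (\<lambda>p q. f p q - (\<Sum>k<N. poly (\<alpha> k) p * poly (\<beta> k) q)) R S e \<delta>" and e: "0 \<le> e" "0 \<le> \<delta>"
    and near: "eigs \<tau> \<subseteq> thicken R \<delta>'" "eigs \<sigma> \<subseteq> thicken S \<delta>'" "\<delta>' < \<delta>"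
  shows "\<bar>Phi_pq f \<tau> \<sigma> Y Z - tensor_pq N \<alpha> \<beta> \<tau> \<sigma> Y Z\<bar> \<le> C * (e * \<delta>) * (norm Y * norm Z)"
proof -
  note h = pd[THEN PD_Herm]
  define w where "w = (\<lambda>t. Phi_q f (\<tau> + t *\<^sub>R Y) \<sigma> Z - tensor_q N \<alpha> \<beta> (\<tau> + t *\<^sub>R Y) \<sigma> Z)"
  have dw: "(w has_real_derivative Phi_pq f \<tau> \<sigma> Y Z - tensor_pq N \<alpha> \<beta> \<tau> \<sigma> Y Z) (at 0)"
    unfolding w_def by (intro DERIV_diff Phi_q_line_differentiable tensor_has_derivative f pd YZ)
  have sub: "eigs \<tau> \<subseteq> thicken R \<delta>" using near(1) thicken_mono[of \<delta>' \<delta> R] near(3) by auto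
  have "\<forall>\<^sub>F t in at 0. eigs (\<tau> + t *\<^sub>R Y) \<subseteq> thicken R \<delta>"
    by (rule eventually_nhds_at[OF eventually_eigs_line[OF h(1) YZ(1) near(1,3)]])
  moreover have "\<forall>\<^sub>F t in at 0. \<tau> + t *\<^sub>R Y \<in> PD" by (intro eventually_nhds_at eventually_PD_line pd YZ)
  ultimately have "\<forall>\<^sub>F t in at 0. \<bar>w t - w 0\<bar> \<le> (C * (e * \<delta>) * (norm Y * norm Z)) * \<bar>t\<bar>"
  proof eventually_elim
    case (elim t)
    have "\<bar>w t - w 0\<bar> \<le> C * (e * \<delta>) * norm ((\<tau> + t *\<^sub>R Y) - \<tau>) * norm Z"
      unfolding w_def using Phi_q_diff_bound[OF f pd(1) elim(2) pd(2) YZ(2) sm e sub elim(1) near(2,3)] by simp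
    then show ?case by (simp add: mult_ac)
  qed
  then show ?thesis by (rule DERIV_unique_bound[OF dw])
qed

text \<open>The spectra stay within a multiple of |s| of that of \<rho>, so the factor \<delta> in
  \<open>small_near\<close> becomes |s| and the error is o(s). Separate directions \<open>A\<close>
  and \<open>B\<close> cover both uses: \<open>B = 0\<close> for the connections and
  \<open>A = B\<close> for the derivative of the metric.\<close>

lemma Phi_pq_line_diff_tensor:
  fixes \<rho> A B Y Z :: "complex^'n^'n"
  assumes f: "tensor_approx f" and pd: "\<rho> \<in> PD" and AB: "A \<in> Herm" "B \<in> Herm" and YZ: "Y \<in> Herm" "Z \<in> Herm"
    and sm: "small_near (\<lambda>p q. f p q - (\<Sum>k<N. poly (\<alpha> k) p * poly (\<beta> k) q)) (eigs \<rho>) (eigs \<rho>)"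
  shows "((\<lambda>s. Phi_pq f (\<rho> + s *\<^sub>R A) (\<rho> + s *\<^sub>R B) Y Z - tensor_pq N \<alpha> \<beta> (\<rho> + s *\<^sub>R A) (\<rho> + s *\<^sub>R B) Y Z)
    has_real_derivative 0) (at 0)"
proof (rule has_real_derivative_zeroI)
  note h = pd[THEN PD_Herm]
  let ?w = "\<lambda>s. Phi_pq f (\<rho> + s *\<^sub>R A) (\<rho> + s *\<^sub>R B) Y Z - tensor_pq N \<alpha> \<beta> (\<rho> + s *\<^sub>R A) (\<rho> + s *\<^sub>R B) Y Z"
  fix e :: real assume e: "0 < e"
  \<comment> \<open>Both spectra move by at most \<open>m * \<bar>s\<bar>\<close>. The estimate is
    used at twice this radius, since \<open>Phi_pq_bound\<close> asks for a strict inequality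
    between the radii.\<close>
  define m where "m = K * (norm A + norm B) + 1"
  have m: "0 < m" using K by (simp add: m_def add_nonneg_pos)
  define D where "D = C * (norm Y * norm Z) * (2 * m) + 1"
  have D: "0 < D" using C m by (simp add: D_def add_nonneg_pos)
  have e1: "0 < e / D" using e D by simp
  obtain b where bb: "0 < b \<and> (\<forall>\<delta>. 0 < \<delta> \<longrightarrow> \<delta> < b \<longrightarrow>
      small_at (\<lambda>p q. f p q - (\<Sum>k<N. poly (\<alpha> k) p * poly (\<beta> k) q)) (eigs \<rho>) (eigs \<rho>) (e / D) \<delta>)"
    using small_nearD[OF sm e1] by (elim exE)
  note b = conjunct1[OF bb] conjunct2[OF bb, rule_format]
  have w0: "?w 0 = 0" using Phi_pq_eq_tensor_pq[OF f pd pd YZ sm] by simp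
  have "((\<lambda>s. 2 * m * \<bar>s\<bar>) \<longlongrightarrow> 2 * m * \<bar>0\<bar>) (at (0::real))" by (intro tendsto_intros)
  then have "\<forall>\<^sub>F s in at 0. 2 * m * \<bar>s\<bar> < b" using b(1) by (intro order_tendstoD(2)) auto
  moreover have "\<forall>\<^sub>F s in at 0. \<rho> + s *\<^sub>R A \<in> PD" "\<forall>\<^sub>F s in at 0. \<rho> + s *\<^sub>R B \<in> PD"
    by (intro eventually_nhds_at eventually_PD_line pd AB)+
  moreover have "\<forall>\<^sub>F s in at (0::real). s \<noteq> 0" by (simp add: eventually_at_filter)
  ultimately show "\<forall>\<^sub>F s in at 0. \<bar>?w s - ?w 0\<bar> \<le> e * \<bar>s\<bar>"
  proof eventually_elim
    case (elim s)
    have pos: "0 < m * \<bar>s\<bar>" using m elim(4) by simp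
    have KA: "K * norm A \<le> m" "K * norm B \<le> m"
      using K by (auto simp: m_def distrib_left intro: add_increasing2 add_increasing)
    have near: "eigs (\<rho> + s *\<^sub>R A) \<subseteq> thicken (eigs \<rho>) (m * \<bar>s\<bar>)" "eigs (\<rho> + s *\<^sub>R B) \<subseteq> thicken (eigs \<rho>) (m * \<bar>s\<bar>)"
      using mult_right_mono[OF KA(1), of "\<bar>s\<bar>"] mult_right_mono[OF KA(2), of "\<bar>s\<bar>"]
      by (intro eigs_subset_thicken[OF h Herm_line[OF h AB(1)] eigs_thicken_self[of 0 \<rho>]]
        eigs_subset_thicken[OF h Herm_line[OF h AB(2)] eigs_thicken_self[of 0 \<rho>]]; simp add: mult_ac)+
    have "\<bar>?w s\<bar> \<le> C * (e / D * (2 * m * \<bar>s\<bar>)) * (norm Y * norm Z)"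
      by (rule Phi_pq_bound[OF f elim(2,3) YZ b(2) _ _ near]) (use pos elim(1) e1 in auto)
    also have "\<dots> = (C * (norm Y * norm Z) * (2 * m)) * (e / D) * \<bar>s\<bar>" by simp
    also have "\<dots> \<le> D * (e / D) * \<bar>s\<bar>"
      using e1 by (intro mult_right_mono) (auto simp: D_def)
    also have "\<dots> = e * \<bar>s\<bar>" using D by simp
    finally show ?case unfolding w0 by simp
  qed
qed

lemma Phi_derivatives_aux:
  fixes \<rho> :: "complex^'n^'n"
  assumes f: "tensor_approx f" and \<rho>: "\<rho> \<in> PD"
  shows "\<exists>(N :: nat) \<alpha> \<beta>.
    small_near (\<lambda>p q. f p q - (\<Sum>k<N. poly (\<alpha> k) p * poly (\<beta> k) q)) (eigs \<rho>) (eigs \<rho>) \<and>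
    (\<forall>Y\<in>Herm. \<forall>Z\<in>Herm. Phi_pq f \<rho> \<rho> Y Z = tensor_pq N \<alpha> \<beta> \<rho> \<rho> Y Z) \<and>
    (\<forall>X\<in>Herm. \<forall>Y\<in>Herm. \<forall>Z\<in>Herm.
      ((\<lambda>s. Phi_pq f (\<rho> + s *\<^sub>R X) \<rho> Y Z) has_real_derivative tensor_ppq N \<alpha> \<beta> \<rho> \<rho> X Y Z) (at 0) \<and>
      ((\<lambda>s. Phi_pq (\<lambda>p q. f q p) (\<rho> + s *\<^sub>R X) \<rho> Y Z) has_real_derivative tensor_ppq N \<beta> \<alpha> \<rho> \<rho> X Y Z) (at 0) \<and>
      ((\<lambda>s. Phi_pq f (\<rho> + s *\<^sub>R X) (\<rho> + s *\<^sub>R X) Y Z) has_real_derivative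
        tensor_ppq N \<alpha> \<beta> \<rho> \<rho> X Y Z + tensor_ppq N \<beta> \<alpha> \<rho> \<rho> X Z Y) (at 0))"
proof -
  note eq = Phi_pq_eq_tensor_pq and line = Phi_pq_line_diff_tensor
  obtain N :: nat and \<alpha> \<beta> where
    s: "small_near (\<lambda>p q. f p q - (\<Sum>k<N. poly (\<alpha> k) p * poly (\<beta> k) q)) (eigs \<rho>) (eigs \<rho>)"
    using tensor_approxD[OF f \<rho> \<rho>] by (elim exE)
  \<comment> \<open>The exchanged polynomial osculates the exchanged \<open>f\<close>, so both
    entropies are treated with the same data.\<close>
  have s': "small_near (\<lambda>p q. f q p - (\<Sum>k<N. poly (\<beta> k) p * poly (\<alpha> k) q)) (eigs \<rho>) (eigs \<rho>)"
    using small_near_swap[OF s] by (simp add: mult.commute)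
  have z: "(0 :: complex^'n^'n) \<in> Herm" by (rule subspace_0[OF subspace_Herm])
  show ?thesis
  proof (intro exI conjI ballI)
    show "small_near (\<lambda>p q. f p q - (\<Sum>k<N. poly (\<alpha> k) p * poly (\<beta> k) q)) (eigs \<rho>) (eigs \<rho>)" by (rule s)
    fix Y Z :: "complex^'n^'n" assume YZ: "Y \<in> Herm" "Z \<in> Herm"
    show "Phi_pq f \<rho> \<rho> Y Z = tensor_pq N \<alpha> \<beta> \<rho> \<rho> Y Z" by (rule eq[OF f \<rho> \<rho> YZ s])
  next
    fix X Y Z :: "complex^'n^'n" assume X: "X \<in> Herm" and YZ: "Y \<in> Herm" "Z \<in> Herm"
    have "((\<lambda>s. Phi_pq f (\<rho> + s *\<^sub>R X) \<rho> Y Z - tensor_pq N \<alpha> \<beta> (\<rho> + s *\<^sub>R X) \<rho> Y Z) has_real_derivative 0) (at 0)"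
      using line[OF f \<rho> X z YZ s] by simp
    from DERIV_add[OF this tensor_has_derivative(3)[where N = N and \<alpha> = \<alpha> and \<beta> = \<beta> and \<tau> = \<rho> and \<sigma> = \<rho> and X = X
      and Y = Y and Z = Z]]
    show "((\<lambda>s. Phi_pq f (\<rho> + s *\<^sub>R X) \<rho> Y Z) has_real_derivative tensor_ppq N \<alpha> \<beta> \<rho> \<rho> X Y Z) (at 0)" by simp
    have "((\<lambda>s. Phi_pq (\<lambda>p q. f q p) (\<rho> + s *\<^sub>R X) \<rho> Y Z - tensor_pq N \<beta> \<alpha> (\<rho> + s *\<^sub>R X) \<rho> Y Z) has_real_derivative
        0) (at 0)"
      using line[OF tensor_approx_swap[OF f] \<rho> X z YZ s'] by simp
    from DERIV_add[OF this tensor_has_derivative(3)[where N = N and \<alpha> = \<beta> and \<beta> = \<alpha> and \<tau> = \<rho> and \<sigma> = \<rho> and X = X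
      and Y = Y and Z = Z]]
    show "((\<lambda>s. Phi_pq (\<lambda>p q. f q p) (\<rho> + s *\<^sub>R X) \<rho> Y Z) has_real_derivative tensor_ppq N \<beta> \<alpha> \<rho> \<rho> X Y Z) (at 0)"
      by simp
    from DERIV_add[OF line[OF f \<rho> X X YZ s] tensor_has_derivative(4)[where N = N and \<alpha> = \<alpha> and \<beta> = \<beta> and \<tau> = \<rho>
      and \<sigma> = \<rho> and X = X and Y = Y and Z = Z]]
    show "((\<lambda>s. Phi_pq f (\<rho> + s *\<^sub>R X) (\<rho> + s *\<^sub>R X) Y Z) has_real_derivative
        tensor_ppq N \<alpha> \<beta> \<rho> \<rho> X Y Z + tensor_ppq N \<beta> \<alpha> \<rho> \<rho> X Z Y) (at 0)" by simp
  qed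
qed

end

text \<open>One tensor polynomial for all derivatives at \<rho>, and, with its factors exchanged,
  also for the exchanged \<open>f\<close>. The two connections and the derivative of the metric are
  then expressed by the same terms and can be compared directly.\<close>

lemma Phi_derivatives:
  fixes \<rho> :: "complex^'n::finite^'n"
  assumes f: "tensor_approx f" and \<rho>: "\<rho> \<in> PD"
  shows "\<exists>(N :: nat) \<alpha> \<beta>.
    small_near (\<lambda>p q. f p q - (\<Sum>k<N. poly (\<alpha> k) p * poly (\<beta> k) q)) (eigs \<rho>) (eigs \<rho>) \<and>
    (\<forall>Y\<in>Herm. \<forall>Z\<in>Herm. Phi_pq f \<rho> \<rho> Y Z = tensor_pq N \<alpha> \<beta> \<rho> \<rho> Y Z) \<and>
    (\<forall>X\<in>Herm. \<forall>Y\<in>Herm. \<forall>Z\<in>Herm.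
      ((\<lambda>s. Phi_pq f (\<rho> + s *\<^sub>R X) \<rho> Y Z) has_real_derivative tensor_ppq N \<alpha> \<beta> \<rho> \<rho> X Y Z) (at 0) \<and>
      ((\<lambda>s. Phi_pq (\<lambda>p q. f q p) (\<rho> + s *\<^sub>R X) \<rho> Y Z) has_real_derivative tensor_ppq N \<beta> \<alpha> \<rho> \<rho> X Y Z) (at 0) \<and>
      ((\<lambda>s. Phi_pq f (\<rho> + s *\<^sub>R X) (\<rho> + s *\<^sub>R X) Y Z) has_real_derivative
        tensor_ppq N \<alpha> \<beta> \<rho> \<rho> X Y Z + tensor_ppq N \<beta> \<alpha> \<rho> \<rho> X Z Y) (at 0))"
proof (rule Phi_diff_bounds[where ?'n = 'n], rule eigs_near[where ?'n = 'n])
  fix C K :: real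
  assume "0 < C"
    and "\<And>(\<tau> :: complex^'n^'n) \<tau>' \<sigma> f L. \<tau> \<in> Herm \<Longrightarrow> \<tau>' \<in> Herm \<Longrightarrow> \<sigma> \<in> Herm \<Longrightarrow> 0 \<le> L \<Longrightarrow>
      (\<And>p p' q. p \<in> eigs \<tau> \<Longrightarrow> p' \<in> eigs \<tau>' \<Longrightarrow> q \<in> eigs \<sigma> \<Longrightarrow> \<bar>f p' q - f p q\<bar> \<le> L * \<bar>p' - p\<bar>) \<Longrightarrow>
      \<bar>Phi f \<tau>' \<sigma> - Phi f \<tau> \<sigma>\<bar> \<le> C * L * norm (\<tau>' - \<tau>)"
    and "\<And>(\<tau> :: complex^'n^'n) \<tau>' \<sigma> \<sigma>' f L. \<tau> \<in> Herm \<Longrightarrow> \<tau>' \<in> Herm \<Longrightarrow> \<sigma> \<in> Herm \<Longrightarrow> \<sigma>' \<in> Herm \<Longrightarrow> 0 \<le> L \<Longrightarrow>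
      (\<And>p p' q q'. p \<in> eigs \<tau> \<Longrightarrow> p' \<in> eigs \<tau>' \<Longrightarrow> q \<in> eigs \<sigma> \<Longrightarrow> q' \<in> eigs \<sigma>' \<Longrightarrow>
        \<bar>mixed_diff f p p' q q'\<bar> \<le> L * (\<bar>p' - p\<bar> * \<bar>q' - q\<bar>)) \<Longrightarrow>
      \<bar>Phi f \<tau>' \<sigma>' - Phi f \<tau>' \<sigma> - Phi f \<tau> \<sigma>' + Phi f \<tau> \<sigma>\<bar> \<le> C * L * (norm (\<tau>' - \<tau>) * norm (\<sigma>' - \<sigma>))"
    and "0 < K"
    and "\<And>(\<tau> :: complex^'n^'n) \<tau>' c'. \<tau> \<in> Herm \<Longrightarrow> \<tau>' \<in> Herm \<Longrightarrow> c' \<in> eigs \<tau>' \<Longrightarrow>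
     \<exists>c\<in>eigs \<tau>. \<bar>c' - c\<bar> \<le> K * norm (\<tau>' - \<tau>)"
  then show ?thesis by (rule Phi_derivatives_aux[OF _ _ _ _ _ f \<rho>])
qed

section \<open>Second derivatives in spectral coordinates\<close>

text \<open>The first divided difference of the k-th power, by the recursion that mirrors
  \<open>mat_pow_d\<close>; unlike a quotient it has the right value at p = p' too.\<close>

primrec pow_dd :: "real \<Rightarrow> real \<Rightarrow> nat \<Rightarrow> real" where
  "pow_dd p p' 0 = 0"
| "pow_dd p p' (Suc k) = p * pow_dd p p' k + p' ^ k"

lemma pow_dd_eq: "(p' - p) * pow_dd p p' k = p' ^ k - p ^ k"
proof (induction k)
  case (Suc k)
  have "(p' - p) * pow_dd p p' (Suc k) = p * ((p' - p) * pow_dd p p' k) + (p' - p) * p' ^ k"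
    by (simp add: algebra_simps)
  then show ?case unfolding Suc by (simp add: algebra_simps)
qed simp

lemma pow_dd_self: "pow_dd p p k = real k * p ^ (k - 1)"
proof (induction k)
  case (Suc k)
  then show ?case by (cases k) (simp_all add: algebra_simps)
qed simp

text \<open>The Daletskii-Krein formula for powers: between two eigenspaces, the derivative
  multiplies the direction by a divided difference at the two eigenvalues.\<close>

lemma eig_proj_mat_pow_d:
  fixes \<rho> :: "complex^'n::finite^'n"
  assumes h: "\<rho> \<in> Herm"
  shows "eig_proj \<rho> p ** mat_pow_d \<rho> Y k ** eig_proj \<rho> p' = pow_dd p p' k *\<^sub>R (eig_proj \<rho> p ** Y ** eig_proj \<rho> p')"
proof (induction k)
  case (Suc k)
  have pw: "mat_pow \<rho> k ** eig_proj \<rho> p' = p' ^ k *\<^sub>R eig_proj \<rho> p'" for k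
    by (induction k) (simp_all add: matrix_mul_assoc[symmetric] matmul.scaleR_right eig_proj_left[OF h])
  have "eig_proj \<rho> p ** mat_pow_d \<rho> Y (Suc k) ** eig_proj \<rho> p' =
      (eig_proj \<rho> p ** \<rho>) ** mat_pow_d \<rho> Y k ** eig_proj \<rho> p' + eig_proj \<rho> p ** Y ** (mat_pow \<rho> k ** eig_proj \<rho> p')"
    by (simp add: matmul.add_left matmul.add_right matrix_mul_assoc)
  also have "\<dots> = p *\<^sub>R (eig_proj \<rho> p ** mat_pow_d \<rho> Y k ** eig_proj \<rho> p') +
      p' ^ k *\<^sub>R (eig_proj \<rho> p ** Y ** eig_proj \<rho> p')"
    by (simp add: pw eig_proj_right[OF h] matmul.scaleR_left matmul.scaleR_right)
  finally show ?case unfolding Suc by (simp add: scaleR_left_distrib)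
qed (simp add: matmul.zero_left matmul.zero_right)

definition poly_dd :: "real poly \<Rightarrow> real \<Rightarrow> real \<Rightarrow> real" where
  "poly_dd c p p' = (\<Sum>i\<le>degree c. coeff c i * pow_dd p p' i)"

lemma poly_dd_eq: "(p' - p) * poly_dd c p p' = poly c p' - poly c p"
  unfolding poly_dd_def poly_altdef sum_distrib_left sum_subtractf[symmetric]
    mult.left_commute[of "p' - p"] pow_dd_eq right_diff_distrib ..

lemma poly_dd_self: "poly_dd c p p = poly (pderiv c) p"
proof -
  have "((\<lambda>x. \<Sum>i\<le>degree c. coeff c i * x ^ i) has_real_derivative poly_dd c p p) (at p)"
    unfolding poly_dd_def pow_dd_self by (auto intro!: derivative_eq_intros sum.cong simp: mult_ac)
  moreover have "(\<lambda>x. \<Sum>i\<le>degree c. coeff c i * x ^ i) = poly c" by (simp add: fun_eq_iff poly_altdef)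
  ultimately show ?thesis using poly_DERIV[of c p] DERIV_unique by metis
qed

lemma eig_proj_mat_poly_d:
  fixes \<rho> :: "complex^'n::finite^'n"
  assumes h: "\<rho> \<in> Herm"
  shows "eig_proj \<rho> p ** mat_poly_d c \<rho> Y ** eig_proj \<rho> p' = poly_dd c p p' *\<^sub>R (eig_proj \<rho> p ** Y ** eig_proj \<rho> p')"
  unfolding mat_poly_d_def matmul.sum_right matmul.sum_left matmul.scaleR_right matmul.scaleR_left
    eig_proj_mat_pow_d[OF h]
  by (simp add: poly_dd_def scaleR_sum_left)

lemma re_trace_mult_decomp:
  fixes \<rho> A B :: "complex^'n::finite^'n"
  assumes h: "\<rho> \<in> Herm"
  shows "re_trace (A ** B) = (\<Sum>p\<in>eigs \<rho>. \<Sum>p'\<in>eigs \<rho>.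
    re_trace ((eig_proj \<rho> p ** A ** eig_proj \<rho> p') ** (eig_proj \<rho> p' ** B ** eig_proj \<rho> p)))"
proof -
  have "(\<Sum>p\<in>eigs \<rho>. \<Sum>p'\<in>eigs \<rho>. re_trace ((eig_proj \<rho> p ** A ** eig_proj \<rho> p') **
      (eig_proj \<rho> p' ** B ** eig_proj \<rho> p))) =
      (\<Sum>p\<in>eigs \<rho>. \<Sum>p'\<in>eigs \<rho>. re_trace (eig_proj \<rho> p ** A ** eig_proj \<rho> p' ** B))"
  proof (intro sum.cong refl)
    fix p p'
    have "re_trace ((eig_proj \<rho> p ** A ** eig_proj \<rho> p') ** (eig_proj \<rho> p' ** B ** eig_proj \<rho> p)) =
        re_trace (((eig_proj \<rho> p ** A ** eig_proj \<rho> p') ** (eig_proj \<rho> p' ** B)) ** eig_proj \<rho> p)"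
      by (simp add: matrix_mul_assoc)
    also have "\<dots> = re_trace (eig_proj \<rho> p ** ((eig_proj \<rho> p ** A ** eig_proj \<rho> p') ** (eig_proj \<rho> p' ** B)))"
      by (rule re_trace_commute)
    also have "\<dots> = re_trace ((eig_proj \<rho> p ** eig_proj \<rho> p) ** A ** (eig_proj \<rho> p' ** eig_proj \<rho> p') ** B)"
      by (simp add: matrix_mul_assoc)
    finally show "re_trace ((eig_proj \<rho> p ** A ** eig_proj \<rho> p') ** (eig_proj \<rho> p' ** B ** eig_proj \<rho> p)) =
        re_trace (eig_proj \<rho> p ** A ** eig_proj \<rho> p' ** B)" by (simp add: eig_proj_mult[OF h])
  qed
  also have "\<dots> = re_trace ((\<Sum>p\<in>eigs \<rho>. eig_proj \<rho> p) ** A ** (\<Sum>p'\<in>eigs \<rho>. eig_proj \<rho> p') ** B)"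
    unfolding matmul.sum_left matmul.sum_right re_trace_sum by (rule sum.swap)
  finally show ?thesis by (simp add: sum_eig_proj[OF h])
qed

lemma tensor_pq_decomp:
  fixes \<rho> Y Z :: "complex^'n::finite^'n"
  assumes h: "\<rho> \<in> Herm"
  shows "tensor_pq N \<alpha> \<beta> \<rho> \<rho> Y Z = (\<Sum>p\<in>eigs \<rho>. \<Sum>p'\<in>eigs \<rho>.
    (\<Sum>k<N. poly_dd (\<alpha> k) p p' * poly_dd (\<beta> k) p' p) *
    re_trace ((eig_proj \<rho> p ** Y ** eig_proj \<rho> p') ** (eig_proj \<rho> p' ** Z ** eig_proj \<rho> p)))"
proof -
  have "tensor_pq N \<alpha> \<beta> \<rho> \<rho> Y Z = (\<Sum>k<N. \<Sum>p\<in>eigs \<rho>. \<Sum>p'\<in>eigs \<rho>.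
    poly_dd (\<alpha> k) p p' * poly_dd (\<beta> k) p' p *
    re_trace ((eig_proj \<rho> p ** Y ** eig_proj \<rho> p') ** (eig_proj \<rho> p' ** Z ** eig_proj \<rho> p)))"
    unfolding tensor_pq_def re_trace_mult_decomp[OF h, of "mat_poly_d _ _ _"] eig_proj_mat_poly_d[OF h]
    by (simp add: matmul.scaleR_left matmul.scaleR_right re_trace_scaleR mult_ac)
  also have "\<dots> = (\<Sum>p\<in>eigs \<rho>. \<Sum>p'\<in>eigs \<rho>. \<Sum>k<N.
    poly_dd (\<alpha> k) p p' * poly_dd (\<beta> k) p' p *
    re_trace ((eig_proj \<rho> p ** Y ** eig_proj \<rho> p') ** (eig_proj \<rho> p' ** Z ** eig_proj \<rho> p)))"
    by (rule trans[OF sum.swap sum.cong[OF refl sum.swap]])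
  finally show ?thesis by (simp add: sum_distrib_right)
qed

lemma mixed_diff_sub: "mixed_diff (\<lambda>p q. f p q - g p q) p p' q q' = mixed_diff f p p' q q' - mixed_diff g p p' q q'"
  by (simp add: mixed_diff_def)

lemma mixed_diff_tensor:
  "mixed_diff (\<lambda>p q. \<Sum>k<N. poly (\<alpha> k) p * poly (\<beta> k) q) p p' q q' =
    (\<Sum>k<N. (poly (\<alpha> k) p' - poly (\<alpha> k) p) * (poly (\<beta> k) q' - poly (\<beta> k) q))"
  unfolding mixed_diff_def sum_subtractf[symmetric] sum.distrib[symmetric]
  by (intro sum.cong refl) (simp add: algebra_simps)

text \<open>The eigenvalues themselves belong to every thickened set, so the mixed difference of the
  error at them is bounded by a multiple of \<delta> for all small \<delta> and therefore vanishes.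
  The coefficient can thus be read off from \<open>f\<close>.\<close>

lemma tensor_coefficient_distinct:
  fixes N :: nat
  assumes s: "small_near (\<lambda>p q. f p q - (\<Sum>k<N. poly (\<alpha> k) p * poly (\<beta> k) q)) R R"
    and p: "p \<in> R" "p' \<in> R" "p \<noteq> p'"
  shows "(\<Sum>k<N. poly_dd (\<alpha> k) p p' * poly_dd (\<beta> k) p' p) = mixed_diff f p p' p p' / (p' - p)\<^sup>2"
proof -
  let ?Q = "\<lambda>p q. f p q - (\<Sum>k<N. poly (\<alpha> k) p * poly (\<beta> k) q)"
  obtain b where bb: "0 < b \<and> (\<forall>\<delta>. 0 < \<delta> \<longrightarrow> \<delta> < b \<longrightarrow> small_at ?Q R R 1 \<delta>)"
    using small_nearD[OF s, of 1] by (simp, elim exE)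
  have in_thick: "x \<in> thicken R \<delta>" if "x \<in> R" "0 < \<delta>" for x \<delta>
    unfolding thicken_def using that by (intro CollectI bexI[of _ x]) auto
  have "\<forall>\<^sub>F \<delta> in at_right 0. \<bar>mixed_diff ?Q p p' p p'\<bar> \<le> 1 * \<delta> * (\<bar>p' - p\<bar> * \<bar>p' - p\<bar>)"
  proof -
    have "\<forall>\<^sub>F \<delta> in at_right 0. \<delta> \<in> {0<..<b}" using bb by (intro eventually_at_right_real) simp
    then show ?thesis
    proof eventually_elim
      case (elim \<delta>)
      then have d: "0 < \<delta>" "\<delta> < b" by auto
      have sm: "small_at ?Q R R 1 \<delta>" by (rule conjunct2[OF bb, rule_format, OF d])
      show ?case
        by (rule sm[unfolded small_at_def, rule_format, OF in_thick[OF p(1) d(1)] in_thick[OF p(2) d(1)]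
          in_thick[OF p(1) d(1)] in_thick[OF p(2) d(1)], THEN conjunct1])
    qed
  qed
  moreover have "((\<lambda>\<delta>. 1 * \<delta> * (\<bar>p' - p\<bar> * \<bar>p' - p\<bar>)) \<longlongrightarrow> 1 * 0 * (\<bar>p' - p\<bar> * \<bar>p' - p\<bar>)) (at_right 0)"
    by (intro tendsto_intros)
  ultimately have "\<bar>mixed_diff ?Q p p' p p'\<bar> \<le> 1 * 0 * (\<bar>p' - p\<bar> * \<bar>p' - p\<bar>)"
    by (intro tendsto_lowerbound[of _ _ "at_right (0::real)"]) auto
  then have "mixed_diff f p p' p p' = (\<Sum>k<N. (poly (\<alpha> k) p' - poly (\<alpha> k) p) * (poly (\<beta> k) p' - poly (\<beta> k) p))"
    by (simp add: mixed_diff_sub mixed_diff_tensor)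
  also have "\<dots> = (\<Sum>k<N. poly_dd (\<alpha> k) p p' * poly_dd (\<beta> k) p' p) * (p' - p)\<^sup>2"
    unfolding sum_distrib_right
  proof (intro sum.cong refl)
    fix k
    have "poly (\<beta> k) p' - poly (\<beta> k) p = (p' - p) * poly_dd (\<beta> k) p' p"
      using poly_dd_eq[of p p' "\<beta> k"] by (simp add: algebra_simps)
    then show "(poly (\<alpha> k) p' - poly (\<alpha> k) p) * (poly (\<beta> k) p' - poly (\<beta> k) p) =
        poly_dd (\<alpha> k) p p' * poly_dd (\<beta> k) p' p * (p' - p)\<^sup>2"
      unfolding poly_dd_eq[of p' p "\<alpha> k", symmetric] by (simp add: power2_eq_square mult_ac)
  qed
  finally show ?thesis using p(3) by simp
qed

text \<open>At a repeated eigenvalue the coefficient is a product of derivatives, obtained as a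
  limit of mixed differences. Taking \<delta> = h, which admits the point \<open>p + h\<close>,
  makes the error at most h^3 before the division by h^2.\<close>

lemma tensor_coefficient_same:
  fixes N :: nat
  assumes s: "small_near (\<lambda>p q. f p q - (\<Sum>k<N. poly (\<alpha> k) p * poly (\<beta> k) q)) R R" and p: "p \<in> R"
  shows "((\<lambda>h. mixed_diff f p (p + h) p (p + h) / h\<^sup>2) \<longlongrightarrow>
    (\<Sum>k<N. poly_dd (\<alpha> k) p p * poly_dd (\<beta> k) p p)) (at_right 0)"
proof -
  let ?T = "\<lambda>p q. \<Sum>k<N. poly (\<alpha> k) p * poly (\<beta> k) q"
  let ?Q = "\<lambda>p q. f p q - ?T p q"
  obtain b where bb: "0 < b \<and> (\<forall>\<delta>. 0 < \<delta> \<longrightarrow> \<delta> < b \<longrightarrow> small_at ?Q R R 1 \<delta>)"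
    using small_nearD[OF s, of 1] by (simp, elim exE)
  have ev: "\<forall>\<^sub>F h in at_right 0. h \<in> {0<..<b}" using bb by (intro eventually_at_right_real) simp
  have "((\<lambda>h. mixed_diff ?Q p (p + h) p (p + h) / h\<^sup>2) \<longlongrightarrow> 0) (at_right 0)"
  proof (rule Lim_null_comparison)
    show "\<forall>\<^sub>F h in at_right 0. norm (mixed_diff ?Q p (p + h) p (p + h) / h\<^sup>2) \<le> h"
      using ev
    proof eventually_elim
      case (elim h)
      then have h: "0 < h" "h < b" by auto
      have sm: "small_at ?Q R R 1 h" by (rule conjunct2[OF bb, rule_format, OF h])
      have th: "p \<in> thicken R h" "p + h \<in> thicken R h"
        unfolding thicken_def using p h by (auto intro!: bexI[of _ p])
      have "\<bar>mixed_diff ?Q p (p + h) p (p + h)\<bar> \<le> 1 * h * (\<bar>p + h - p\<bar> * \<bar>p + h - p\<bar>)"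
        by (rule sm[unfolded small_at_def, rule_format, OF th th, THEN conjunct1])
      then have "\<bar>mixed_diff ?Q p (p + h) p (p + h)\<bar> \<le> h * h\<^sup>2" using elim by (simp add: power2_eq_square)
      then show ?case using elim by (simp add: abs_divide pos_divide_le_eq)
    qed
    show "((\<lambda>h. h) \<longlongrightarrow> 0) (at_right (0::real))" by (rule tendsto_ident_at)
  qed
  moreover have "((\<lambda>h. mixed_diff ?T p (p + h) p (p + h) / h\<^sup>2) \<longlongrightarrow>
      (\<Sum>k<N. poly_dd (\<alpha> k) p p * poly_dd (\<beta> k) p p)) (at_right 0)"
  proof -
    have d: "((\<lambda>h. (poly c (p + h) - poly c p) / h) \<longlongrightarrow> poly_dd c p p) (at_right 0)" for c
    proof -
      have "((\<lambda>h. (poly c (p + h) - poly c p) / h) \<longlongrightarrow> poly_dd c p p) (at 0)"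
        using poly_DERIV[of c p] by (simp add: DERIV_def poly_dd_self)
      then show ?thesis by (rule filterlim_mono) (auto intro: at_le)
    qed
    have "((\<lambda>h. \<Sum>k<N. (poly (\<alpha> k) (p + h) - poly (\<alpha> k) p) / h * ((poly (\<beta> k) (p + h) - poly (\<beta> k) p) / h)) \<longlongrightarrow>
      (\<Sum>k<N. poly_dd (\<alpha> k) p p * poly_dd (\<beta> k) p p)) (at_right 0)"
      by (intro tendsto_sum tendsto_mult d)
    then show ?thesis by (simp add: mixed_diff_tensor sum_divide_distrib power2_eq_square)
  qed
  ultimately have "((\<lambda>h. mixed_diff ?Q p (p + h) p (p + h) / h\<^sup>2 + mixed_diff ?T p (p + h) p (p + h) / h\<^sup>2) \<longlongrightarrow>
      0 + (\<Sum>k<N. poly_dd (\<alpha> k) p p * poly_dd (\<beta> k) p p)) (at_right 0)" by (rule tendsto_add)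
  then show ?thesis by (simp add: mixed_diff_sub add_divide_distrib[symmetric])
qed

section \<open>Bounds for the function of a monotone metric\<close>

lemma operator_monotone_mono:
  assumes F: "operator_monotone F" and xy: "0 < x" "x \<le> y"
  shows "F x \<le> F y"
proof -
  let ?U = "1\<^sub>m 1 :: complex mat"
  \<comment> \<open>Matrices of size 1, on which the Loewner order is the order of the
    reals.\<close>
  let ?M = "\<lambda>x :: real. spectral_mat 1 ?U (\<lambda>_. x)"
  have U: "?U \<in> carrier_mat 1 1" by simp
  have adj: "mat_adjoint ?U = ?U" by (rule mat_adjoint_one)
  have car: "?M x \<in> carrier_mat 1 1" for x by (rule spectral_mat_carrier[OF U])
  have entry: "?M x $$ (0, 0) = x" for x
    by (subst spectral_mat_index[OF U]) simp_all
  have diff: "?M y - ?M x = ?M (y - x)" for x y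
  proof (rule eq_matI)
    fix i j assume "i < dim_row (?M (y - x))" "j < dim_col (?M (y - x))"
    then have "i = 0" "j = 0" using carrier_matD[OF car, of "y - x"] by auto
    moreover have "(?M y - ?M x) $$ (0, 0) = ?M y $$ (0, 0) - ?M x $$ (0, 0)"
      using carrier_matD[OF car] by (intro index_minus_mat(1)) simp_all
    ultimately show "(?M y - ?M x) $$ (i, j) = ?M (y - x) $$ (i, j)" using entry by simp
  qed (use carrier_matD[OF car] in simp_all)
  have le: "loewner_le 1 (?M x) (?M y) \<longleftrightarrow> x \<le> y" for x y
  proof
    assume "loewner_le 1 (?M x) (?M y)"
    then have "0 \<le> quad_form (?M (y - x)) (Matrix.vec 1 (\<lambda>_. 1))"
      unfolding loewner_le_def diff pos_semidef_mat_def quad_form_def by simp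
    then show "x \<le> y" by (subst (asm) quad_form_spectral_mat[OF U]) simp_all
  next
    assume "x \<le> y"
    then have "0 \<le> quad_form (?M (y - x)) v" if "v \<in> carrier_vec 1" for v
      by (subst quad_form_spectral_mat[OF U that]) simp
    then show "loewner_le 1 (?M x) (?M y)"
      unfolding loewner_le_def diff pos_semidef_mat_def using spectral_mat_hermitian[OF U]
      by (simp add: quad_form_def)
  qed
  have pd: "pos_def_mat 1 (?M x)" if "0 < x" for x
    by (rule spectral_mat_pos_def[OF U]) (use that adj in simp_all)
  have img: "spectral_image 1 F (?M x) (?M (F x))" for x
    unfolding spectral_image_def spectral_mat_def
    by (intro exI[of _ ?U] exI[of _ "\<lambda>_. x"]) (use adj in simp)
  have "loewner_le 1 (?M (F x)) (?M (F y))"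
    using F[unfolded operator_monotone_def, rule_format, of 1 "?M x" "?M y" "?M (F x)" "?M (F y)"]
      pd[of x] pd[of y] le[of x y] img xy by simp
  then show ?thesis by (simp only: le)
qed

text \<open>Monotonicity gives F(1/u) \<le> 1 \<le> F(u) for u \<ge> 1, and the symmetry of F turns
  the first inequality into F(u) \<le> u. Positivity serves to invert F in \<open>J\<close>; the
  two-sided bound controls F near 1.\<close>

lemma monotone_metric_fun_bounds:
  assumes F: "operator_monotone F" and sym: "\<forall>x>0. F x = x * F (inverse x)" and F1: "F 1 = (1::real)"
  shows "\<And>u. 0 < u \<Longrightarrow> 0 < F u" and "\<And>u. 1 \<le> u \<Longrightarrow> 1 \<le> F u \<and> F u \<le> u"
proof -
  show b: "1 \<le> F u \<and> F u \<le> u" if "1 \<le> u" for u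
  proof -
    have "1 \<le> F u" using operator_monotone_mono[OF F, of 1 u] that F1 by simp
    moreover have "F (inverse u) \<le> F 1" using that by (intro operator_monotone_mono[OF F]) (auto simp: field_simps)
    then have "u * F (inverse u) \<le> u * 1" using that F1 by (intro mult_left_mono) auto
    then have "F u \<le> u" using sym[rule_format, of u] that by linarith
    ultimately show ?thesis by simp
  qed
  show "0 < F u" if "0 < u" for u
  proof (cases "1 \<le> u")
    case True
    then show ?thesis using b[OF True] by linarith
  next
    case False
    then have "1 \<le> inverse u" using that by (simp add: one_le_inverse)
    then have "0 < F (inverse u)" using b[of "inverse u"] by linarith
    then have "0 < u * F (inverse u)" using that by simp
    then show ?thesis using sym[rule_format, OF that] by linarith
  qed
qed

section \<open>Connections on positive definite matrices\<close>

lemma dir_deriv_cong: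
  assumes eq: "\<And>\<sigma>. \<sigma> \<in> PD \<Longrightarrow> f \<sigma> = g \<sigma>" and \<rho>: "\<rho> \<in> PD" and X: "X \<in> Herm"
  shows "dir_deriv f \<rho> X = dir_deriv g \<rho> X"
  unfolding dir_deriv_def
proof (rule vector_derivative_cong_eq)
  show "\<forall>\<^sub>F t in nhds 0. t \<in> UNIV \<longrightarrow> f (\<rho> + t *\<^sub>R X) = g (\<rho> + t *\<^sub>R X)"
    using eventually_PD_line[OF \<rho> X] by eventually_elim (simp add: eq)
qed simp_all

text \<open>Differentiability is given within \<open>PD\<close>, which has no interior among all
  matrices. A short piece of a line in a Hermitian direction lies in \<open>PD\<close>, so the chain
  rule applies along it.\<close>

lemma has_vector_derivative_dir_deriv:
  fixes f :: "complex^'n::finite^'n \<Rightarrow> 'b::real_normed_vector"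
  assumes f: "f differentiable (at \<rho> within PD)" and \<rho>: "\<rho> \<in> PD" and X: "X \<in> Herm"
  shows "((\<lambda>t. f (\<rho> + t *\<^sub>R X)) has_vector_derivative dir_deriv f \<rho> X) (at 0)"
proof -
  obtain f' where f': "(f has_derivative f') (at \<rho> within PD)" using f by (auto simp: differentiable_def)
  obtain e where e: "0 < e" "\<And>t. dist t 0 < e \<Longrightarrow> \<rho> + t *\<^sub>R X \<in> PD"
    using eventually_PD_line[OF \<rho> X] unfolding eventually_nhds_metric by blast
  have line: "((\<lambda>t. \<rho> + t *\<^sub>R X) has_derivative (\<lambda>t. t *\<^sub>R X)) (at 0 within ball 0 e)"
    by (auto intro!: derivative_eq_intros)
  have im: "(\<lambda>t. \<rho> + t *\<^sub>R X) ` ball 0 e \<subseteq> PD" using e(2) by (auto simp: dist_commute)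
  have "(f has_derivative f') (at (\<rho> + 0 *\<^sub>R X) within (\<lambda>t. \<rho> + t *\<^sub>R X) ` ball 0 e)"
    using has_derivative_subset[OF f' im] by simp
  from has_derivative_in_compose[OF line this]
  have "((\<lambda>t. f (\<rho> + t *\<^sub>R X)) has_derivative (\<lambda>t. f' (t *\<^sub>R X))) (at 0)"
    using at_within_open[of "0::real" "ball 0 e"] e(1) by simp
  then have "(\<lambda>t. f (\<rho> + t *\<^sub>R X)) differentiable (at 0)" by (auto simp: differentiable_def)
  then show ?thesis unfolding dir_deriv_def by (simp add: vector_derivative_works[symmetric])
qed

lemma C_k_on_PD_cong:
  assumes "\<And>\<sigma>. \<sigma> \<in> PD \<Longrightarrow> f \<sigma> = g \<sigma>" "C_k_on_PD k f"
  shows "C_k_on_PD k g"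
  using assms
proof (induction k arbitrary: f g)
  case 0
  then show ?case using continuous_on_cong[OF refl, of PD f g] by simp
next
  case (Suc k)
  have "g differentiable_on PD"
    unfolding differentiable_on_def
  proof
    fix x :: "complex^'a^'a" assume x: "x \<in> PD"
    then have "f differentiable (at x within PD)" using Suc.prems(2) by (simp add: differentiable_on_def)
    then show "g differentiable (at x within PD)"
      by (rule differentiable_transform_within[of f x PD 1 g]) (simp_all add: x Suc.prems(1))
  qed
  moreover have "C_k_on_PD k (\<lambda>\<rho>. dir_deriv g \<rho> X)" if X: "X \<in> Herm" for X
  proof (rule Suc.IH)
    show "dir_deriv f \<sigma> X = dir_deriv g \<sigma> X" if "\<sigma> \<in> PD" for \<sigma>
      using Suc.prems(1) that X by (rule dir_deriv_cong)
    show "C_k_on_PD k (\<lambda>\<rho>. dir_deriv f \<rho> X)" using Suc.prems(2) X by simp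
  qed
  ultimately show ?case by simp
qed

lemma dir_deriv_eqI:
  "((\<lambda>t. f (\<rho> + t *\<^sub>R X)) has_vector_derivative d) (at 0) \<Longrightarrow> dir_deriv f \<rho> X = d"
  unfolding dir_deriv_def by (rule vector_derivative_at)

lemma C_k_on_PD_linear:
  assumes L: "bounded_linear L" and f: "C_k_on_PD k f"
  shows "C_k_on_PD k (\<lambda>\<rho>. L (f \<rho>))"
  using f
proof (induction k arbitrary: f)
  case 0
  then show ?case using bounded_linear.continuous_on[OF L] by auto
next
  case (Suc k)
  have d: "f differentiable (at x within PD)" if "x \<in> PD" for x
    using Suc.prems that by (simp add: differentiable_on_def)
  have "(\<lambda>\<rho>. L (f \<rho>)) differentiable_on PD"
    unfolding differentiable_on_def using d bounded_linear.has_derivative[OF L] unfolding differentiable_def by blast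
  moreover have "C_k_on_PD k (\<lambda>\<rho>. dir_deriv (\<lambda>\<rho>. L (f \<rho>)) \<rho> X)" if X: "X \<in> Herm" for X
  proof (rule C_k_on_PD_cong)
    show "L (dir_deriv f \<sigma> X) = dir_deriv (\<lambda>\<rho>. L (f \<rho>)) \<sigma> X" if s: "\<sigma> \<in> PD" for \<sigma>
      by (rule dir_deriv_eqI[symmetric]) (intro bounded_linear.has_vector_derivative[OF L]
        has_vector_derivative_dir_deriv d s X)
    show "C_k_on_PD k (\<lambda>\<rho>. L (dir_deriv f \<rho> X))" using Suc.prems X by (intro Suc.IH) simp
  qed
  ultimately show ?case by simp
qed

lemma C_k_on_PD_add:
  assumes "C_k_on_PD k f" "C_k_on_PD k g"
  shows "C_k_on_PD k (\<lambda>\<rho>. f \<rho> + g \<rho>)"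
  using assms
proof (induction k arbitrary: f g)
  case 0
  then show ?case by (auto intro: continuous_on_add)
next
  case (Suc k)
  have d: "f differentiable (at x within PD)" "g differentiable (at x within PD)" if "x \<in> PD" for x
    using Suc.prems that by (simp_all add: differentiable_on_def)
  have "(\<lambda>\<rho>. f \<rho> + g \<rho>) differentiable_on PD"
    unfolding differentiable_on_def using d by (auto intro: differentiable_add)
  moreover have "C_k_on_PD k (\<lambda>\<rho>. dir_deriv (\<lambda>\<rho>. f \<rho> + g \<rho>) \<rho> X)" if X: "X \<in> Herm" for X
  proof (rule C_k_on_PD_cong)
    show "dir_deriv f \<sigma> X + dir_deriv g \<sigma> X = dir_deriv (\<lambda>\<rho>. f \<rho> + g \<rho>) \<sigma> X" if s: "\<sigma> \<in> PD" for \<sigma>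
      by (rule dir_deriv_eqI[symmetric]) (intro has_vector_derivative_add has_vector_derivative_dir_deriv d s X)
    show "C_k_on_PD k (\<lambda>\<rho>. dir_deriv f \<rho> X + dir_deriv g \<rho> X)" using Suc.prems X by (intro Suc.IH) simp_all
  qed
  ultimately show ?case by simp
qed

lemma C_k_on_PD_const: "C_k_on_PD k (\<lambda>_ :: complex^'n::finite^'n. c)"
proof (induction k arbitrary: c)
  case (Suc k)
  have "dir_deriv (\<lambda>_ :: complex^'n^'n. c) \<rho> X = 0" for \<rho> X by (intro dir_deriv_eqI has_vector_derivative_const)
  then show ?case using Suc[of 0] by simp
qed simp

lemma smooth_on_PD_cong: "(\<And>\<sigma>. \<sigma> \<in> PD \<Longrightarrow> f \<sigma> = g \<sigma>) \<Longrightarrow> smooth_on_PD f \<Longrightarrow> smooth_on_PD g"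
  unfolding smooth_on_PD_def using C_k_on_PD_cong by blast

lemma smooth_on_PD_linear: "bounded_linear L \<Longrightarrow> smooth_on_PD f \<Longrightarrow> smooth_on_PD (\<lambda>\<rho>. L (f \<rho>))"
  unfolding smooth_on_PD_def by (blast intro: C_k_on_PD_linear)

lemma smooth_on_PD_add: "smooth_on_PD f \<Longrightarrow> smooth_on_PD g \<Longrightarrow> smooth_on_PD (\<lambda>\<rho>. f \<rho> + g \<rho>)"
  unfolding smooth_on_PD_def by (blast intro: C_k_on_PD_add)

lemma smooth_on_PD_const: "smooth_on_PD (\<lambda>_. c)"
  unfolding smooth_on_PD_def by (blast intro: C_k_on_PD_const)

lemma smooth_on_PD_differentiable: "smooth_on_PD f \<Longrightarrow> \<rho> \<in> PD \<Longrightarrow> f differentiable (at \<rho> within PD)"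
  unfolding smooth_on_PD_def differentiable_on_def[symmetric] by (metis C_k_on_PD.simps(2) differentiable_on_def)

lemma vector_field_const: "A \<in> Herm \<Longrightarrow> vector_field (\<lambda>_. A)"
  by (simp add: vector_field_def smooth_on_PD_const)

lemma vector_field_add: "vector_field X \<Longrightarrow> vector_field Y \<Longrightarrow> vector_field (\<lambda>\<sigma>. X \<sigma> + Y \<sigma>)"
  unfolding vector_field_def by (auto intro: smooth_on_PD_add subspace_add[OF subspace_Herm])

lemma vector_field_scale: "smooth_on_PD f \<Longrightarrow> A \<in> Herm \<Longrightarrow> vector_field (\<lambda>\<sigma>. f \<sigma> *\<^sub>R A)"
  unfolding vector_field_def
  by (auto intro: smooth_on_PD_linear[OF bounded_linear_scaleR_left] subspace_scale[OF subspace_Herm])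

lemma Herm_zero: "0 \<in> Herm" by (rule subspace_0[OF subspace_Herm])

lemma vector_field_cong: "(\<And>\<sigma>. \<sigma> \<in> PD \<Longrightarrow> X \<sigma> = Y \<sigma>) \<Longrightarrow> vector_field X \<Longrightarrow> vector_field Y"
  unfolding vector_field_def using smooth_on_PD_cong[of X Y] by auto

lemma vector_field_sum:
  assumes "finite B" "\<And>b. b \<in> B \<Longrightarrow> vector_field (X b)"
  shows "vector_field (\<lambda>\<sigma>. \<Sum>b\<in>B. X b \<sigma>)"
  using assms by (induction B rule: finite_induct) (simp_all add: vector_field_const Herm_zero vector_field_add)

lemma dir_deriv_Herm:
  assumes X: "vector_field X" and \<rho>: "\<rho> \<in> PD" and V: "V \<in> Herm"
  shows "dir_deriv X \<rho> V \<in> Herm"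
proof -
  have L: "bounded_linear (conj_transpose :: complex^'a^'a \<Rightarrow> _)"
    by (rule linear_conv_bounded_linear[THEN iffD1, OF linear_conj_transpose])
  have d: "X differentiable (at \<rho> within PD)" using X \<rho> by (simp add: vector_field_def smooth_on_PD_differentiable)
  have "conj_transpose (dir_deriv X \<rho> V) = dir_deriv (\<lambda>\<sigma>. conj_transpose (X \<sigma>)) \<rho> V"
    by (rule dir_deriv_eqI[symmetric]) (intro bounded_linear.has_vector_derivative[OF L]
      has_vector_derivative_dir_deriv d \<rho> V)
  also have "\<dots> = dir_deriv X \<rho> V"
    by (rule dir_deriv_cong[OF _ \<rho> V]) (use X in \<open>simp add: vector_field_def Herm_def\<close>)
  finally show ?thesis by (simp add: Herm_def)
qed

lemma Herm_orthonormal_basis: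
  "\<exists>B :: (complex^'n::finite^'n) set. finite B \<and> B \<subseteq> Herm \<and> (\<forall>A\<in>Herm. (\<Sum>b\<in>B. (A \<bullet> b) *\<^sub>R b) = A)"
proof -
  obtain B :: "(complex^'n^'n) set" where B: "B \<subseteq> Herm" "pairwise orthogonal B" "\<And>x. x \<in> B \<Longrightarrow> norm x = 1"
    "independent B" "span B = Herm"
    using orthonormal_basis_subspace[OF subspace_Herm] by metis
  have fin: "finite B" using B(4) by (rule independent_imp_finite)
  have "(\<Sum>b\<in>B. (A \<bullet> b) *\<^sub>R b) = A" if "A \<in> Herm" for A
    using that B fin by (intro orthonormal_basis_expand) auto
  then show ?thesis using fin B(1) by blast
qed

section \<open>Affine connections in terms of their values on constant fields\<close>

context
  fixes D :: "'n::finite connection"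
  assumes D: "affine_connection D"
begin

lemma connection_vector_field: "vector_field X \<Longrightarrow> vector_field Y \<Longrightarrow> vector_field (D X Y)"
  by (rule D[unfolded affine_connection_def, THEN conjunct1, rule_format, OF conjI])

lemma connection_left:
  assumes "smooth_on_PD f" "vector_field X" "vector_field X'" "vector_field Y" "\<rho> \<in> PD"
  shows "D (\<lambda>\<sigma>. f \<sigma> *\<^sub>R X \<sigma> + X' \<sigma>) Y \<rho> = f \<rho> *\<^sub>R D X Y \<rho> + D X' Y \<rho>"
  by (rule D[unfolded affine_connection_def, THEN conjunct2, THEN conjunct1, rule_format]) (use assms in simp_all)

lemma connection_right_add:
  assumes "vector_field X" "vector_field Y" "vector_field Y'" "\<rho> \<in> PD"
  shows "D X (\<lambda>\<sigma>. Y \<sigma> + Y' \<sigma>) \<rho> = D X Y \<rho> + D X Y' \<rho>"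
  by (rule D[unfolded affine_connection_def, THEN conjunct2, THEN conjunct2, THEN conjunct1, rule_format])
    (use assms in simp_all)

lemma connection_right_scale:
  assumes "smooth_on_PD f" "vector_field X" "vector_field Y" "\<rho> \<in> PD"
  shows "D X (\<lambda>\<sigma>. f \<sigma> *\<^sub>R Y \<sigma>) \<rho> = dir_deriv f \<rho> (X \<rho>) *\<^sub>R Y \<rho> + f \<rho> *\<^sub>R D X Y \<rho>"
  by (rule D[unfolded affine_connection_def, THEN conjunct2, THEN conjunct2, THEN conjunct2, rule_format])
    (use assms in simp_all)

text \<open>Off \<open>PD\<close> fields are arbitrary: two fields that agree on \<open>PD\<close> differ by the product of a field
  and a function that vanishes on \<open>PD\<close>.\<close>

lemma off_PD:
  "smooth_on_PD (\<lambda>\<sigma> :: complex^'n^'n. if \<sigma> \<in> PD then 0 else 1 :: real)"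
  by (rule smooth_on_PD_cong[OF _ smooth_on_PD_const[of 0]]) simp

lemma connection_left_cong:
  assumes eq: "\<And>\<sigma>. \<sigma> \<in> PD \<Longrightarrow> X \<sigma> = X' \<sigma>" and X: "vector_field X" and Y: "vector_field Y" and \<rho>: "\<rho> \<in> PD"
  shows "D X Y \<rho> = D X' Y \<rho>"
proof -
  let ?f = "\<lambda>\<sigma> :: complex^'n^'n. if \<sigma> \<in> PD then 0 else 1 :: real"
  have X': "vector_field X'" using vector_field_cong[OF eq X] .
  have W: "vector_field (\<lambda>\<sigma>. X \<sigma> - X' \<sigma>)"
    by (rule vector_field_cong[OF _ vector_field_const[OF Herm_zero]]) (simp add: eq)
  have "X = (\<lambda>\<sigma>. ?f \<sigma> *\<^sub>R (X \<sigma> - X' \<sigma>) + X' \<sigma>)" using eq by auto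
  then have "D X Y \<rho> = D (\<lambda>\<sigma>. ?f \<sigma> *\<^sub>R (X \<sigma> - X' \<sigma>) + X' \<sigma>) Y \<rho>" by metis
  also have "\<dots> = D X' Y \<rho>" unfolding connection_left[OF off_PD W X' Y \<rho>] using \<rho> by simp
  finally show ?thesis .
qed

lemma connection_right_cong:
  assumes eq: "\<And>\<sigma>. \<sigma> \<in> PD \<Longrightarrow> Y \<sigma> = Y' \<sigma>" and X: "vector_field X" and Y: "vector_field Y" and \<rho>: "\<rho> \<in> PD"
  shows "D X Y \<rho> = D X Y' \<rho>"
proof -
  let ?f = "\<lambda>\<sigma> :: complex^'n^'n. if \<sigma> \<in> PD then 0 else 1 :: real"
  have Y': "vector_field Y'" using vector_field_cong[OF eq Y] .
  have W: "vector_field (\<lambda>\<sigma>. Y \<sigma> - Y' \<sigma>)"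
    by (rule vector_field_cong[OF _ vector_field_const[OF Herm_zero]]) (simp add: eq)
  have fW: "vector_field (\<lambda>\<sigma>. ?f \<sigma> *\<^sub>R (Y \<sigma> - Y' \<sigma>))"
    by (rule vector_field_cong[OF _ vector_field_const[OF Herm_zero]]) (simp add: eq)
  have "Y = (\<lambda>\<sigma>. ?f \<sigma> *\<^sub>R (Y \<sigma> - Y' \<sigma>) + Y' \<sigma>)" using eq by auto
  then have "D X Y \<rho> = D X (\<lambda>\<sigma>. ?f \<sigma> *\<^sub>R (Y \<sigma> - Y' \<sigma>) + Y' \<sigma>) \<rho>" by metis
  also have "\<dots> = D X Y' \<rho>"
    unfolding connection_right_add[OF X fW Y' \<rho>] connection_right_scale[OF off_PD X W \<rho>] using \<rho> eq by simp
  finally show ?thesis .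
qed

lemma connection_left_sum:
  assumes "finite B" "B \<subseteq> Herm" "\<And>b. b \<in> B \<Longrightarrow> smooth_on_PD (f b)" "vector_field Y" "\<rho> \<in> PD"
  shows "D (\<lambda>\<sigma>. \<Sum>b\<in>B. f b \<sigma> *\<^sub>R b) Y \<rho> = (\<Sum>b\<in>B. f b \<rho> *\<^sub>R D (\<lambda>_. b) Y \<rho>)"
  using assms
proof (induction B rule: finite_induct)
  case empty
  have z: "vector_field (\<lambda>_. 0 :: complex^'n^'n)" by (rule vector_field_const[OF Herm_zero])
  have "D (\<lambda>\<sigma>. 1 *\<^sub>R 0 + 0) Y \<rho> = 1 *\<^sub>R D (\<lambda>_. 0) Y \<rho> + D (\<lambda>_. 0) Y \<rho>"
    by (rule connection_left[OF smooth_on_PD_const z z empty.prems(3,4)])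
  then show ?case by simp
next
  case (insert b B)
  have "vector_field (\<lambda>\<sigma>. \<Sum>b\<in>B. f b \<sigma> *\<^sub>R b)"
    using insert.prems insert.hyps by (intro vector_field_sum vector_field_scale) auto
  then show ?case using insert by (simp add: connection_left vector_field_const)
qed

lemma connection_right_sum:
  assumes "finite B" "B \<subseteq> Herm" "\<And>b. b \<in> B \<Longrightarrow> smooth_on_PD (f b)" "vector_field X" "\<rho> \<in> PD"
  shows "D X (\<lambda>\<sigma>. \<Sum>b\<in>B. f b \<sigma> *\<^sub>R b) \<rho> =
    (\<Sum>b\<in>B. dir_deriv (f b) \<rho> (X \<rho>) *\<^sub>R b + f b \<rho> *\<^sub>R D X (\<lambda>_. b) \<rho>)"
  using assms
proof (induction B rule: finite_induct)
  case empty
  have z: "vector_field (\<lambda>_. 0 :: complex^'n^'n)" by (rule vector_field_const[OF Herm_zero])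
  have "D X (\<lambda>\<sigma>. 0 + 0) \<rho> = D X (\<lambda>_. 0) \<rho> + D X (\<lambda>_. 0) \<rho>"
    by (rule connection_right_add[OF empty.prems(3) z z empty.prems(4)])
  then show ?case by simp
next
  case (insert b B)
  have "vector_field (\<lambda>\<sigma>. \<Sum>b\<in>B. f b \<sigma> *\<^sub>R b)" "vector_field (\<lambda>\<sigma>. f b \<sigma> *\<^sub>R b)"
    using insert.prems insert.hyps by (auto intro!: vector_field_sum vector_field_scale)
  then show ?case using insert by (simp add: connection_right_add connection_right_scale vector_field_const)
qed

lemma smooth_on_PD_coordinate: "vector_field X \<Longrightarrow> smooth_on_PD (\<lambda>\<sigma>. X \<sigma> \<bullet> b)"
  unfolding vector_field_def by (auto intro: smooth_on_PD_linear[OF bounded_linear_inner_left])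

text \<open>Expansion in a constant orthonormal basis. Linearity over functions leaves only the
  value of X at \<rho>, and the Leibniz rule collects the derivatives of the coordinates of Y into
  \<open>dir_deriv\<close>. The remaining term is the Christoffel symbol.\<close>

lemma connection_at:
  assumes X: "vector_field X" and Y: "vector_field Y" and \<rho>: "\<rho> \<in> PD"
  shows "D X Y \<rho> = dir_deriv Y \<rho> (X \<rho>) + D (\<lambda>_. X \<rho>) (\<lambda>_. Y \<rho>) \<rho>"
proof -
  obtain B :: "(complex^'n^'n) set" where BB: "finite B \<and> B \<subseteq> Herm \<and> (\<forall>A\<in>Herm. (\<Sum>b\<in>B. (A \<bullet> b) *\<^sub>R b) = A)"
    using Herm_orthonormal_basis by (elim exE)
  then have B: "finite B" "B \<subseteq> Herm" by simp_all
  have ex: "(\<Sum>b\<in>B. (A \<bullet> b) *\<^sub>R b) = A" if "A \<in> Herm" for A using BB that by simp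
  have XH: "X \<sigma> \<in> Herm" and YH: "Y \<sigma> \<in> Herm" if "\<sigma> \<in> PD" for \<sigma>
    using X Y that by (auto simp: vector_field_def)
  have Xc: "vector_field (\<lambda>_. X \<rho>)" and Yc: "vector_field (\<lambda>_. Y \<rho>)" using XH YH \<rho> by (auto intro: vector_field_const)
  have left: "D X W \<rho> = D (\<lambda>_. X \<rho>) W \<rho>" if W: "vector_field W" for W
  proof -
    have "D X W \<rho> = D (\<lambda>\<sigma>. \<Sum>b\<in>B. (X \<sigma> \<bullet> b) *\<^sub>R b) W \<rho>"
      by (rule connection_left_cong[OF _ X W \<rho>]) (simp add: ex XH)
    also have "\<dots> = (\<Sum>b\<in>B. (X \<rho> \<bullet> b) *\<^sub>R D (\<lambda>_. b) W \<rho>)"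
      by (rule connection_left_sum[OF B smooth_on_PD_coordinate[OF X] W \<rho>])
    also have "\<dots> = D (\<lambda>\<sigma>. \<Sum>b\<in>B. (X \<rho> \<bullet> b) *\<^sub>R b) W \<rho>"
      by (rule connection_left_sum[OF B smooth_on_PD_const W \<rho>, symmetric])
    finally show ?thesis by (simp add: ex XH \<rho>)
  qed
  have dY: "dir_deriv (\<lambda>\<sigma>. Y \<sigma> \<bullet> b) \<rho> (X \<rho>) = dir_deriv Y \<rho> (X \<rho>) \<bullet> b" for b
    by (rule dir_deriv_eqI) (intro bounded_linear.has_vector_derivative[OF bounded_linear_inner_left]
      has_vector_derivative_dir_deriv smooth_on_PD_differentiable \<rho> XH, use Y in \<open>simp add: vector_field_def\<close>)
  have dc: "dir_deriv (\<lambda>_. c :: real) \<rho> V = 0" for c V by (intro dir_deriv_eqI has_vector_derivative_const)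
  have "D X Y \<rho> = D X (\<lambda>\<sigma>. \<Sum>b\<in>B. (Y \<sigma> \<bullet> b) *\<^sub>R b) \<rho>"
    by (rule connection_right_cong[OF _ X Y \<rho>]) (simp add: ex YH)
  also have "\<dots> = (\<Sum>b\<in>B. dir_deriv (\<lambda>\<sigma>. Y \<sigma> \<bullet> b) \<rho> (X \<rho>) *\<^sub>R b + (Y \<rho> \<bullet> b) *\<^sub>R D X (\<lambda>_. b) \<rho>)"
    by (rule connection_right_sum[OF B smooth_on_PD_coordinate[OF Y] X \<rho>])
  also have "\<dots> = dir_deriv Y \<rho> (X \<rho>) + (\<Sum>b\<in>B. (Y \<rho> \<bullet> b) *\<^sub>R D X (\<lambda>_. b) \<rho>)"
    unfolding dY sum.distrib by (simp add: ex dir_deriv_Herm[OF Y \<rho> XH[OF \<rho>]])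
  also have "(\<Sum>b\<in>B. (Y \<rho> \<bullet> b) *\<^sub>R D X (\<lambda>_. b) \<rho>) = D X (\<lambda>\<sigma>. \<Sum>b\<in>B. (Y \<rho> \<bullet> b) *\<^sub>R b) \<rho>"
    by (subst connection_right_sum[OF B smooth_on_PD_const X \<rho>]) (simp add: dc)
  also have "\<dots> = D (\<lambda>_. X \<rho>) (\<lambda>_. Y \<rho>) \<rho>" using left[OF Yc] by (simp add: ex YH \<rho>)
  finally show ?thesis .
qed

lemma connection_const_right_sum:
  assumes "finite B" "B \<subseteq> Herm" "A \<in> Herm" "\<rho> \<in> PD"
  shows "D (\<lambda>_. A) (\<lambda>_. \<Sum>b\<in>B. c b *\<^sub>R b) \<rho> = (\<Sum>b\<in>B. c b *\<^sub>R D (\<lambda>_. A) (\<lambda>_. b) \<rho>)"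
proof -
  have dc: "dir_deriv (\<lambda>_. c :: real) \<rho> V = 0" for c V by (intro dir_deriv_eqI has_vector_derivative_const)
  show ?thesis
    using connection_right_sum[OF assms(1,2) smooth_on_PD_const vector_field_const[OF assms(3)] assms(4), of c]
    by (simp add: dc)
qed

lemma connection_const_Herm: "A \<in> Herm \<Longrightarrow> B \<in> Herm \<Longrightarrow> \<rho> \<in> PD \<Longrightarrow> D (\<lambda>_. A) (\<lambda>_. B) \<rho> \<in> Herm"
  using connection_vector_field[OF vector_field_const vector_field_const] by (simp add: vector_field_def)

text \<open>The derivative terms of \<open>connection_at\<close> are exactly the Lie bracket, so the
  torsion consists of the Christoffel terms alone.\<close>

lemma torsion_freeI:
  assumes "\<And>\<rho> A B. \<rho> \<in> PD \<Longrightarrow> A \<in> Herm \<Longrightarrow> B \<in> Herm \<Longrightarrow> D (\<lambda>_. A) (\<lambda>_. B) \<rho> = D (\<lambda>_. B) (\<lambda>_. A) \<rho>"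
  shows "torsion_free D"
  unfolding torsion_free_def lie_bracket_def
proof (intro allI impI ballI)
  fix X Y :: "'n field" and \<rho> :: "complex^'n^'n" assume XY: "vector_field X \<and> vector_field Y" and \<rho>: "\<rho> \<in> PD"
  then have "D (\<lambda>_. X \<rho>) (\<lambda>_. Y \<rho>) \<rho> = D (\<lambda>_. Y \<rho>) (\<lambda>_. X \<rho>) \<rho>"
    by (intro assms) (auto simp: vector_field_def)
  then show "D X Y \<rho> - D Y X \<rho> = dir_deriv Y \<rho> (X \<rho>) - dir_deriv X \<rho> (Y \<rho>)"
    using connection_at[of X Y \<rho>] connection_at[of Y X \<rho>] XY \<rho> by simp
qed

end

section \<open>Riemannian metrics and reduction of duality to constant fields\<close>

lemma riemannian_metric_linear:
  assumes "riemannian_metric lam" "\<rho> \<in> PD" "X \<in> Herm" "Y \<in> Herm" "Z \<in> Herm"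
  shows "lam \<rho> (a *\<^sub>R X + Y) Z = a * lam \<rho> X Z + lam \<rho> Y Z"
  by (rule assms(1)[unfolded riemannian_metric_def, THEN conjunct1, rule_format]) (use assms in simp_all)

lemma riemannian_metric_commute:
  "riemannian_metric lam \<Longrightarrow> \<rho> \<in> PD \<Longrightarrow> X \<in> Herm \<Longrightarrow> Y \<in> Herm \<Longrightarrow> lam \<rho> X Y = lam \<rho> Y X"
  by (simp add: riemannian_metric_def)

lemma riemannian_metric_pos:
  "riemannian_metric lam \<Longrightarrow> \<rho> \<in> PD \<Longrightarrow> X \<in> Herm \<Longrightarrow> X \<noteq> 0 \<Longrightarrow> 0 < lam \<rho> X X"
  by (simp add: riemannian_metric_def)

lemma riemannian_metric_sum:
  assumes lam: "riemannian_metric lam" and \<rho>: "\<rho> \<in> PD" and Z: "Z \<in> Herm"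
    and S: "finite S" "\<And>b. b \<in> S \<Longrightarrow> V b \<in> Herm"
  shows "lam \<rho> (\<Sum>b\<in>S. c b *\<^sub>R V b) Z = (\<Sum>b\<in>S. c b * lam \<rho> (V b) Z)"
  using S
proof (induction S rule: finite_induct)
  case empty
  have "lam \<rho> (1 *\<^sub>R 0 + 0) Z = 1 * lam \<rho> 0 Z + lam \<rho> 0 Z"
    by (rule riemannian_metric_linear[OF lam \<rho> Herm_zero Herm_zero Z])
  then show ?case by simp
next
  case (insert b S)
  have "(\<Sum>b\<in>S. c b *\<^sub>R V b) \<in> Herm"
    using insert.prems by (intro subspace_sum[OF subspace_Herm] subspace_scale[OF subspace_Herm]) auto
  then have "lam \<rho> (c b *\<^sub>R V b + (\<Sum>b\<in>S. c b *\<^sub>R V b)) Z =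
      c b * lam \<rho> (V b) Z + lam \<rho> (\<Sum>b\<in>S. c b *\<^sub>R V b) Z"
    using insert.prems by (intro riemannian_metric_linear[OF lam \<rho> _ _ Z]) auto
  then show ?case using insert by simp
qed

lemma riemannian_metric_add:
  assumes "riemannian_metric lam" "\<rho> \<in> PD" "X \<in> Herm" "Y \<in> Herm" "Z \<in> Herm"
  shows "lam \<rho> (X + Y) Z = lam \<rho> X Z + lam \<rho> Y Z"
proof -
  have "lam \<rho> (1 *\<^sub>R X + Y) Z = 1 * lam \<rho> X Z + lam \<rho> Y Z"
    by (rule riemannian_metric_linear[OF assms])
  then show ?thesis by simp
qed

text \<open>Positivity of the metric is tested on the difference of the two vectors.\<close>

lemma riemannian_metric_cancel:
  assumes lam: "riemannian_metric lam" and \<rho>: "\<rho> \<in> PD" and XY: "X \<in> Herm" "Y \<in> Herm"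
    and eq: "\<And>Z. Z \<in> Herm \<Longrightarrow> lam \<rho> X Z = lam \<rho> Y Z"
  shows "X = Y"
proof (rule ccontr)
  assume "X \<noteq> Y"
  define W where "W = (-1) *\<^sub>R Y + X"
  have W: "W \<in> Herm" "W \<noteq> 0" using XY \<open>X \<noteq> Y\<close>
    by (auto simp: W_def intro: subspace_diff[OF subspace_Herm])
  have "0 < lam \<rho> W W" by (rule riemannian_metric_pos[OF lam \<rho> W])
  also have "lam \<rho> W W = (-1) * lam \<rho> Y W + lam \<rho> X W"
    unfolding W_def by (rule riemannian_metric_linear[OF lam \<rho> XY(2,1) W(1)[unfolded W_def]])
  finally show False using eq[OF W(1)] by simp
qed

text \<open>In a constant basis the metric of Y and Z is a sum of products of coordinates and metric
  coefficients. Differentiated coordinates account for the derivative terms of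
  \<open>connection_at\<close>, differentiated coefficients for the Christoffel terms, and only the
  latter need the hypothesis \<open>const\<close>.\<close>

lemma dual_connectionsI:
  fixes lam :: "'n::finite metric"
  assumes lam: "riemannian_metric lam" and D: "affine_connection D" and D': "affine_connection D'"
    and const: "\<And>\<rho> A Y Z. \<rho> \<in> PD \<Longrightarrow> A \<in> Herm \<Longrightarrow> Y \<in> Herm \<Longrightarrow> Z \<in> Herm \<Longrightarrow>
      ((\<lambda>t. lam (\<rho> + t *\<^sub>R A) Y Z) has_real_derivative
        lam \<rho> (D (\<lambda>_. A) (\<lambda>_. Y) \<rho>) Z + lam \<rho> Y (D' (\<lambda>_. A) (\<lambda>_. Z) \<rho>)) (at 0)"
  shows "dual_connections lam D D'"
  unfolding dual_connections_def Let_def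
proof (intro allI impI ballI)
  fix X Y Z :: "'n field" and \<rho> :: "complex^'n^'n"
  assume XYZ: "vector_field X \<and> vector_field Y \<and> vector_field Z" and \<rho>: "\<rho> \<in> PD"
  then have vf: "vector_field X" "vector_field Y" "vector_field Z" by auto
  have H: "X \<sigma> \<in> Herm" "Y \<sigma> \<in> Herm" "Z \<sigma> \<in> Herm" if "\<sigma> \<in> PD" for \<sigma>
    using vf that by (auto simp: vector_field_def)
  define A where "A = X \<rho>"
  have A: "A \<in> Herm" by (simp add: A_def H \<rho>)
  obtain B :: "(complex^'n^'n) set" where BB: "finite B \<and> B \<subseteq> Herm \<and> (\<forall>A\<in>Herm. (\<Sum>b\<in>B. (A \<bullet> b) *\<^sub>R b) = A)"
    using Herm_orthonormal_basis by (elim exE)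
  then have B: "finite B" "B \<subseteq> Herm" by simp_all
  have ex: "(\<Sum>b\<in>B. (A \<bullet> b) *\<^sub>R b) = A" if "A \<in> Herm" for A using BB that by simp
  have BH: "b \<in> Herm" if "b \<in> B" for b using B that by auto
  have lsum: "lam \<sigma> (\<Sum>b\<in>B. c b *\<^sub>R b) V = (\<Sum>b\<in>B. c b * lam \<sigma> b V)"
    if "\<sigma> \<in> PD" "V \<in> Herm" for c \<sigma> V
    by (rule riemannian_metric_sum[OF lam that B(1) BH])
  have bil: "lam \<sigma> U V = (\<Sum>b\<in>B. \<Sum>c\<in>B. (U \<bullet> b) * (V \<bullet> c) * lam \<sigma> b c)"
    if s: "\<sigma> \<in> PD" and U: "U \<in> Herm" and V: "V \<in> Herm" for \<sigma> U V
  proof -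
    have "lam \<sigma> U V = (\<Sum>b\<in>B. (U \<bullet> b) * lam \<sigma> b V)"
      using lsum[OF s V, of "\<lambda>b. U \<bullet> b"] by (simp add: ex U)
    also have "\<dots> = (\<Sum>b\<in>B. \<Sum>c\<in>B. (U \<bullet> b) * (V \<bullet> c) * lam \<sigma> b c)"
    proof (intro sum.cong refl)
      fix b assume b: "b \<in> B"
      have "lam \<sigma> b V = lam \<sigma> V b" by (rule riemannian_metric_commute[OF lam s BH[OF b] V])
      also have "\<dots> = (\<Sum>c\<in>B. (V \<bullet> c) * lam \<sigma> c b)"
        using lsum[OF s BH[OF b], of "\<lambda>b. V \<bullet> b"] by (simp add: ex V)
      also have "\<dots> = (\<Sum>c\<in>B. (V \<bullet> c) * lam \<sigma> b c)"
        by (intro sum.cong refl arg_cong2[of _ _ _ _ "(*)"] riemannian_metric_commute[OF lam s] BH b)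
      finally show "(U \<bullet> b) * lam \<sigma> b V = (\<Sum>c\<in>B. (U \<bullet> b) * (V \<bullet> c) * lam \<sigma> b c)"
        by (simp add: sum_distrib_left mult.assoc)
    qed
    finally show ?thesis .
  qed
  define dY where "dY = dir_deriv Y \<rho> A"
  define dZ where "dZ = dir_deriv Z \<rho> A"
  have dH: "dY \<in> Herm" "dZ \<in> Herm" using vf \<rho> A by (auto simp: dY_def dZ_def intro: dir_deriv_Herm)
  have der: "((\<lambda>t. W (\<rho> + t *\<^sub>R A) \<bullet> b) has_real_derivative dir_deriv W \<rho> A \<bullet> b) (at 0)" if "vector_field W" for W b
    unfolding has_real_derivative_iff_has_vector_derivative
    by (intro bounded_linear.has_vector_derivative[OF bounded_linear_inner_left]
      has_vector_derivative_dir_deriv smooth_on_PD_differentiable \<rho> A) (use that in \<open>simp add: vector_field_def\<close>)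
  let ?DA = "\<lambda>b. D (\<lambda>_. A) (\<lambda>_. b) \<rho>" and ?DA' = "\<lambda>b. D' (\<lambda>_. A) (\<lambda>_. b) \<rho>"
  have DH: "?DA b \<in> Herm" "?DA' b \<in> Herm" if "b \<in> Herm" for b
    using connection_const_Herm[OF D A that \<rho>] connection_const_Herm[OF D' A that \<rho>] .
  let ?m = "\<lambda>b c. lam \<rho> (?DA b) c + lam \<rho> b (?DA' c)"
  \<comment> \<open>The product rule for three factors; the three groups of terms are reassembled
    into values of the metric afterwards.\<close>
  have "((\<lambda>t. \<Sum>b\<in>B. \<Sum>c\<in>B. (Y (\<rho> + t *\<^sub>R A) \<bullet> b) * (Z (\<rho> + t *\<^sub>R A) \<bullet> c) * lam (\<rho> + t *\<^sub>R A) b c)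
    has_real_derivative (\<Sum>b\<in>B. \<Sum>c\<in>B. (dY \<bullet> b) * (Z \<rho> \<bullet> c) * lam \<rho> b c + (Y \<rho> \<bullet> b) * (dZ \<bullet> c) * lam \<rho> b c
       + (Y \<rho> \<bullet> b) * (Z \<rho> \<bullet> c) * ?m b c)) (at 0)"
  proof (intro DERIV_sum)
    fix b c assume bc: "b \<in> B" "c \<in> B"
    show "((\<lambda>t. (Y (\<rho> + t *\<^sub>R A) \<bullet> b) * (Z (\<rho> + t *\<^sub>R A) \<bullet> c) * lam (\<rho> + t *\<^sub>R A) b c) has_real_derivative
      (dY \<bullet> b) * (Z \<rho> \<bullet> c) * lam \<rho> b c + (Y \<rho> \<bullet> b) * (dZ \<bullet> c) * lam \<rho> b c + (Y \<rho> \<bullet> b) * (Z \<rho> \<bullet> c) * ?m b c) (at 0)"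
      by (rule DERIV_cong[OF DERIV_mult[OF DERIV_mult[OF der[OF vf(2)] der[OF vf(3)]]
        const[OF \<rho> A BH[OF bc(1)] BH[OF bc(2)]]]])
        (simp add: dY_def dZ_def algebra_simps)
  qed
  also have "(\<Sum>b\<in>B. \<Sum>c\<in>B. (dY \<bullet> b) * (Z \<rho> \<bullet> c) * lam \<rho> b c + (Y \<rho> \<bullet> b) * (dZ \<bullet> c) * lam \<rho> b c
       + (Y \<rho> \<bullet> b) * (Z \<rho> \<bullet> c) * ?m b c) =
     lam \<rho> dY (Z \<rho>) + lam \<rho> (Y \<rho>) dZ + (lam \<rho> (?DA (Y \<rho>)) (Z \<rho>) + lam \<rho> (Y \<rho>) (?DA' (Z \<rho>)))"
  proof -
    have YZ: "Y \<rho> \<in> Herm" "Z \<rho> \<in> Herm" using H \<rho> by auto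
    have e1: "?DA (Y \<rho>) = (\<Sum>b\<in>B. (Y \<rho> \<bullet> b) *\<^sub>R ?DA b)"
      using connection_const_right_sum[OF D B A \<rho>, of "\<lambda>b. Y \<rho> \<bullet> b"] by (simp add: ex YZ)
    have e2: "?DA' (Z \<rho>) = (\<Sum>b\<in>B. (Z \<rho> \<bullet> b) *\<^sub>R ?DA' b)"
      using connection_const_right_sum[OF D' B A \<rho>, of "\<lambda>b. Z \<rho> \<bullet> b"] by (simp add: ex YZ)
    have s1: "(\<Sum>b\<in>B. \<Sum>c\<in>B. (Y \<rho> \<bullet> b) * (Z \<rho> \<bullet> c) * lam \<rho> (?DA b) c) = lam \<rho> (?DA (Y \<rho>)) (Z \<rho>)"
    proof -
      have "lam \<rho> (?DA (Y \<rho>)) (Z \<rho>) = (\<Sum>b\<in>B. (Y \<rho> \<bullet> b) * lam \<rho> (?DA b) (Z \<rho>))"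
        unfolding e1 by (intro riemannian_metric_sum[OF lam \<rho>] B(1) DH BH YZ)
      also have "\<dots> = (\<Sum>b\<in>B. \<Sum>c\<in>B. (Y \<rho> \<bullet> b) * (Z \<rho> \<bullet> c) * lam \<rho> (?DA b) c)"
      proof (intro sum.cong refl)
        fix b assume b: "b \<in> B"
        have "lam \<rho> (?DA b) (Z \<rho>) = lam \<rho> (\<Sum>c\<in>B. (Z \<rho> \<bullet> c) *\<^sub>R c) (?DA b)"
          using riemannian_metric_commute[OF lam \<rho> DH(1)[OF BH[OF b]] YZ(2)] by (simp add: ex YZ)
        also have "\<dots> = (\<Sum>c\<in>B. (Z \<rho> \<bullet> c) * lam \<rho> c (?DA b))" by (intro riemannian_metric_sum[OF lam \<rho>] B(1) DH BH b)
        also have "\<dots> = (\<Sum>c\<in>B. (Z \<rho> \<bullet> c) * lam \<rho> (?DA b) c)"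
          by (intro sum.cong refl arg_cong2[of _ _ _ _ "(*)"] riemannian_metric_commute[OF lam \<rho>] BH DH b)
        finally show "(Y \<rho> \<bullet> b) * lam \<rho> (?DA b) (Z \<rho>) = (\<Sum>c\<in>B. (Y \<rho> \<bullet> b) * (Z \<rho> \<bullet> c) * lam \<rho> (?DA b) c)"
          by (simp add: sum_distrib_left mult.assoc)
      qed
      finally show ?thesis ..
    qed
    have s2: "(\<Sum>b\<in>B. \<Sum>c\<in>B. (Y \<rho> \<bullet> b) * (Z \<rho> \<bullet> c) * lam \<rho> b (?DA' c)) = lam \<rho> (Y \<rho>) (?DA' (Z \<rho>))"
    proof -
      have "lam \<rho> (Y \<rho>) (?DA' (Z \<rho>)) = (\<Sum>b\<in>B. (Y \<rho> \<bullet> b) * lam \<rho> b (?DA' (Z \<rho>)))"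
        using lsum[OF \<rho> DH(2)[OF YZ(2)], of "\<lambda>b. Y \<rho> \<bullet> b"] by (simp add: ex YZ)
      also have "\<dots> = (\<Sum>b\<in>B. \<Sum>c\<in>B. (Y \<rho> \<bullet> b) * (Z \<rho> \<bullet> c) * lam \<rho> b (?DA' c))"
      proof (intro sum.cong refl)
        fix b assume b: "b \<in> B"
        have "lam \<rho> b (?DA' (Z \<rho>)) = lam \<rho> (\<Sum>c\<in>B. (Z \<rho> \<bullet> c) *\<^sub>R ?DA' c) b"
          using riemannian_metric_commute[OF lam \<rho> BH[OF b] DH(2)[OF YZ(2)]] by (simp add: e2)
        also have "\<dots> = (\<Sum>c\<in>B. (Z \<rho> \<bullet> c) * lam \<rho> (?DA' c) b)" by (intro riemannian_metric_sum[OF lam \<rho>] B(1) DH BH b)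
        also have "\<dots> = (\<Sum>c\<in>B. (Z \<rho> \<bullet> c) * lam \<rho> b (?DA' c))"
          by (intro sum.cong refl arg_cong2[of _ _ _ _ "(*)"] riemannian_metric_commute[OF lam \<rho>] BH DH b)
        finally show "(Y \<rho> \<bullet> b) * lam \<rho> b (?DA' (Z \<rho>)) = (\<Sum>c\<in>B. (Y \<rho> \<bullet> b) * (Z \<rho> \<bullet> c) * lam \<rho> b (?DA' c))"
          by (simp add: sum_distrib_left mult.assoc)
      qed
      finally show ?thesis ..
    qed
    show ?thesis
      unfolding sum.distrib distrib_left s1 s2 bil[OF \<rho> dH(1) YZ(2), symmetric] bil[OF \<rho> YZ(1) dH(2), symmetric] ..
  qed
  also have "\<dots> = lam \<rho> (D X Y \<rho>) (Z \<rho>) + lam \<rho> (Y \<rho>) (D' X Z \<rho>)"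
  proof -
    have YZ: "Y \<rho> \<in> Herm" "Z \<rho> \<in> Herm" using H \<rho> by auto
    have 1: "D X Y \<rho> = dY + ?DA (Y \<rho>)" "D' X Z \<rho> = dZ + ?DA' (Z \<rho>)"
      using connection_at[OF D vf(1,2) \<rho>] connection_at[OF D' vf(1,3) \<rho>] by (simp_all add: A_def dY_def dZ_def)
    have 2: "lam \<rho> (Y \<rho>) (dZ + ?DA' (Z \<rho>)) = lam \<rho> (Y \<rho>) dZ + lam \<rho> (Y \<rho>) (?DA' (Z \<rho>))"
      using riemannian_metric_add[OF lam \<rho> dH(2) DH(2)[OF YZ(2)] YZ(1)]
        riemannian_metric_commute[OF lam \<rho> YZ(1) subspace_add[OF subspace_Herm dH(2) DH(2)[OF YZ(2)]]]
        riemannian_metric_commute[OF lam \<rho> YZ(1) dH(2)] riemannian_metric_commute[OF lam \<rho> YZ(1) DH(2)[OF YZ(2)]]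
          by simp
    show ?thesis unfolding 1 2 riemannian_metric_add[OF lam \<rho> dH(1) DH(1)[OF YZ(1)] YZ(2)] by simp
  qed
  finally have der0: "((\<lambda>t. \<Sum>b\<in>B. \<Sum>c\<in>B. (Y (\<rho> + t *\<^sub>R A) \<bullet> b) * (Z (\<rho> + t *\<^sub>R A) \<bullet> c) * lam (\<rho> + t *\<^sub>R A) b c)
    has_real_derivative lam \<rho> (D X Y \<rho>) (Z \<rho>) + lam \<rho> (Y \<rho>) (D' X Z \<rho>)) (at 0)" .
  have "\<forall>\<^sub>F t in nhds 0. lam (\<rho> + t *\<^sub>R A) (Y (\<rho> + t *\<^sub>R A)) (Z (\<rho> + t *\<^sub>R A)) =
     (\<Sum>b\<in>B. \<Sum>c\<in>B. (Y (\<rho> + t *\<^sub>R A) \<bullet> b) * (Z (\<rho> + t *\<^sub>R A) \<bullet> c) * lam (\<rho> + t *\<^sub>R A) b c)"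
    using eventually_PD_line[OF \<rho> A]
  proof eventually_elim
    case (elim t)
    show ?case by (rule bil[OF elim H(2,3)[OF elim]])
  qed
  then show "((\<lambda>t. lam (\<rho> + t *\<^sub>R X \<rho>) (Y (\<rho> + t *\<^sub>R X \<rho>)) (Z (\<rho> + t *\<^sub>R X \<rho>))) has_real_derivative
      lam \<rho> (D X Y \<rho>) (Z \<rho>) + lam \<rho> (Y \<rho>) (D' X Z \<rho>)) (at 0)"
    unfolding A_def[symmetric] using der0 by (subst DERIV_cong_ev[OF refl _ refl]) auto
qed

section \<open>Dual connections of relative entropies\<close>

lemma tensor_approx_entropy:
  "thrice_differentiable g \<Longrightarrow> tensor_approx (\<lambda>p q. p * g (q / p))"
  unfolding tensor_approx_def by (intro allI impI thrice_differentiable_tensor_approx) auto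

lemma rel_entropy_transpose:
  assumes "\<tau> \<in> PD" "\<sigma> \<in> PD"
  shows "rel_entropy (transpose_fun g) \<tau> \<sigma> = Phi (\<lambda>p q. q * g (p / q)) \<tau> \<sigma>"
  unfolding rel_entropy_eq_Phi[OF assms]
proof (rule Phi_cong)
  fix p q assume "p \<in> eigs \<tau>" "q \<in> eigs \<sigma>"
  then have "0 < p" "0 < q" using PD_eigs_pos assms by auto
  then show "p * transpose_fun g (q / p) = q * g (p / q)" by (simp add: transpose_fun_def)
qed

text \<open>Formulated for any \<open>f\<close> that represents the entropy on \<open>PD\<close>, in
  order to apply to \<open>g\<close> and to its transpose, whose \<open>f\<close> has its arguments
  exchanged. Near a positive definite matrix, Hermitian lines stay in \<open>PD\<close>, so the
  derivatives agree as well.\<close>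

context
  fixes g :: "real \<Rightarrow> real" and f :: "real \<Rightarrow> real \<Rightarrow> real" and ty :: "'n::finite itself"
  assumes rel: "\<And>\<tau> \<sigma> :: complex^'n^'n. \<tau> \<in> PD \<Longrightarrow> \<sigma> \<in> PD \<Longrightarrow> rel_entropy g \<tau> \<sigma> = Phi f \<tau> \<sigma>"
begin

lemma deriv_rel_entropy_eq_Phi_q:
  fixes \<tau> \<sigma> Z :: "complex^'n^'n"
  assumes "\<tau> \<in> PD" "\<sigma> \<in> PD" "Z \<in> Herm"
  shows "deriv (\<lambda>u. rel_entropy g \<tau> (\<sigma> + u *\<^sub>R Z)) 0 = Phi_q f \<tau> \<sigma> Z"
  unfolding Phi_q_def
proof (rule deriv_cong_ev[OF _ refl])
  show "\<forall>\<^sub>F u in nhds 0. rel_entropy g \<tau> (\<sigma> + u *\<^sub>R Z) = Phi f \<tau> (\<sigma> + u *\<^sub>R Z)"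
    using eventually_PD_line[OF assms(2,3)] by eventually_elim (rule rel[OF assms(1)])
qed

lemma deriv_rel_entropy_eq_Phi_pq:
  fixes \<tau> \<sigma> Y Z :: "complex^'n^'n"
  assumes "\<tau> \<in> PD" "\<sigma> \<in> PD" "Y \<in> Herm" "Z \<in> Herm"
  shows "deriv (\<lambda>t. deriv (\<lambda>u. rel_entropy g (\<tau> + t *\<^sub>R Y) (\<sigma> + u *\<^sub>R Z)) 0) 0 = Phi_pq f \<tau> \<sigma> Y Z"
  unfolding Phi_pq_def
proof (rule deriv_cong_ev[OF _ refl])
  show "\<forall>\<^sub>F t in nhds 0. deriv (\<lambda>u. rel_entropy g (\<tau> + t *\<^sub>R Y) (\<sigma> + u *\<^sub>R Z)) 0 = Phi_q f (\<tau> + t *\<^sub>R Y) \<sigma> Z"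
    using eventually_PD_line[OF assms(1,3)] by eventually_elim (rule deriv_rel_entropy_eq_Phi_q[OF _ assms(2,4)])
qed

lemma entropy_metric_eq_Phi_pq:
  fixes \<rho> X Y :: "complex^'n^'n"
  assumes "\<rho> \<in> PD" "X \<in> Herm" "Y \<in> Herm"
  shows "entropy_metric g \<rho> X Y = - Phi_pq f \<rho> \<rho> X Y"
  unfolding entropy_metric_def deriv_rel_entropy_eq_Phi_pq[OF assms(1,1,2,3)] ..

lemma deriv_rel_entropy_third:
  fixes \<rho> X Y Z :: "complex^'n^'n"
  assumes "\<rho> \<in> PD" "X \<in> Herm" "Y \<in> Herm" "Z \<in> Herm"
  shows "deriv (\<lambda>s. deriv (\<lambda>t. deriv (\<lambda>u. rel_entropy g (\<rho> + s *\<^sub>R X + t *\<^sub>R Y) (\<rho> + u *\<^sub>R Z)) 0) 0) 0 =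
    deriv (\<lambda>s. Phi_pq f (\<rho> + s *\<^sub>R X) \<rho> Y Z) 0"
proof (rule deriv_cong_ev[OF _ refl])
  show "\<forall>\<^sub>F s in nhds 0. deriv (\<lambda>t. deriv (\<lambda>u. rel_entropy g (\<rho> + s *\<^sub>R X + t *\<^sub>R Y) (\<rho> + u *\<^sub>R Z)) 0) 0 =
      Phi_pq f (\<rho> + s *\<^sub>R X) \<rho> Y Z"
    using eventually_PD_line[OF assms(1,2)]
    by eventually_elim (rule deriv_rel_entropy_eq_Phi_pq[OF _ assms(1,3,4)])
qed

end

text \<open>Both sides are sums over pairs of eigenvalues with the same trace weights, so it
  suffices to match the coefficients: mixed differences of \<open>f\<close> for distinct eigenvalues
  and their limits for equal ones. The hypothesis \<open>mixed\<close> is symmetric under exchange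
  of the arguments of \<open>f\<close>, so both entropies are covered.\<close>

lemma monotone_metric_eq_Phi_pq:
  fixes lam :: "'n::finite metric"
  assumes metric: "monotone_metric F lam" and f: "tensor_approx f"
    and mixed: "\<And>p p'. 0 < p \<Longrightarrow> 0 < p' \<Longrightarrow> mixed_diff f p p' p p' = - (p' - p)\<^sup>2 / (p * F (p' / p))"
    and \<rho>: "\<rho> \<in> PD" and YZ: "Y \<in> Herm" "Z \<in> Herm"
  shows "lam \<rho> Y Z = - Phi_pq f \<rho> \<rho> Y Z"
proof -
  have h: "\<rho> \<in> Herm" using \<rho> by (rule PD_Herm)
  have F: "operator_monotone F" "\<forall>x>0. F x = x * F (inverse x)" "F 1 = 1"
    and tr: "complex_of_real (lam \<rho> Y Z) = trace (Y ** J F \<rho> Z)"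
    using metric \<rho> YZ unfolding monotone_metric_def by blast+
  note Fb = monotone_metric_fun_bounds[OF F]
  obtain N :: nat and \<alpha> \<beta> where P:
    "small_near (\<lambda>p q. f p q - (\<Sum>k<N. poly (\<alpha> k) p * poly (\<beta> k) q)) (eigs \<rho>) (eigs \<rho>) \<and>
    (\<forall>Y\<in>Herm. \<forall>Z\<in>Herm. Phi_pq f \<rho> \<rho> Y Z = tensor_pq N \<alpha> \<beta> \<rho> \<rho> Y Z) \<and>
    (\<forall>X\<in>Herm. \<forall>Y\<in>Herm. \<forall>Z\<in>Herm.
      ((\<lambda>s. Phi_pq f (\<rho> + s *\<^sub>R X) \<rho> Y Z) has_real_derivative tensor_ppq N \<alpha> \<beta> \<rho> \<rho> X Y Z) (at 0) \<and>
      ((\<lambda>s. Phi_pq (\<lambda>p q. f q p) (\<rho> + s *\<^sub>R X) \<rho> Y Z) has_real_derivative tensor_ppq N \<beta> \<alpha> \<rho> \<rho> X Y Z) (at 0) \<and>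
      ((\<lambda>s. Phi_pq f (\<rho> + s *\<^sub>R X) (\<rho> + s *\<^sub>R X) Y Z) has_real_derivative
        tensor_ppq N \<alpha> \<beta> \<rho> \<rho> X Y Z + tensor_ppq N \<beta> \<alpha> \<rho> \<rho> X Z Y) (at 0))"
    using Phi_derivatives[OF f \<rho>] by (elim exE)
  note s = conjunct1[OF P]
  have Phi: "Phi_pq f \<rho> \<rho> Y Z = tensor_pq N \<alpha> \<beta> \<rho> \<rho> Y Z"
    using conjunct1[OF conjunct2[OF P]] YZ by simp
  have coeff: "(\<Sum>k<N. poly_dd (\<alpha> k) p p' * poly_dd (\<beta> k) p' p) = - 1 / (p * F (p' / p))"
    if p: "p \<in> eigs \<rho>" "p' \<in> eigs \<rho>" for p p'
  proof (cases "p = p'")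
    case False
    have "0 < p" "0 < p'" using PD_eigs_pos[OF \<rho>] p by auto
    then show ?thesis
      using tensor_coefficient_distinct[OF s p False] mixed[of p p'] False by (simp add: divide_simps)
  next
    case True
    have p0: "0 < p" using PD_eigs_pos[OF \<rho> p(1)] .
    \<comment> \<open>Continuity of \<open>F\<close> at 1 from the right comes from squeezing it
      between 1 and its argument.\<close>
    have lim: "((\<lambda>h. F ((p + h) / p)) \<longlongrightarrow> 1) (at_right 0)"
    proof (rule tendsto_sandwich)
      have h0: "\<forall>\<^sub>F h in at_right (0::real). 0 < h" by (simp add: eventually_at_right_less)
      have b: "1 \<le> F ((p + h) / p) \<and> F ((p + h) / p) \<le> (p + h) / p" if "0 < h" for h
        using that p0 by (intro Fb(2)) (simp add: field_simps)
      show "\<forall>\<^sub>F h in at_right 0. 1 \<le> F ((p + h) / p)" using h0 by eventually_elim (use b in blast)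
      show "\<forall>\<^sub>F h in at_right 0. F ((p + h) / p) \<le> (p + h) / p" using h0 by eventually_elim (use b in blast)
      show "((\<lambda>h. 1) \<longlongrightarrow> 1) (at_right (0::real))" by (rule tendsto_const)
      have "((\<lambda>h. (p + h) / p) \<longlongrightarrow> (p + 0) / p) (at_right 0)" by (intro tendsto_intros) (use p0 in simp)
      then show "((\<lambda>h. (p + h) / p) \<longlongrightarrow> 1) (at_right 0)" using p0 by simp
    qed
    have "((\<lambda>h. - 1 / (p * F ((p + h) / p))) \<longlongrightarrow> - 1 / (p * 1)) (at_right 0)"
      using p0 by (intro tendsto_divide tendsto_const tendsto_mult lim) simp
    moreover have "\<forall>\<^sub>F h in at_right 0. - 1 / (p * F ((p + h) / p)) = mixed_diff f p (p + h) p (p + h) / h\<^sup>2"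
    proof -
      have "\<forall>\<^sub>F h in at_right (0::real). 0 < h" by (simp add: eventually_at_right_less)
      then show ?thesis
      proof eventually_elim
        case (elim h)
        then show ?case using mixed[of p "p + h"] p0 by simp
      qed
    qed
    ultimately have "((\<lambda>h. mixed_diff f p (p + h) p (p + h) / h\<^sup>2) \<longlongrightarrow> - 1 / (p * 1)) (at_right 0)"
      by (rule Lim_transform_eventually)
    from tendsto_unique[OF _ this tensor_coefficient_same[OF s p(1)]]
    show ?thesis using True F(3) p0 by simp
  qed
  have "lam \<rho> Y Z = re_trace (Y ** J F \<rho> Z)"
    using arg_cong[OF tr, of Re] by (simp add: re_trace_def)
  also have "\<dots> = (\<Sum>q\<in>eigs \<rho>. \<Sum>p\<in>eigs \<rho>. 1 / (p * F (q / p)) *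
      re_trace ((eig_proj \<rho> p ** Y ** eig_proj \<rho> q) ** (eig_proj \<rho> q ** Z ** eig_proj \<rho> p)))"
  proof -
    have t: "re_trace (Y ** (eig_proj \<rho> q ** Z ** eig_proj \<rho> p)) =
        re_trace ((eig_proj \<rho> p ** Y ** eig_proj \<rho> q) ** (eig_proj \<rho> q ** Z ** eig_proj \<rho> p))" for p q
    proof -
      have "re_trace ((eig_proj \<rho> p ** Y ** eig_proj \<rho> q) ** (eig_proj \<rho> q ** Z ** eig_proj \<rho> p)) =
          re_trace (eig_proj \<rho> p ** (Y ** (eig_proj \<rho> q ** eig_proj \<rho> q) ** Z ** eig_proj \<rho> p))"
        by (simp add: matrix_mul_assoc)
      also have "\<dots> = re_trace ((Y ** (eig_proj \<rho> q ** eig_proj \<rho> q) ** Z ** eig_proj \<rho> p) ** eig_proj \<rho> p)"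
        by (rule re_trace_commute)
      also have "\<dots> = re_trace (Y ** (eig_proj \<rho> q ** eig_proj \<rho> q) ** Z ** (eig_proj \<rho> p ** eig_proj \<rho> p))"
        by (simp add: matrix_mul_assoc)
      finally show ?thesis by (simp add: eig_proj_mult[OF h] matrix_mul_assoc)
    qed
    have J: "J F \<rho> Z = (\<Sum>q\<in>eigs \<rho>. \<Sum>p\<in>eigs \<rho>. (1 / (p * F (q / p))) *\<^sub>R (eig_proj \<rho> q ** Z ** eig_proj \<rho> p))"
      by (rule J_eq[OF \<rho> Fb(1)])
    show ?thesis unfolding J matmul.sum_right re_trace_sum matmul.scaleR_right re_trace_scaleR
      by (simp add: t)
  qed
  also have "\<dots> = (\<Sum>p\<in>eigs \<rho>. \<Sum>p'\<in>eigs \<rho>. - (\<Sum>k<N. poly_dd (\<alpha> k) p p' * poly_dd (\<beta> k) p' p) *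
      re_trace ((eig_proj \<rho> p ** Y ** eig_proj \<rho> p') ** (eig_proj \<rho> p' ** Z ** eig_proj \<rho> p)))"
    by (subst sum.swap) (simp add: coeff)
  also have "\<dots> = - tensor_pq N \<alpha> \<beta> \<rho> \<rho> Y Z"
    unfolding tensor_pq_decomp[OF h] by (simp add: sum_negf)
  finally show ?thesis unfolding Phi .
qed

theorem proposition5p1:
  fixes lam :: "'n::finite metric"
    and F g h :: "real \<Rightarrow> real"
    and D D' :: "'n connection"
  assumes metric: "monotone_metric F lam"
    and h: "\<And>u. u > 0 \<Longrightarrow> h u = 1 / 2 * ((u - 1)\<^sup>2 / F u)"
    and g: "g \<in> G"
    and g_sum: "\<And>u. u > 0 \<Longrightarrow> g u + transpose_fun g u = 2 * h u"
    and D: "g_connection g D"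
    and D': "g_connection (transpose_fun g) D'"
  shows "(\<forall>\<rho>\<in>PD. \<forall>X\<in>Herm. \<forall>Y\<in>Herm.
            lam \<rho> X Y = entropy_metric g \<rho> X Y \<and>
            lam \<rho> X Y = entropy_metric (transpose_fun g) \<rho> X Y) \<and>
         dual_connections lam D D' \<and> torsion_free D \<and> torsion_free D'"
proof -
  define f where "f = (\<lambda>p q. p * g (q / p))"
  have g1: "g 1 = 0" and gc: "operator_convex g" using g by (simp_all add: G_def)
  have f: "tensor_approx f"
    unfolding f_def by (rule tensor_approx_entropy[OF operator_convex_thrice_differentiable[OF gc]])
  have f': "tensor_approx (\<lambda>p q. f q p)" using f by (rule tensor_approx_swap)
  have lam: "riemannian_metric lam" using metric unfolding monotone_metric_def by (rule conjunct1)
  have rel: "rel_entropy g \<tau> \<sigma> = Phi f \<tau> \<sigma>" if "\<tau> \<in> PD" "\<sigma> \<in> PD" for \<tau> \<sigma> :: "complex^'n^'n"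
    unfolding f_def using that by (rule rel_entropy_eq_Phi)
  have rel': "rel_entropy (transpose_fun g) \<tau> \<sigma> = Phi (\<lambda>p q. f q p) \<tau> \<sigma>" if "\<tau> \<in> PD" "\<sigma> \<in> PD"
    for \<tau> \<sigma> :: "complex^'n^'n"
    unfolding f_def using that by (rule rel_entropy_transpose)
  \<comment> \<open>The diagonal values of \<open>f\<close> vanish because \<open>g 1 = 0\<close>,
    and the other two combine to a multiple of \<open>g u + transpose_fun g u\<close>. Thus the
    metric sees only the sum of \<open>g\<close> and its transpose.\<close>
  have mixed: "mixed_diff f p p' p p' = - (p' - p)\<^sup>2 / (p * F (p' / p))" if p: "0 < p" "0 < p'" for p p'
  proof -
    define u where "u = p' / p"
    have u: "0 < u" using p by (simp add: u_def)
    have "mixed_diff f p p' p p' = - (p' * g (p / p') + p * g (p' / p))"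
      using p g1 by (simp add: mixed_diff_def f_def)
    also have "p' * g (p / p') + p * g (p' / p) = p * (g u + transpose_fun g u)"
      using p by (simp add: u_def transpose_fun_def distrib_left)
    also have "\<dots> = p * ((u - 1)\<^sup>2 / F u)" using g_sum[OF u] h[OF u] by simp
    also have "\<dots> = (p' - p)\<^sup>2 / (p * F (p' / p))"
    proof -
      have "u - 1 = (p' - p) / p" using p by (simp add: u_def diff_divide_distrib)
      then show ?thesis using p by (simp add: u_def power_divide) (simp add: power2_eq_square)
    qed
    finally show ?thesis by simp
  qed
  \<comment> \<open>Both pairs of points are the same, so exchanging the arguments of
    \<open>f\<close> merely swaps the two middle terms.\<close>
  have mixed': "mixed_diff (\<lambda>p q. f q p) p p' p p' = - (p' - p)\<^sup>2 / (p * F (p' / p))" if "0 < p" "0 < p'" for p p'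
    using mixed[OF that] by (simp add: mixed_diff_def)
  note lam_eq = monotone_metric_eq_Phi_pq[OF metric f mixed]
  have metric_eq: "lam \<rho> X Y = entropy_metric g \<rho> X Y" "lam \<rho> X Y = entropy_metric (transpose_fun g) \<rho> X Y"
    if "\<rho> \<in> PD" "X \<in> Herm" "Y \<in> Herm" for \<rho> X Y
    using entropy_metric_eq_Phi_pq[OF rel that] entropy_metric_eq_Phi_pq[OF rel' that]
      lam_eq[OF _ _ that] monotone_metric_eq_Phi_pq[OF metric f' mixed' that] by simp_all
  have conn: "affine_connection D" "affine_connection D'" using D D' by (simp_all add: g_connection_def)
  \<comment> \<open>\<open>T\<close> and \<open>T'\<close> are the third derivatives of the two
    entropies. In \<open>T' X Z Y\<close> the last two arguments are exchanged: a motion of the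
    second argument of \<open>f\<close> is one of the first argument of the exchanged sum, which is
    already differentiated along \<open>Z\<close> there.\<close>
  have third: "\<exists>T T'. \<forall>X\<in>Herm. \<forall>Y\<in>Herm. \<forall>Z\<in>Herm.
      lam \<rho> (D (\<lambda>_. X) (\<lambda>_. Y) \<rho>) Z = - T X Y Z \<and> lam \<rho> (D' (\<lambda>_. X) (\<lambda>_. Y) \<rho>) Z = - T' X Y Z \<and>
      T X Y Z = T Y X Z \<and> T' X Y Z = T' Y X Z \<and>
      ((\<lambda>s. lam (\<rho> + s *\<^sub>R X) Y Z) has_real_derivative - (T X Y Z + T' X Z Y)) (at 0)"
    if \<rho>: "\<rho> \<in> PD" for \<rho>
  proof -
    obtain N :: nat and \<alpha> \<beta> where P:
      "small_near (\<lambda>p q. f p q - (\<Sum>k<N. poly (\<alpha> k) p * poly (\<beta> k) q)) (eigs \<rho>) (eigs \<rho>) \<and>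
      (\<forall>Y\<in>Herm. \<forall>Z\<in>Herm. Phi_pq f \<rho> \<rho> Y Z = tensor_pq N \<alpha> \<beta> \<rho> \<rho> Y Z) \<and>
      (\<forall>X\<in>Herm. \<forall>Y\<in>Herm. \<forall>Z\<in>Herm.
        ((\<lambda>s. Phi_pq f (\<rho> + s *\<^sub>R X) \<rho> Y Z) has_real_derivative tensor_ppq N \<alpha> \<beta> \<rho> \<rho> X Y Z) (at 0) \<and>
        ((\<lambda>s. Phi_pq (\<lambda>p q. f q p) (\<rho> + s *\<^sub>R X) \<rho> Y Z) has_real_derivative tensor_ppq N \<beta> \<alpha> \<rho> \<rho> X Y Z) (at 0) \<and>
        ((\<lambda>s. Phi_pq f (\<rho> + s *\<^sub>R X) (\<rho> + s *\<^sub>R X) Y Z) has_real_derivative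
          tensor_ppq N \<alpha> \<beta> \<rho> \<rho> X Y Z + tensor_ppq N \<beta> \<alpha> \<rho> \<rho> X Z Y) (at 0))"
      using Phi_derivatives[OF f \<rho>] by (elim exE)
    note der = conjunct2[OF conjunct2[OF P], rule_format]
    show ?thesis
    proof (intro exI ballI conjI)
      fix X Y Z :: "complex^'n^'n" assume XYZ: "X \<in> Herm" "Y \<in> Herm" "Z \<in> Herm"
      note d = der[OF XYZ]
      have "lam \<rho> (D (\<lambda>_. X) (\<lambda>_. Y) \<rho>) Z = entropy_metric g \<rho> (D (\<lambda>_. X) (\<lambda>_. Y) \<rho>) Z"
        by (intro metric_eq(1) \<rho> XYZ connection_const_Herm[OF conn(1)])
      also have "\<dots> = - deriv (\<lambda>s. Phi_pq f (\<rho> + s *\<^sub>R X) \<rho> Y Z) 0"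
        using D \<rho> XYZ deriv_rel_entropy_third[OF rel \<rho> XYZ] by (simp add: g_connection_def)
      also have "\<dots> = - tensor_ppq N \<alpha> \<beta> \<rho> \<rho> X Y Z" using DERIV_imp_deriv[OF conjunct1[OF d]] by simp
      finally show "lam \<rho> (D (\<lambda>_. X) (\<lambda>_. Y) \<rho>) Z = - tensor_ppq N \<alpha> \<beta> \<rho> \<rho> X Y Z" .
      have "lam \<rho> (D' (\<lambda>_. X) (\<lambda>_. Y) \<rho>) Z = entropy_metric (transpose_fun g) \<rho> (D' (\<lambda>_. X) (\<lambda>_. Y) \<rho>) Z"
        by (intro metric_eq(2) \<rho> XYZ connection_const_Herm[OF conn(2)])
      also have "\<dots> = - deriv (\<lambda>s. Phi_pq (\<lambda>p q. f q p) (\<rho> + s *\<^sub>R X) \<rho> Y Z) 0"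
        using D' \<rho> XYZ deriv_rel_entropy_third[OF rel' \<rho> XYZ] by (simp add: g_connection_def)
      also have "\<dots> = - tensor_ppq N \<beta> \<alpha> \<rho> \<rho> X Y Z"
        using DERIV_imp_deriv[OF conjunct1[OF conjunct2[OF d]]] by simp
      finally show "lam \<rho> (D' (\<lambda>_. X) (\<lambda>_. Y) \<rho>) Z = - tensor_ppq N \<beta> \<alpha> \<rho> \<rho> X Y Z" .
      show "tensor_ppq N \<alpha> \<beta> \<rho> \<rho> X Y Z = tensor_ppq N \<alpha> \<beta> \<rho> \<rho> Y X Z"
        "tensor_ppq N \<beta> \<alpha> \<rho> \<rho> X Y Z = tensor_ppq N \<beta> \<alpha> \<rho> \<rho> Y X Z"
        by (rule tensor_ppq_commute)+
      have ev: "\<forall>\<^sub>F s in nhds 0. lam (\<rho> + s *\<^sub>R X) Y Z = - Phi_pq f (\<rho> + s *\<^sub>R X) (\<rho> + s *\<^sub>R X) Y Z"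
        using eventually_PD_line[OF \<rho> XYZ(1)]
      proof eventually_elim
        case (elim s)
        show ?case by (rule lam_eq[OF _ _ elim XYZ(2,3)])
      qed
      show "((\<lambda>s. lam (\<rho> + s *\<^sub>R X) Y Z) has_real_derivative
          - (tensor_ppq N \<alpha> \<beta> \<rho> \<rho> X Y Z + tensor_ppq N \<beta> \<alpha> \<rho> \<rho> X Z Y)) (at 0)"
        using DERIV_minus[OF conjunct2[OF conjunct2[OF d]]] by (subst DERIV_cong_ev[OF refl ev refl])
    qed
  qed
  \<comment> \<open>Symmetry of the third derivative passes to the connection because the metric is
    nondegenerate.\<close>
  have tf: "E (\<lambda>_. A) (\<lambda>_. B) \<rho> = E (\<lambda>_. B) (\<lambda>_. A) \<rho>"
    if E: "affine_connection E" and \<rho>: "\<rho> \<in> PD" and AB: "A \<in> Herm" "B \<in> Herm"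
      and T: "\<forall>X\<in>Herm. \<forall>Y\<in>Herm. \<forall>Z\<in>Herm. lam \<rho> (E (\<lambda>_. X) (\<lambda>_. Y) \<rho>) Z = - T X Y Z \<and> T X Y Z = T Y X Z"
    for E A B \<rho> and T :: "complex^'n^'n \<Rightarrow> complex^'n^'n \<Rightarrow> complex^'n^'n \<Rightarrow> real"
  proof (rule riemannian_metric_cancel[OF lam \<rho>])
    show "E (\<lambda>_. A) (\<lambda>_. B) \<rho> \<in> Herm" "E (\<lambda>_. B) (\<lambda>_. A) \<rho> \<in> Herm"
      by (rule connection_const_Herm[OF E] AB \<rho>)+
    fix Z :: "complex^'n^'n" assume Z: "Z \<in> Herm"
    have "lam \<rho> (E (\<lambda>_. A) (\<lambda>_. B) \<rho>) Z = - T A B Z" using T AB Z by blast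
    also have "\<dots> = - T B A Z" using T AB Z by metis
    also have "\<dots> = lam \<rho> (E (\<lambda>_. B) (\<lambda>_. A) \<rho>) Z" using T AB Z by metis
    finally show "lam \<rho> (E (\<lambda>_. A) (\<lambda>_. B) \<rho>) Z = lam \<rho> (E (\<lambda>_. B) (\<lambda>_. A) \<rho>) Z" .
  qed
  have "torsion_free D"
  proof (rule torsion_freeI[OF conn(1)])
    fix \<rho> A B :: "complex^'n^'n" assume \<rho>: "\<rho> \<in> PD" and AB: "A \<in> Herm" "B \<in> Herm"
    obtain T where "\<forall>X\<in>Herm. \<forall>Y\<in>Herm. \<forall>Z\<in>Herm. lam \<rho> (D (\<lambda>_. X) (\<lambda>_. Y) \<rho>) Z = - T X Y Z \<and> T X Y Z = T Y X Z"
      using third[OF \<rho>] by (elim exE) blast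
    then show "D (\<lambda>_. A) (\<lambda>_. B) \<rho> = D (\<lambda>_. B) (\<lambda>_. A) \<rho>" by (rule tf[OF conn(1) \<rho> AB])
  qed
  moreover have "torsion_free D'"
  proof (rule torsion_freeI[OF conn(2)])
    fix \<rho> A B :: "complex^'n^'n" assume \<rho>: "\<rho> \<in> PD" and AB: "A \<in> Herm" "B \<in> Herm"
    obtain T where "\<forall>X\<in>Herm. \<forall>Y\<in>Herm. \<forall>Z\<in>Herm. lam \<rho> (D' (\<lambda>_. X) (\<lambda>_. Y) \<rho>) Z = - T X Y Z \<and> T X Y Z = T Y X Z"
      using third[OF \<rho>] by (elim exE) blast
    then show "D' (\<lambda>_. A) (\<lambda>_. B) \<rho> = D' (\<lambda>_. B) (\<lambda>_. A) \<rho>" by (rule tf[OF conn(2) \<rho> AB])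
  qed
  moreover have "dual_connections lam D D'"
  proof (rule dual_connectionsI[OF lam conn])
    fix \<rho> A Y Z :: "complex^'n^'n" assume \<rho>: "\<rho> \<in> PD" and AYZ: "A \<in> Herm" "Y \<in> Herm" "Z \<in> Herm"
    obtain T T' where T: "\<forall>X\<in>Herm. \<forall>Y\<in>Herm. \<forall>Z\<in>Herm.
      lam \<rho> (D (\<lambda>_. X) (\<lambda>_. Y) \<rho>) Z = - T X Y Z \<and> lam \<rho> (D' (\<lambda>_. X) (\<lambda>_. Y) \<rho>) Z = - T' X Y Z \<and>
      T X Y Z = T Y X Z \<and> T' X Y Z = T' Y X Z \<and>
      ((\<lambda>s. lam (\<rho> + s *\<^sub>R X) Y Z) has_real_derivative - (T X Y Z + T' X Z Y)) (at 0)"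
      using third[OF \<rho>] by (elim exE)
    note t = T[rule_format, OF AYZ] and t' = T[rule_format, OF AYZ(1,3,2)]
    \<comment> \<open>The defining equation of \<open>D'\<close> has the connection in the first
      slot of the metric, duality has it in the second.\<close>
    have "lam \<rho> Y (D' (\<lambda>_. A) (\<lambda>_. Z) \<rho>) = lam \<rho> (D' (\<lambda>_. A) (\<lambda>_. Z) \<rho>) Y"
      by (intro riemannian_metric_commute[OF lam \<rho>] AYZ connection_const_Herm[OF conn(2)] \<rho>)
    also have "\<dots> = - T' A Z Y" by (rule t'[THEN conjunct2, THEN conjunct1])
    finally have "lam \<rho> (D (\<lambda>_. A) (\<lambda>_. Y) \<rho>) Z + lam \<rho> Y (D' (\<lambda>_. A) (\<lambda>_. Z) \<rho>) = - (T A Y Z + T' A Z Y)"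
      using conjunct1[OF t] by linarith
    from DERIV_cong[OF t[THEN conjunct2, THEN conjunct2, THEN conjunct2, THEN conjunct2] this[symmetric]]
    show "((\<lambda>t. lam (\<rho> + t *\<^sub>R A) Y Z) has_real_derivative
        lam \<rho> (D (\<lambda>_. A) (\<lambda>_. Y) \<rho>) Z + lam \<rho> Y (D' (\<lambda>_. A) (\<lambda>_. Z) \<rho>)) (at 0)" .
  qed
  ultimately show ?thesis using metric_eq by (intro conjI ballI)
qed

end
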